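(* Let $n\ge1$, $\alpha\in(0,n)$, $0<\beta\le2$, $p>1$, and set $$p_{\mathrm{Fuj}}(n,\beta,\alpha)=1+\frac{\beta+\alpha}{n-\alpha},\qquad q_{\mathrm{sc}}=\frac{n(p-1)}{\beta+\alpha}.$$ Consider the Cauchy problem $$u_t+(-\Delta)^{\beta/2}u=I_\alpha(|u|^p),\quad x\in\mathbb{R}^n,\ t>0,\qquad u(x,0)=u_0(x),\quad x\in\mathbb{R}^n. \quad (P)$$ (i) If $u_0\in L^1(\mathbb{R}^n)\cap L^\infty(\mathbb{R}^n)$, $u_0\ge0$, $\int_{\mathbb{R}^n}u_0(x)\,dx>0$, and $$\frac{n}{n-\alpha}<p\le p_{\mathrm{Fuj}}(n,\beta,\alpha),$$ then the mild solution of (P) blows up in finite time. (ii) If $p>p_{\mathrm{Fuj}}(n,\beta,\alpha)$ and $u_0\in L^{q_{\mathrm{sc}}}(\mathbb{R}^n)\cap L^\infty(\mathbb{R}^n)$, then the mild solution of (P) exists globally in time and satisfies $u\in L^\infty((0,\infty),L^\infty(\mathbb{R}^n))$, provided that $\|u_0\|_{L^{q_{\mathrm{sc}}}}$ is sufficiently small.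
   Context: For $\alpha\in(0,n)$ the Riesz potential is $I_\alpha f(x)=A_\alpha\int_{\mathbb{R}^n}\frac{f(y)}{|x-y|^{n-\alpha}}\,dy$ with $A_\alpha=\frac{\Gamma((n-\alpha)/2)}{\Gamma(\alpha/2)\,\pi^{n/2}\,2^\alpha}$. For $\beta\in(0,2]$, $S_\beta(t)$ denotes the semigroup generated by $-(-\Delta)^{\beta/2}$, i.e. $S_\beta(t)v=S_\beta(\cdot,t)*v$ for $t>0$ and $S_\beta(0)v=v$, where $$S_\beta(x,t)=\frac{1}{(2\pi)^{n}}\int_{\mathbb{R}^n}e^{ix\cdot\xi-t|\xi|^\beta}\,d\xi .$$ This kernel satisfies $S_\beta(x,t)\ge 0$ and $\int_{\mathbb{R}^n}S_\beta(x,t)\,dx=1$. A mild solution of (P) on $[0,T]$ is a function $u\in L^\infty((0,T),X)$, with $X$ a Banach space, here $X=L^s(\mathbb{R}^n)\cap L^\infty(\mathbb{R}^n)$ for a fixed exponent $s$ with $\frac{n}{n-\alpha}<s<\frac{n(p-1)}{\alpha}$ and $u_0\in L^s(\mathbb{R}^n)$, which has initial data $u_0$ and satisfies $$u(t)=S_\beta(t)u_0+\int_0^tS_\beta(t-\tau)I_\alpha(|u|^p)(\tau)\,d\tau .$$ Such exponents $s$ exist in both (i) and (ii) (in (ii), $\frac{n}{n-\alpha}<q_{\mathrm{sc}}<\frac{n(p-1)}{\alpha}$). For $p>\frac{n}{n-\alpha}$ and such $s$ and $u_0\in L^s\cap L^\infty$, problem (P) has a unique maximal mild solution $u\in C([0,T_{\max}),L^s(\mathbb{R}^n))\cap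 L^\infty_{\mathrm{loc}}([0,T_{\max}),L^\infty(\mathbb{R}^n))$, with $0<T_{\max}\le\infty$, and either $T_{\max}=\infty$ or $\lim_{t\to T_{\max}^-}(\|u(t)\|_{L^\infty}+\|u(t)\|_{L^s})=+\infty$; "the mild solution" refers to this one. It "blows up in finite time" if $T_{\max}<\infty$, and "exists globally in time" if $T_{\max}=\infty$. "Sufficiently small" means: there is $\varepsilon>0$ depending only on $n,\alpha,\beta,p$ such that the conclusion holds whenever $\|u_0\|_{L^{q_{\mathrm{sc}}}}\le\varepsilon$. *)

theory Defs
  imports "HOL-Analysis.Analysis" "HOL-Probability.Essential_Supremum"
begin

text \<open>
  Elements of Lebesgue spaces are represented by functions on \<open>real ^ 'n\<close>, with \<open>lborel\<close> as the
  measure; identities between such elements are therefore stated almost everywhere.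
\<close>

definition Lp_space :: "real \<Rightarrow> (real ^ 'n \<Rightarrow> real) set" where
  "Lp_space q = {f. f \<in> borel_measurable lborel \<and> integrable lborel (\<lambda>x. \<bar>f x\<bar> powr q)}"

definition Lp_norm :: "real \<Rightarrow> (real ^ 'n \<Rightarrow> real) \<Rightarrow> real" where
  "Lp_norm q f = (LINT x|lborel. \<bar>f x\<bar> powr q) powr (1 / q)"

definition Linf_norm :: "(real ^ 'n \<Rightarrow> real) \<Rightarrow> ereal" where
  "Linf_norm f = esssup lborel (\<lambda>x. ereal \<bar>f x\<bar>)"

definition Linf_space :: "(real ^ 'n \<Rightarrow> real) set" where
  "Linf_space = {f. f \<in> borel_measurable lborel \<and> Linf_norm f < \<infinity>}"

definition riesz_const :: "nat \<Rightarrow> real \<Rightarrow> real" where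
  "riesz_const n \<alpha> =
     Gamma ((real n - \<alpha>) / 2) / (Gamma (\<alpha> / 2) * pi powr (real n / 2) * 2 powr \<alpha>)"

definition riesz_potential :: "real \<Rightarrow> (real ^ 'n \<Rightarrow> real) \<Rightarrow> real ^ 'n \<Rightarrow> real" where
  "riesz_potential \<alpha> f x =
     riesz_const CARD('n) \<alpha> * (LINT y|lborel. f y / norm (x - y) powr (real CARD('n) - \<alpha>))"

text \<open>The Fourier integral is real because the integrand at \<open>- \<xi>\<close> is the complex conjugate of the
  one at \<open>\<xi>\<close>; \<open>Re\<close> only changes the type.\<close>

definition frac_heat_kernel :: "real \<Rightarrow> real \<Rightarrow> real ^ 'n \<Rightarrow> real" where
  "frac_heat_kernel \<beta> t x =
     Re (1 / (2 * of_real pi) ^ CARD('n) *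
       (LINT \<xi>|lborel. exp (\<i> * of_real (x \<bullet> \<xi>) - of_real (t * norm \<xi> powr \<beta>))))"

definition frac_heat_semigroup ::
    "real \<Rightarrow> real \<Rightarrow> (real ^ 'n \<Rightarrow> real) \<Rightarrow> real ^ 'n \<Rightarrow> real" where
  "frac_heat_semigroup \<beta> t v =
     (if t = 0 then v else (\<lambda>x. LINT y|lborel. frac_heat_kernel \<beta> t (x - y) * v y))"

definition p_Fuj :: "nat \<Rightarrow> real \<Rightarrow> real \<Rightarrow> real" where
  "p_Fuj n \<beta> \<alpha> = 1 + (\<beta> + \<alpha>) / (real n - \<alpha>)"

definition q_sc :: "nat \<Rightarrow> real \<Rightarrow> real \<Rightarrow> real \<Rightarrow> real" where
  "q_sc n \<beta> \<alpha> p = real n * (p - 1) / (\<beta> + \<alpha>)"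

text \<open>Membership of \<open>u\<close> in \<open>C([0,T), L\<^sup>s)\<close> and in \<open>L\<^sup>\<infinity>(I, L\<^sup>\<infinity>)\<close>.\<close>

definition continuous_in_Lp :: "real \<Rightarrow> ereal \<Rightarrow> (real \<Rightarrow> real ^ 'n \<Rightarrow> real) \<Rightarrow> bool" where
  "continuous_in_Lp s T u \<longleftrightarrow>
     (\<forall>t. 0 \<le> t \<and> ereal t < T \<longrightarrow>
        u t \<in> Lp_space s \<and>
        ((\<lambda>r. Lp_norm s (\<lambda>x. u r x - u t x)) \<longlongrightarrow> 0) (at t within {r. 0 \<le> r \<and> ereal r < T}))"

definition ess_bounded_in_Linf :: "real set \<Rightarrow> (real \<Rightarrow> real ^ 'n \<Rightarrow> real) \<Rightarrow> bool" where
  "ess_bounded_in_Linf I u \<longleftrightarrow>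
     (\<exists>C. AE t in lborel. t \<in> I \<longrightarrow> u t \<in> Linf_space \<and> Linf_norm (u t) \<le> ereal C)"

text \<open>
  A mild solution on the compact interval \<open>[0,T]\<close>, with values in the intersection of \<open>L\<^sup>s\<close> and
  \<open>L\<^sup>\<infinity>\<close>. The time integral is evaluated pointwise in \<open>x\<close>. The definition says nothing about
  measurability in time; this is supplied by the continuity into \<open>L\<^sup>s\<close> that is imposed on
  solutions below. For such \<open>u\<close> the integrand at a fixed \<open>x\<close> depends only on the almost-everywhere
  classes of the \<open>u \<tau>\<close>, and it is continuous in \<open>\<tau>\<close> and bounded.
\<close>

definition mild_solution ::
    "real \<Rightarrow> real \<Rightarrow> real \<Rightarrow> real \<Rightarrow> (real ^ 'n \<Rightarrow> real) \<Rightarrow> real \<Rightarrow> (real \<Rightarrow> real ^ 'n \<Rightarrow> real) \<Rightarrow> bool"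
where
  "mild_solution \<alpha> \<beta> p s u0 T u \<longleftrightarrow>
     (\<exists>C. AE t in lborel. t \<in> {0<..<T} \<longrightarrow>
        u t \<in> Lp_space s \<inter> Linf_space \<and> ereal (Lp_norm s (u t)) + Linf_norm (u t) \<le> ereal C) \<and>
     (\<forall>t\<in>{0..T}. AE x in lborel.
        u t x = frac_heat_semigroup \<beta> t u0 x +
          (LINT \<tau>:{0..t}|lborel.
             frac_heat_semigroup \<beta> (t - \<tau>) (riesz_potential \<alpha> (\<lambda>y. \<bar>u \<tau> y\<bar> powr p)) x))"

text \<open>Mild solutions on \<open>[0,T)\<close> in the class \<open>C([0,T), L\<^sup>s)\<close> and \<open>L\<^sup>\<infinity>\<close> locally on \<open>[0,T)\<close> with values
  in \<open>L\<^sup>\<infinity>\<close>, where \<open>T\<close> may be \<open>\<infinity>\<close>.\<close>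

definition mild_solution_upto ::
    "real \<Rightarrow> real \<Rightarrow> real \<Rightarrow> real \<Rightarrow> (real ^ 'n \<Rightarrow> real) \<Rightarrow> ereal \<Rightarrow> (real \<Rightarrow> real ^ 'n \<Rightarrow> real) \<Rightarrow> bool"
where
  "mild_solution_upto \<alpha> \<beta> p s u0 T u \<longleftrightarrow>
     continuous_in_Lp s T u \<and>
     (\<forall>T'. 0 < T' \<and> ereal T' < T \<longrightarrow>
        ess_bounded_in_Linf {0<..<T'} u \<and> mild_solution \<alpha> \<beta> p s u0 T' u)"

definition maximal_mild_solution ::
    "real \<Rightarrow> real \<Rightarrow> real \<Rightarrow> real \<Rightarrow> (real ^ 'n \<Rightarrow> real) \<Rightarrow> ereal \<Rightarrow> (real \<Rightarrow> real ^ 'n \<Rightarrow> real) \<Rightarrow> bool"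
where
  "maximal_mild_solution \<alpha> \<beta> p s u0 T u \<longleftrightarrow>
     0 < T \<and> mild_solution_upto \<alpha> \<beta> p s u0 T u \<and>
     \<not> (\<exists>T' v. T < T' \<and> mild_solution_upto \<alpha> \<beta> p s u0 T' v \<and>
          (\<forall>t. 0 \<le> t \<and> ereal t < T \<longrightarrow> (AE x in lborel. v t x = u t x)))"

end

theory Submission
  imports Defs "HOL-Probability.Characteristic_Functions"
begin

text \<open>
  The kernel of \<open>S\<^sub>\<beta>(t) I\<^sub>\<alpha>\<close> belongs to \<open>L\<^sup>b\<close> for \<open>b > n / (n - \<alpha>)\<close>, with a norm given by scaling, so that by the
  Young and Hoelder inequalities a solution is estimated in \<open>L\<^sup>s\<close> and \<open>L\<^sup>\<infinity>\<close> by a Volterra integral of its own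
  norm times the \<open>L\<^sup>a\<close> norm of \<open>\<bar>u\<bar>\<^sup>p\<^sup>-\<^sup>1\<close>. The Picard iterates are dominated by the increasing iterates for the
  data \<open>\<bar>u\<^sub>0\<bar>\<close>, and their differences by the increments of these. All estimates are therefore made for nonnegative
  extended-valued functions, and the iteration converges wherever the supremum of the majorants is finite.
  For small data in the scale-invariant space, a norm weighted by a power of \<open>t\<close> stays bounded for all times.

  In the subcritical and critical cases, the kernel is bounded below by \<open>\<rho> powr - (n - \<alpha>)\<close> on parabolic cylinders
  of radius \<open>\<rho>\<close>. Hence the integral of \<open>u\<^sup>p\<close> over such cylinders satisfies a superlinear growth inequality. This
  bounds the integral over all of space-time, whereas the same inequality shows that each dyadic time slab
  contributes at least a fixed amount.
\<close>


section \<open>Powers and Lebesgue norms of extended nonnegative functions\<close>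

text \<open>Positivity and unit mass of the heat kernel are not assumed but derived from its Fourier
  formula: \<open>exp (- t * norm \<xi> powr \<beta>)\<close> is a limit of exponentials of Gaussian
  mixtures, and Gaussians have positive transforms. The obstacle in the solution theory is that a
  mild solution is a family of almost-everywhere classes with bounds at almost every time, while the
  estimates need joint measurability and bounds at every time. The predicate \<open>solves\<close>
  expresses the latter. The two notions are converted into each other, so that uniqueness and
  continuation are proved for \<open>solves\<close> alone. Global existence involves three
  exponents: \<open>q\<close> is dictated by scaling, \<open>r\<close> carries the decay in time,
  and \<open>s\<close> is prescribed from outside. The smallness must not depend on
  \<open>s\<close>. Therefore only \<open>r\<close> enters the nonlinear estimate; the
  \<open>s\<close>-norm follows from a linear Volterra inequality and may grow exponentially.
  Blow-up includes the critical power because the argument needs only a fixed gain on each time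
  slab, not one that grows with the radius.\<close>

definition epow :: "ennreal \<Rightarrow> real \<Rightarrow> ennreal" where
  "epow x a = (if x = top then top else ennreal (enn2real x powr a))"

lemma epow_ennreal [simp]: "0 \<le> x \<Longrightarrow> epow (ennreal x) a = ennreal (x powr a)"
  by (simp add: epow_def)

lemma epow_top [simp]: "epow top a = top"
  by (simp add: epow_def)

lemma epow_0 [simp]: "epow 0 a = 0"
  by (simp add: epow_def)

lemma epow_one [simp]: "epow 1 a = 1"
  using epow_ennreal[of 1 a] by simp

lemma epow_1 [simp]: "epow x 1 = x"
  by (cases x) (auto simp: epow_def)

lemma epow_eq_0_iff [simp]: "epow x a = 0 \<longleftrightarrow> x = 0"
  by (cases x) (auto simp: epow_def)

lemma epow_eq_top_iff [simp]: "epow x a = top \<longleftrightarrow> x = top"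
  by (cases x) (auto simp: epow_def)

lemma epow_less_top_iff [simp]: "epow x a < top \<longleftrightarrow> x < top"
  by (simp add: less_top[symmetric])

lemma epow_mono: "0 \<le> a \<Longrightarrow> x \<le> y \<Longrightarrow> epow x a \<le> epow y a"
  by (cases x; cases y) (auto simp: epow_def powr_mono2 top_unique)

lemma epow_mult: "epow (x * y) a = epow x a * epow y a"
  by (cases x; cases y)
     (auto simp: powr_mult ennreal_mult'[symmetric] ennreal_mult_top ennreal_top_mult)

lemma epow_epow [simp]: "epow (epow x a) b = epow x (a * b)"
  by (cases x) (auto simp: powr_powr)

text \<open>The values 0 and \<open>top\<close> are fixed by every power, also when the exponent is
  zero or negative. This convention frees the laws for products, sums of exponents and iterated
  powers from side conditions.\<close>

lemma epow_add: "epow x (a + b) = epow x a * epow x b"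
  by (cases x) (auto simp: powr_add ennreal_mult' ennreal_mult_top)

lemma epow_le_iff:
  assumes "0 < a"
  shows "epow x a \<le> y \<longleftrightarrow> x \<le> epow y (1 / a)"
proof
  assume "epow x a \<le> y"
  then have "epow (epow x a) (1 / a) \<le> epow y (1 / a)"
    using assms by (intro epow_mono) auto
  then show "x \<le> epow y (1 / a)" using assms by simp
next
  assume "x \<le> epow y (1 / a)"
  then have "epow x a \<le> epow (epow y (1 / a)) a"
    using assms by (intro epow_mono) auto
  then show "epow x a \<le> y" using assms by simp
qed

lemma epow_SUP:
  assumes "0 < a"
  shows "epow (SUP i\<in>I. f i) a = (SUP i\<in>I. epow (f i) a)"
proof (rule antisym)
  show "epow (SUP i\<in>I. f i) a \<le> (SUP i\<in>I. epow (f i) a)"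
    unfolding epow_le_iff[OF assms]
    by (rule SUP_least) (auto simp: epow_le_iff[OF assms, symmetric] intro: SUP_upper)
  show "(SUP i\<in>I. epow (f i) a) \<le> epow (SUP i\<in>I. f i) a"
    using assms by (intro SUP_least epow_mono SUP_upper) auto
qed

lemma borel_measurable_epow [measurable (raw)]:
  assumes [measurable]: "f \<in> borel_measurable M"
  shows "(\<lambda>x. epow (f x) a) \<in> borel_measurable M"
  unfolding epow_def by measurable

text \<open>With values in \<open>ennreal\<close> the norm is \<open>top\<close> outside the
  Lebesgue space, so inequalities between norms carry no membership hypotheses.\<close>

definition Lnorm :: "'a measure \<Rightarrow> real \<Rightarrow> ('a \<Rightarrow> ennreal) \<Rightarrow> ennreal" where
  "Lnorm M s f = epow (\<integral>\<^sup>+x. epow (f x) s \<partial>M) (1 / s)"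

abbreviation Lnorm_abs :: "real \<Rightarrow> ('a::euclidean_space \<Rightarrow> real) \<Rightarrow> ennreal" where
  "Lnorm_abs s f \<equiv> Lnorm lborel s (\<lambda>x. ennreal \<bar>f x\<bar>)"

lemma Lnorm_1: "Lnorm M 1 f = (\<integral>\<^sup>+x. f x \<partial>M)"
  by (simp add: Lnorm_def)

lemma epow_Lnorm: "0 < s \<Longrightarrow> epow (Lnorm M s f) s = (\<integral>\<^sup>+x. epow (f x) s \<partial>M)"
  by (simp add: Lnorm_def)

lemma Lnorm_le_iff: "0 < s \<Longrightarrow> Lnorm M s f \<le> c \<longleftrightarrow> (\<integral>\<^sup>+x. epow (f x) s \<partial>M) \<le> epow c s"
  by (simp add: Lnorm_def epow_le_iff)

lemma Lnorm_mono_AE: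
  assumes s: "0 < s" and "AE x in M. f x \<le> g x"
  shows "Lnorm M s f \<le> Lnorm M s g"
proof -
  have "AE x in M. epow (f x) s \<le> epow (g x) s"
    using assms(2) by (rule eventually_mono) (rule epow_mono, use s in auto)
  then show ?thesis
    unfolding Lnorm_def using s by (intro epow_mono nn_integral_mono_AE) auto
qed

lemma Lnorm_mono: "0 < s \<Longrightarrow> (\<And>x. f x \<le> g x) \<Longrightarrow> Lnorm M s f \<le> Lnorm M s g"
  by (rule Lnorm_mono_AE) auto

lemma Lnorm_cong_AE:
  "AE x in M. f x = g x \<Longrightarrow> Lnorm M s f = Lnorm M s g"
  unfolding Lnorm_def by (intro arg_cong2[where f=epow] nn_integral_cong_AE) (auto elim!: AE_mp)

lemma Lnorm_cmult:
  assumes [measurable]: "f \<in> borel_measurable M" and "0 < s"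
  shows "Lnorm M s (\<lambda>x. c * f x) = c * Lnorm M s f"
  using assms(2) by (simp add: Lnorm_def epow_mult nn_integral_cmult)

lemma Lnorm_eq_0_iff:
  assumes [measurable]: "f \<in> borel_measurable M"
  shows "Lnorm M s f = 0 \<longleftrightarrow> (AE x in M. f x = 0)"
  by (simp add: Lnorm_def nn_integral_0_iff_AE)

lemma Lnorm_epow:
  "0 < c \<Longrightarrow> 0 < s \<Longrightarrow> Lnorm M s (\<lambda>x. epow (f x) c) = epow (Lnorm M (c * s) f) c"
  by (simp add: Lnorm_def)

lemma Lnorm_SUP:
  assumes [measurable]: "\<And>i::nat. f i \<in> borel_measurable M" and "incseq f" and s: "0 < s"
  shows "Lnorm M s (\<lambda>x. SUP i. f i x) = (SUP i. Lnorm M s (f i))"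
proof -
  have "incseq (\<lambda>i x. epow (f i x) s)"
    using assms by (auto simp: incseq_def le_fun_def intro!: epow_mono)
  then show ?thesis
    unfolding Lnorm_def using s
    by (simp add: epow_SUP nn_integral_monotone_convergence_SUP)
qed

section \<open>Hoelder and Minkowski inequalities\<close>

lemma young_ennreal:
  assumes "1 < a" "1 < b" "1 / a + 1 / b = 1"
  shows "x * y \<le> ennreal (1 / a) * epow x a + ennreal (1 / b) * epow y b"
proof (cases "x = top \<or> y = top")
  case True
  then show ?thesis using assms by (auto simp: ennreal_mult_top)
next
  case False
  then obtain x' y' where xy: "x = ennreal x'" "y = ennreal y'" "0 \<le> x'" "0 \<le> y'"
    by (cases x; cases y) auto
  have "x' * y' \<le> x' powr a / a + y' powr b / b"
    using Youngs_inequality[OF assms xy(3,4)] .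
  then show ?thesis
    using xy assms by (simp add: ennreal_mult'[symmetric] ennreal_plus[symmetric] ennreal_leI
        del: ennreal_plus)
qed

lemma nn_integral_Hoelder:
  assumes [measurable]: "f \<in> borel_measurable M" "g \<in> borel_measurable M"
  assumes ab: "1 < a" "1 < b" "1 / a + 1 / b = 1"
  shows "(\<integral>\<^sup>+x. f x * g x \<partial>M) \<le> Lnorm M a f * Lnorm M b g"
proof -
  let ?F = "Lnorm M a f" and ?G = "Lnorm M b g"
  \<comment> \<open>Normalising both functions requires positive finite norms, which is the last
    case. If one norm is 0, the product vanishes almost everywhere; otherwise an infinite norm makes
    the right side infinite.\<close>
  consider "?F = 0" | "?G = 0" | "?F = top" "?G \<noteq> 0" | "?F \<noteq> 0" "?G = top"
    | "?F \<noteq> 0" "?F \<noteq> top" "?G \<noteq> 0" "?G \<noteq> top" by blast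
  then show ?thesis
  proof cases
    case 1
    then have "AE x in M. f x * g x = 0" by (auto simp: Lnorm_eq_0_iff)
    then have "(\<integral>\<^sup>+x. f x * g x \<partial>M) = 0" by (simp add: nn_integral_0_iff_AE)
    then show ?thesis by simp
  next
    case 2
    then have "AE x in M. f x * g x = 0" by (auto simp: Lnorm_eq_0_iff)
    then have "(\<integral>\<^sup>+x. f x * g x \<partial>M) = 0" by (simp add: nn_integral_0_iff_AE)
    then show ?thesis by simp
  next
    case 5
    obtain c where c: "?F = ennreal c" "0 < c" using 5 by (cases ?F) (auto simp: le_less)
    obtain d where d: "?G = ennreal d" "0 < d" using 5 by (cases ?G) (auto simp: le_less)
    define f' where "f' = (\<lambda>x. ennreal (1 / c) * f x)"
    define g' where "g' = (\<lambda>x. ennreal (1 / d) * g x)"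
    have [measurable]: "f' \<in> borel_measurable M" "g' \<in> borel_measurable M"
      unfolding f'_def g'_def by auto
    have F1: "(\<integral>\<^sup>+x. epow (f' x) a \<partial>M) = 1" 
      using ab c unfolding f'_def
      by (subst epow_Lnorm[symmetric]) (auto simp: Lnorm_cmult ennreal_mult'[symmetric])
    have G1: "(\<integral>\<^sup>+x. epow (g' x) b \<partial>M) = 1"
      using ab d unfolding g'_def
      by (subst epow_Lnorm[symmetric]) (auto simp: Lnorm_cmult ennreal_mult'[symmetric])
    have eq: "f x * g x = ennreal (c * d) * (f' x * g' x)" for x
    proof -
      have "ennreal (c * d) * (f' x * g' x)
          = (ennreal (c * d) * (ennreal (1 / c) * ennreal (1 / d))) * (f x * g x)"
        unfolding f'_def g'_def by (simp add: mult_ac)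
      also have "ennreal (c * d) * (ennreal (1 / c) * ennreal (1 / d)) = 1"
        using c d by (simp add: ennreal_mult'[symmetric] del: ennreal_mult')
      finally show ?thesis by simp
    qed
    have "(\<integral>\<^sup>+x. f' x * g' x \<partial>M)
        \<le> (\<integral>\<^sup>+x. ennreal (1 / a) * epow (f' x) a + ennreal (1 / b) * epow (g' x) b \<partial>M)"
      by (intro nn_integral_mono young_ennreal ab)
    also have "\<dots> = ennreal (1 / a) + ennreal (1 / b)"
      by (simp add: nn_integral_add nn_integral_cmult F1 G1)
    also have "\<dots> = 1"
      using ab by (simp add: ennreal_plus[symmetric] del: ennreal_plus)
    finally have "(\<integral>\<^sup>+x. f' x * g' x \<partial>M) \<le> 1" .
    then have "ennreal (c * d) * (\<integral>\<^sup>+x. f' x * g' x \<partial>M) \<le> ennreal (c * d) * 1"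
      by (intro mult_left_mono) auto
    then show ?thesis
      unfolding eq using c d by (simp add: nn_integral_cmult ennreal_mult')
  qed (auto simp: ennreal_mult_top ennreal_top_mult)
qed

text \<open>Hoelder's inequality for the \<open>c\<close>-th powers, with the conjugate exponents
  \<open>a / c\<close> and \<open>b / c\<close>.\<close>

lemma Lnorm_mult_le:
  assumes [measurable]: "f \<in> borel_measurable M" "g \<in> borel_measurable M"
  assumes "0 < a" "0 < b" "0 < c" "1 / a + 1 / b = 1 / c"
  shows "Lnorm M c (\<lambda>x. f x * g x) \<le> Lnorm M a f * Lnorm M b g"
proof -
  have "1 / c > 1 / a" "1 / c > 1 / b" using assms by (auto simp flip: assms(6))
  then have ac: "a / c > 1" "b / c > 1" using assms(3-5) by (auto simp: field_simps)
  have "c / a + c / b = 1" using assms(3-6) by (metis add_divide_distrib divide_self_if divide_divide_eq_left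
        less_irrefl mult.commute mult_1 times_divide_eq_right distrib_left)
  then have s: "1 / (a / c) + 1 / (b / c) = 1" by simp
  have "(\<integral>\<^sup>+x. epow (f x * g x) c \<partial>M) = (\<integral>\<^sup>+x. epow (f x) c * epow (g x) c \<partial>M)"
    by (simp add: epow_mult)
  also have "\<dots> \<le> Lnorm M (a / c) (\<lambda>x. epow (f x) c) * Lnorm M (b / c) (\<lambda>x. epow (g x) c)"
    by (rule nn_integral_Hoelder) (use ac s in auto)
  also have "\<dots> = epow (Lnorm M a f * Lnorm M b g) c"
    using assms by (simp add: Lnorm_epow epow_mult)
  finally show ?thesis using assms by (simp add: Lnorm_le_iff)
qed

text \<open>Hoelder's inequality with weights that sum to 1 in place of conjugate exponents. In this
  form it can be iterated to treat more factors.\<close>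

lemma nn_integral_Hoelder_weights:
  assumes [measurable]: "f \<in> borel_measurable M" "g \<in> borel_measurable M"
  assumes "0 < l" "0 < m" "l + m = 1"
  shows "(\<integral>\<^sup>+x. epow (f x) l * epow (g x) m \<partial>M) \<le> epow (\<integral>\<^sup>+x. f x \<partial>M) l * epow (\<integral>\<^sup>+x. g x \<partial>M) m"
proof -
  have "(\<integral>\<^sup>+x. epow (f x) l * epow (g x) m \<partial>M)
      \<le> Lnorm M (1 / l) (\<lambda>x. epow (f x) l) * Lnorm M (1 / m) (\<lambda>x. epow (g x) m)"
    by (rule nn_integral_Hoelder) (use assms in auto)
  then show ?thesis using assms by (simp add: Lnorm_epow Lnorm_1)
qed

lemma nn_integral_Hoelder3:
  assumes [measurable]: "f \<in> borel_measurable M" "g \<in> borel_measurable M" "h \<in> borel_measurable M"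
  assumes "0 < l" "0 < m" "0 < k" "l + m + k = 1"
  shows "(\<integral>\<^sup>+x. epow (f x) l * epow (g x) m * epow (h x) k \<partial>M)
    \<le> epow (\<integral>\<^sup>+x. f x \<partial>M) l * epow (\<integral>\<^sup>+x. g x \<partial>M) m * epow (\<integral>\<^sup>+x. h x \<partial>M) k"
proof -
  \<comment> \<open>The first two factors are grouped with joint weight \<open>j\<close>; inside the
    group the weights are \<open>l / j\<close> and \<open>m / j\<close>.\<close>
  define j where "j = l + m"
  have j: "0 < j" "j + k = 1" using assms by (auto simp: j_def)
  have [simp]: "l / j * j = l" "m / j * j = m" using j by auto
  have lm: "l / j + m / j = 1" using j by (simp add: j_def add_divide_distrib[symmetric])
  have "(\<integral>\<^sup>+x. epow (f x) l * epow (g x) m * epow (h x) k \<partial>M)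
      = (\<integral>\<^sup>+x. epow (epow (f x) (l / j) * epow (g x) (m / j)) j * epow (h x) k \<partial>M)"
    using j by (simp add: epow_mult)
  also have "\<dots> \<le> epow (\<integral>\<^sup>+x. epow (f x) (l / j) * epow (g x) (m / j) \<partial>M) j * epow (\<integral>\<^sup>+x. h x \<partial>M) k"
    by (rule nn_integral_Hoelder_weights) (use j assms in auto)
  also have "\<dots> \<le> epow (epow (\<integral>\<^sup>+x. f x \<partial>M) (l / j) * epow (\<integral>\<^sup>+x. g x \<partial>M) (m / j)) j * epow (\<integral>\<^sup>+x. h x \<partial>M) k"
    by (intro mult_right_mono epow_mono nn_integral_Hoelder_weights) (use j lm assms in auto)
  also have "\<dots> = epow (\<integral>\<^sup>+x. f x \<partial>M) l * epow (\<integral>\<^sup>+x. g x \<partial>M) m * epow (\<integral>\<^sup>+x. h x \<partial>M) k"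
    using j(1) by (simp add: epow_mult)
  finally show ?thesis .
qed

text \<open>The inequality is obtained by testing \<open>F\<close> against \<open>F\<^sup>s\<^sup>-\<^sup>1\<close>; dividing by the norm of \<open>F\<close> needs
  that norm to be finite, hence the truncations \<open>G\<close>.\<close>

lemma Minkowski_integral:
  fixes f :: "'b \<Rightarrow> 'a \<Rightarrow> ennreal"
  assumes "sigma_finite_measure M" "sigma_finite_measure N"
  assumes f [measurable]: "(\<lambda>(t, x). f t x) \<in> borel_measurable (N \<Otimes>\<^sub>M M)" and s: "1 \<le> s"
  shows "Lnorm M s (\<lambda>x. \<integral>\<^sup>+t. f t x \<partial>N) \<le> (\<integral>\<^sup>+t. Lnorm M s (f t) \<partial>N)"
proof (cases "s = 1")
  case True
  interpret M: sigma_finite_measure M by fact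
  interpret N: sigma_finite_measure N by fact
  interpret pair_sigma_finite N M ..
  show ?thesis
    using Fubini'[OF f] by (simp add: True Lnorm_1)
next
  case False
  then have s1: "1 < s" using s by simp
  interpret M: sigma_finite_measure M by fact
  interpret N: sigma_finite_measure N by fact
  interpret pair_sigma_finite N M ..
  define F where "F x = (\<integral>\<^sup>+t. f t x \<partial>N)" for x
  define \<Phi> where "\<Phi> = (\<integral>\<^sup>+t. Lnorm M s (f t) \<partial>N)"
  have [measurable]: "F \<in> borel_measurable M" unfolding F_def by measurable
  obtain A :: "nat \<Rightarrow> 'a set" where A: "range A \<subseteq> sets M" "(\<Union>i. A i) = space M"
    "\<And>i. emeasure M (A i) \<noteq> \<infinity>" "incseq A"
    using M.sigma_finite_incseq by metis
  have [measurable]: "A i \<in> sets M" for i using A(1) by auto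
  define G where "G i x = min (F x) (of_nat i) * indicator (A i) x" for i x
  have [measurable]: "G i \<in> borel_measurable M" for i unfolding G_def by measurable
  have G_mono: "incseq G"
    unfolding G_def incseq_def le_fun_def
    by (auto intro!: mult_mono min.mono simp: indicator_def dest: monoD[OF A(4)])
       (rule order_trans[OF min.cobounded2 of_nat_mono])
  have GF: "G i x \<le> F x" for i x
    unfolding G_def by (auto simp: indicator_def)
  have G_SUP: "(SUP i. G i x) = F x" if "x \<in> space M" for x
  proof (rule antisym)
    show "(SUP i. G i x) \<le> F x" by (auto intro: SUP_least GF)
    have "x \<in> (\<Union>i. A i)" unfolding A(2) by (rule that)
    then obtain i0 where i0: "x \<in> A i0" by (rule UN_E)
    have "min (F x) (of_nat i) \<le> (SUP i. G i x)" for i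
    proof -
      have "x \<in> A (max i i0)" by (rule subsetD[OF incseqD[OF A(4)] i0]) simp
      moreover have "min (F x) (of_nat i) \<le> min (F x) (of_nat (max i i0))"
        by (intro min.mono order_refl of_nat_mono) simp
      ultimately have "min (F x) (of_nat i) \<le> G (max i i0) x"
        unfolding G_def by (simp only: indicator_simps mult_1_right)
      also have "\<dots> \<le> (SUP i. G i x)" by (rule SUP_upper) simp
      finally show ?thesis .
    qed
    then have "(SUP i. min (F x) (of_nat i)) \<le> (SUP i. G i x)" by (intro SUP_least)
    moreover have "(SUP i::nat. min (F x) (of_nat i)) = F x"
    proof (cases "F x")
      case (real r)
      obtain k :: nat where "r \<le> real k" using real_arch_simple by blast
      then have "F x \<le> min (F x) (of_nat k)" using real by (auto simp: ennreal_of_nat_eq_real_of_nat)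
      also have "\<dots> \<le> (SUP i::nat. min (F x) (of_nat i))" by (rule SUP_upper) simp
      finally show ?thesis by (intro antisym SUP_least) auto
    next
      case top
      then show ?thesis by (simp add: ennreal_SUP_of_nat_eq_top)
    qed
    ultimately show "F x \<le> (SUP i. G i x)" by simp
  qed
  have bound: "Lnorm M s (G i) \<le> \<Phi>" for i
  proof -
    define c where "c = (\<integral>\<^sup>+x. epow (G i x) s \<partial>M)"
    have "c \<le> (\<integral>\<^sup>+x. epow (of_nat i) s * indicator (A i) x \<partial>M)"
      unfolding c_def G_def using s1
      by (intro nn_integral_mono) (auto simp: indicator_def intro!: epow_mono)
    also have "\<dots> = epow (of_nat i) s * emeasure M (A i)"
      by (simp add: nn_integral_cmult_indicator)
    also have "\<dots> < top"
      using A(3)[of i] by (auto simp: less_top[symmetric] ennreal_mult_eq_top_iff)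
    finally have c_fin: "c < top" .
    have "c \<le> (\<integral>\<^sup>+x. epow (G i x) (s - 1) * F x \<partial>M)"
      unfolding c_def
    proof (rule nn_integral_mono)
      fix x
      have "epow (G i x) s = epow (G i x) (s - 1) * G i x"
        using epow_add[of "G i x" "s - 1" 1] by simp
      also have "\<dots> \<le> epow (G i x) (s - 1) * F x" by (intro mult_left_mono GF) auto
      finally show "epow (G i x) s \<le> epow (G i x) (s - 1) * F x" .
    qed
    also have "\<dots> = (\<integral>\<^sup>+x. \<integral>\<^sup>+t. epow (G i x) (s - 1) * f t x \<partial>N \<partial>M)"
      unfolding F_def by (intro nn_integral_cong) (simp add: nn_integral_cmult)
    also have "\<dots> = (\<integral>\<^sup>+t. \<integral>\<^sup>+x. epow (G i x) (s - 1) * f t x \<partial>M \<partial>N)"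
      by (rule Fubini') measurable
    also have "\<dots> \<le> (\<integral>\<^sup>+t. epow c (1 - 1 / s) * Lnorm M s (f t) \<partial>N)"
    proof (rule nn_integral_mono)
      fix t assume "t \<in> space N"
      then have [measurable]: "f t \<in> borel_measurable M" by simp
      have "(\<integral>\<^sup>+x. epow (G i x) (s - 1) * f t x \<partial>M)
          \<le> Lnorm M (s / (s - 1)) (\<lambda>x. epow (G i x) (s - 1)) * Lnorm M s (f t)"
        using s1 by (intro nn_integral_Hoelder) (auto simp: less_divide_eq add_divide_distrib[symmetric])
      also have "Lnorm M (s / (s - 1)) (\<lambda>x. epow (G i x) (s - 1)) = epow c (1 - 1 / s)"
        using s1 by (simp add: Lnorm_def c_def diff_divide_distrib)
      finally show "(\<integral>\<^sup>+x. epow (G i x) (s - 1) * f t x \<partial>M) \<le> epow c (1 - 1 / s) * Lnorm M s (f t)" .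
    qed
    also have "\<dots> = epow c (1 - 1 / s) * \<Phi>"
      unfolding \<Phi>_def by (rule nn_integral_cmult) (simp add: Lnorm_def)
    finally have main: "c \<le> epow c (1 - 1 / s) * \<Phi>" .
    show ?thesis
    proof (cases "c = 0")
      case True
      then show ?thesis by (simp add: Lnorm_def c_def[symmetric])
    next
      case False
      have "epow c (1 - 1 / s) * epow c (1 / s) = c" by (simp add: epow_add[symmetric])
      then have "epow c (1 - 1 / s) * epow c (1 / s) \<le> epow c (1 - 1 / s) * \<Phi>" using main by simp
      then have "epow c (1 / s) \<le> \<Phi>"
        using False c_fin by (subst (asm) ennreal_mult_le_mult_iff) auto
      then show ?thesis by (simp add: Lnorm_def c_def)
    qed
  qed
  have "Lnorm M s F = Lnorm M s (\<lambda>x. SUP i. G i x)"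
    by (rule Lnorm_cong_AE) (auto intro!: AE_I2 simp: G_SUP)
  also have "\<dots> = (SUP i. Lnorm M s (G i))"
    using s1 by (intro Lnorm_SUP G_mono) auto
  also have "\<dots> \<le> \<Phi>" by (intro SUP_least bound)
  finally show ?thesis by (simp add: F_def[abs_def] \<Phi>_def)
qed

text \<open>This is \<open>Minkowski_integral\<close> for the counting measure on the two points of
  \<open>bool\<close>.\<close>

lemma Lnorm_triangle:
  assumes "sigma_finite_measure M"
  assumes [measurable]: "f \<in> borel_measurable M" "g \<in> borel_measurable M" and s: "1 \<le> s"
  shows "Lnorm M s (\<lambda>x. f x + g x) \<le> Lnorm M s f + Lnorm M s g"
proof -
  interpret M: sigma_finite_measure M by fact
  let ?N = "count_space (UNIV :: bool set)"
  have "sigma_finite_measure ?N"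
    by (rule sigma_finite_measure_count_space_finite) simp
  moreover have "(\<lambda>(t, x). if t then f x else g x) \<in> borel_measurable (?N \<Otimes>\<^sub>M M)"
    by (rule measurable_pair_measure_countable1) auto
  ultimately have "Lnorm M s (\<lambda>x. \<integral>\<^sup>+t. (if t then f x else g x) \<partial>?N)
      \<le> (\<integral>\<^sup>+t. Lnorm M s (\<lambda>x. if t then f x else g x) \<partial>?N)"
    using Minkowski_integral[of M ?N "\<lambda>t x. if t then f x else g x" s] assms by simp
  then show ?thesis
    by (simp add: nn_integral_count_space_finite UNIV_bool add_ac)
qed

section \<open>Convolution\<close>

abbreviation jointly_measurable :: "(real \<Rightarrow> 'a::euclidean_space \<Rightarrow> 'b::topological_space) \<Rightarrow> bool" where
  "jointly_measurable f \<equiv> (\<lambda>(t, x). f t x) \<in> borel_measurable (borel \<Otimes>\<^sub>M borel)"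

definition conv :: "('a::euclidean_space \<Rightarrow> ennreal) \<Rightarrow> ('a \<Rightarrow> ennreal) \<Rightarrow> 'a \<Rightarrow> ennreal" where
  "conv k f x = (\<integral>\<^sup>+y. k (x - y) * f y \<partial>lborel)"

lemma nn_integral_affine:
  fixes f :: "'a::euclidean_space \<Rightarrow> ennreal"
  assumes [measurable]: "f \<in> borel_measurable borel" and c: "c \<noteq> 0"
  shows "(\<integral>\<^sup>+x. f x \<partial>lborel) = ennreal (\<bar>c\<bar> ^ DIM('a)) * (\<integral>\<^sup>+x. f (t + c *\<^sub>R x) \<partial>lborel)"
  by (subst lborel_affine[OF c, of t], subst nn_integral_density)
     (auto simp: nn_integral_distr nn_integral_cmult)

lemma nn_integral_reflect:
  fixes f :: "'a::euclidean_space \<Rightarrow> ennreal"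
  assumes "f \<in> borel_measurable borel"
  shows "(\<integral>\<^sup>+y. f (x - y) \<partial>lborel) = (\<integral>\<^sup>+y. f y \<partial>lborel)"
  using assms
  using nn_integral_affine[of f "-1" x] by simp

lemma nn_integral_shift:
  fixes f :: "'a::euclidean_space \<Rightarrow> ennreal"
  assumes "f \<in> borel_measurable borel"
  shows "(\<integral>\<^sup>+y. f (y - x) \<partial>lborel) = (\<integral>\<^sup>+y. f y \<partial>lborel)"
  using assms
  by (subst (2) lborel_distr_plus[of "-x", symmetric], subst nn_integral_distr) auto

lemma measurable_conv [measurable]:
  fixes k f :: "'a::euclidean_space \<Rightarrow> ennreal"
  assumes [measurable]: "k \<in> borel_measurable borel" "f \<in> borel_measurable borel"
  shows "conv k f \<in> borel_measurable borel"
  unfolding conv_def by measurable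

lemma conv_commute:
  fixes k f :: "'a::euclidean_space \<Rightarrow> ennreal"
  assumes [measurable]: "k \<in> borel_measurable borel" "f \<in> borel_measurable borel"
  shows "conv k f = conv f k"
proof
  fix x
  show "conv k f x = conv f k x"
    unfolding conv_def
    by (subst nn_integral_reflect[of _ x, symmetric]) (auto simp: mult.commute)
qed

lemma conv_assoc:
  fixes k f g :: "'a::euclidean_space \<Rightarrow> ennreal"
  assumes [measurable]: "k \<in> borel_measurable borel" "f \<in> borel_measurable borel"
    "g \<in> borel_measurable borel"
  shows "conv (conv k f) g x = conv k (conv f g) x"
proof -
  have "conv (conv k f) g x = (\<integral>\<^sup>+y. (\<integral>\<^sup>+z. k (x - y - z) * f z * g y \<partial>lborel) \<partial>lborel)"
    unfolding conv_def by (simp add: nn_integral_multc)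
  also have "\<dots> = (\<integral>\<^sup>+y. (\<integral>\<^sup>+z. k (x - z) * f (z - y) * g y \<partial>lborel) \<partial>lborel)"
  proof (rule nn_integral_cong)
    fix y
    show "(\<integral>\<^sup>+z. k (x - y - z) * f z * g y \<partial>lborel) = (\<integral>\<^sup>+z. k (x - z) * f (z - y) * g y \<partial>lborel)"
      using nn_integral_shift[of "\<lambda>z. k (x - y - z) * f z * g y" y] by (simp add: diff_diff_eq)
  qed
  also have "\<dots> = (\<integral>\<^sup>+z. (\<integral>\<^sup>+y. k (x - z) * f (z - y) * g y \<partial>lborel) \<partial>lborel)"
    by (rule lborel_pair.Fubini') measurable
  also have "\<dots> = conv k (conv f g) x"
    unfolding conv_def by (simp add: nn_integral_cmult mult.assoc)
  finally show ?thesis .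
qed

lemma nn_integral_conv:
  fixes k f :: "'a::euclidean_space \<Rightarrow> ennreal"
  assumes [measurable]: "k \<in> borel_measurable borel" "f \<in> borel_measurable borel"
  shows "(\<integral>\<^sup>+x. conv k f x \<partial>lborel) = (\<integral>\<^sup>+x. k x \<partial>lborel) * (\<integral>\<^sup>+x. f x \<partial>lborel)"
proof -
  have "(\<integral>\<^sup>+x. conv k f x \<partial>lborel) = (\<integral>\<^sup>+y. (\<integral>\<^sup>+x. k (x - y) * f y \<partial>lborel) \<partial>lborel)"
    unfolding conv_def by (rule lborel_pair.Fubini') measurable
  also have "\<dots> = (\<integral>\<^sup>+y. (\<integral>\<^sup>+x. k x \<partial>lborel) * f y \<partial>lborel)"
    by (simp add: nn_integral_multc nn_integral_shift)
  finally show ?thesis by (simp add: nn_integral_cmult)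
qed

lemma conv_mono: "(\<And>x. k x \<le> k' x) \<Longrightarrow> (\<And>x. f x \<le> f' x) \<Longrightarrow> conv k f x \<le> conv k' f' x"
  unfolding conv_def by (intro nn_integral_mono mult_mono) auto

lemma conv_mono_AE: "AE x in lborel. f x \<le> g x \<Longrightarrow> conv k f x \<le> conv k g x"
  unfolding conv_def by (intro nn_integral_mono_AE) (auto elim!: AE_mp intro!: mult_left_mono)

text \<open>The endpoint of Young's inequality with target exponent infinity.\<close>

lemma conv_le_Hoelder:
  fixes k f :: "'a::euclidean_space \<Rightarrow> ennreal"
  assumes [measurable]: "k \<in> borel_measurable borel" "f \<in> borel_measurable borel"
  assumes "1 < a" "1 < b" "1 / a + 1 / b = 1"
  shows "conv k f x \<le> Lnorm lborel b k * Lnorm lborel a f"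
proof -
  have "conv k f x \<le> Lnorm lborel b (\<lambda>y. k (x - y)) * Lnorm lborel a f"
    unfolding conv_def by (rule nn_integral_Hoelder) (use assms in auto)
  also have "Lnorm lborel b (\<lambda>y. k (x - y)) = Lnorm lborel b k"
    unfolding Lnorm_def by (subst nn_integral_reflect) auto
  finally show ?thesis .
qed

text \<open>The convolution is a superposition of translates of \<open>f\<close> with weight
  \<open>k\<close>, and translates have equal norms; Minkowski's inequality adds them up.\<close>

lemma Lnorm_conv_L1:
  fixes k f :: "'a::euclidean_space \<Rightarrow> ennreal"
  assumes [measurable]: "k \<in> borel_measurable borel" "f \<in> borel_measurable borel"
  assumes "1 \<le> r"
  shows "Lnorm lborel r (conv k f) \<le> (\<integral>\<^sup>+x. k x \<partial>lborel) * Lnorm lborel r f"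
proof -
  have "Lnorm lborel r (conv k f) = Lnorm lborel r (\<lambda>x. \<integral>\<^sup>+y. f (x - y) * k y \<partial>lborel)"
    by (subst conv_commute) (auto simp: conv_def[abs_def])
  also have "\<dots> \<le> (\<integral>\<^sup>+y. Lnorm lborel r (\<lambda>x. f (x - y) * k y) \<partial>lborel)"
    by (rule Minkowski_integral) (use assms in \<open>auto intro: sigma_finite_lborel\<close>)
  also have "\<dots> = (\<integral>\<^sup>+y. k y * Lnorm lborel r f \<partial>lborel)"
  proof (rule nn_integral_cong)
    fix y :: 'a
    have "Lnorm lborel r (\<lambda>x. f (x - y)) = Lnorm lborel r f"
      unfolding Lnorm_def by (subst nn_integral_shift) auto
    then show "Lnorm lborel r (\<lambda>x. f (x - y) * k y) = k y * Lnorm lborel r f"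
      using assms by (subst mult.commute, subst Lnorm_cmult) auto
  qed
  also have "\<dots> = (\<integral>\<^sup>+x. k x \<partial>lborel) * Lnorm lborel r f"
    by (simp add: nn_integral_multc)
  finally show ?thesis .
qed

text \<open>Young's inequality for convolutions, by a three-factor Hoelder inequality at each point
  followed by the exact formula for the integral of a convolution.\<close>

lemma Lnorm_conv_Young:
  fixes k f :: "'a::euclidean_space \<Rightarrow> ennreal"
  assumes [measurable]: "k \<in> borel_measurable borel" "f \<in> borel_measurable borel"
  assumes q: "1 < q" "q < r" and b: "0 < b" "1 / b + 1 / q = 1 + 1 / r"
  shows "Lnorm lborel r (conv k f) \<le> Lnorm lborel b k * Lnorm lborel q f"
proof -
  let ?K = "\<integral>\<^sup>+x. epow (k x) b \<partial>lborel" and ?F = "\<integral>\<^sup>+x. epow (f x) q \<partial>lborel"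
  have r: "0 < r" using q by simp
  have e1: "b / r + b * (1 - 1 / q) = 1"
  proof -
    have "1 / b = 1 + 1 / r - 1 / q" using b(2) by simp
    then have "b * (1 / b) = b * (1 + 1 / r - 1 / q)" by (rule arg_cong)
    then show ?thesis using b(1) by (simp add: algebra_simps)
  qed
  have e2: "q / r + q * (1 / q - 1 / r) = 1" using q by (simp add: algebra_simps)
  \<comment> \<open>The integrand is written as \<open>(k^b f^q)^(1/r)\<close> times
    \<open>(f^q)^(1/q - 1/r)\<close> times \<open>(k^b)^(1 - 1/q)\<close>. The exponents recombine
    by \<open>e1\<close> and \<open>e2\<close>, and the three weights sum to 1.\<close>
  have pt: "conv k f x \<le> epow (conv (\<lambda>x. epow (k x) b) (\<lambda>x. epow (f x) q) x) (1 / r)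
      * epow ?F (1 / q - 1 / r) * epow ?K (1 - 1 / q)" for x
  proof -
    have "conv k f x = (\<integral>\<^sup>+y. epow (epow (k (x - y)) b * epow (f y) q) (1 / r)
        * epow (epow (f y) q) (1 / q - 1 / r) * epow (epow (k (x - y)) b) (1 - 1 / q) \<partial>lborel)"
      unfolding conv_def
    proof (intro nn_integral_cong)
      fix y
      have "k (x - y) * f y = epow (k (x - y)) (b / r + b * (1 - 1 / q)) * epow (f y) (q / r + q * (1 / q - 1 / r))"
        unfolding e1 e2 by simp
      then show "k (x - y) * f y = epow (epow (k (x - y)) b * epow (f y) q) (1 / r)
        * epow (epow (f y) q) (1 / q - 1 / r) * epow (epow (k (x - y)) b) (1 - 1 / q)"
        by (simp add: epow_add epow_mult mult_ac)
    qed
    also have "\<dots> \<le> epow (\<integral>\<^sup>+y. epow (k (x - y)) b * epow (f y) q \<partial>lborel) (1 / r)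
        * epow ?F (1 / q - 1 / r) * epow (\<integral>\<^sup>+y. epow (k (x - y)) b \<partial>lborel) (1 - 1 / q)"
      by (rule nn_integral_Hoelder3) (use q r in \<open>auto simp: field_simps\<close>)
    also have "(\<integral>\<^sup>+y. epow (k (x - y)) b \<partial>lborel) = ?K"
      by (subst nn_integral_reflect) auto
    finally show ?thesis by (simp add: conv_def)
  qed
  let ?c = "epow ?F (1 / q - 1 / r) * epow ?K (1 - 1 / q)"
  have "Lnorm lborel r (conv k f)
      \<le> Lnorm lborel r (\<lambda>x. ?c * epow (conv (\<lambda>x. epow (k x) b) (\<lambda>x. epow (f x) q) x) (1 / r))"
    using r pt by (intro Lnorm_mono) (auto simp: mult_ac)
  also have "\<dots> = ?c * epow (?K * ?F) (1 / r)"
    using r by (subst Lnorm_cmult) (auto simp: Lnorm_epow Lnorm_1 nn_integral_conv)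
  also have "\<dots> = epow ?K (1 / r + (1 - 1 / q)) * epow ?F (1 / r + (1 / q - 1 / r))"
    by (subst (1 2) epow_add) (simp add: epow_mult mult_ac)
  also have "1 / r + (1 - 1 / q) = 1 / b" using b by simp
  finally show ?thesis by (simp add: Lnorm_def)
qed

text \<open>Hoelder's inequality puts the product into the space with exponent \<open>q\<close>,
  where \<open>1/q = 1/s + 1/a\<close>. Young's inequality leads from there back to
  \<open>s\<close>, and the kernel exponent this requires is the conjugate of \<open>a\<close>
  whatever \<open>s\<close> is. The last hypothesis means \<open>q > 1\<close>.\<close>

lemma Lnorm_conv_bilinear:
  fixes k w g :: "'a::euclidean_space \<Rightarrow> ennreal"
  assumes [measurable]: "k \<in> borel_measurable borel" "w \<in> borel_measurable borel"
    "g \<in> borel_measurable borel"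
  assumes s: "0 < s" and a: "1 < a" and b: "0 < b" "1 / b = 1 - 1 / a" and sa: "1 / s + 1 / a < 1"
  shows "Lnorm lborel s (conv k (\<lambda>x. w x * g x)) \<le> Lnorm lborel b k * (Lnorm lborel s w * Lnorm lborel a g)"
proof -
  define q where "q = 1 / (1 / s + 1 / a)"
  have q: "1 / q = 1 / s + 1 / a" "0 < q" using s a by (auto simp: q_def add_pos_pos)
  have "1 / q < 1" "1 / s < 1 / q" using q sa a by auto
  then have q2: "1 < q" "q < s" using q(2) s by (auto simp: divide_less_eq field_simps)
  have "Lnorm lborel s (conv k (\<lambda>x. w x * g x)) \<le> Lnorm lborel b k * Lnorm lborel q (\<lambda>x. w x * g x)"
    by (rule Lnorm_conv_Young) (use q q2 b in auto)
  also have "\<dots> \<le> Lnorm lborel b k * (Lnorm lborel s w * Lnorm lborel a g)"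
    by (intro mult_left_mono Lnorm_mult_le) (use q s a in auto)
  finally show ?thesis .
qed

text \<open>The same bilinear estimate at the endpoint where \<open>w\<close> is merely essentially
  bounded; the kernel norm is unchanged.\<close>

lemma conv_bilinear_le:
  fixes k w g :: "'a::euclidean_space \<Rightarrow> ennreal"
  assumes [measurable]: "k \<in> borel_measurable borel" "w \<in> borel_measurable borel"
    "g \<in> borel_measurable borel"
  assumes a: "1 < a" and b: "0 < b" "1 / b = 1 - 1 / a" and c: "AE x in lborel. w x \<le> c"
  shows "conv k (\<lambda>x. w x * g x) x \<le> Lnorm lborel b k * (c * Lnorm lborel a g)"
proof -
  have "1 / b < 1" "0 < 1 / b" using a b by auto
  then have b1: "1 < b" using b(1) by (simp add: divide_less_eq)
  have "conv k (\<lambda>x. w x * g x) x \<le> conv k (\<lambda>x. c * g x) x"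
    using c by (intro conv_mono_AE) (auto elim!: AE_mp intro!: mult_right_mono)
  also have "\<dots> \<le> Lnorm lborel b k * Lnorm lborel a (\<lambda>x. c * g x)"
    by (rule conv_le_Hoelder) (use a b b1 in auto)
  finally show ?thesis using a by (simp add: Lnorm_cmult)
qed

section \<open>Null sequences of extended nonnegative numbers\<close>

lemma tendsto_0_ennreal_iff:
  fixes f :: "'a \<Rightarrow> ennreal"
  shows "(f \<longlongrightarrow> 0) F \<longleftrightarrow> (\<forall>e>0. \<forall>\<^sub>F x in F. f x \<le> ennreal e)"
proof
  assume L: "(f \<longlongrightarrow> 0) F"
  show "\<forall>e>0. \<forall>\<^sub>F x in F. f x \<le> ennreal e"
  proof (intro allI impI)
    fix e :: real assume "0 < e"
    then have "\<forall>\<^sub>F x in F. f x < ennreal e" by (intro order_tendstoD(2)[OF L]) auto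
    then show "\<forall>\<^sub>F x in F. f x \<le> ennreal e" by (rule eventually_mono) auto
  qed
next
  assume R: "\<forall>e>0. \<forall>\<^sub>F x in F. f x \<le> ennreal e"
  show "(f \<longlongrightarrow> 0) F"
  proof (rule order_tendstoI)
    fix a :: ennreal assume "0 < a"
    then obtain e where e: "0 < e" "ennreal e < a"
      using ennreal_rat_dense by (metis dense ennreal_less_zero_iff not_gr_zero
          ennreal_cases ennreal_0 le_less order_less_le_trans top.not_eq_extremum)
    then have "\<forall>\<^sub>F x in F. f x \<le> ennreal e" using R by auto
    then show "\<forall>\<^sub>F x in F. f x < a" by (rule eventually_mono) (use e in auto)
  qed auto
qed

text \<open>Made for density arguments: the comparison function may change with the tolerated
  error.\<close>

lemma tendsto_0_ennreal_approx:
  fixes f :: "'a \<Rightarrow> ennreal"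
  assumes "\<And>e. 0 < e \<Longrightarrow> \<exists>g. (g \<longlongrightarrow> 0) F \<and> (\<forall>\<^sub>F x in F. f x \<le> g x + ennreal e)"
  shows "(f \<longlongrightarrow> 0) F"
  unfolding tendsto_0_ennreal_iff
proof (intro allI impI)
  fix e :: real assume e: "0 < e"
  then obtain g where g: "(g \<longlongrightarrow> 0) F" "\<forall>\<^sub>F x in F. f x \<le> g x + ennreal (e / 2)"
    using assms[of "e / 2"] by auto
  have "\<forall>\<^sub>F x in F. g x \<le> ennreal (e / 2)"
    using g(1) e unfolding tendsto_0_ennreal_iff by auto
  with g(2) show "\<forall>\<^sub>F x in F. f x \<le> ennreal e"
  proof eventually_elim
    case (elim x)
    then have "f x \<le> ennreal (e / 2) + ennreal (e / 2)"
      by (meson add_right_mono order_trans)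
    then show ?case using e by (simp add: ennreal_plus[symmetric] del: ennreal_plus)
  qed
qed

lemma tendsto_0_ennreal_le:
  fixes f g :: "'a \<Rightarrow> ennreal"
  assumes "(g \<longlongrightarrow> 0) F" "\<forall>\<^sub>F x in F. f x \<le> g x"
  shows "(f \<longlongrightarrow> 0) F"
  by (rule tendsto_sandwich[OF _ assms(2) tendsto_const assms(1)]) auto

lemma tendsto_0_ennreal_cmult:
  fixes f :: "'a \<Rightarrow> ennreal"
  assumes "(f \<longlongrightarrow> 0) F" "c < top"
  shows "((\<lambda>x. c * f x) \<longlongrightarrow> 0) F"
  using ennreal_tendsto_cmult[of c f 0 F] assms by auto

lemma tendsto_0_epow:
  fixes f :: "'a \<Rightarrow> ennreal"
  assumes "(f \<longlongrightarrow> 0) F" "0 < c"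
  shows "((\<lambda>x. epow (f x) c) \<longlongrightarrow> 0) F"
  unfolding tendsto_0_ennreal_iff epow_le_iff[OF assms(2)]
  using assms(1) unfolding tendsto_0_ennreal_iff by auto

lemma Lnorm_tendsto_0_iff:
  assumes "0 < s"
  shows "((\<lambda>k. Lnorm M s (f k)) \<longlongrightarrow> 0) F \<longleftrightarrow> ((\<lambda>k. \<integral>\<^sup>+x. epow (f k x) s \<partial>M) \<longlongrightarrow> 0) F"
proof
  assume "((\<lambda>k. Lnorm M s (f k)) \<longlongrightarrow> 0) F"
  from tendsto_0_epow[OF this assms] show "((\<lambda>k. \<integral>\<^sup>+x. epow (f k x) s \<partial>M) \<longlongrightarrow> 0) F"
    using assms by (simp add: epow_Lnorm)
next
  assume "((\<lambda>k. \<integral>\<^sup>+x. epow (f k x) s \<partial>M) \<longlongrightarrow> 0) F"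
  from tendsto_0_epow[OF this, of "1 / s"] show "((\<lambda>k. Lnorm M s (f k)) \<longlongrightarrow> 0) F"
    using assms by (simp add: Lnorm_def)
qed

section \<open>Power weights\<close>

lemma nn_integral_powr_Icc:
  assumes "-1 < a" "0 \<le> c"
  shows "(\<integral>\<^sup>+s. indicator {0..c} s * ennreal (s powr a) \<partial>lborel) = ennreal (c powr (a + 1) / (a + 1))"
  using nn_integral_has_integral_lebesgue[OF _ has_integral_powr_from_0[OF assms]]
  by (simp add: ennreal_mult' ennreal_indicator)

lemma nn_integral_powr_Ici:
  assumes "a < -1" "0 < c"
  shows "(\<integral>\<^sup>+s. indicator {c..} s * ennreal (s powr a) \<partial>lborel) = ennreal (c powr (a + 1) / - (a + 1))"
  using nn_integral_has_integral_lebesgue[OF _ has_integral_powr_to_inf[OF assms]]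
  by (simp add: ennreal_mult' ennreal_indicator minus_divide_right)

text \<open>Layer-cake formula. By Tonelli it reduces integrals of radial powers to volumes of balls
  and takes the place of polar coordinates.\<close>

lemma powr_as_integral:
  assumes "0 < g" "0 < r"
  shows "ennreal (r powr - g) = (\<integral>\<^sup>+s. ennreal g * (indicator {s. r \<le> s} s * ennreal (s powr (- g - 1))) \<partial>lborel)"
  using assms nn_integral_powr_Ici[of "- g - 1" r] unfolding atLeast_def
  by (simp add: nn_integral_cmult ennreal_mult'[symmetric])

text \<open>After the layer-cake formula, level \<open>s\<close> sees only the shell between the
  radii \<open>\<rho>\<close> and \<open>s\<close>. Estimating it by the full ball is affordable,
  since \<open>g\<close> exceeds the dimension and the resulting power of \<open>s\<close> is
  integrable at infinity.\<close>

lemma nn_integral_norm_powr_outside: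
  fixes \<rho> g :: real
  assumes g: "real DIM('a::euclidean_space) < g" and \<rho>: "0 < \<rho>"
  shows "(\<integral>\<^sup>+(x::'a). indicator {x. \<rho> < norm x} x * ennreal (norm x powr - g) \<partial>lborel)
    \<le> ennreal (g * unit_ball_vol DIM('a) / (g - DIM('a)) * \<rho> powr (DIM('a) - g))"
proof -
  let ?n = "real DIM('a)" and ?V = "unit_ball_vol DIM('a)"
  have g0: "0 < g" using g by (meson less_le_trans not_le of_nat_0_le_iff order.strict_trans1)
  have "(\<integral>\<^sup>+(x::'a). indicator {x. \<rho> < norm x} x * ennreal (norm x powr - g) \<partial>lborel)
      = (\<integral>\<^sup>+(x::'a). (\<integral>\<^sup>+s. indicator {x. \<rho> < norm x} x * (ennreal g * (indicator {s. norm x \<le> s} s * ennreal (s powr (- g - 1)))) \<partial>lborel) \<partial>lborel)"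
  proof (rule nn_integral_cong)
    fix x :: 'a
    show "indicator {x. \<rho> < norm x} x * ennreal (norm x powr - g) =
      (\<integral>\<^sup>+s. indicator {x. \<rho> < norm x} x * (ennreal g * (indicator {s. norm x \<le> s} s * ennreal (s powr (- g - 1)))) \<partial>lborel)"
    proof (cases "\<rho> < norm x")
      case True
      then have 1: "indicator {x. \<rho> < norm x} x = (1::ennreal)" and x: "0 < norm x" using \<rho> by auto
      show ?thesis unfolding 1 mult_1 by (rule powr_as_integral[OF g0 x])
    qed simp
  qed
  also have "\<dots> = (\<integral>\<^sup>+s. (\<integral>\<^sup>+(x::'a). indicator {x. \<rho> < norm x} x * (ennreal g * (indicator {s. norm x \<le> s} s * ennreal (s powr (- g - 1)))) \<partial>lborel) \<partial>lborel)"
    by (rule lborel_pair.Fubini') measurable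
  also have "\<dots> \<le> (\<integral>\<^sup>+s. ennreal (g * ?V) * (indicator {\<rho>..} s * ennreal (s powr (?n - g - 1))) \<partial>lborel)"
  proof (rule nn_integral_mono)
    fix s :: real
    show "(\<integral>\<^sup>+(x::'a). indicator {x. \<rho> < norm x} x * (ennreal g * (indicator {s. norm x \<le> s} s * ennreal (s powr (- g - 1)))) \<partial>lborel)
       \<le> ennreal (g * ?V) * (indicator {\<rho>..} s * ennreal (s powr (?n - g - 1)))"
    proof (cases "\<rho> \<le> s")
      case True
      then have s: "0 < s" using \<rho> by simp
      have "(\<integral>\<^sup>+(x::'a). indicator {x. \<rho> < norm x} x * (ennreal g * (indicator {s. norm x \<le> s} s * ennreal (s powr (- g - 1)))) \<partial>lborel)
        \<le> (\<integral>\<^sup>+(x::'a). ennreal (g * s powr (- g - 1)) * indicator (cball 0 s) x \<partial>lborel)"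
        using g0 by (intro nn_integral_mono) (auto simp: indicator_def ennreal_mult')
      also have "\<dots> = ennreal (g * s powr (- g - 1)) * ennreal (?V * s ^ DIM('a))"
        using s by (simp add: nn_integral_cmult_indicator emeasure_cball)
      also have "\<dots> = ennreal (g * ?V * (s powr ?n * s powr (- g - 1)))"
        using s g0 by (simp add: ennreal_mult'[symmetric] powr_realpow mult_ac)
      also have "s powr ?n * s powr (- g - 1) = s powr (?n - g - 1)"
        by (simp add: powr_add[symmetric] algebra_simps)
      finally show ?thesis using True g0 by (simp add: ennreal_mult')
    next
      case False
      have z: "indicator {x. \<rho> < norm x} x * (ennreal g * (indicator {s. norm x \<le> s} s * ennreal (s powr (- g - 1)))) = 0" for x :: 'a
        using False by (auto simp: indicator_def)
      show ?thesis unfolding z by simp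
    qed
  qed
  also have "\<dots> = ennreal (g * ?V) * ennreal (\<rho> powr (?n - g) / (g - ?n))"
    using g \<rho> nn_integral_powr_Ici[of "?n - g - 1" \<rho>] by (simp add: nn_integral_cmult)
  also have "\<dots> = ennreal (g * ?V / (g - ?n) * \<rho> powr (?n - g))"
    using g g0 by (simp add: ennreal_mult'[symmetric])
  finally show ?thesis .
qed

lemma nn_integral_norm_powr_inside:
  fixes \<rho> g :: real
  assumes g: "0 < g" "g < real DIM('a::euclidean_space)" and \<rho>: "0 < \<rho>"
  shows "(\<integral>\<^sup>+(x::'a). indicator {x. norm x \<le> \<rho>} x * ennreal (norm x powr - g) \<partial>lborel)
    \<le> ennreal ((g * unit_ball_vol DIM('a) / (DIM('a) - g) + unit_ball_vol DIM('a)) * \<rho> powr (DIM('a) - g))"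
proof -
  let ?n = "real DIM('a)" and ?V = "unit_ball_vol DIM('a)"
  have "(\<integral>\<^sup>+(x::'a). indicator {x. norm x \<le> \<rho>} x * ennreal (norm x powr - g) \<partial>lborel)
      \<le> (\<integral>\<^sup>+(x::'a). (\<integral>\<^sup>+s. indicator {x. norm x \<le> \<rho>} x * (ennreal g * (indicator {s. norm x \<le> s} s * ennreal (s powr (- g - 1)))) \<partial>lborel) \<partial>lborel)"
  proof (rule nn_integral_mono)
    fix x :: 'a
    show "indicator {x. norm x \<le> \<rho>} x * ennreal (norm x powr - g) \<le>
      (\<integral>\<^sup>+s. indicator {x. norm x \<le> \<rho>} x * (ennreal g * (indicator {s. norm x \<le> s} s * ennreal (s powr (- g - 1)))) \<partial>lborel)"
    \<comment> \<open>At the origin the left side is 0 by the convention for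
      \<open>0 powr _\<close>, whereas the layer-cake formula needs a positive norm. Hence an
      inequality, not an equation.\<close>
    proof (cases "norm x \<le> \<rho> \<and> x \<noteq> 0")
      case True
      then have 1: "indicator {x. norm x \<le> \<rho>} x = (1::ennreal)" and x: "0 < norm x" by auto
      show ?thesis unfolding 1 mult_1 by (rule eq_refl[OF powr_as_integral[OF g(1) x]])
    qed auto
  qed
  also have "\<dots> = (\<integral>\<^sup>+s. (\<integral>\<^sup>+(x::'a). indicator {x. norm x \<le> \<rho>} x * (ennreal g * (indicator {s. norm x \<le> s} s * ennreal (s powr (- g - 1)))) \<partial>lborel) \<partial>lborel)"
    by (rule lborel_pair.Fubini') measurable
  \<comment> \<open>The slice at level \<open>s\<close> is a ball of radius
    \<open>min s \<rho>\<close>. The two ranges of \<open>s\<close> use \<open>g\<close> below the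
    dimension near 0 and \<open>g > 0\<close> at infinity, respectively.\<close>
  also have "\<dots> \<le> (\<integral>\<^sup>+s. ennreal (g * ?V) * (indicator {0..\<rho>} s * ennreal (s powr (?n - g - 1)))
      + ennreal (g * ?V * \<rho> powr ?n) * (indicator {\<rho>..} s * ennreal (s powr (- g - 1))) \<partial>lborel)"
  proof (rule nn_integral_mono)
    fix s :: real
    let ?L = "(\<integral>\<^sup>+(x::'a). indicator {x. norm x \<le> \<rho>} x * (ennreal g * (indicator {s. norm x \<le> s} s * ennreal (s powr (- g - 1)))) \<partial>lborel)"
    show "?L \<le> ennreal (g * ?V) * (indicator {0..\<rho>} s * ennreal (s powr (?n - g - 1)))
      + ennreal (g * ?V * \<rho> powr ?n) * (indicator {\<rho>..} s * ennreal (s powr (- g - 1)))"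
    proof -
      consider "s < 0" | "s = 0" | "0 < s" "s \<le> \<rho>" | "\<rho> < s" by linarith
      then show ?thesis
      proof cases
        case 1
        have z: "indicator {x. norm x \<le> \<rho>} x * (ennreal g * (indicator {s. norm x \<le> s} s * ennreal (s powr (- g - 1)))) = 0" for x :: 'a
          using 1 norm_ge_zero[of x] by (auto simp: indicator_def simp del: norm_ge_zero)
        show ?thesis unfolding z by simp
      next
        case 3
        have "?L \<le> (\<integral>\<^sup>+(x::'a). ennreal (g * s powr (- g - 1)) * indicator (cball 0 s) x \<partial>lborel)"
          using g by (intro nn_integral_mono) (auto simp: indicator_def ennreal_mult')
        also have "\<dots> = ennreal (g * s powr (- g - 1)) * ennreal (?V * s ^ DIM('a))"
          using 3 by (simp add: nn_integral_cmult_indicator emeasure_cball)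
        also have "\<dots> = ennreal (g * ?V * (s powr ?n * s powr (- g - 1)))"
          using 3 g by (simp add: ennreal_mult'[symmetric] powr_realpow mult_ac)
        also have "s powr ?n * s powr (- g - 1) = s powr (?n - g - 1)"
          by (simp add: powr_add[symmetric] algebra_simps)
        finally show ?thesis using 3 g by (simp add: ennreal_mult' add_increasing2)
      next
        case 4
        have "?L \<le> (\<integral>\<^sup>+(x::'a). ennreal (g * s powr (- g - 1)) * indicator (cball 0 \<rho>) x \<partial>lborel)"
          using g by (intro nn_integral_mono) (auto simp: indicator_def ennreal_mult')
        also have "\<dots> = ennreal (g * s powr (- g - 1)) * ennreal (?V * \<rho> ^ DIM('a))"
          using \<rho> by (simp add: nn_integral_cmult_indicator emeasure_cball)
        also have "\<dots> = ennreal (g * ?V * \<rho> powr ?n) * ennreal (s powr (- g - 1))"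
          using \<rho> g by (simp add: ennreal_mult'[symmetric] powr_realpow mult_ac)
        finally show ?thesis using 4 \<rho> by simp
      qed simp
    qed
  qed
  also have "\<dots> = ennreal (g * ?V) * ennreal (\<rho> powr (?n - g) / (?n - g))
      + ennreal (g * ?V * \<rho> powr ?n) * ennreal (\<rho> powr (- g) / g)"
    using g \<rho> nn_integral_powr_Icc[of "?n - g - 1" \<rho>] nn_integral_powr_Ici[of "- g - 1" \<rho>]
    by (simp add: nn_integral_cmult nn_integral_add)
  also have "\<dots> = ennreal (g * ?V * (\<rho> powr (?n - g) / (?n - g)) + g * ?V * \<rho> powr ?n * (\<rho> powr (- g) / g))"
    using g by (simp add: ennreal_mult'[symmetric])
  also have "g * ?V * \<rho> powr ?n * (\<rho> powr (- g) / g) = ?V * \<rho> powr (?n - g)"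
    using g by (simp add: powr_diff powr_minus field_simps)
  finally show ?thesis using g by (simp add: field_simps)
qed

section \<open>Translations and approximate identities\<close>

text \<open>The symmetric difference of \<open>U\<close> and its translate consists of two halves.
  The half \<open>a\<close> inside \<open>U\<close> tends to 0 by dominated convergence, because
  \<open>U\<close> is open; the half \<open>b\<close> has the same measure, because \<open>U\<close>
  and its translate have the same finite measure.\<close>

lemma L1_translation_open:
  fixes U :: "'a::euclidean_space set"
  assumes U: "open U" "emeasure lborel U < \<infinity>" and z: "z \<longlonglongrightarrow> 0"
  shows "(\<lambda>k. \<integral>\<^sup>+x. ennreal \<bar>indicator U (x - z k) - indicator U x\<bar> \<partial>lborel) \<longlonglongrightarrow> 0"
proof -
  have [measurable]: "U \<in> sets borel" using U by auto
  define a where "a k = (\<integral>\<^sup>+x. indicator U x * indicator (- U) (x - z k) \<partial>lborel)" for k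
  define b where "b k = (\<integral>\<^sup>+x. indicator (- U) x * indicator U (x - z k) \<partial>lborel)" for k
  define m where "m k = (\<integral>\<^sup>+x. indicator U x * indicator U (x - z k) \<partial>lborel)" for k
  have am: "a k + m k = emeasure lborel U" for k
  proof -
    have "a k + m k = (\<integral>\<^sup>+x. indicator U x * indicator (- U) (x - z k) + indicator U x * indicator U (x - z k) \<partial>lborel)"
      unfolding a_def m_def by (subst nn_integral_add) auto
    also have "\<dots> = (\<integral>\<^sup>+x. indicator U x \<partial>lborel)"
      by (intro nn_integral_cong) (auto simp: indicator_def)
    finally show ?thesis by simp
  qed
  have bm: "b k + m k = emeasure lborel U" for k
  proof -
    have "b k + m k = (\<integral>\<^sup>+x. indicator (- U) x * indicator U (x - z k) + indicator U x * indicator U (x - z k) \<partial>lborel)"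
      unfolding b_def m_def by (subst nn_integral_add) auto
    also have "\<dots> = (\<integral>\<^sup>+x. indicator U (x - z k) \<partial>lborel)"
      by (intro nn_integral_cong) (auto simp: indicator_def)
    also have "\<dots> = (\<integral>\<^sup>+x. indicator U x \<partial>lborel)"
      by (rule nn_integral_shift) auto
    finally show ?thesis by simp
  qed
  have ab: "a k = b k" for k
  proof -
    have "m k \<le> emeasure lborel U" using am[of k] by (metis le_iff_add add.commute)
    then have "m k < top" using U(2) by (auto simp: less_top)
    moreover have "m k + a k = m k + b k" using am[of k] bm[of k] by (simp add: add.commute)
    ultimately show ?thesis by (auto simp: ennreal_add_left_cancel)
  qed
  have "a \<longlonglongrightarrow> (\<integral>\<^sup>+(x::'a). 0 \<partial>lborel)"
    unfolding a_def
  proof (rule nn_integral_dominated_convergence[where w="indicator U"])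
    show "AE x in lborel. (\<lambda>k. indicator U x * indicator (- U) (x - z k)) \<longlonglongrightarrow> (0::ennreal)"
    proof (rule AE_I2)
      fix x :: 'a
      show "(\<lambda>k. indicator U x * indicator (- U) (x - z k)) \<longlonglongrightarrow> (0::ennreal)"
      proof (cases "x \<in> U")
        case True
        have "(\<lambda>k. x - z k) \<longlonglongrightarrow> x - 0" by (intro tendsto_intros z)
        then have "(\<lambda>k. x - z k) \<longlonglongrightarrow> x" by simp
        from topological_tendstoD[OF this U(1) True]
        have "\<forall>\<^sub>F k in sequentially. x - z k \<in> U" .
        then have "\<forall>\<^sub>F k in sequentially. indicator U x * indicator (- U) (x - z k) = (0::ennreal)"
          by (rule eventually_mono) auto
        then show ?thesis by (rule tendsto_eventually)
      qed simp
    qed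
    show "(\<integral>\<^sup>+x. indicator U x \<partial>lborel) < \<infinity>" using U(2) by simp
  qed (auto simp: indicator_def)
  then have "(\<lambda>k. a k + b k) \<longlonglongrightarrow> 0 + 0"
    unfolding ab[symmetric] by (intro tendsto_add) auto
  moreover have "(\<integral>\<^sup>+x. ennreal \<bar>indicator U (x - z k) - indicator U x\<bar> \<partial>lborel) = a k + b k" for k
    unfolding a_def b_def
    by (subst nn_integral_add[symmetric]) (auto intro!: nn_integral_cong simp: indicator_def)
  ultimately show ?thesis by simp
qed

lemma L1_translation_continuous:
  fixes f :: "'a::euclidean_space \<Rightarrow> real"
  assumes "integrable lborel f" and z: "z \<longlonglongrightarrow> 0"
  shows "(\<lambda>k. \<integral>\<^sup>+x. ennreal \<bar>f (x - z k) - f x\<bar> \<partial>lborel) \<longlonglongrightarrow> 0"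
  using assms(1)
proof (induction rule: integrable_induct)
  case (base A c)
  then have [measurable]: "A \<in> sets borel" by simp
  have "(\<lambda>k. \<integral>\<^sup>+x. ennreal \<bar>indicator A (x - z k) - indicator A x\<bar> \<partial>lborel) \<longlonglongrightarrow> 0"
  proof (rule tendsto_0_ennreal_approx)
    fix e :: real assume e: "0 < e"
    \<comment> \<open>Outer regularity reduces the Borel set to an open one. The excess
      \<open>U - A\<close> enters twice, once at \<open>x\<close> and once at the translated point,
      hence \<open>e / 2\<close>.\<close>
    obtain U where U: "open U" "A \<subseteq> U" "emeasure lborel (U - A) < ennreal (e / 2)"
      using outer_regular_lborel[of A "e / 2"] e by auto
    have [measurable]: "U \<in> sets borel" using U by auto
    have "emeasure lborel U = emeasure lborel A + emeasure lborel (U - A)"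
      using U(2) by (subst plus_emeasure) (auto simp: Un_absorb1)
    also have "\<dots> < \<infinity>" using base order_less_trans[OF U(3), of top] by (auto simp: less_top)
    finally have fin: "emeasure lborel U < \<infinity>" .
    have "(\<integral>\<^sup>+x. ennreal \<bar>indicator A (x - z k) - indicator A x\<bar> \<partial>lborel)
        \<le> (\<integral>\<^sup>+x. ennreal \<bar>indicator U (x - z k) - indicator U x\<bar> \<partial>lborel) + ennreal e" for k
    proof -
      have "(\<integral>\<^sup>+x. ennreal \<bar>indicator A (x - z k) - indicator A x\<bar> \<partial>lborel)
        \<le> (\<integral>\<^sup>+x. ennreal \<bar>indicator U (x - z k) - indicator U x\<bar> + (indicator (U - A) (x - z k) + indicator (U - A) x) \<partial>lborel)"
        using U(2) by (intro nn_integral_mono) (auto simp: indicator_def)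
      also have "\<dots> = (\<integral>\<^sup>+x. ennreal \<bar>indicator U (x - z k) - indicator U x\<bar> \<partial>lborel)
          + (emeasure lborel (U - A) + emeasure lborel (U - A))"
        by (simp add: nn_integral_add nn_integral_shift[of "indicator (U - A)"])
      also have "\<dots> \<le> (\<integral>\<^sup>+x. ennreal \<bar>indicator U (x - z k) - indicator U x\<bar> \<partial>lborel)
          + (ennreal (e / 2) + ennreal (e / 2))"
        using U(3) by (intro add_mono) auto
      finally show ?thesis using e by (simp add: ennreal_plus[symmetric] del: ennreal_plus)
    qed
    then show "\<exists>g. g \<longlonglongrightarrow> 0 \<and> (\<forall>\<^sub>F k in sequentially.
        (\<integral>\<^sup>+x. ennreal \<bar>indicator A (x - z k) - indicator A x\<bar> \<partial>lborel) \<le> g k + ennreal e)"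
      using L1_translation_open[OF U(1) fin z]
      by (intro exI[of _ "\<lambda>k. \<integral>\<^sup>+x. ennreal \<bar>indicator U (x - z k) - indicator U x\<bar> \<partial>lborel"])
         (auto intro: always_eventually)
  qed
  then have "(\<lambda>k. ennreal \<bar>c\<bar> * (\<integral>\<^sup>+x. ennreal \<bar>indicator A (x - z k) - indicator A x\<bar> \<partial>lborel)) \<longlonglongrightarrow> 0"
    by (rule tendsto_0_ennreal_cmult) simp
  moreover have "ennreal \<bar>c\<bar> * (\<integral>\<^sup>+x. ennreal \<bar>indicator A (x - z k) - indicator A x\<bar> \<partial>lborel)
      = (\<integral>\<^sup>+x. ennreal \<bar>indicator A (x - z k) *\<^sub>R c - indicator A x *\<^sub>R c\<bar> \<partial>lborel)" for k
    by (subst nn_integral_cmult[symmetric])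
       (auto simp: ennreal_mult'[symmetric] abs_mult[symmetric] algebra_simps)
  ultimately show ?case by simp
next
  case (add f g)
  have [measurable]: "f \<in> borel_measurable borel" "g \<in> borel_measurable borel"
    using add by auto
  have "(\<lambda>k. (\<integral>\<^sup>+x. ennreal \<bar>f (x - z k) - f x\<bar> \<partial>lborel) + (\<integral>\<^sup>+x. ennreal \<bar>g (x - z k) - g x\<bar> \<partial>lborel)) \<longlonglongrightarrow> 0 + 0"
    by (intro tendsto_add add)
  then have L: "(\<lambda>k. (\<integral>\<^sup>+x. ennreal \<bar>f (x - z k) - f x\<bar> \<partial>lborel) + (\<integral>\<^sup>+x. ennreal \<bar>g (x - z k) - g x\<bar> \<partial>lborel)) \<longlonglongrightarrow> 0"
    by simp
  show ?case
  proof (rule tendsto_0_ennreal_le[OF L], rule always_eventually, rule allI)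
    fix k
    show "(\<integral>\<^sup>+x. ennreal \<bar>f (x - z k) + g (x - z k) - (f x + g x)\<bar> \<partial>lborel)
      \<le> (\<integral>\<^sup>+x. ennreal \<bar>f (x - z k) - f x\<bar> \<partial>lborel) + (\<integral>\<^sup>+x. ennreal \<bar>g (x - z k) - g x\<bar> \<partial>lborel)"
      by (subst nn_integral_add[symmetric])
         (auto intro!: nn_integral_mono simp: ennreal_plus[symmetric] simp del: ennreal_plus)
  qed
next
  case (lim f s)
  have f_int: "integrable lborel f" by fact
  have [measurable]: "f \<in> borel_measurable borel"
    using f_int by auto
  have [measurable]: "s i \<in> borel_measurable borel" for i
    using lim(1)[of i] by auto
  have "(\<lambda>i. \<integral>\<^sup>+x. norm (f x - s i x) \<partial>lborel) \<longlonglongrightarrow> 0"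
  proof (rule nn_integral_dominated_convergence_norm[where w="\<lambda>x. 2 * norm (f x)"])
    show "AE x in lborel. norm (s j x) \<le> 2 * norm (f x)" for j
      using lim(3) by auto
    show "AE x in lborel. (\<lambda>i. s i x) \<longlonglongrightarrow> f x"
      using lim(2) by auto
    show "(\<integral>\<^sup>+x. ennreal (2 * norm (f x)) \<partial>lborel) < \<infinity>"
      using f_int by (auto simp: integrable_iff_bounded ennreal_mult nn_integral_cmult ennreal_mult_less_top)
  qed auto
  then have conv: "(\<lambda>i. \<integral>\<^sup>+x. ennreal \<bar>f x - s i x\<bar> \<partial>lborel) \<longlonglongrightarrow> 0" by simp
  show ?case
  proof (rule tendsto_0_ennreal_approx)
    fix e :: real assume e: "0 < e"
    obtain i where i: "(\<integral>\<^sup>+x. ennreal \<bar>f x - s i x\<bar> \<partial>lborel) \<le> ennreal (e / 2)"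
      using conv[unfolded tendsto_0_ennreal_iff, rule_format, of "e / 2"] e
      by (auto simp: eventually_sequentially)
    have "(\<integral>\<^sup>+x. ennreal \<bar>f (x - z k) - f x\<bar> \<partial>lborel)
        \<le> (\<integral>\<^sup>+x. ennreal \<bar>s i (x - z k) - s i x\<bar> \<partial>lborel) + ennreal e" for k
    proof -
      have "(\<integral>\<^sup>+x. ennreal \<bar>f (x - z k) - f x\<bar> \<partial>lborel)
        \<le> (\<integral>\<^sup>+x. ennreal \<bar>s i (x - z k) - s i x\<bar> + (ennreal \<bar>f (x - z k) - s i (x - z k)\<bar> + ennreal \<bar>f x - s i x\<bar>) \<partial>lborel)"
        by (intro nn_integral_mono) (auto simp: ennreal_plus[symmetric] simp del: ennreal_plus intro!: ennreal_leI)
      also have "\<dots> = (\<integral>\<^sup>+x. ennreal \<bar>s i (x - z k) - s i x\<bar> \<partial>lborel)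
          + ((\<integral>\<^sup>+x. ennreal \<bar>f x - s i x\<bar> \<partial>lborel) + (\<integral>\<^sup>+x. ennreal \<bar>f x - s i x\<bar> \<partial>lborel))"
        by (simp add: nn_integral_add nn_integral_shift[of "\<lambda>x. ennreal \<bar>f x - s i x\<bar>"])
      also have "\<dots> \<le> (\<integral>\<^sup>+x. ennreal \<bar>s i (x - z k) - s i x\<bar> \<partial>lborel) + (ennreal (e / 2) + ennreal (e / 2))"
        by (intro add_mono i) auto
      finally show ?thesis using e by (simp add: ennreal_plus[symmetric] del: ennreal_plus)
    qed
    then show "\<exists>g. g \<longlonglongrightarrow> 0 \<and> (\<forall>\<^sub>F k in sequentially.
        (\<integral>\<^sup>+x. ennreal \<bar>f (x - z k) - f x\<bar> \<partial>lborel) \<le> g k + ennreal e)"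
      using lim(5)[of i]
      by (intro exI[of _ "\<lambda>k. \<integral>\<^sup>+x. ennreal \<bar>s i (x - z k) - s i x\<bar> \<partial>lborel"])
         (auto intro: always_eventually)
  qed
qed

text \<open>By homogeneity \<open>x + y = 1\<close> may be assumed, and \<open>t powr s\<close> is
  at most \<open>t\<close> on the unit interval.\<close>

lemma powr_superadditive:
  fixes x y s :: real
  assumes "0 \<le> x" "0 \<le> y" "1 \<le> s"
  shows "x powr s + y powr s \<le> (x + y) powr s"
proof (cases "x + y = 0")
  case True
  then show ?thesis using assms by (simp add: add_nonneg_eq_0_iff)
next
  case False
  then have p: "0 < x + y" using assms by simp
  have le: "t powr s \<le> t" if "0 \<le> t" "t \<le> 1" for t :: real
  proof (cases "t = 0")
    case False
    then have "t powr s \<le> t powr 1" using that assms by (intro powr_mono') auto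
    then show ?thesis using that by simp
  qed (use assms in simp)
  have "(x / (x + y)) powr s + (y / (x + y)) powr s \<le> x / (x + y) + y / (x + y)"
    using p assms by (intro add_mono le) auto
  also have "\<dots> = 1" using p by (simp add: add_divide_distrib[symmetric])
  finally show ?thesis using p assms by (simp add: powr_divide field_simps)
qed

text \<open>The substitution \<open>v \<mapsto> sgn v * \<bar>v\<bar>\<^sup>s\<close> reduces continuity of translations in \<open>L\<^sup>s\<close> to \<open>L\<^sup>1\<close>.\<close>

lemma abs_diff_powr_le:
  fixes a b s :: real
  assumes s: "1 \<le> s"
  shows "\<bar>a - b\<bar> powr s \<le> 2 powr s * \<bar>sgn a * \<bar>a\<bar> powr s - sgn b * \<bar>b\<bar> powr s\<bar>"
proof -
  have one: "1 \<le> (2::real) powr s" using s by (intro ge_one_powr_ge_zero) auto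
  have same: "(x - y) powr s \<le> 2 powr s * (x powr s - y powr s)" if "0 \<le> y" "y \<le> x" for x y :: real
  proof -
    have "(x - y) powr s \<le> x powr s - y powr s"
      using powr_superadditive[of "x - y" y s] that s by simp
    moreover have "0 \<le> x powr s - y powr s" using that s by (simp add: powr_mono2)
    ultimately show ?thesis using mult_right_mono[OF one, of "x powr s - y powr s"]
      by (metis mult_1 order_trans)
  qed
  have opp: "(x + y) powr s \<le> 2 powr s * (x powr s + y powr s)" if "0 \<le> x" "0 \<le> y" for x y :: real
  proof -
    have "(x + y) powr s \<le> (2 * max x y) powr s" using that s by (intro powr_mono2) auto
    also have "\<dots> = 2 powr s * max x y powr s" using that by (simp add: powr_mult)
    also have "\<dots> \<le> 2 powr s * (x powr s + y powr s)" by (intro mult_left_mono) (auto simp: max_def)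
    finally show ?thesis .
  qed
  consider "0 \<le> b" "b \<le> a" | "0 \<le> a" "a \<le> b" | "a \<le> 0" "b \<le> a" | "b \<le> 0" "a \<le> b"
    | "0 \<le> a" "b \<le> 0" | "a \<le> 0" "0 \<le> b" by linarith
  then show ?thesis
  proof cases
    case 1
    then show ?thesis using same[of b a] s powr_mono2[of s b a] by (cases "b = 0") (auto simp: sgn_if)
  next
    case 2
    then show ?thesis using same[of a b] s powr_mono2[of s a b] by (cases "a = 0") (auto simp: sgn_if abs_minus_commute)
  next
    case 3
    then show ?thesis using same[of "-a" "-b"] s powr_mono2[of s "-a" "-b"] by (cases "a = 0") (auto simp: sgn_if)
  next
    case 4
    then show ?thesis using same[of "-b" "-a"] s powr_mono2[of s "-b" "-a"] by (cases "b = 0") (auto simp: sgn_if abs_minus_commute)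
  next
    case 5
    then show ?thesis using opp[of a "-b"] one by (cases "b = 0"; cases "a = 0") (auto simp: sgn_if)
  next
    case 6
    then show ?thesis using opp[of "-a" b] one by (cases "b = 0"; cases "a = 0") (auto simp: sgn_if abs_minus_commute add.commute)
  qed
qed

lemma Ls_translation_continuous:
  fixes v :: "'a::euclidean_space \<Rightarrow> real"
  assumes [measurable]: "v \<in> borel_measurable borel" and v: "Lnorm_abs s v < top"
    and s: "1 \<le> s" and z: "z \<longlonglongrightarrow> 0"
  shows "(\<lambda>k. Lnorm lborel s (\<lambda>x. ennreal \<bar>v (x - z k) - v x\<bar>)) \<longlonglongrightarrow> 0"
proof -
  define w where "w x = sgn (v x) * \<bar>v x\<bar> powr s" for x
  have [measurable]: "w \<in> borel_measurable borel" unfolding w_def by measurable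
  have "\<bar>w x\<bar> = \<bar>v x\<bar> powr s" for x
    unfolding w_def by (cases "v x = 0") (auto simp: abs_mult sgn_if)
  then have "integrable lborel w"
    using v s by (auto simp: integrable_iff_bounded Lnorm_def)
  from L1_translation_continuous[OF this z]
  have L: "(\<lambda>k. ennreal (2 powr s) * (\<integral>\<^sup>+x. ennreal \<bar>w (x - z k) - w x\<bar> \<partial>lborel)) \<longlonglongrightarrow> 0"
    by (intro tendsto_0_ennreal_cmult) auto
  have le: "(\<integral>\<^sup>+x. epow (ennreal \<bar>v (x - z k) - v x\<bar>) s \<partial>lborel)
     \<le> ennreal (2 powr s) * (\<integral>\<^sup>+x. ennreal \<bar>w (x - z k) - w x\<bar> \<partial>lborel)" for k
    using s abs_diff_powr_le[OF s] unfolding w_def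
    by (subst nn_integral_cmult[symmetric]) (auto intro!: nn_integral_mono ennreal_leI simp: ennreal_mult'[symmetric])
  have "(\<lambda>k. \<integral>\<^sup>+x. epow (ennreal \<bar>v (x - z k) - v x\<bar>) s \<partial>lborel) \<longlonglongrightarrow> 0"
    by (rule tendsto_0_ennreal_le[OF L]) (rule always_eventually, rule allI, rule le)
  then show ?thesis using s by (subst Lnorm_tendsto_0_iff) auto
qed

text \<open>Minkowski's inequality moves the norm inside the integral over \<open>y\<close>. There
  the translation error tends to 0 for each \<open>y\<close> and never exceeds twice the norm of
  \<open>v\<close>, so dominated convergence with weight \<open>\<phi>\<close> applies.\<close>

lemma approximate_identity:
  fixes v :: "'a::euclidean_space \<Rightarrow> real"
  assumes [measurable]: "v \<in> borel_measurable borel" and v: "Lnorm_abs s v < top"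
    and s: "1 \<le> s" and [measurable]: "\<phi> \<in> borel_measurable borel" and \<phi>: "(\<integral>\<^sup>+y. \<phi> y \<partial>lborel) < top"
    and r: "r \<longlonglongrightarrow> 0"
  shows "(\<lambda>k. Lnorm lborel s (\<lambda>x. \<integral>\<^sup>+y. \<phi> y * ennreal \<bar>v (x - r k *\<^sub>R y) - v x\<bar> \<partial>lborel)) \<longlonglongrightarrow> 0"
proof -
  let ?L = "Lnorm lborel s"
  have "(\<lambda>k. \<integral>\<^sup>+y. \<phi> y * ?L (\<lambda>x. ennreal \<bar>v (x - r k *\<^sub>R y) - v x\<bar>) \<partial>lborel) \<longlonglongrightarrow> (\<integral>\<^sup>+(y::'a). 0 \<partial>lborel)"
  proof (rule nn_integral_dominated_convergence[where w="\<lambda>y. \<phi> y * (2 * ?L (\<lambda>x. ennreal \<bar>v x\<bar>))"])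
    fix k
    show "AE y in lborel. \<phi> y * ?L (\<lambda>x. ennreal \<bar>v (x - r k *\<^sub>R y) - v x\<bar>) \<le> \<phi> y * (2 * ?L (\<lambda>x. ennreal \<bar>v x\<bar>))"
    proof (rule AE_I2)
      fix y :: 'a
      have "?L (\<lambda>x. ennreal \<bar>v (x - r k *\<^sub>R y) - v x\<bar>) \<le> ?L (\<lambda>x. ennreal \<bar>v (x - r k *\<^sub>R y)\<bar> + ennreal \<bar>v x\<bar>)"
        using s by (intro Lnorm_mono) (auto simp: ennreal_plus[symmetric] simp del: ennreal_plus intro!: ennreal_leI)
      also have "\<dots> \<le> ?L (\<lambda>x. ennreal \<bar>v (x - r k *\<^sub>R y)\<bar>) + ?L (\<lambda>x. ennreal \<bar>v x\<bar>)"
        by (rule Lnorm_triangle) (use s in \<open>auto intro: sigma_finite_lborel\<close>)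
      also have "?L (\<lambda>x. ennreal \<bar>v (x - r k *\<^sub>R y)\<bar>) = ?L (\<lambda>x. ennreal \<bar>v x\<bar>)"
        unfolding Lnorm_def by (subst nn_integral_shift) auto
      finally show "\<phi> y * ?L (\<lambda>x. ennreal \<bar>v (x - r k *\<^sub>R y) - v x\<bar>) \<le> \<phi> y * (2 * ?L (\<lambda>x. ennreal \<bar>v x\<bar>))"
        by (intro mult_left_mono) (auto simp: mult_2)
    qed
  next
    show "(\<integral>\<^sup>+y. \<phi> y * (2 * ?L (\<lambda>x. ennreal \<bar>v x\<bar>)) \<partial>lborel) < \<infinity>"
      using \<phi> v by (simp add: nn_integral_multc ennreal_mult_less_top)
  next
    have "AE y in lborel. \<phi> y < top"
      using nn_integral_PInf_AE[of \<phi> lborel] \<phi> by (auto simp: less_top)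
    then show "AE y in lborel. (\<lambda>k. \<phi> y * ?L (\<lambda>x. ennreal \<bar>v (x - r k *\<^sub>R y) - v x\<bar>)) \<longlonglongrightarrow> 0"
    proof (rule eventually_mono)
      fix y :: 'a assume "\<phi> y < top"
      moreover have "(\<lambda>k. r k *\<^sub>R y) \<longlonglongrightarrow> 0" using tendsto_scaleR[OF r tendsto_const] by simp
      ultimately show "(\<lambda>k. \<phi> y * ?L (\<lambda>x. ennreal \<bar>v (x - r k *\<^sub>R y) - v x\<bar>)) \<longlonglongrightarrow> 0"
        using v s by (intro tendsto_0_ennreal_cmult Ls_translation_continuous) auto
    qed
  qed (auto simp: Lnorm_def)
  then have L: "(\<lambda>k. \<integral>\<^sup>+y. \<phi> y * ?L (\<lambda>x. ennreal \<bar>v (x - r k *\<^sub>R y) - v x\<bar>) \<partial>lborel) \<longlonglongrightarrow> 0" by simp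
  show ?thesis
  proof (rule tendsto_0_ennreal_le[OF L], rule always_eventually, rule allI)
    fix k
    have "?L (\<lambda>x. \<integral>\<^sup>+y. \<phi> y * ennreal \<bar>v (x - r k *\<^sub>R y) - v x\<bar> \<partial>lborel)
      \<le> (\<integral>\<^sup>+y. ?L (\<lambda>x. \<phi> y * ennreal \<bar>v (x - r k *\<^sub>R y) - v x\<bar>) \<partial>lborel)"
      by (rule Minkowski_integral) (use s in \<open>auto intro: sigma_finite_lborel\<close>)
    also have "\<dots> = (\<integral>\<^sup>+y. \<phi> y * ?L (\<lambda>x. ennreal \<bar>v (x - r k *\<^sub>R y) - v x\<bar>) \<partial>lborel)"
      using s by (intro nn_integral_cong Lnorm_cmult) auto
    finally show "?L (\<lambda>x. \<integral>\<^sup>+y. \<phi> y * ennreal \<bar>v (x - r k *\<^sub>R y) - v x\<bar> \<partial>lborel)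
      \<le> (\<integral>\<^sup>+y. \<phi> y * ?L (\<lambda>x. ennreal \<bar>v (x - r k *\<^sub>R y) - v x\<bar>) \<partial>lborel)" .
  qed
qed

section \<open>Gaussian integrals\<close>

lemma lborel_integral_scale:
  fixes f :: "'a::euclidean_space \<Rightarrow> 'b :: {banach, second_countable_topology}"
  assumes [measurable]: "f \<in> borel_measurable borel" and c: "c \<noteq> 0"
  shows "(\<integral>x. f x \<partial>lborel) = \<bar>c\<bar> ^ DIM('a) *\<^sub>R (\<integral>x. f (c *\<^sub>R x) \<partial>lborel)"
proof -
  have "(\<integral>x. f x \<partial>lborel) = (\<integral>x. f x \<partial>density (distr lborel borel (\<lambda>x. 0 + c *\<^sub>R x)) (\<lambda>_. \<bar>c\<bar> ^ DIM('a)))"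
    by (subst lborel_affine[OF c, of 0]) simp
  also have "\<dots> = \<bar>c\<bar> ^ DIM('a) *\<^sub>R (\<integral>x. f (c *\<^sub>R x) \<partial>lborel)"
    by (subst integral_density) (auto simp: integral_distr)
  finally show ?thesis .
qed

lemma integrable_exp_square_real:
  assumes "0 < (d::real)"
  shows "integrable lborel (\<lambda>s::real. exp (- d * s\<^sup>2))"
proof -
  define \<sigma> where "\<sigma> = 1 / sqrt (2 * d)"
  have s: "0 < \<sigma>" "\<sigma>\<^sup>2 = 1 / (2 * d)" using assms by (auto simp: \<sigma>_def power_divide)
  have "exp (- d * s\<^sup>2) = sqrt (2 * pi * \<sigma>\<^sup>2) * normal_density 0 \<sigma> s" for s
    using s assms by (simp add: normal_density_def)
  moreover have "integrable lborel (normal_density 0 \<sigma>)" using s by auto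
  ultimately show ?thesis by simp
qed

lemma integrable_exp_square_iexp:
  assumes "0 < (d::real)"
  shows "integrable lborel (\<lambda>s::real. iexp (a * s) * complex_of_real (exp (- d * s\<^sup>2)))"
  by (rule Bochner_Integration.integrable_bound[OF integrable_exp_square_real[OF assms]]) (auto simp: norm_mult)

text \<open>The characteristic function of the standard normal law, rescaled by
  \<open>c = sqrt (2 * d)\<close>.\<close>

lemma integral_exp_square_iexp:
  assumes d: "0 < (d::real)"
  shows "(\<integral>s. iexp (a * s) * complex_of_real (exp (- d * s\<^sup>2)) \<partial>lborel)
    = complex_of_real (sqrt (pi / d) * exp (- (a\<^sup>2 / (4 * d))))"
proof -
  define c where "c = sqrt (2 * d)"
  have c: "0 < c" "c\<^sup>2 = 2 * d" using d by (auto simp: c_def)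
  let ?I = "\<integral>s. iexp (a * s) * complex_of_real (exp (- d * s\<^sup>2)) \<partial>lborel"
  have "complex_of_real (exp (- ((a / c)\<^sup>2) / 2)) = char std_normal_distribution (a / c)"
    by (simp add: char_std_normal_distribution)
  also have "\<dots> = (\<integral>x. std_normal_density x *\<^sub>R iexp (a / c * x) \<partial>lborel)"
    unfolding char_def by (subst integral_density) (auto simp: normal_density_nonneg)
  also have "\<dots> = \<bar>c\<bar> *\<^sub>R (\<integral>x. std_normal_density (0 + c * x) *\<^sub>R iexp (a / c * (0 + c * x)) \<partial>lborel)"
    using c by (intro lborel_integral_real_affine) auto
  also have "(\<integral>x. std_normal_density (0 + c * x) *\<^sub>R iexp (a / c * (0 + c * x)) \<partial>lborel)
      = (\<integral>x. complex_of_real (1 / sqrt (2 * pi)) * (iexp (a * x) * complex_of_real (exp (- d * x\<^sup>2))) \<partial>lborel)"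
    using c by (intro Bochner_Integration.integral_cong) 
      (auto simp: std_normal_density_def scaleR_conv_of_real power_mult_distrib mult_ac)
  also have "\<dots> = complex_of_real (1 / sqrt (2 * pi)) * ?I"
    by simp
  finally have "complex_of_real (exp (- ((a / c)\<^sup>2) / 2)) = complex_of_real (c / sqrt (2 * pi)) * ?I"
    using c by (simp add: scaleR_conv_of_real)
  then have "?I = complex_of_real (sqrt (2 * pi) / c * exp (- ((a / c)\<^sup>2) / 2))"
    using c by (simp add: field_simps)
  also have "sqrt (2 * pi) / c = sqrt (pi / d)"
    using d by (simp add: c_def real_sqrt_divide[symmetric])
  also have "- ((a / c)\<^sup>2) / 2 = - (a\<^sup>2 / (4 * d))"
    using d c by (simp add: power_divide)
  finally show ?thesis .
qed

text \<open>Fubini in coordinates: \<open>lborel\<close> is the image of the product of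
  one-dimensional Lebesgue measures. It reduces Gaussian integrals to dimension one.\<close>

lemma lborel_prod_Basis:
  fixes f :: "'a::euclidean_space \<Rightarrow> real \<Rightarrow> complex"
  assumes f: "\<And>b. b \<in> Basis \<Longrightarrow> integrable lborel (f b)"
  shows "integrable lborel (\<lambda>x::'a. \<Prod>b\<in>Basis. f b (x \<bullet> b))" (is ?A)
    and "(\<integral>(x::'a). (\<Prod>b\<in>Basis. f b (x \<bullet> b)) \<partial>lborel) = (\<Prod>b\<in>Basis. \<integral>s. f b s \<partial>lborel)" (is ?B)
proof -
  interpret product_sigma_finite "\<lambda>_::'a. lborel :: real measure" ..
  have [measurable]: "f b \<in> borel_measurable borel" if "b \<in> Basis" for b
    using f[OF that] by auto
  let ?S = "\<lambda>g :: 'a \<Rightarrow> real. \<Sum>b\<in>Basis. g b *\<^sub>R b"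
  have S: "(\<Prod>b\<in>Basis. f b (?S g \<bullet> b)) = (\<Prod>b\<in>Basis. f b (g b))" for g
    by (intro prod.cong refl) (simp add: inner_sum_left_Basis)
  have m: "(\<lambda>x::'a. \<Prod>b\<in>Basis. f b (x \<bullet> b)) \<in> borel_measurable borel"
    by (intro borel_measurable_prod) (auto intro: measurable_compose)
  have mS: "?S \<in> measurable (\<Pi>\<^sub>M b\<in>Basis. lborel) borel" by measurable
  show ?A
    by (subst lborel_eq, subst integrable_distr_eq[OF mS m])
       (simp only: S, intro product_integrable_prod f, auto)
  show ?B
    by (subst lborel_eq, subst integral_distr[OF mS m])
       (simp only: S, intro product_integral_prod f, auto)
qed

definition gauss_ft :: "real \<Rightarrow> 'a::euclidean_space \<Rightarrow> real" where
  "gauss_ft d x = sqrt (pi / d) ^ DIM('a) * exp (- ((norm x)\<^sup>2 / (4 * d)))"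

lemma gauss_ft_nonneg: "0 < d \<Longrightarrow> 0 \<le> gauss_ft d x"
  by (simp add: gauss_ft_def)

lemma gauss_fourier:
  fixes x :: "'a::euclidean_space"
  assumes d: "0 < d"
  shows integrable_cos_gauss: "integrable lborel (\<lambda>\<xi>. cos (x \<bullet> \<xi>) * exp (- d * (norm \<xi>)\<^sup>2))"
    and integral_cos_gauss: "(\<integral>\<xi>. cos (x \<bullet> \<xi>) * exp (- d * (norm \<xi>)\<^sup>2) \<partial>lborel) = gauss_ft d x"
proof -
  let ?f = "\<lambda>b s. iexp ((x \<bullet> b) * s) * complex_of_real (exp (- d * s\<^sup>2))"
  have eq: "(\<Prod>b\<in>Basis. ?f b (\<xi> \<bullet> b)) = iexp (x \<bullet> \<xi>) * complex_of_real (exp (- d * (norm \<xi>)\<^sup>2))" for \<xi>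
  proof -
    have "(\<Prod>b\<in>Basis. iexp ((x \<bullet> b) * (\<xi> \<bullet> b))) = iexp (x \<bullet> \<xi>)"
      by (subst euclidean_inner[of x \<xi>]) (simp add: exp_sum[symmetric] sum_distrib_left)
    moreover have "(\<Prod>b\<in>Basis. exp (- d * (\<xi> \<bullet> b)\<^sup>2)) = exp (- d * (norm \<xi>)\<^sup>2)"
      by (subst power2_norm_eq_inner, subst euclidean_inner[of \<xi> \<xi>])
         (simp add: exp_sum[symmetric] sum_distrib_left sum_negf power2_eq_square)
    ultimately show ?thesis by (simp add: prod.distrib flip: of_real_prod)
  qed
  have I: "integrable lborel (\<lambda>\<xi>. iexp (x \<bullet> \<xi>) * complex_of_real (exp (- d * (norm \<xi>)\<^sup>2)))"
    using lborel_prod_Basis(1)[of ?f, OF integrable_exp_square_iexp[OF d]] unfolding eq .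
  have "(\<integral>\<xi>. iexp (x \<bullet> \<xi>) * complex_of_real (exp (- d * (norm \<xi>)\<^sup>2)) \<partial>lborel)
      = (\<Prod>b\<in>Basis. complex_of_real (sqrt (pi / d) * exp (- ((x \<bullet> b)\<^sup>2 / (4 * d)))))"
    using lborel_prod_Basis(2)[of ?f, OF integrable_exp_square_iexp[OF d]]
    unfolding eq integral_exp_square_iexp[OF d] .
  also have "\<dots> = complex_of_real (gauss_ft d x)"
    unfolding gauss_ft_def
    by (subst power2_norm_eq_inner, subst euclidean_inner[of x x])
       (simp add: exp_sum[symmetric] sum_divide_distrib sum_negf power2_eq_square prod.distrib
         flip: of_real_prod)
  finally have J: "(\<integral>\<xi>. iexp (x \<bullet> \<xi>) * complex_of_real (exp (- d * (norm \<xi>)\<^sup>2)) \<partial>lborel)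
    = complex_of_real (gauss_ft d x)" .
  have R: "Re (iexp (x \<bullet> \<xi>) * complex_of_real (exp (- d * (norm \<xi>)\<^sup>2)))
      = cos (x \<bullet> \<xi>) * exp (- d * (norm \<xi>)\<^sup>2)" for \<xi>
    by (simp add: Re_exp)
  show "integrable lborel (\<lambda>\<xi>. cos (x \<bullet> \<xi>) * exp (- d * (norm \<xi>)\<^sup>2))"
    using integrable_Re[OF I] by (simp only: R)
  show "(\<integral>\<xi>. cos (x \<bullet> \<xi>) * exp (- d * (norm \<xi>)\<^sup>2) \<partial>lborel) = gauss_ft d x"
    using integral_Re[OF I] by (simp only: R J Re_complex_of_real)
qed

lemma integrable_gauss: "0 < d \<Longrightarrow> integrable lborel (\<lambda>\<xi>::'a::euclidean_space. exp (- d * (norm \<xi>)\<^sup>2))"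
  using integrable_cos_gauss[of d "0::'a"] by simp

lemma integral_gauss: "0 < d \<Longrightarrow> (\<integral>(\<xi>::'a::euclidean_space). exp (- d * (norm \<xi>)\<^sup>2) \<partial>lborel) = sqrt (pi / d) ^ DIM('a)"
  using integral_cos_gauss[of d "0::'a"] by (simp add: gauss_ft_def)

section \<open>Functions of positive type\<close>

text \<open>Positivity of the Fourier transform, tested after multiplication by Gaussians; in this form it
  is visibly stable under bounded pointwise limits and under multiplication by mixtures of
  Gaussians, which is all that is needed for the exponentials of \<open>- \<bar>\<xi>\<bar>\<^sup>\<beta>\<close>.\<close>

definition pos_type :: "('a::euclidean_space \<Rightarrow> real) \<Rightarrow> bool" where
  "pos_type h \<longleftrightarrow> h \<in> borel_measurable borel \<and> (\<exists>B. \<forall>\<xi>. \<bar>h \<xi>\<bar> \<le> B) \<and>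
     (\<forall>x d. 0 < d \<longrightarrow> 0 \<le> (\<integral>\<xi>. cos (x \<bullet> \<xi>) * h \<xi> * exp (- d * (norm \<xi>)\<^sup>2) \<partial>lborel))"

lemma integrable_cos_bounded_gauss:
  assumes [measurable]: "h \<in> borel_measurable borel" and h: "\<And>\<xi>. \<bar>h \<xi>\<bar> \<le> B" and d: "0 < d"
  shows "integrable lborel (\<lambda>\<xi>::'a::euclidean_space. cos (x \<bullet> \<xi>) * h \<xi> * exp (- d * (norm \<xi>)\<^sup>2))"
proof (rule Bochner_Integration.integrable_bound)
  show "integrable lborel (\<lambda>\<xi>::'a. B * exp (- d * (norm \<xi>)\<^sup>2))" by (intro integrable_mult_right integrable_gauss d)
  have "\<bar>cos (x \<bullet> \<xi>)\<bar> * \<bar>h \<xi>\<bar> \<le> 1 * B" for \<xi>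
    by (intro mult_mono h) auto
  moreover have "0 \<le> B" using h[of 0] by linarith
  ultimately show "AE \<xi> in lborel. norm (cos (x \<bullet> \<xi>) * h \<xi> * exp (- d * (norm \<xi>)\<^sup>2)) \<le> norm (B * exp (- d * (norm \<xi>)\<^sup>2))"
    by (intro AE_I2) (auto simp: abs_mult intro!: mult_right_mono)
qed measurable

text \<open>The common bound times the test Gaussian is an integrable dominating function. This is
  what the Gaussian in \<open>pos_type\<close> is for, since \<open>h\<close> itself need not be
  integrable.\<close>

lemma pos_type_lim:
  assumes p: "\<And>k::nat. pos_type (h k)" and B: "\<And>k \<xi>. \<bar>h k \<xi>\<bar> \<le> B"
    and lim: "\<And>\<xi>. (\<lambda>k. h k \<xi>) \<longlonglongrightarrow> g \<xi>"
  shows "pos_type (g :: 'a::euclidean_space \<Rightarrow> real)"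
proof -
  have [measurable]: "h k \<in> borel_measurable borel" for k using p by (auto simp: pos_type_def)
  have [measurable]: "g \<in> borel_measurable borel"
    by (rule borel_measurable_LIMSEQ_real[OF lim]) auto
  have gB: "\<bar>g \<xi>\<bar> \<le> B" for \<xi>
    by (rule LIMSEQ_le_const2[OF tendsto_rabs[OF lim]]) (use B in auto)
  have B0: "0 \<le> B" using gB[of 0] by linarith
  have "0 \<le> (\<integral>\<xi>. cos (x \<bullet> \<xi>) * g \<xi> * exp (- d * (norm \<xi>)\<^sup>2) \<partial>lborel)" if d: "0 < d" for x d
  proof (rule LIMSEQ_le_const)
    show "(\<lambda>k. \<integral>\<xi>. cos (x \<bullet> \<xi>) * h k \<xi> * exp (- d * (norm \<xi>)\<^sup>2) \<partial>lborel)
       \<longlonglongrightarrow> (\<integral>\<xi>. cos (x \<bullet> \<xi>) * g \<xi> * exp (- d * (norm \<xi>)\<^sup>2) \<partial>lborel)"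
    proof (rule integral_dominated_convergence)
      show "integrable lborel (\<lambda>\<xi>::'a. B * exp (- d * (norm \<xi>)\<^sup>2))" by (intro integrable_mult_right integrable_gauss d)
      show "AE \<xi> in lborel. norm (cos (x \<bullet> \<xi>) * h k \<xi> * exp (- d * (norm \<xi>)\<^sup>2)) \<le> B * exp (- d * (norm \<xi>)\<^sup>2)" for k
      proof (rule AE_I2)
        fix \<xi> :: 'a
        have "\<bar>cos (x \<bullet> \<xi>)\<bar> * \<bar>h k \<xi>\<bar> \<le> 1 * B" by (intro mult_mono B) auto
        then show "norm (cos (x \<bullet> \<xi>) * h k \<xi> * exp (- d * (norm \<xi>)\<^sup>2)) \<le> B * exp (- d * (norm \<xi>)\<^sup>2)"
          by (auto simp: abs_mult intro!: mult_right_mono)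
      qed
    qed (auto intro!: tendsto_intros lim)
    show "\<exists>N. \<forall>k\<ge>N. 0 \<le> (\<integral>\<xi>. cos (x \<bullet> \<xi>) * h k \<xi> * exp (- d * (norm \<xi>)\<^sup>2) \<partial>lborel)"
      using p that by (auto simp: pos_type_def)
  qed
  then show ?thesis unfolding pos_type_def using gB by auto
qed

lemma pos_type_add:
  assumes "pos_type f" "pos_type g"
  shows "pos_type (\<lambda>\<xi>::'a::euclidean_space. f \<xi> + g \<xi>)"
proof -
  obtain A B where A: "\<And>\<xi>. \<bar>f \<xi>\<bar> \<le> A" and B: "\<And>\<xi>. \<bar>g \<xi>\<bar> \<le> B"
    using assms unfolding pos_type_def by blast
  have [measurable]: "f \<in> borel_measurable borel" "g \<in> borel_measurable borel"
    using assms by (auto simp: pos_type_def)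
  have "\<bar>f \<xi> + g \<xi>\<bar> \<le> A + B" for \<xi> using A[of \<xi>] B[of \<xi>] by linarith
  moreover have "0 \<le> (\<integral>\<xi>. cos (x \<bullet> \<xi>) * (f \<xi> + g \<xi>) * exp (- d * (norm \<xi>)\<^sup>2) \<partial>lborel)" if "0 < d" for x d
  proof -
    have "(\<integral>\<xi>. cos (x \<bullet> \<xi>) * (f \<xi> + g \<xi>) * exp (- d * (norm \<xi>)\<^sup>2) \<partial>lborel)
      = (\<integral>\<xi>. cos (x \<bullet> \<xi>) * f \<xi> * exp (- d * (norm \<xi>)\<^sup>2) + cos (x \<bullet> \<xi>) * g \<xi> * exp (- d * (norm \<xi>)\<^sup>2) \<partial>lborel)"
      by (simp add: algebra_simps)
    also have "\<dots> = (\<integral>\<xi>. cos (x \<bullet> \<xi>) * f \<xi> * exp (- d * (norm \<xi>)\<^sup>2) \<partial>lborel) + (\<integral>\<xi>. cos (x \<bullet> \<xi>) * g \<xi> * exp (- d * (norm \<xi>)\<^sup>2) \<partial>lborel)"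
      by (intro Bochner_Integration.integral_add integrable_cos_bounded_gauss[where B=A] integrable_cos_bounded_gauss[where B=B] A B that) auto
    also have "\<dots> \<ge> 0" using assms that by (auto simp: pos_type_def)
    finally show ?thesis .
  qed
  ultimately show ?thesis unfolding pos_type_def by auto
qed

lemma pos_type_cmult:
  assumes "pos_type f" "0 \<le> c"
  shows "pos_type (\<lambda>\<xi>::'a::euclidean_space. c * f \<xi>)"
proof -
  obtain A where A: "\<And>\<xi>. \<bar>f \<xi>\<bar> \<le> A"
    using assms unfolding pos_type_def by blast
  have [measurable]: "f \<in> borel_measurable borel" using assms by (auto simp: pos_type_def)
  have "\<bar>c * f \<xi>\<bar> \<le> c * A" for \<xi> using A[of \<xi>] assms(2) by (simp add: abs_mult mult_left_mono)
  moreover have "0 \<le> (\<integral>\<xi>. cos (x \<bullet> \<xi>) * (c * f \<xi>) * exp (- d * (norm \<xi>)\<^sup>2) \<partial>lborel)" if "0 < d" for x d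
  proof -
    have "(\<integral>\<xi>. cos (x \<bullet> \<xi>) * (c * f \<xi>) * exp (- d * (norm \<xi>)\<^sup>2) \<partial>lborel)
      = c * (\<integral>\<xi>. cos (x \<bullet> \<xi>) * f \<xi> * exp (- d * (norm \<xi>)\<^sup>2) \<partial>lborel)"
      by (subst integral_mult_right_zero[symmetric]) (simp add: mult_ac)
    also have "\<dots> \<ge> 0" using assms that by (auto simp: pos_type_def)
    finally show ?thesis .
  qed
  ultimately show ?thesis unfolding pos_type_def by auto
qed

lemma pos_type_gauss:
  assumes "0 \<le> s"
  shows "pos_type (\<lambda>\<xi>::'a::euclidean_space. exp (- s * (norm \<xi>)\<^sup>2))"
proof -
  have "0 \<le> (\<integral>\<xi>. cos (x \<bullet> \<xi>) * exp (- s * (norm \<xi>)\<^sup>2) * exp (- d * (norm \<xi>)\<^sup>2) \<partial>lborel)" if "0 < d" for x :: 'a and d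
  proof -
    have "cos (x \<bullet> \<xi>) * exp (- s * (norm \<xi>)\<^sup>2) * exp (- d * (norm \<xi>)\<^sup>2) = cos (x \<bullet> \<xi>) * exp (- (s + d) * (norm \<xi>)\<^sup>2)" for \<xi>
      by (simp add: mult_exp_exp algebra_simps)
    then have eq: "(\<lambda>\<xi>. cos (x \<bullet> \<xi>) * exp (- s * (norm \<xi>)\<^sup>2) * exp (- d * (norm \<xi>)\<^sup>2)) = (\<lambda>\<xi>. cos (x \<bullet> \<xi>) * exp (- (s + d) * (norm \<xi>)\<^sup>2))"
      by (rule ext)
    have sd: "0 < s + d" using assms that by simp
    show ?thesis unfolding eq integral_cos_gauss[OF sd] by (rule gauss_ft_nonneg[OF sd])
  qed
  moreover have "\<bar>exp (- s * (norm \<xi>)\<^sup>2)\<bar> \<le> 1" for \<xi> :: 'a using assms by simp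
  ultimately show ?thesis unfolding pos_type_def by (intro conjI exI[of _ 1]) auto
qed

text \<open>For fixed \<open>s\<close> the Gaussian of the mixture merges with the test Gaussian
  into one with parameter \<open>s + d\<close>, and \<open>pos_type\<close> tests all positive
  parameters. Fubini then integrates nonnegative numbers against \<open>m\<close>.\<close>

lemma pos_type_mix:
  fixes h :: "'a::euclidean_space \<Rightarrow> real"
  assumes m: "integrable lborel m" and m0: "\<And>s. 0 \<le> m s" and m1: "\<And>s. s < 0 \<Longrightarrow> m s = 0"
    and h: "pos_type h"
  shows "pos_type (\<lambda>\<xi>. (\<integral>s. m s * exp (- s * (norm \<xi>)\<^sup>2) \<partial>lborel) * h \<xi>)"
proof -
  obtain B where B: "\<And>\<xi>. \<bar>h \<xi>\<bar> \<le> B" using h unfolding pos_type_def by blast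
  have B0: "0 \<le> B" using B[of 0] by linarith
  have [measurable]: "h \<in> borel_measurable borel" "m \<in> borel_measurable borel"
    using h m by (auto simp: pos_type_def)
  define g where "g \<xi> = (\<integral>s. m s * exp (- s * (norm \<xi>)\<^sup>2) \<partial>lborel)" for \<xi> :: 'a
  have [measurable]: "g \<in> borel_measurable borel" unfolding g_def by measurable
  have le: "\<bar>m s * exp (- s * (norm \<xi>)\<^sup>2)\<bar> \<le> m s" for s and \<xi> :: 'a
  proof (cases "s < 0")
    case False
    then show ?thesis using m0[of s] by (simp add: abs_mult mult_left_le)
  qed (use m1 in auto)
  have int: "integrable lborel (\<lambda>s. m s * exp (- s * (norm \<xi>)\<^sup>2))" for \<xi> :: 'a
    by (rule Bochner_Integration.integrable_bound[OF m]) (use le m0 in auto)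
  have gb: "\<bar>g \<xi>\<bar> \<le> (\<integral>s. m s \<partial>lborel)" for \<xi>
  proof -
    have "\<bar>g \<xi>\<bar> \<le> (\<integral>s. \<bar>m s * exp (- s * (norm \<xi>)\<^sup>2)\<bar> \<partial>lborel)"
      unfolding g_def by (rule integral_abs_bound)
    also have "\<dots> \<le> (\<integral>s. m s \<partial>lborel)"
      by (intro Bochner_Integration.integral_mono m integrable_abs int) (rule le)
    finally show ?thesis .
  qed
  have "\<bar>g \<xi> * h \<xi>\<bar> \<le> (\<integral>s. m s \<partial>lborel) * B" for \<xi>
    unfolding abs_mult using gb[of \<xi>] by (intro mult_mono B) auto
  moreover have "0 \<le> (\<integral>\<xi>. cos (x \<bullet> \<xi>) * (g \<xi> * h \<xi>) * exp (- d * (norm \<xi>)\<^sup>2) \<partial>lborel)" if d: "0 < d" for x d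
  proof -
    define F where "F s \<xi> = m s * exp (- s * (norm \<xi>)\<^sup>2) * (cos (x \<bullet> \<xi>) * h \<xi> * exp (- d * (norm \<xi>)\<^sup>2))" for s \<xi>
    have [measurable]: "case_prod F \<in> borel_measurable (lborel \<Otimes>\<^sub>M lborel)" unfolding F_def by measurable
    have Fint: "integrable (lborel \<Otimes>\<^sub>M lborel) (case_prod F)"
    proof (rule integrableI_bounded)
      have "(\<integral>\<^sup>+z. ennreal (norm (case_prod F z)) \<partial>(lborel \<Otimes>\<^sub>M lborel))
          = (\<integral>\<^sup>+s. \<integral>\<^sup>+\<xi>. ennreal \<bar>F s \<xi>\<bar> \<partial>lborel \<partial>lborel)"
        by (subst lborel.nn_integral_fst[symmetric]) auto
      also have "\<dots> \<le> (\<integral>\<^sup>+s. \<integral>\<^sup>+(\<xi>::'a). ennreal (m s) * ennreal (B * exp (- d * (norm \<xi>)\<^sup>2)) \<partial>lborel \<partial>lborel)"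
      proof (intro nn_integral_mono)
        fix s and \<xi> :: 'a
        have "\<bar>cos (x \<bullet> \<xi>)\<bar> * \<bar>h \<xi>\<bar> \<le> 1 * B" by (intro mult_mono B) auto
        then have "\<bar>F s \<xi>\<bar> \<le> m s * (B * exp (- d * (norm \<xi>)\<^sup>2))"
          unfolding F_def abs_mult[of "m s * _"] using m0 B0
          by (intro mult_mono le) (auto simp: abs_mult intro!: mult_right_mono)
        then show "ennreal \<bar>F s \<xi>\<bar> \<le> ennreal (m s) * ennreal (B * exp (- d * (norm \<xi>)\<^sup>2))"
          using m0 by (simp add: ennreal_mult'[symmetric] ennreal_leI)
      qed
      also have "\<dots> = (\<integral>\<^sup>+s. ennreal (m s) \<partial>lborel) * (\<integral>\<^sup>+(\<xi>::'a). ennreal (B * exp (- d * (norm \<xi>)\<^sup>2)) \<partial>lborel)"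
        by (simp add: nn_integral_cmult nn_integral_multc)
      also have "\<dots> < \<infinity>"
      proof -
        have "(\<integral>\<^sup>+s. ennreal (m s) \<partial>lborel) < \<infinity>"
          using m m0 by (auto simp: integrable_iff_bounded)
        moreover have "integrable lborel (\<lambda>\<xi>::'a. B * exp (- d * (norm \<xi>)\<^sup>2))" by (intro integrable_mult_right integrable_gauss d)
        then have "(\<integral>\<^sup>+(\<xi>::'a). ennreal (norm (B * exp (- d * (norm \<xi>)\<^sup>2))) \<partial>lborel) < \<infinity>"
          unfolding integrable_iff_bounded by (rule conjunct2)
        then have "(\<integral>\<^sup>+(\<xi>::'a). ennreal (B * exp (- d * (norm \<xi>)\<^sup>2)) \<partial>lborel) < \<infinity>"
          using B0 by (simp add: abs_mult)
        ultimately show ?thesis by (simp add: ennreal_mult_less_top)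
      qed
      finally show "(\<integral>\<^sup>+z. ennreal (norm (case_prod F z)) \<partial>(lborel \<Otimes>\<^sub>M lborel)) < \<infinity>" .
    qed measurable
    have inner: "(\<integral>s. F s \<xi> \<partial>lborel) = g \<xi> * (cos (x \<bullet> \<xi>) * h \<xi> * exp (- d * (norm \<xi>)\<^sup>2))" for \<xi>
      unfolding F_def g_def by (rule integral_mult_left_zero)
    have "(\<integral>\<xi>. cos (x \<bullet> \<xi>) * (g \<xi> * h \<xi>) * exp (- d * (norm \<xi>)\<^sup>2) \<partial>lborel) = (\<integral>\<xi>. (\<integral>s. F s \<xi> \<partial>lborel) \<partial>lborel)"
      unfolding inner by (simp add: mult_ac)
    also have "\<dots> = (\<integral>s. (\<integral>\<xi>. F s \<xi> \<partial>lborel) \<partial>lborel)"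
      by (rule lborel_pair.Fubini_integral[OF Fint])
    also have "\<dots> \<ge> 0"
    proof (rule Bochner_Integration.integral_nonneg)
      fix s :: real
      show "0 \<le> (\<integral>\<xi>. F s \<xi> \<partial>lborel)"
      proof (cases "s < 0")
        case False
        have "F s \<xi> = m s * (cos (x \<bullet> \<xi>) * h \<xi> * exp (- (s + d) * (norm \<xi>)\<^sup>2))" for \<xi>
          unfolding F_def by (simp add: mult_exp_exp algebra_simps)
        moreover have "0 \<le> (\<integral>\<xi>. cos (x \<bullet> \<xi>) * h \<xi> * exp (- (s + d) * (norm \<xi>)\<^sup>2) \<partial>lborel)"
          using h False d unfolding pos_type_def by (metis add_nonneg_pos not_less)
        ultimately show ?thesis using m0[of s] by simp
      qed (simp add: F_def m1)
    qed
    finally show ?thesis .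
  qed
  ultimately show ?thesis unfolding pos_type_def g_def[symmetric] by auto
qed

text \<open>Powers of the mixture are obtained by repeated multiplication with it, starting from the
  constant 1. The partial sums of the exponential series are bounded by the exponential of the total
  mass of \<open>m\<close>, so the limit lemma applies.\<close>

lemma pos_type_exp_mix:
  assumes m: "integrable lborel m" and m0: "\<And>s. 0 \<le> m s" and m1: "\<And>s. s < 0 \<Longrightarrow> m s = 0"
  shows "pos_type (\<lambda>\<xi>::'a::euclidean_space. exp (\<integral>s. m s * exp (- s * (norm \<xi>)\<^sup>2) \<partial>lborel))"
proof -
  define g where "g \<xi> = (\<integral>s. m s * exp (- s * (norm \<xi>)\<^sup>2) \<partial>lborel)" for \<xi> :: 'a
  have [measurable]: "m \<in> borel_measurable borel" using m by auto
  have g0: "0 \<le> g \<xi>" for \<xi> unfolding g_def using m0 by (intro Bochner_Integration.integral_nonneg) auto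
  have g1: "g \<xi> \<le> (\<integral>s. m s \<partial>lborel)" for \<xi>
    unfolding g_def
  proof (rule integral_mono_AE')
    show "AE s in lborel. m s * exp (- s * (norm \<xi>)\<^sup>2) \<le> m s"
    proof (rule AE_I2)
      fix s show "m s * exp (- s * (norm \<xi>)\<^sup>2) \<le> m s"
        using m0[of s] m1[of s] by (cases "s < 0") (auto simp: mult_left_le)
    qed
  qed (use m m0 in auto)
  have pw: "pos_type (\<lambda>\<xi>. g \<xi> ^ i)" for i :: nat
  proof (induction i)
    case 0
    show ?case using pos_type_gauss[of 0] by simp
  next
    case (Suc i)
    from pos_type_mix[OF m m0 m1 Suc] show ?case by (simp add: g_def)
  qed
  have ps: "pos_type (\<lambda>\<xi>. \<Sum>i<N. g \<xi> ^ i /\<^sub>R fact i)" for N :: nat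
  proof (induction N)
    case 0
    show ?case using pos_type_cmult[OF pos_type_gauss[of 0], of 0] by simp
  next
    case (Suc N)
    from pos_type_add[OF Suc pos_type_cmult[OF pw[of N], of "inverse (fact N)"]]
    show ?case by simp
  qed
  have "pos_type (\<lambda>\<xi>. exp (g \<xi>))"
  proof (rule pos_type_lim[OF ps])
    fix N and \<xi> :: 'a
    have s: "(\<lambda>i. g \<xi> ^ i /\<^sub>R fact i) sums exp (g \<xi>)" by (rule exp_converges)
    then show "(\<lambda>N. \<Sum>i<N. g \<xi> ^ i /\<^sub>R fact i) \<longlonglongrightarrow> exp (g \<xi>)" by (simp add: sums_def)
    have "(\<Sum>i<N. g \<xi> ^ i /\<^sub>R fact i) \<le> exp (g \<xi>)"
      using s g0[of \<xi>] by (subst sums_unique[OF s]) (auto intro!: sum_le_suminf sums_summable)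
    also have "\<dots> \<le> exp (\<integral>s. m s \<partial>lborel)" using g1 by simp
    finally show "\<bar>\<Sum>i<N. g \<xi> ^ i /\<^sub>R fact i\<bar> \<le> exp (\<integral>s. m s \<partial>lborel)"
      using g0[of \<xi>] by (subst abs_of_nonneg) (auto intro!: sum_nonneg)
  qed
  then show ?thesis by (simp add: g_def)
qed

text \<open>For \<open>0 < \<gamma> < 1\<close>, \<open>\<lambda>\<^sup>\<gamma>\<close> is a constant times the integral of \<open>(1 - e\<^sup>-\<^sup>s\<^sup>\<lambda>) s\<^sup>-\<^sup>1\<^sup>-\<^sup>\<gamma>\<close> over \<open>s > 0\<close>.\<close>

definition levy_int :: "real \<Rightarrow> real \<Rightarrow> real" where
  "levy_int \<gamma> l = (\<integral>s. indicator {0<..} s * s powr (- 1 - \<gamma>) * (1 - exp (- s * l)) \<partial>lborel)"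

text \<open>The factor \<open>1 - exp (- s * l)\<close> is at most \<open>s * l\<close>, which
  leaves the exponent \<open>- \<gamma> > -1\<close> near 0, and at most 1, which leaves
  \<open>- 1 - \<gamma> < -1\<close> at infinity.\<close>

lemma levy_integrable:
  assumes g: "0 < \<gamma>" "\<gamma> < 1" and l: "0 \<le> l"
  shows "integrable lborel (\<lambda>s. indicator {0<..} s * s powr (- 1 - \<gamma>) * (1 - exp (- s * l)) :: real)"
proof (rule Bochner_Integration.integrable_bound)
  have "integrable lborel (\<lambda>s. indicator {0..1} s * s powr (- \<gamma>) :: real)"
    using nn_integral_powr_Icc[of "- \<gamma>" 1] g
    by (intro integrableI_bounded) (auto simp: abs_mult ennreal_mult' ennreal_indicator)
  moreover have "integrable lborel (\<lambda>s. indicator {1..} s * s powr (- 1 - \<gamma>) :: real)"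
    using nn_integral_powr_Ici[of "- 1 - \<gamma>" 1] g
    by (intro integrableI_bounded) (auto simp: abs_mult ennreal_mult' ennreal_indicator)
  ultimately show "integrable lborel (\<lambda>s. l * (indicator {0..1} s * s powr (- \<gamma>)) + indicator {1..} s * s powr (- 1 - \<gamma>) :: real)"
    by simp
  show "AE s in lborel. norm (indicator {0<..} s * s powr (- 1 - \<gamma>) * (1 - exp (- s * l)))
    \<le> norm (l * (indicator {0..1} s * s powr (- \<gamma>)) + indicator {1..} s * s powr (- 1 - \<gamma>))"
  proof (rule AE_I2)
    fix s :: real
    show "norm (indicator {0<..} s * s powr (- 1 - \<gamma>) * (1 - exp (- s * l)))
    \<le> norm (l * (indicator {0..1} s * s powr (- \<gamma>)) + indicator {1..} s * s powr (- 1 - \<gamma>))"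
    proof (cases "0 < s")
      case True
      have e: "0 \<le> 1 - exp (- s * l)" "1 - exp (- s * l) \<le> s * l" "1 - exp (- s * l) \<le> 1"
        using True l exp_ge_add_one_self[of "- s * l"] by auto
      have "s powr (- 1 - \<gamma>) * s = s powr (- \<gamma>)"
        using True powr_add[of s "- 1 - \<gamma>" 1] by simp
      then have "s powr (- 1 - \<gamma>) * (1 - exp (- s * l)) \<le> l * s powr (- \<gamma>)"
        using mult_left_mono[OF e(2), of "s powr (- 1 - \<gamma>)"] by (simp add: mult_ac)
      moreover have "s powr (- 1 - \<gamma>) * (1 - exp (- s * l)) \<le> s powr (- 1 - \<gamma>)"
        using mult_left_mono[OF e(3), of "s powr (- 1 - \<gamma>)"] by simp
      moreover have "0 \<le> s powr (- 1 - \<gamma>) * (1 - exp (- s * l))" using e by simp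
      ultimately show ?thesis using True l e by (auto simp: indicator_def add_increasing)
    qed simp
  qed
qed measurable

lemma levy_int_scale:
  assumes g: "0 < \<gamma>" "\<gamma> < 1" and l: "0 \<le> l"
  shows "levy_int \<gamma> l = l powr \<gamma> * levy_int \<gamma> 1"
proof (cases "l = 0")
  case False
  then have l: "0 < l" using l by simp
  let ?f = "\<lambda>s. indicator {0<..} s * s powr (- 1 - \<gamma>) * (1 - exp (- s * l)) :: real"
  have "levy_int \<gamma> l = \<bar>1 / l\<bar> *\<^sub>R (\<integral>s. ?f (0 + (1 / l) * s) \<partial>lborel)"
    unfolding levy_int_def using l by (intro lborel_integral_real_affine) auto
  also have "\<dots> = \<bar>1 / l\<bar> *\<^sub>R (\<integral>s. (1 / l) powr (- 1 - \<gamma>) * (indicator {0<..} s * s powr (- 1 - \<gamma>) * (1 - exp (- s * 1))) \<partial>lborel)"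
    using l by (intro arg_cong[where f="\<lambda>x. \<bar>1 / l\<bar> *\<^sub>R x"] Bochner_Integration.integral_cong refl)
       (auto simp: indicator_def powr_divide zero_less_divide_iff zero_less_mult_iff)
  also have "\<dots> = (1 / l) * (1 / l) powr (- 1 - \<gamma>) * levy_int \<gamma> 1"
    using l by (simp add: levy_int_def)
  also have "(1 / l) * (1 / l) powr (- 1 - \<gamma>) = l powr \<gamma>"
    using l by (simp add: powr_divide powr_diff powr_minus field_simps)
  finally show ?thesis .
qed (simp add: levy_int_def)

lemma levy_int_pos:
  assumes g: "0 < \<gamma>" "\<gamma> < 1"
  shows "0 < levy_int \<gamma> 1"
proof -
  let ?c = "2 powr (- 1 - \<gamma>) * (1 - exp (- 1)) :: real"
  have "(\<integral>(s::real). ?c * indicator {1..2} s \<partial>lborel) \<le> levy_int \<gamma> 1"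
    unfolding levy_int_def
  proof (rule Bochner_Integration.integral_mono)
    show "integrable lborel (\<lambda>s. indicator {0<..} s * s powr (- 1 - \<gamma>) * (1 - exp (- s * 1)) :: real)"
      by (rule levy_integrable[OF g]) simp
    fix s :: real
    show "?c * indicator {1..2} s \<le> indicator {0<..} s * s powr (- 1 - \<gamma>) * (1 - exp (- s * 1))"
    proof (cases "s \<in> {1..2}")
      case True
      then have "?c \<le> s powr (- 1 - \<gamma>) * (1 - exp (- s))"
        using g by (intro mult_mono powr_mono2') auto
      then show ?thesis using True by simp
    qed (auto simp: indicator_def)
  qed auto
  moreover have "(\<integral>(s::real). ?c * indicator {1..2} s \<partial>lborel) = ?c" by simp
  moreover have "0 < ?c" by simp
  ultimately show ?thesis by linarith
qed

text \<open>Subordination with \<open>\<gamma> = \<beta> / 2\<close>. The density of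
  \<open>levy_int\<close> has infinite mass near 0, so it is truncated to
  \<open>s \<ge> 1 / Suc k\<close>. Then the exponential of the integral factors into a constant and
  the exponential of a finite Gaussian mixture, and \<open>k\<close> tends to infinity. For
  \<open>\<beta> = 2\<close> the function is itself a Gaussian.\<close>

lemma pos_type_exp_norm_powr:
  assumes \<beta>: "0 < \<beta>" "\<beta> \<le> 2" and t: "0 < t"
  shows "pos_type (\<lambda>\<xi>::'a::euclidean_space. exp (- t * norm \<xi> powr \<beta>))"
proof (cases "\<beta> = 2")
  case True
  have "norm \<xi> powr 2 = (norm \<xi>)\<^sup>2" for \<xi> :: 'a by (cases "\<xi> = 0") auto
  then show ?thesis using pos_type_gauss[of t] t True by simp
next
  case False
  define \<gamma> where "\<gamma> = \<beta> / 2"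
  have g: "0 < \<gamma>" "\<gamma> < 1" using \<beta> False by (auto simp: \<gamma>_def)
  \<comment> \<open>Normalised such that \<open>c * levy_int \<gamma> ((norm \<xi>)\<^sup>2)\<close>
    equals \<open>t * norm \<xi> powr \<beta>\<close>.\<close>
  define c where "c = t / levy_int \<gamma> 1"
  have c: "0 < c" using t levy_int_pos[OF g] by (simp add: c_def)
  define m where "m k s = c * (indicator {1 / real (Suc k)..} s * s powr (- 1 - \<gamma>))" for k s
  have m_int: "integrable lborel (m k)" for k
  proof -
    have "integrable lborel (\<lambda>s. indicator {1 / real (Suc k)..} s * s powr (- 1 - \<gamma>) :: real)"
      using nn_integral_powr_Ici[of "- 1 - \<gamma>" "1 / real (Suc k)"] g
      by (intro integrableI_bounded) (auto simp: abs_mult ennreal_mult' ennreal_indicator)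
    then show ?thesis unfolding m_def by simp
  qed
  have m0: "0 \<le> m k s" for k s using c by (simp add: m_def)
  have m1: "m k s = 0" if "s < 0" for k s
  proof -
    have "0 < 1 / real (Suc k)" by simp
    then have "\<not> 1 / real (Suc k) \<le> s" using that by linarith
    then show ?thesis by (simp add: m_def)
  qed
  have [measurable]: "m k \<in> borel_measurable borel" for k unfolding m_def by measurable
  define f where "f k \<xi> = exp (- (\<integral>s. m k s \<partial>lborel)) * exp (\<integral>s. m k s * exp (- s * (norm \<xi>)\<^sup>2) \<partial>lborel)"
    for k and \<xi> :: 'a
  have pf: "pos_type (f k)" for k
    unfolding f_def by (intro pos_type_cmult pos_type_exp_mix m_int m0 m1) auto
  have le: "m k s * exp (- s * (norm \<xi>)\<^sup>2) \<le> m k s" for k s and \<xi> :: 'a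
    using m0[of k s] m1[of s k] by (cases "s < 0") (auto simp: mult_left_le)
  have int: "integrable lborel (\<lambda>s. m k s * exp (- s * (norm \<xi>)\<^sup>2))" for k and \<xi> :: 'a
    by (rule Bochner_Integration.integrable_bound[OF m_int]) (use le m0 in auto)
  have f_eq: "f k \<xi> = exp (- (\<integral>s. m k s * (1 - exp (- s * (norm \<xi>)\<^sup>2)) \<partial>lborel))" for k \<xi>
  proof -
    have "(\<integral>s. m k s * (1 - exp (- s * (norm \<xi>)\<^sup>2)) \<partial>lborel)
        = (\<integral>s. m k s \<partial>lborel) - (\<integral>s. m k s * exp (- s * (norm \<xi>)\<^sup>2) \<partial>lborel)"
      using Bochner_Integration.integral_diff[OF m_int int, of k k \<xi>] by (simp add: right_diff_distrib)
    then show ?thesis by (simp add: f_def exp_add[symmetric])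
  qed
  have "pos_type (\<lambda>\<xi>::'a. exp (- (c * levy_int \<gamma> ((norm \<xi>)\<^sup>2))))"
  proof (rule pos_type_lim[OF pf])
    fix k and \<xi> :: 'a
    have nn: "0 \<le> m k s * (1 - exp (- s * (norm \<xi>)\<^sup>2))" for s
      using le[of k s \<xi>] by (simp add: right_diff_distrib)
    have "0 \<le> (\<integral>s. m k s * (1 - exp (- s * (norm \<xi>)\<^sup>2)) \<partial>lborel)"
      by (intro Bochner_Integration.integral_nonneg nn)
    then show "\<bar>f k \<xi>\<bar> \<le> 1" by (simp add: f_eq)
  next
    fix \<xi> :: 'a
    let ?l = "(norm \<xi>)\<^sup>2"
    have "(\<lambda>k. \<integral>s. m k s * (1 - exp (- s * ?l)) \<partial>lborel)
       \<longlonglongrightarrow> (\<integral>s. c * (indicator {0<..} s * s powr (- 1 - \<gamma>) * (1 - exp (- s * ?l))) \<partial>lborel)"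
    proof (rule integral_dominated_convergence)
      show "integrable lborel (\<lambda>s. c * (indicator {0<..} s * s powr (- 1 - \<gamma>) * (1 - exp (- s * ?l))))"
        using levy_integrable[OF g, of ?l] by (intro integrable_mult_right) auto
      show "AE s in lborel. (\<lambda>k. m k s * (1 - exp (- s * ?l))) \<longlonglongrightarrow> c * (indicator {0<..} s * s powr (- 1 - \<gamma>) * (1 - exp (- s * ?l)))"
      proof (rule AE_I2)
        fix s :: real
        show "(\<lambda>k. m k s * (1 - exp (- s * ?l))) \<longlonglongrightarrow> c * (indicator {0<..} s * s powr (- 1 - \<gamma>) * (1 - exp (- s * ?l)))"
        proof (cases "0 < s")
          case True
          then obtain N where N: "1 / real (Suc N) < s" using nat_approx_posE by metis
          have "\<forall>\<^sub>F k in sequentially. m k s * (1 - exp (- s * ?l)) = c * (indicator {0<..} s * s powr (- 1 - \<gamma>) * (1 - exp (- s * ?l)))"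
            unfolding eventually_sequentially
          proof (intro exI allI impI)
            fix k assume "N \<le> k"
            then have "1 / real (Suc k) \<le> 1 / real (Suc N)" by (simp add: field_simps)
            then show "m k s * (1 - exp (- s * ?l)) = c * (indicator {0<..} s * s powr (- 1 - \<gamma>) * (1 - exp (- s * ?l)))"
              using N True by (simp add: m_def)
          qed
          then show ?thesis by (rule tendsto_eventually)
        next
          case False
          then have "m k s * (1 - exp (- s * ?l)) = 0" for k
            using m1[of s k] by (cases "s = 0") auto
          then have z: "(\<lambda>k. m k s * (1 - exp (- s * ?l))) = (\<lambda>k. 0)" by (rule ext)
          show ?thesis unfolding z using False by simp
        qed
      qed
      show "AE s in lborel. norm (m k s * (1 - exp (- s * ?l))) \<le> c * (indicator {0<..} s * s powr (- 1 - \<gamma>) * (1 - exp (- s * ?l)))" for k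
      proof (rule AE_I2)
        fix s :: real
        show "norm (m k s * (1 - exp (- s * ?l))) \<le> c * (indicator {0<..} s * s powr (- 1 - \<gamma>) * (1 - exp (- s * ?l)))"
        proof (cases "0 < s")
          case True
          then have "0 \<le> 1 - exp (- s * ?l)" by simp
          then show ?thesis using True c by (auto simp: m_def abs_mult indicator_def)
        next
          case False
          then have "m k s * (1 - exp (- s * ?l)) = 0"
            using m1[of s k] by (cases "s = 0") auto
          then show ?thesis using False by simp
        qed
      qed
    qed measurable
    then have "(\<lambda>k. \<integral>s. m k s * (1 - exp (- s * ?l)) \<partial>lborel) \<longlonglongrightarrow> c * levy_int \<gamma> ?l"
      by (simp add: levy_int_def)
    then show "(\<lambda>k. f k \<xi>) \<longlonglongrightarrow> exp (- (c * levy_int \<gamma> ((norm \<xi>)\<^sup>2)))"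
      unfolding f_eq by (intro tendsto_intros)
  qed
  moreover have "- (c * levy_int \<gamma> ((norm \<xi>)\<^sup>2)) = - t * norm \<xi> powr \<beta>" for \<xi> :: 'a
  proof -
    have "(norm \<xi>)\<^sup>2 = norm \<xi> powr 2" by (cases "\<xi> = 0") auto
    then have "((norm \<xi>)\<^sup>2) powr \<gamma> = norm \<xi> powr (2 * \<gamma>)"
      by (simp only: powr_powr)
    then have "((norm \<xi>)\<^sup>2) powr \<gamma> = norm \<xi> powr \<beta>" by (simp add: \<gamma>_def)
    then show ?thesis
      using levy_int_pos[OF g] levy_int_scale[OF g, of "(norm \<xi>)\<^sup>2"] by (simp add: c_def)
  qed
  ultimately show ?thesis by simp
qed

section \<open>The kernel of the fractional heat semigroup\<close>

lemma integrable_exp_norm_powr: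
  assumes \<beta>: "0 < \<beta>" and t: "0 < t"
  shows "integrable lborel (\<lambda>\<xi>::'a::euclidean_space. exp (- t * norm \<xi> powr \<beta>))"
proof (rule integrableI_bounded)
  \<comment> \<open>The exponential is compared with a power: \<open>exp (- y)\<close> is at most
    \<open>(k / y) ^ k\<close>, which is integrable at infinity as soon as
    \<open>\<beta> * k\<close> exceeds the dimension.\<close>
  obtain k :: nat where k: "real DIM('a) / \<beta> < real k" using reals_Archimedean2 by blast
  then have kb: "real DIM('a) < \<beta> * real k" using \<beta> by (simp add: field_simps)
  have k0: "0 < k" using k \<beta> by (metis DIM_positive divide_pos_pos of_nat_0 of_nat_0_less_iff gr0I not_less_iff_gr_or_eq order_less_trans)
  define C where "C = (real k / t) ^ k"
  have [measurable]: "cball (0::'a) 1 \<in> sets borel" by simp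
  have "(\<integral>\<^sup>+(\<xi>::'a). ennreal (norm (exp (- t * norm \<xi> powr \<beta>))) \<partial>lborel)
     \<le> (\<integral>\<^sup>+(\<xi>::'a). indicator (cball 0 1) \<xi> + ennreal C * (indicator {x. 1 < norm x} \<xi> * ennreal (norm \<xi> powr - (\<beta> * real k))) \<partial>lborel)"
  proof (rule nn_integral_mono)
    fix \<xi> :: 'a
    show "ennreal (norm (exp (- t * norm \<xi> powr \<beta>))) \<le> indicator (cball 0 1) \<xi> + ennreal C * (indicator {x. 1 < norm x} \<xi> * ennreal (norm \<xi> powr - (\<beta> * real k)))"
    proof (cases "norm \<xi> \<le> 1")
      case True
      have "exp (- t * norm \<xi> powr \<beta>) \<le> 1" using t by simp
      then show ?thesis using True by (simp add: ennreal_le_1 add_increasing2)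
    next
      case False
      define y where "y = t * norm \<xi> powr \<beta>"
      have x0: "0 < norm \<xi>" using False by linarith
      then have y: "0 < y" using t by (auto simp: y_def)
      have le: "y / real k \<le> exp (y / real k)" using exp_ge_add_one_self[of "y / real k"] by linarith
      have pk: "(norm \<xi> powr \<beta>) ^ k = norm \<xi> powr (\<beta> * real k)"
        using x0 by (simp add: powr_powr[symmetric] powr_realpow)
      have "(y / real k) ^ k \<le> exp (y / real k) ^ k"
        using y le by (intro power_mono) auto
      also have "\<dots> = exp y" using k0 by (simp add: exp_of_nat_mult[symmetric])
      finally have "exp (- y) \<le> 1 / (y / real k) ^ k"
        using y k0 by (simp add: exp_minus field_simps)
      also have "\<dots> = C * norm \<xi> powr - (\<beta> * real k)"
        using y k0 t x0 unfolding C_def y_def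
        by (simp add: power_divide power_mult_distrib powr_minus pk field_simps)
      finally show ?thesis using False
        by (simp add: y_def ennreal_mult'[symmetric] ennreal_leI C_def t less_imp_le)
    qed
  qed
  also have "\<dots> = emeasure lborel (cball (0::'a) 1) + ennreal C * (\<integral>\<^sup>+(\<xi>::'a). indicator {x. 1 < norm x} \<xi> * ennreal (norm \<xi> powr - (\<beta> * real k)) \<partial>lborel)"
    by (subst nn_integral_add) (auto simp: nn_integral_cmult)
  also have "\<dots> < \<infinity>"
    using order_le_less_trans[OF nn_integral_norm_powr_outside[OF kb, of 1] ennreal_less_top]
      emeasure_lborel_cball_finite[of "0::'a" 1]
    by (auto simp: ennreal_mult_less_top)
  finally show "(\<integral>\<^sup>+(\<xi>::'a). ennreal (norm (exp (- t * norm \<xi> powr \<beta>))) \<partial>lborel) < \<infinity>" .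
qed measurable

text \<open>The Fourier integral in real form and on an arbitrary Euclidean space. The sine part
  integrates to zero by symmetry, so a cosine remains.\<close>

definition stable_kernel :: "real \<Rightarrow> real \<Rightarrow> 'a::euclidean_space \<Rightarrow> real" where
  "stable_kernel \<beta> t x = (\<integral>\<xi>. cos (x \<bullet> \<xi>) * exp (- t * norm \<xi> powr \<beta>) \<partial>lborel) / (2 * pi) ^ DIM('a)"

lemma integrable_cos_exp_norm_powr:
  assumes "0 < \<beta>" "0 < t"
  shows "integrable lborel (\<lambda>\<xi>::'a::euclidean_space. cos (x \<bullet> \<xi>) * exp (- t * norm \<xi> powr \<beta>))"
proof (rule Bochner_Integration.integrable_bound[OF integrable_exp_norm_powr[OF assms]])
  show "AE \<xi> in lborel. norm (cos (x \<bullet> \<xi>) * exp (- t * norm \<xi> powr \<beta>)) \<le> norm (exp (- t * norm \<xi> powr \<beta>))"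
    by (intro AE_I2) (simp add: abs_mult mult_left_le_one_le)
qed measurable

lemma frac_heat_kernel_eq:
  assumes "0 < \<beta>" "0 < t"
  shows "frac_heat_kernel \<beta> t x = stable_kernel \<beta> t (x :: real ^ 'n)"
proof -
  let ?f = "\<lambda>\<xi>::real^'n. exp (\<i> * of_real (x \<bullet> \<xi>) - of_real (t * norm \<xi> powr \<beta>))"
  have n: "norm (?f \<xi>) = exp (- t * norm \<xi> powr \<beta>)" for \<xi> by simp
  have I: "integrable lborel ?f"
    by (rule Bochner_Integration.integrable_bound[OF integrable_exp_norm_powr[OF assms]]) (auto simp: n)
  have R: "Re (?f \<xi>) = cos (x \<bullet> \<xi>) * exp (- t * norm \<xi> powr \<beta>)" for \<xi>
    by (simp add: Re_exp mult.commute)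
  have "Re (1 / (2 * of_real pi) ^ CARD('n) * (LINT \<xi>|lborel. ?f \<xi>)) = (1 / (2 * pi) ^ CARD('n)) * Re (LINT \<xi>|lborel. ?f \<xi>)"
  proof -
    have "1 / (2 * complex_of_real pi) ^ CARD('n) = complex_of_real (1 / (2 * pi) ^ CARD('n))" by simp
    then show ?thesis by (simp only: Re_complex_of_real times_complex.sel Im_complex_of_real mult_zero_left diff_zero)
  qed
  also have "Re (LINT \<xi>|lborel. ?f \<xi>) = (\<integral>\<xi>. cos (x \<bullet> \<xi>) * exp (- t * norm \<xi> powr \<beta>) \<partial>lborel)"
    using integral_Re[OF I] by (simp only: R)
  finally show ?thesis by (simp add: frac_heat_kernel_def stable_kernel_def)
qed

lemma stable_kernel_measurable [measurable]:
  "(\<lambda>z. stable_kernel \<beta> (fst z) (snd z)) \<in> borel_measurable (borel \<Otimes>\<^sub>M (borel :: 'a::euclidean_space measure))"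
  unfolding stable_kernel_def by measurable

lemma stable_kernel_measurable1 [measurable (raw)]:
  assumes [measurable]: "f \<in> borel_measurable M" "g \<in> measurable M (borel :: 'a::euclidean_space measure)"
  shows "(\<lambda>z. stable_kernel \<beta> (f z) (g z)) \<in> borel_measurable M"
  using measurable_compose[OF measurable_Pair[OF assms] stable_kernel_measurable] by simp

text \<open>The test Gaussian in \<open>pos_type\<close> is removed by letting its parameter
  \<open>1 / Suc k\<close> tend to 0, since the exponential is integrable by itself.\<close>

lemma stable_kernel_nonneg:
  assumes \<beta>: "0 < \<beta>" "\<beta> \<le> 2" and t: "0 < t"
  shows "0 \<le> stable_kernel \<beta> t (x :: 'a::euclidean_space)"
proof -
  let ?h = "\<lambda>\<xi>::'a. exp (- t * norm \<xi> powr \<beta>)"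
  have "0 \<le> (\<integral>\<xi>. cos (x \<bullet> \<xi>) * ?h \<xi> \<partial>lborel)"
  proof (rule LIMSEQ_le_const)
    show "(\<lambda>k. \<integral>\<xi>. cos (x \<bullet> \<xi>) * ?h \<xi> * exp (- (1 / real (Suc k)) * (norm \<xi>)\<^sup>2) \<partial>lborel)
       \<longlonglongrightarrow> (\<integral>\<xi>. cos (x \<bullet> \<xi>) * ?h \<xi> \<partial>lborel)"
    proof (rule integral_dominated_convergence[OF _ _ integrable_exp_norm_powr[OF \<beta>(1) t]])
      show "AE \<xi> in lborel. (\<lambda>k. cos (x \<bullet> \<xi>) * ?h \<xi> * exp (- (1 / real (Suc k)) * (norm \<xi>)\<^sup>2)) \<longlonglongrightarrow> cos (x \<bullet> \<xi>) * ?h \<xi>"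
      proof (rule AE_I2)
        fix \<xi> :: 'a
        have "(\<lambda>k. - (1 / real (Suc k)) * (norm \<xi>)\<^sup>2) \<longlonglongrightarrow> - 0 * (norm \<xi>)\<^sup>2"
          by (intro tendsto_mult tendsto_minus tendsto_const LIMSEQ_Suc[OF lim_1_over_n])
        then have "(\<lambda>k. cos (x \<bullet> \<xi>) * ?h \<xi> * exp (- (1 / real (Suc k)) * (norm \<xi>)\<^sup>2)) \<longlonglongrightarrow> cos (x \<bullet> \<xi>) * ?h \<xi> * exp (- 0 * (norm \<xi>)\<^sup>2)"
          by (rule tendsto_mult[OF tendsto_const tendsto_exp])
        then show "(\<lambda>k. cos (x \<bullet> \<xi>) * ?h \<xi> * exp (- (1 / real (Suc k)) * (norm \<xi>)\<^sup>2)) \<longlonglongrightarrow> cos (x \<bullet> \<xi>) * ?h \<xi>"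
          by simp
      qed
      show "AE \<xi> in lborel. norm (cos (x \<bullet> \<xi>) * ?h \<xi> * exp (- (1 / real (Suc k)) * (norm \<xi>)\<^sup>2)) \<le> ?h \<xi>" for k
      proof (rule AE_I2)
        fix \<xi> :: 'a
        have "\<bar>cos (x \<bullet> \<xi>)\<bar> * ?h \<xi> * exp (- (1 / real (Suc k)) * (norm \<xi>)\<^sup>2) \<le> 1 * ?h \<xi> * 1"
          by (intro mult_mono) auto
        then show "norm (cos (x \<bullet> \<xi>) * ?h \<xi> * exp (- (1 / real (Suc k)) * (norm \<xi>)\<^sup>2)) \<le> ?h \<xi>"
          by (simp add: abs_mult)
      qed
    qed measurable
    have "0 \<le> (\<integral>\<xi>. cos (x \<bullet> \<xi>) * ?h \<xi> * exp (- (1 / real (Suc k)) * (norm \<xi>)\<^sup>2) \<partial>lborel)" for k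
    proof -
      have "0 < 1 / real (Suc k)" by simp
      then show ?thesis using pos_type_exp_norm_powr[OF \<beta> t, where 'a='a] unfolding pos_type_def by blast
    qed
    then show "\<exists>N. \<forall>k\<ge>N. 0 \<le> (\<integral>\<xi>. cos (x \<bullet> \<xi>) * ?h \<xi> * exp (- (1 / real (Suc k)) * (norm \<xi>)\<^sup>2) \<partial>lborel)"
      by blast
  qed
  then show ?thesis by (simp add: stable_kernel_def)
qed

lemma stable_kernel_le_0:
  assumes "0 < \<beta>" "0 < t"
  shows "stable_kernel \<beta> t (x :: 'a::euclidean_space) \<le> stable_kernel \<beta> t (0::'a)"
proof -
  have "cos (x \<bullet> \<xi>) * exp (- t * norm \<xi> powr \<beta>) \<le> cos (0 \<bullet> \<xi>) * exp (- t * norm \<xi> powr \<beta>)" for \<xi> :: 'a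
    by simp
  then show ?thesis unfolding stable_kernel_def
    by (intro divide_right_mono Bochner_Integration.integral_mono integrable_cos_exp_norm_powr assms) auto
qed

lemma stable_kernel_scale:
  assumes \<beta>: "0 < \<beta>" and t: "0 < t"
  shows "stable_kernel \<beta> t (x :: 'a::euclidean_space) = t powr (- real DIM('a) / \<beta>) * stable_kernel \<beta> 1 (t powr (- 1 / \<beta>) *\<^sub>R x)"
proof -
  define c where "c = t powr (- 1 / \<beta>)"
  have c0: "0 < c" using t by (auto simp: c_def)
  have "c powr \<beta> = t powr (- 1)" unfolding c_def powr_powr using \<beta> by simp
  then have c: "0 < c" "c powr \<beta> = 1 / t" using c0 t by (auto simp: powr_minus_divide)
  have "(\<integral>(\<xi>::'a). cos (x \<bullet> \<xi>) * exp (- t * norm \<xi> powr \<beta>) \<partial>lborel)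
      = \<bar>c\<bar> ^ DIM('a) *\<^sub>R (\<integral>(\<xi>::'a). cos (x \<bullet> (c *\<^sub>R \<xi>)) * exp (- t * norm (c *\<^sub>R \<xi>) powr \<beta>) \<partial>lborel)"
    using c by (intro lborel_integral_scale) auto
  also have "(\<lambda>\<xi>::'a. cos (x \<bullet> (c *\<^sub>R \<xi>)) * exp (- t * norm (c *\<^sub>R \<xi>) powr \<beta>)) = (\<lambda>\<xi>. cos ((c *\<^sub>R x) \<bullet> \<xi>) * exp (- 1 * norm \<xi> powr \<beta>))"
    using c t by (auto simp: powr_mult)
  also have "\<bar>c\<bar> ^ DIM('a) = t powr (- real DIM('a) / \<beta>)"
    using c t by (simp add: c_def powr_realpow[symmetric] powr_powr)
  finally show ?thesis by (simp add: stable_kernel_def c_def)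
qed

lemma stable_kernel_1_continuous:
  assumes \<beta>: "0 < \<beta>" and y: "y \<longlonglongrightarrow> (x :: 'a::euclidean_space)"
  shows "(\<lambda>k. stable_kernel \<beta> 1 (y k)) \<longlonglongrightarrow> stable_kernel \<beta> 1 x"
  unfolding stable_kernel_def
proof (intro tendsto_divide tendsto_const)
  show "(\<lambda>k. \<integral>\<xi>. cos (y k \<bullet> \<xi>) * exp (- 1 * norm \<xi> powr \<beta>) \<partial>lborel) \<longlonglongrightarrow> (\<integral>\<xi>. cos (x \<bullet> \<xi>) * exp (- 1 * norm \<xi> powr \<beta>) \<partial>lborel)"
  proof (rule integral_dominated_convergence[OF _ _ integrable_exp_norm_powr[OF \<beta>, of 1]])
    show "AE \<xi> in lborel. (\<lambda>k. cos (y k \<bullet> \<xi>) * exp (- 1 * norm \<xi> powr \<beta>)) \<longlonglongrightarrow> cos (x \<bullet> \<xi>) * exp (- 1 * norm \<xi> powr \<beta>)"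
      by (intro AE_I2 tendsto_intros y)
    show "AE \<xi> in lborel. norm (cos (y k \<bullet> \<xi>) * exp (- 1 * norm \<xi> powr \<beta>)) \<le> exp (- 1 * norm \<xi> powr \<beta>)" for k
      by (intro AE_I2) (simp add: abs_mult mult_left_le_one_le)
  qed auto
qed auto

lemma stable_kernel_continuous_time:
  assumes \<beta>: "0 < \<beta>" and r: "r \<longlonglongrightarrow> t" "\<And>k. 0 < r k" "0 < t"
  shows "(\<lambda>k. stable_kernel \<beta> (r k) (x :: 'a::euclidean_space)) \<longlonglongrightarrow> stable_kernel \<beta> t x"
proof -
  have "(\<lambda>k. r k powr (- real DIM('a) / \<beta>) * stable_kernel \<beta> 1 (r k powr (- 1 / \<beta>) *\<^sub>R x))
    \<longlonglongrightarrow> t powr (- real DIM('a) / \<beta>) * stable_kernel \<beta> 1 (t powr (- 1 / \<beta>) *\<^sub>R x)"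
    using r by (intro tendsto_mult tendsto_powr stable_kernel_1_continuous \<beta> tendsto_intros) auto
  then show ?thesis
    using stable_kernel_scale[OF \<beta> r(2), of _ x] stable_kernel_scale[OF \<beta> r(3), of x] by simp
qed

lemma stable_kernel_bounded_time:
  assumes "0 < \<beta>" "0 < t"
  shows "stable_kernel \<beta> t (x :: 'a::euclidean_space) \<le> stable_kernel \<beta> 1 (0::'a) * t powr (- real DIM('a) / \<beta>)"
  using stable_kernel_le_0[OF assms, of x] stable_kernel_scale[OF assms, of "0::'a"] by (simp add: mult.commute)

text \<open>The kernel is integrated against a wide Gaussian. By Fubini this is a Gaussian average
  of \<open>exp (- t * norm \<xi> powr \<beta>)\<close> that concentrates at the origin, where the
  value is 1. Nonnegativity of the kernel allows monotone convergence to remove the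
  Gaussian.\<close>

lemma nn_integral_stable_kernel:
  assumes \<beta>: "0 < \<beta>" "\<beta> \<le> 2" and t: "0 < t"
  shows "(\<integral>\<^sup>+(x::'a::euclidean_space). ennreal (stable_kernel \<beta> t x) \<partial>lborel) = 1"
proof -
  let ?n = "DIM('a)" and ?S = "stable_kernel \<beta> t :: 'a \<Rightarrow> real"
  \<comment> \<open>With \<open>c = 1 / Suc k\<close> this is \<open>c\<^sup>2 / 4\<close>. The
    substitution of \<open>c *\<^sub>R \<eta>\<close> for the frequency then turns the transformed
    Gaussian into \<open>exp (- (norm \<eta>)\<^sup>2)\<close>, free of \<open>k\<close>.\<close>
  define d where "d k = 1 / (4 * (real (Suc k))\<^sup>2)" for k
  have d: "0 < d k" for k by (simp add: d_def)
  have S0: "0 \<le> ?S x" for x by (rule stable_kernel_nonneg[OF \<beta> t])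
  have SB: "\<bar>?S x\<bar> \<le> ?S 0" for x using S0[of x] stable_kernel_le_0[OF \<beta>(1) t, of x] by simp
  have [measurable]: "?S \<in> borel_measurable borel" by measurable
  have Sint: "integrable lborel (\<lambda>x. ?S x * exp (- d k * (norm x)\<^sup>2))" for k
    using integrable_cos_bounded_gauss[of ?S "?S 0" "d k" 0] SB d by simp
  have eq: "(\<integral>x. ?S x * exp (- d k * (norm x)\<^sup>2) \<partial>lborel)
      = (\<integral>(\<eta>::'a). exp (- t * norm ((1 / real (Suc k)) *\<^sub>R \<eta>) powr \<beta>) * exp (- 1 * (norm \<eta>)\<^sup>2) \<partial>lborel) / sqrt pi ^ ?n" for k
  proof -
    define c where "c = 1 / real (Suc k)"
    have c: "0 < c" "d k = c\<^sup>2 / 4" by (auto simp: c_def d_def power_divide)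
    define F where "F \<xi> x = cos (x \<bullet> \<xi>) * exp (- t * norm \<xi> powr \<beta>) * exp (- d k * (norm x)\<^sup>2)" for \<xi> x :: 'a
    have [measurable]: "case_prod F \<in> borel_measurable (lborel \<Otimes>\<^sub>M lborel)" unfolding F_def by measurable
    have "integrable (lborel \<Otimes>\<^sub>M lborel) (case_prod F)"
    proof (rule integrableI_bounded)
      have "(\<integral>\<^sup>+z. ennreal (norm (case_prod F z)) \<partial>(lborel \<Otimes>\<^sub>M lborel))
          = (\<integral>\<^sup>+\<xi>. \<integral>\<^sup>+x. ennreal \<bar>F \<xi> x\<bar> \<partial>lborel \<partial>lborel)"
        by (subst lborel.nn_integral_fst[symmetric]) auto
      also have "\<dots> \<le> (\<integral>\<^sup>+(\<xi>::'a). \<integral>\<^sup>+(x::'a). ennreal (exp (- t * norm \<xi> powr \<beta>)) * ennreal (exp (- d k * (norm x)\<^sup>2)) \<partial>lborel \<partial>lborel)"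
      proof (intro nn_integral_mono)
        fix \<xi> x :: 'a
        have "\<bar>F \<xi> x\<bar> \<le> 1 * exp (- t * norm \<xi> powr \<beta>) * exp (- d k * (norm x)\<^sup>2)"
          unfolding F_def abs_mult by (intro mult_mono) auto
        then show "ennreal \<bar>F \<xi> x\<bar> \<le> ennreal (exp (- t * norm \<xi> powr \<beta>)) * ennreal (exp (- d k * (norm x)\<^sup>2))"
          by (simp add: ennreal_mult'[symmetric] ennreal_leI)
      qed
      also have "\<dots> = (\<integral>\<^sup>+(\<xi>::'a). ennreal (exp (- t * norm \<xi> powr \<beta>)) \<partial>lborel) * (\<integral>\<^sup>+(x::'a). ennreal (exp (- d k * (norm x)\<^sup>2)) \<partial>lborel)"
        by (simp add: nn_integral_cmult nn_integral_multc)
      also have "\<dots> < \<infinity>"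
        using integrable_exp_norm_powr[OF \<beta>(1) t, where 'a='a] integrable_gauss[OF d[of k], where 'a='a]
        by (auto simp: integrable_iff_bounded ennreal_mult_less_top)
      finally show "(\<integral>\<^sup>+z. ennreal (norm (case_prod F z)) \<partial>(lborel \<Otimes>\<^sub>M lborel)) < \<infinity>" .
    qed measurable
    note Fub = lborel_pair.Fubini_integral[OF this]
    have "(\<integral>x. ?S x * exp (- d k * (norm x)\<^sup>2) \<partial>lborel) = (\<integral>x. (\<integral>\<xi>. F \<xi> x \<partial>lborel) \<partial>lborel) / (2 * pi) ^ ?n"
      unfolding stable_kernel_def F_def by simp
    also have "(\<integral>x. (\<integral>\<xi>. F \<xi> x \<partial>lborel) \<partial>lborel) = (\<integral>\<xi>. (\<integral>x. F \<xi> x \<partial>lborel) \<partial>lborel)"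
      by (rule Fub)
    also have "\<dots> = (\<integral>(\<xi>::'a). exp (- t * norm \<xi> powr \<beta>) * gauss_ft (d k) \<xi> \<partial>lborel)"
    proof (intro Bochner_Integration.integral_cong refl)
      fix \<xi> :: 'a
      have "F \<xi> x = exp (- t * norm \<xi> powr \<beta>) * (cos (\<xi> \<bullet> x) * exp (- d k * (norm x)\<^sup>2))" for x
        by (simp add: F_def inner_commute)
      then have "(\<integral>x. F \<xi> x \<partial>lborel) = exp (- t * norm \<xi> powr \<beta>) * (\<integral>x. cos (\<xi> \<bullet> x) * exp (- d k * (norm x)\<^sup>2) \<partial>lborel)"
        by simp
      then show "(\<integral>x. F \<xi> x \<partial>lborel) = exp (- t * norm \<xi> powr \<beta>) * gauss_ft (d k) \<xi>"
        by (simp only: integral_cos_gauss[OF d])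
    qed
    also have "\<dots> = \<bar>c\<bar> ^ ?n *\<^sub>R (\<integral>(\<xi>::'a). exp (- t * norm (c *\<^sub>R \<xi>) powr \<beta>) * gauss_ft (d k) (c *\<^sub>R \<xi>) \<partial>lborel)"
      using c by (intro lborel_integral_scale) (auto simp: gauss_ft_def)
    also have "(\<lambda>\<xi>::'a. exp (- t * norm (c *\<^sub>R \<xi>) powr \<beta>) * gauss_ft (d k) (c *\<^sub>R \<xi>))
       = (\<lambda>\<xi>. sqrt (pi / d k) ^ ?n * (exp (- t * norm (c *\<^sub>R \<xi>) powr \<beta>) * exp (- 1 * (norm \<xi>)\<^sup>2)))"
    proof
      fix \<xi> :: 'a
      have "(norm (c *\<^sub>R \<xi>))\<^sup>2 / (4 * d k) = (norm \<xi>)\<^sup>2"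
        unfolding c(2) using c(1) by (simp add: power_mult_distrib)
      then show "exp (- t * norm (c *\<^sub>R \<xi>) powr \<beta>) * gauss_ft (d k) (c *\<^sub>R \<xi>)
        = sqrt (pi / d k) ^ ?n * (exp (- t * norm (c *\<^sub>R \<xi>) powr \<beta>) * exp (- 1 * (norm \<xi>)\<^sup>2))"
        unfolding gauss_ft_def by (simp only: mult_ac mult_minus_left mult_1)
    qed
    also have "sqrt (pi / d k) = 2 * sqrt pi / c"
      unfolding c(2) using c(1) by (simp add: real_sqrt_divide real_sqrt_mult)
    finally have "(\<integral>x. ?S x * exp (- d k * (norm x)\<^sup>2) \<partial>lborel)
      = (c ^ ?n * (2 * sqrt pi / c) ^ ?n / (2 * pi) ^ ?n) * (\<integral>(\<eta>::'a). exp (- t * norm (c *\<^sub>R \<eta>) powr \<beta>) * exp (- 1 * (norm \<eta>)\<^sup>2) \<partial>lborel)"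
      using c(1) by simp
    also have "c ^ ?n * (2 * sqrt pi / c) ^ ?n / (2 * pi) ^ ?n = 1 / sqrt pi ^ ?n"
    proof -
      have "c * (2 * sqrt pi / c) / (2 * pi) = 1 / sqrt pi"
        using c by (simp add: field_simps)
      then have "(c * (2 * sqrt pi / c) / (2 * pi)) ^ ?n = (1 / sqrt pi) ^ ?n" by (rule arg_cong)
      then show ?thesis by (simp only: power_mult_distrib power_divide power_one)
    qed
    finally show ?thesis unfolding c_def by simp
  qed
  have lim: "(\<lambda>k. \<integral>x. ?S x * exp (- d k * (norm x)\<^sup>2) \<partial>lborel) \<longlonglongrightarrow> 1"
  proof -
    have "(\<lambda>k. \<integral>(\<eta>::'a). exp (- t * norm ((1 / real (Suc k)) *\<^sub>R \<eta>) powr \<beta>) * exp (- 1 * (norm \<eta>)\<^sup>2) \<partial>lborel)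
      \<longlonglongrightarrow> (\<integral>(\<eta>::'a). exp (- 1 * (norm \<eta>)\<^sup>2) \<partial>lborel)"
    proof (rule integral_dominated_convergence[OF _ _ integrable_gauss[of 1]])
      show "AE \<eta>::'a in lborel. (\<lambda>k. exp (- t * norm ((1 / real (Suc k)) *\<^sub>R \<eta>) powr \<beta>) * exp (- 1 * (norm \<eta>)\<^sup>2)) \<longlonglongrightarrow> exp (- 1 * (norm \<eta>)\<^sup>2)"
      proof (rule AE_I2)
        fix \<eta> :: 'a
        have "(\<lambda>k. norm ((1 / real (Suc k)) *\<^sub>R \<eta>)) \<longlonglongrightarrow> norm (0 *\<^sub>R \<eta>)"
          by (intro tendsto_norm tendsto_scaleR tendsto_const LIMSEQ_Suc[OF lim_1_over_n])
        then have "(\<lambda>k. norm ((1 / real (Suc k)) *\<^sub>R \<eta>)) \<longlonglongrightarrow> 0" by simp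
        from tendsto_powr2[OF this tendsto_const, of \<beta>] \<beta>
        have "(\<lambda>k. norm ((1 / real (Suc k)) *\<^sub>R \<eta>) powr \<beta>) \<longlonglongrightarrow> 0 powr \<beta>"
          by (simp del: powr_zero_eq_one)
        then have "(\<lambda>k. exp (- t * norm ((1 / real (Suc k)) *\<^sub>R \<eta>) powr \<beta>) * exp (- 1 * (norm \<eta>)\<^sup>2)) \<longlonglongrightarrow> exp (- t * 0 powr \<beta>) * exp (- 1 * (norm \<eta>)\<^sup>2)"
          by (rule tendsto_mult[OF tendsto_exp[OF tendsto_mult[OF tendsto_const]] tendsto_const])
        then show "(\<lambda>k. exp (- t * norm ((1 / real (Suc k)) *\<^sub>R \<eta>) powr \<beta>) * exp (- 1 * (norm \<eta>)\<^sup>2)) \<longlonglongrightarrow> exp (- 1 * (norm \<eta>)\<^sup>2)"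
          by simp
      qed
      show "AE \<eta>::'a in lborel. norm (exp (- t * norm ((1 / real (Suc k)) *\<^sub>R \<eta>) powr \<beta>) * exp (- 1 * (norm \<eta>)\<^sup>2)) \<le> exp (- 1 * (norm \<eta>)\<^sup>2)" for k
        using t by (intro AE_I2) (simp add: abs_mult mult_left_le_one_le)
    qed auto
    from tendsto_divide[OF this tendsto_const, of "sqrt pi ^ ?n"]
    have "(\<lambda>k. \<integral>x. ?S x * exp (- d k * (norm x)\<^sup>2) \<partial>lborel) \<longlonglongrightarrow> (\<integral>(\<eta>::'a). exp (- 1 * (norm \<eta>)\<^sup>2) \<partial>lborel) / sqrt pi ^ ?n"
      unfolding eq by simp
    then show ?thesis using integral_gauss[of 1, where 'a='a] by simp
  qed
  have "(\<integral>\<^sup>+x. ennreal (?S x) \<partial>lborel) = (\<integral>\<^sup>+x. (SUP k. ennreal (?S x * exp (- d k * (norm x)\<^sup>2))) \<partial>lborel)"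
  proof (rule nn_integral_cong)
    fix x :: 'a
    have "(\<lambda>k. (1 / real (Suc k))\<^sup>2 / 4) \<longlonglongrightarrow> 0\<^sup>2 / 4"
      by (intro tendsto_divide tendsto_power tendsto_const LIMSEQ_Suc[OF lim_1_over_n]) auto
    moreover have "d = (\<lambda>k. (1 / real (Suc k))\<^sup>2 / 4)"
      by (auto simp: d_def power_divide fun_eq_iff)
    ultimately have "d \<longlonglongrightarrow> 0" by simp
    then have "(\<lambda>k. ?S x * exp (- d k * (norm x)\<^sup>2)) \<longlonglongrightarrow> ?S x * exp (- 0 * (norm x)\<^sup>2)"
      by (intro tendsto_intros)
    then have "(\<lambda>k. ennreal (?S x * exp (- d k * (norm x)\<^sup>2))) \<longlonglongrightarrow> ennreal (?S x)" by simp
    moreover have "incseq (\<lambda>k. ennreal (?S x * exp (- d k * (norm x)\<^sup>2)))"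
      unfolding incseq_def
    proof (intro allI impI ennreal_leI mult_left_mono S0)
      fix j k :: nat assume "j \<le> k"
      then have "d k \<le> d j" unfolding d_def by (intro divide_left_mono mult_left_mono power_mono) auto
      then show "exp (- d j * (norm x)\<^sup>2) \<le> exp (- d k * (norm x)\<^sup>2)" by (simp add: mult_right_mono)
    qed
    ultimately show "ennreal (?S x) = (SUP k. ennreal (?S x * exp (- d k * (norm x)\<^sup>2)))"
      using LIMSEQ_SUP LIMSEQ_unique by blast
  qed
  also have "\<dots> = (SUP k. \<integral>\<^sup>+x. ennreal (?S x * exp (- d k * (norm x)\<^sup>2)) \<partial>lborel)"
  proof (rule nn_integral_monotone_convergence_SUP)
    show "incseq (\<lambda>k x. ennreal (?S x * exp (- d k * (norm x)\<^sup>2)))"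
      unfolding incseq_def le_fun_def
    proof (intro allI impI ennreal_leI mult_left_mono S0)
      fix j k :: nat and x :: 'a assume "j \<le> k"
      then have "d k \<le> d j" unfolding d_def by (intro divide_left_mono mult_left_mono power_mono) auto
      then show "exp (- d j * (norm x)\<^sup>2) \<le> exp (- d k * (norm x)\<^sup>2)" by (simp add: mult_right_mono)
    qed
  qed measurable
  also have "\<dots> = (SUP k. ennreal (\<integral>x. ?S x * exp (- d k * (norm x)\<^sup>2) \<partial>lborel))"
    using Sint S0 by (subst nn_integral_eq_integral) auto
  also have "\<dots> = 1"
  proof -
    have "incseq (\<lambda>k. ennreal (\<integral>x. ?S x * exp (- d k * (norm x)\<^sup>2) \<partial>lborel))"
      unfolding incseq_def
    proof (intro allI impI ennreal_leI Bochner_Integration.integral_mono Sint mult_left_mono S0)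
      fix j k :: nat and x :: 'a assume "j \<le> k"
      then have "d k \<le> d j" unfolding d_def by (intro divide_left_mono mult_left_mono power_mono) auto
      then show "exp (- d j * (norm x)\<^sup>2) \<le> exp (- d k * (norm x)\<^sup>2)" by (simp add: mult_right_mono)
    qed
    from LIMSEQ_SUP[OF this] tendsto_ennrealI[OF lim] show ?thesis
      using LIMSEQ_unique by fastforce
  qed
  finally show ?thesis .
qed

lemma integrable_stable_kernel:
  assumes \<beta>: "0 < \<beta>" "\<beta> \<le> 2" and t: "0 < t"
  shows "integrable lborel (stable_kernel \<beta> t :: 'a::euclidean_space \<Rightarrow> real)"
proof (rule integrableI_bounded)
  have "(\<integral>\<^sup>+(x::'a). ennreal (norm (stable_kernel \<beta> t x)) \<partial>lborel) = (\<integral>\<^sup>+(x::'a). ennreal (stable_kernel \<beta> t x) \<partial>lborel)"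
    using stable_kernel_nonneg[OF assms, where 'a='a] by simp
  then show "(\<integral>\<^sup>+(x::'a). ennreal (norm (stable_kernel \<beta> t x)) \<partial>lborel) < \<infinity>"
    by (simp add: nn_integral_stable_kernel[OF assms])
qed measurable

text \<open>Scheffe's lemma: pointwise convergence of densities that all have mass 1 implies
  convergence in the mean.\<close>

lemma stable_kernel_L1_continuous:
  assumes \<beta>: "0 < \<beta>" "\<beta> \<le> 2" and r: "r \<longlonglongrightarrow> t" "\<And>k. 0 < r k" "0 < t"
  shows "(\<lambda>k. \<integral>\<^sup>+(x::'a::euclidean_space). ennreal \<bar>stable_kernel \<beta> (r k) x - stable_kernel \<beta> t x\<bar> \<partial>lborel) \<longlonglongrightarrow> 0"
proof -
  have "(\<lambda>k. \<integral>\<^sup>+(x::'a). norm (stable_kernel \<beta> (r k) x - stable_kernel \<beta> t x) \<partial>lborel) \<longlonglongrightarrow> 0"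
  proof (rule Scheffe_lemma2)
    show "integrable lborel (stable_kernel \<beta> t :: 'a \<Rightarrow> real)" using \<beta> r by (intro integrable_stable_kernel)
    show "AE x::'a in lborel. (\<lambda>k. stable_kernel \<beta> (r k) x) \<longlonglongrightarrow> stable_kernel \<beta> t x"
      using \<beta> r by (intro AE_I2 stable_kernel_continuous_time)
    show "(\<integral>\<^sup>+(x::'a). norm (stable_kernel \<beta> (r k) x) \<partial>lborel) \<le> (\<integral>\<^sup>+(x::'a). norm (stable_kernel \<beta> t x) \<partial>lborel)" for k
      using stable_kernel_nonneg[OF \<beta> r(2)[of k], where 'a='a] stable_kernel_nonneg[OF \<beta> r(3), where 'a='a]
      by (simp add: nn_integral_stable_kernel[OF \<beta> r(2)] nn_integral_stable_kernel[OF \<beta> r(3)])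
  qed measurable
  then show ?thesis by simp
qed

text \<open>Interpolation between the integral and the supremum.\<close>

lemma Lnorm_le_bounded:
  assumes [measurable]: "f \<in> borel_measurable M" and b: "1 < b" and le: "\<And>x. f x \<le> K"
  shows "Lnorm M b f \<le> epow K (1 - 1 / b) * epow (\<integral>\<^sup>+x. f x \<partial>M) (1 / b)"
proof -
  have "(\<integral>\<^sup>+x. epow (f x) b \<partial>M) \<le> (\<integral>\<^sup>+x. epow K (b - 1) * f x \<partial>M)"
  proof (rule nn_integral_mono)
    fix x
    have "epow (f x) b = epow (f x) (b - 1) * f x"
      using epow_add[of "f x" "b - 1" 1] by simp
    also have "\<dots> \<le> epow K (b - 1) * f x"
      using b le by (intro mult_right_mono epow_mono) auto
    finally show "epow (f x) b \<le> epow K (b - 1) * f x" .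
  qed
  also have "\<dots> = epow K (b - 1) * (\<integral>\<^sup>+x. f x \<partial>M)" by (simp add: nn_integral_cmult)
  finally have "Lnorm M b f \<le> epow (epow K (b - 1) * (\<integral>\<^sup>+x. f x \<partial>M)) (1 / b)"
    unfolding Lnorm_def using b by (intro epow_mono) auto
  also have "\<dots> = epow K ((b - 1) * (1 / b)) * epow (\<integral>\<^sup>+x. f x \<partial>M) (1 / b)"
    by (simp add: epow_mult)
  also have "(b - 1) * (1 / b) = 1 - 1 / b" using b by (simp add: field_simps)
  finally show ?thesis .
qed

lemma conv_add_right:
  fixes k f g :: "'a::euclidean_space \<Rightarrow> ennreal"
  assumes [measurable]: "k \<in> borel_measurable borel" "f \<in> borel_measurable borel" "g \<in> borel_measurable borel"
  shows "conv k (\<lambda>x. f x + g x) x = conv k f x + conv k g x"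
  unfolding conv_def by (simp add: distrib_left nn_integral_add)

lemma conv_add_left:
  fixes k f g :: "'a::euclidean_space \<Rightarrow> ennreal"
  assumes [measurable]: "k \<in> borel_measurable borel" "f \<in> borel_measurable borel" "g \<in> borel_measurable borel"
  shows "conv (\<lambda>x. f x + g x) k x = conv f k x + conv g k x"
  unfolding conv_def by (simp add: distrib_right nn_integral_add)

lemma measurable_conv_param [measurable (raw)]:
  fixes k f :: "'b \<Rightarrow> 'a::euclidean_space \<Rightarrow> ennreal"
  assumes [measurable]: "(\<lambda>(s, x). k s x) \<in> borel_measurable (N \<Otimes>\<^sub>M borel)"
    "(\<lambda>(s, x). f s x) \<in> borel_measurable (N \<Otimes>\<^sub>M borel)" "h \<in> measurable N borel"
  shows "(\<lambda>s. conv (k s) (f s) (h s)) \<in> borel_measurable N"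
  unfolding conv_def by measurable

section \<open>The heat kernel composed with the Riesz kernel\<close>

text \<open>The dimension is carried as a real number \<open>n\<close>, so that exponents need no
  coercions. The parameter \<open>dom\<close> carries the type of the space, which occurs in no
  other parameter.\<close>

locale fractional_heat =
  fixes \<alpha> \<beta> n :: real and dom :: "'a::euclidean_space itself"
  assumes alpha: "0 < \<alpha>" "\<alpha> < n" and beta: "0 < \<beta>" "\<beta> \<le> 2" and dim [simp]: "real DIM('a) = n"
begin

lemma n_pos: "0 < n" using alpha by simp

lemmas norm_powr_inside = nn_integral_norm_powr_inside[where 'a='a, unfolded dim]
lemmas norm_powr_outside = nn_integral_norm_powr_outside[where 'a='a, unfolded dim]
lemmas kernel_scale = stable_kernel_scale[where 'a='a, unfolded dim]
lemmas kernel_bounded_time = stable_kernel_bounded_time[where 'a='a, unfolded dim]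

text \<open>The extension by 0 to nonpositive times makes the kernel causal: time convolutions are
  cut off at the current time without an explicit upper limit.\<close>

definition heat_real :: "real \<Rightarrow> 'a \<Rightarrow> real" where
  "heat_real t x = (if 0 < t then stable_kernel \<beta> t x else 0)"

definition heat :: "real \<Rightarrow> 'a \<Rightarrow> ennreal" where
  "heat t x = ennreal (heat_real t x)"

definition heat_diff :: "real \<Rightarrow> real \<Rightarrow> 'a \<Rightarrow> ennreal" where
  "heat_diff s t x = ennreal \<bar>heat_real s x - heat_real t x\<bar>"

definition riesz :: "'a \<Rightarrow> ennreal" where
  "riesz x = ennreal (riesz_const DIM('a) \<alpha> / norm x powr (n - \<alpha>))"

definition kern :: "real \<Rightarrow> 'a \<Rightarrow> ennreal" where
  "kern t = conv (heat t) riesz"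

text \<open>A majorant for the difference of the two composed kernels: the absolute value is taken
  before convolving with the Riesz kernel, which avoids subtraction in
  \<open>ennreal\<close>.\<close>

definition kern_diff :: "real \<Rightarrow> real \<Rightarrow> 'a \<Rightarrow> ennreal" where
  "kern_diff s t = conv (heat_diff s t) riesz"

lemma heat_real_measurable [measurable (raw)]:
  assumes [measurable]: "f \<in> borel_measurable M" "g \<in> measurable M borel"
  shows "(\<lambda>z. heat_real (f z) (g z)) \<in> borel_measurable M"
  unfolding heat_real_def by measurable

lemma heat_measurable [measurable (raw)]:
  assumes [measurable]: "f \<in> borel_measurable M" "g \<in> measurable M borel"
  shows "(\<lambda>z. heat (f z) (g z)) \<in> borel_measurable M"
  unfolding heat_def by measurable

lemma heat_measurable1 [measurable]: "heat t \<in> borel_measurable borel"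
  using heat_measurable[of "\<lambda>_. t" borel "\<lambda>x. x"] by simp

lemma heat_diff_measurable [measurable (raw)]:
  assumes [measurable]: "f \<in> borel_measurable M" "g \<in> borel_measurable M" "h \<in> measurable M borel"
  shows "(\<lambda>z. heat_diff (f z) (g z) (h z)) \<in> borel_measurable M"
  unfolding heat_diff_def by measurable

lemma heat_diff_measurable1 [measurable]: "heat_diff s t \<in> borel_measurable borel"
  using heat_diff_measurable[of "\<lambda>_. s" borel "\<lambda>_. t" "\<lambda>x. x"] by simp

lemma riesz_measurable [measurable]: "riesz \<in> borel_measurable borel"
  unfolding riesz_def by measurable

lemma kern_measurable [measurable (raw)]:
  assumes [measurable]: "f \<in> borel_measurable M" "g \<in> measurable M borel"
  shows "(\<lambda>z. kern (f z) (g z)) \<in> borel_measurable M"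
  unfolding kern_def by measurable

lemma kern_measurable1 [measurable]: "kern t \<in> borel_measurable borel"
  using kern_measurable[of "\<lambda>_. t" borel "\<lambda>x. x"] by simp

lemma kern_diff_measurable [measurable (raw)]:
  assumes [measurable]: "f \<in> borel_measurable M" "g \<in> borel_measurable M" "h \<in> measurable M borel"
  shows "(\<lambda>z. kern_diff (f z) (g z) (h z)) \<in> borel_measurable M"
  unfolding kern_diff_def by measurable

lemma kern_diff_measurable1 [measurable]: "kern_diff s t \<in> borel_measurable borel"
  using kern_diff_measurable[of "\<lambda>_. s" borel "\<lambda>_. t" "\<lambda>x. x"] by simp

lemma riesz_const_pos: "0 < riesz_const DIM('a) \<alpha>"
  unfolding riesz_const_def using alpha
  by (intro divide_pos_pos mult_pos_pos Gamma_real_pos) auto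

lemma heat_real_nonneg: "0 \<le> heat_real t x"
  using stable_kernel_nonneg[OF beta, where 'a='a] by (simp add: heat_real_def)

lemma nn_integral_heat: "0 < t \<Longrightarrow> (\<integral>\<^sup>+x. heat t x \<partial>lborel) = 1"
  using nn_integral_stable_kernel[OF beta, where 'a='a] by (simp add: heat_def heat_real_def)

lemma nn_integral_heat_le: "(\<integral>\<^sup>+x. heat t x \<partial>lborel) \<le> 1"
  using nn_integral_heat[of t] by (cases "0 < t") (auto simp: heat_def heat_real_def)

lemma heat_le: "0 < t \<Longrightarrow> heat t x \<le> ennreal (stable_kernel \<beta> 1 (0::'a) * t powr (- n / \<beta>))"
  using kernel_bounded_time[OF beta(1), of t x] by (simp add: heat_def heat_real_def ennreal_leI)

lemma stable_kernel_0_nonneg: "0 \<le> stable_kernel \<beta> 1 (0::'a)"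
  by (rule stable_kernel_nonneg[OF beta]) simp

lemma Lnorm_heat_le:
  assumes b: "1 < b" and t: "0 < t"
  shows "Lnorm lborel b (heat t) \<le> ennreal (stable_kernel \<beta> 1 (0::'a) powr (1 - 1 / b) * t powr (- n / \<beta> * (1 - 1 / b)))"
proof -
  have "Lnorm lborel b (heat t) \<le> epow (ennreal (stable_kernel \<beta> 1 (0::'a) * t powr (- n / \<beta>))) (1 - 1 / b) * epow (\<integral>\<^sup>+x. heat t x \<partial>lborel) (1 / b)"
    by (rule Lnorm_le_bounded) (use b heat_le[OF t] in auto)
  also have "\<dots> = ennreal (stable_kernel \<beta> 1 (0::'a) powr (1 - 1 / b) * t powr (- n / \<beta> * (1 - 1 / b)))"
    using stable_kernel_0_nonneg t by (simp add: nn_integral_heat powr_mult powr_powr)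
  finally show ?thesis .
qed

text \<open>The Riesz kernel itself lies in no Lebesgue space. Its part near the origin is
  integrable, and its far part lies in the spaces with exponent above
  \<open>n / (n - \<alpha>)\<close>.\<close>

definition riesz_near :: "real \<Rightarrow> 'a \<Rightarrow> ennreal" where
  "riesz_near \<rho> x = indicator {x. norm x \<le> \<rho>} x * riesz x"

definition riesz_far :: "real \<Rightarrow> 'a \<Rightarrow> ennreal" where
  "riesz_far \<rho> x = indicator {x. \<rho> < norm x} x * riesz x"

lemma riesz_parts_measurable [measurable]:
  "riesz_near \<rho> \<in> borel_measurable borel" "riesz_far \<rho> \<in> borel_measurable borel"
  unfolding riesz_near_def riesz_far_def by measurable

lemma riesz_split: "riesz = (\<lambda>x. riesz_near \<rho> x + riesz_far \<rho> x)"
  by (auto simp: riesz_near_def riesz_far_def indicator_def)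

lemma riesz_eq: "riesz x = ennreal (riesz_const DIM('a) \<alpha>) * ennreal (norm x powr - (n - \<alpha>))"
  using riesz_const_pos by (simp add: riesz_def powr_minus[symmetric] ennreal_mult'[symmetric] divide_inverse)

lemma nn_integral_riesz_near:
  obtains C where "0 \<le> C" "\<And>\<rho>. 0 < \<rho> \<Longrightarrow> (\<integral>\<^sup>+x. riesz_near \<rho> x \<partial>lborel) \<le> ennreal (C * \<rho> powr \<alpha>)"
proof
  let ?A = "riesz_const DIM('a) \<alpha>" and ?V = "unit_ball_vol n"
  let ?D = "(n - \<alpha>) * ?V / (n - (n - \<alpha>)) + ?V"
  have D: "0 \<le> ?D" using alpha by simp
  show "0 \<le> ?A * ?D" using riesz_const_pos D by simp
  fix \<rho> :: real assume \<rho>: "0 < \<rho>"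
  have "(\<integral>\<^sup>+x. riesz_near \<rho> x \<partial>lborel) = ennreal ?A * (\<integral>\<^sup>+(x::'a). indicator {x. norm x \<le> \<rho>} x * ennreal (norm x powr - (n - \<alpha>)) \<partial>lborel)"
    unfolding riesz_near_def riesz_eq by (subst nn_integral_cmult[symmetric]) (auto simp: mult_ac)
  also have "\<dots> \<le> ennreal ?A * ennreal (?D * \<rho> powr (n - (n - \<alpha>)))"
    by (intro mult_left_mono norm_powr_inside) (use alpha \<rho> in auto)
  also have "\<dots> = ennreal (?A * ?D * \<rho> powr \<alpha>)"
    using riesz_const_pos D by (simp add: ennreal_mult'[symmetric] mult.assoc)
  finally show "(\<integral>\<^sup>+x. riesz_near \<rho> x \<partial>lborel) \<le> ennreal (?A * ?D * \<rho> powr \<alpha>)" .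
qed

lemma Lnorm_riesz_far:
  assumes b: "n / (n - \<alpha>) < b"
  obtains C where "0 \<le> C" "\<And>\<rho>. 0 < \<rho> \<Longrightarrow> Lnorm lborel b (riesz_far \<rho>) \<le> ennreal (C * \<rho> powr (n / b - (n - \<alpha>)))"
proof -
  let ?A = "riesz_const DIM('a) \<alpha>" and ?V = "unit_ball_vol n" and ?g = "(n - \<alpha>) * b"
  define Dc where "Dc = ?g * ?V / (?g - n)"
  have g: "n < ?g" using b alpha by (simp add: divide_less_eq mult.commute)
  have b0: "0 < b" using b alpha by (meson divide_pos_pos diff_gt_0_iff_gt less_trans n_pos)
  have g0: "0 \<le> ?g" using g n_pos by linarith
  have D: "0 \<le> Dc" unfolding Dc_def
    by (intro divide_nonneg_nonneg mult_nonneg_nonneg g0 unit_ball_vol_nonneg) (use g n_pos in linarith)+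
  have A0: "0 \<le> ?A * Dc powr (1 / b)" using riesz_const_pos by simp
  have "Lnorm lborel b (riesz_far \<rho>) \<le> ennreal (?A * Dc powr (1 / b) * \<rho> powr (n / b - (n - \<alpha>)))" if \<rho>: "0 < \<rho>" for \<rho>
  proof -
  have "Lnorm lborel b (riesz_far \<rho>) = Lnorm lborel b (\<lambda>x::'a. ennreal ?A * (indicator {x. \<rho> < norm x} x * ennreal (norm x powr - (n - \<alpha>))))"
    unfolding riesz_far_def riesz_eq by (simp add: mult_ac)
  also have "\<dots> = ennreal ?A * Lnorm lborel b (\<lambda>x::'a. indicator {x. \<rho> < norm x} x * ennreal (norm x powr - (n - \<alpha>)))"
    by (rule Lnorm_cmult) (use b0 in auto)
  also have "\<dots> \<le> ennreal ?A * ennreal ((Dc * \<rho> powr (n - ?g)) powr (1 / b))"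
  proof (intro mult_left_mono)
    have e: "(\<alpha> - n) * b = - ((n - \<alpha>) * b)" by (simp add: algebra_simps)
    have "(\<integral>\<^sup>+(x::'a). epow (indicator {x. \<rho> < norm x} x * ennreal (norm x powr - (n - \<alpha>))) b \<partial>lborel)
       = (\<integral>\<^sup>+(x::'a). indicator {x. \<rho> < norm x} x * ennreal (norm x powr - ?g) \<partial>lborel)"
      by (intro nn_integral_cong) (auto simp: indicator_def powr_powr e)
    also have "\<dots> \<le> ennreal (Dc * \<rho> powr (n - ?g))"
      unfolding Dc_def by (rule norm_powr_outside[OF g \<rho>])
    finally show "Lnorm lborel b (\<lambda>x::'a. indicator {x. \<rho> < norm x} x * ennreal (norm x powr - (n - \<alpha>))) \<le> ennreal ((Dc * \<rho> powr (n - ?g)) powr (1 / b))"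
      using b0 D by (simp add: Lnorm_le_iff powr_powr)
  qed simp
  also have "\<dots> = ennreal (?A * Dc powr (1 / b) * \<rho> powr ((n - ?g) * (1 / b)))"
    using riesz_const_pos D by (simp add: ennreal_mult'[symmetric] powr_mult powr_powr mult.assoc)
  also have "(n - ?g) * (1 / b) = n / b - (n - \<alpha>)" using b0 by (simp add: field_simps)
  finally show ?thesis .
  qed
  with A0 show ?thesis by (rule that)
qed

lemma b_gt_1: "n / (n - \<alpha>) < b \<Longrightarrow> 1 < b"
  using alpha by (smt (verit) divide_le_eq_1_pos less_divide_eq_1_pos)

text \<open>Young's inequality with the roles exchanged: near the origin the Riesz kernel is the
  integrable factor, far away it is \<open>k\<close>. The radius remains free, to be chosen
  according to the time scale.\<close>

lemma Lnorm_conv_riesz_le: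
  assumes b: "n / (n - \<alpha>) < b" and [measurable]: "k \<in> borel_measurable borel"
  shows "Lnorm lborel b (conv k riesz) \<le> (\<integral>\<^sup>+x. riesz_near \<rho> x \<partial>lborel) * Lnorm lborel b k
    + (\<integral>\<^sup>+x. k x \<partial>lborel) * Lnorm lborel b (riesz_far \<rho>)"
proof -
  have b1: "1 \<le> b" using b_gt_1[OF b] by simp
  have "conv k riesz = (\<lambda>x. conv (riesz_near \<rho>) k x + conv k (riesz_far \<rho>) x)"
    by (subst riesz_split[of \<rho>]) (auto simp: conv_add_right conv_commute[of k "riesz_near \<rho>"])
  then have "Lnorm lborel b (conv k riesz) = Lnorm lborel b (\<lambda>x. conv (riesz_near \<rho>) k x + conv k (riesz_far \<rho>) x)"
    by simp
  also have "\<dots> \<le> Lnorm lborel b (conv (riesz_near \<rho>) k) + Lnorm lborel b (conv k (riesz_far \<rho>))"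
    by (rule Lnorm_triangle) (use b1 in \<open>auto intro: sigma_finite_lborel\<close>)
  also have "\<dots> \<le> (\<integral>\<^sup>+x. riesz_near \<rho> x \<partial>lborel) * Lnorm lborel b k
    + (\<integral>\<^sup>+x. k x \<partial>lborel) * Lnorm lborel b (riesz_far \<rho>)"
    by (intro add_mono Lnorm_conv_L1 b1) auto
  finally show ?thesis .
qed

text \<open>The singularity in time of the composed operator from exponent \<open>a\<close> to
  infinity: \<open>n / (a * \<beta>)\<close> is the price of the heat semigroup, and
  \<open>\<alpha> / \<beta>\<close> is gained from the Riesz potential.\<close>

definition \<theta> :: "real \<Rightarrow> real" where
  "\<theta> a = (n / a - \<alpha>) / \<beta>"

text \<open>Splitting the Riesz kernel at \<open>\<bar>x\<bar> = t\<^sup>1\<^sup>/\<^sup>\<beta>\<close> gives the decay rate dictated by scaling. The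
  exponent \<open>b\<close> is the conjugate of \<open>a\<close>.\<close>

lemma Lnorm_kern:
  assumes a: "1 < a" "\<alpha> / n < 1 / a" and b: "1 / b = 1 - 1 / a"
  obtains C where "0 < C" "\<And>t. 0 < t \<Longrightarrow> Lnorm lborel b (kern t) \<le> ennreal (C * t powr (- \<theta> a))"
proof -
  have "0 < 1 / b" using a b by simp
  then have b0: "0 < b" by simp
  have "1 / b < (n - \<alpha>) / n" using a b alpha by (simp add: diff_divide_distrib)
  then have bn: "n / (n - \<alpha>) < b" using b0 alpha by (simp add: field_simps)
  have b1: "1 < b" by (rule b_gt_1[OF bn])
  obtain C1 where C1: "0 \<le> C1" "\<And>\<rho>. 0 < \<rho> \<Longrightarrow> (\<integral>\<^sup>+x. riesz_near \<rho> x \<partial>lborel) \<le> ennreal (C1 * \<rho> powr \<alpha>)"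
    using nn_integral_riesz_near by blast
  obtain C2 where C2: "0 \<le> C2" "\<And>\<rho>. 0 < \<rho> \<Longrightarrow> Lnorm lborel b (riesz_far \<rho>) \<le> ennreal (C2 * \<rho> powr (n / b - (n - \<alpha>)))"
    using Lnorm_riesz_far[OF bn] by blast
  define S where "S = stable_kernel \<beta> 1 (0::'a) powr (1 - 1 / b)"
  have S: "0 \<le> S" by (simp add: S_def)
  \<comment> \<open>The added 1 makes the constant strictly positive.\<close>
  have main: "Lnorm lborel b (kern t) \<le> ennreal ((C1 * S + C2 + 1) * t powr (- \<theta> a))" if t: "0 < t" for t
  proof -
    let ?\<rho> = "t powr (1 / \<beta>)"
    have \<rho>: "0 < ?\<rho>" using t by simp
    have "Lnorm lborel b (kern t) \<le> (\<integral>\<^sup>+x. riesz_near ?\<rho> x \<partial>lborel) * Lnorm lborel b (heat t)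
      + (\<integral>\<^sup>+x. heat t x \<partial>lborel) * Lnorm lborel b (riesz_far ?\<rho>)"
      unfolding kern_def by (rule Lnorm_conv_riesz_le[OF bn]) auto
    also have "\<dots> \<le> ennreal (C1 * ?\<rho> powr \<alpha>) * ennreal (S * t powr (- n / \<beta> * (1 - 1 / b)))
      + 1 * ennreal (C2 * ?\<rho> powr (n / b - (n - \<alpha>)))"
      unfolding S_def by (intro add_mono mult_mono C1 C2 \<rho> Lnorm_heat_le[OF b1 t] nn_integral_heat_le) auto
    also have "\<dots> = ennreal (C1 * S * (?\<rho> powr \<alpha> * t powr (- n / \<beta> * (1 - 1 / b))) + C2 * ?\<rho> powr (n / b - (n - \<alpha>)))"
      using C1(1) C2(1) S by (simp add: ennreal_mult'[symmetric] mult_ac)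
    also have "?\<rho> powr \<alpha> * t powr (- n / \<beta> * (1 - 1 / b)) = t powr (- \<theta> a)"
    proof -
      have "1 / \<beta> * \<alpha> + - n / \<beta> * (1 - 1 / b) = - \<theta> a"
        unfolding \<theta>_def b using beta a by (simp add: field_simps)
      then show ?thesis unfolding powr_powr powr_add[symmetric] by simp
    qed
    also have "?\<rho> powr (n / b - (n - \<alpha>)) = t powr (- \<theta> a)"
    proof -
      have nb: "n / b = n * (1 - 1 / a)" using b by (metis times_divide_eq_right mult.right_neutral)
      have "1 / \<beta> * (n / b - (n - \<alpha>)) = - \<theta> a"
        unfolding \<theta>_def nb using beta a by (simp add: field_simps)
      then show ?thesis unfolding powr_powr by simp
    qed
    also have "C1 * S * t powr (- \<theta> a) + C2 * t powr (- \<theta> a) \<le> (C1 * S + C2 + 1) * t powr (- \<theta> a)"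
      by (simp add: algebra_simps)
    finally show ?thesis by (simp add: ennreal_leI)
  qed
  show ?thesis
    by (rule that[of "C1 * S + C2 + 1"]) (use C1 C2 S main in \<open>auto intro: add_nonneg_pos\<close>)
qed

lemma heat_diff_le: "heat_diff s t x \<le> heat s x + heat t x"
  unfolding heat_diff_def heat_def
  using heat_real_nonneg[of s x] heat_real_nonneg[of t x]
  by (simp add: ennreal_plus[symmetric] ennreal_leI del: ennreal_plus)

lemma kern_diff_le: "kern_diff s t x \<le> kern s x + kern t x"
proof -
  have "kern_diff s t x \<le> conv (\<lambda>x. heat s x + heat t x) riesz x"
    unfolding kern_diff_def by (intro conv_mono heat_diff_le) auto
  then show ?thesis by (simp add: kern_def conv_add_left)
qed

lemma heat_le_heat_diff: "heat s x \<le> heat t x + heat_diff s t x"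
  unfolding heat_diff_def heat_def
  using heat_real_nonneg[of s x] heat_real_nonneg[of t x]
  by (simp add: ennreal_plus[symmetric] ennreal_leI del: ennreal_plus)

lemma kern_le_kern_diff: "kern s x \<le> kern t x + kern_diff s t x"
proof -
  have "kern s x \<le> conv (\<lambda>x. heat t x + heat_diff s t x) riesz x"
    unfolding kern_def by (intro conv_mono heat_le_heat_diff) auto
  then show ?thesis by (simp add: kern_def kern_diff_def conv_add_left)
qed

lemma heat_diff_commute: "heat_diff s t = heat_diff t s"
  by (simp add: heat_diff_def fun_eq_iff abs_minus_commute)

lemma kern_diff_commute: "kern_diff s t = kern_diff t s"
  by (simp add: kern_diff_def heat_diff_commute)

lemma heat_diff_L1_tendsto:
  assumes r: "r \<longlonglongrightarrow> t" "\<And>k. 0 < r k" "0 < t"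
  shows "(\<lambda>k. \<integral>\<^sup>+x. heat_diff (r k) t x \<partial>lborel) \<longlonglongrightarrow> 0"
  using stable_kernel_L1_continuous[OF beta r, where 'a='a] r(2,3)
  by (simp add: heat_diff_def heat_real_def)

text \<open>Mean convergence of the heat kernels is upgraded to exponent \<open>b\<close> by a
  uniform bound, which is available because the times eventually stay above \<open>t / 2\<close>.
  The Riesz kernel can be split at the fixed radius 1.\<close>

lemma Lnorm_kern_diff_tendsto:
  assumes b: "n / (n - \<alpha>) < b" and r: "r \<longlonglongrightarrow> t" "\<And>k. 0 < r k" "0 < t"
  shows "(\<lambda>k. Lnorm lborel b (kern_diff (r k) t)) \<longlonglongrightarrow> 0"
proof -
  have b1: "1 < b" by (rule b_gt_1[OF b])
  let ?d = "\<lambda>k. \<integral>\<^sup>+x. heat_diff (r k) t x \<partial>lborel"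
  have d: "?d \<longlonglongrightarrow> 0" by (rule heat_diff_L1_tendsto[OF r])
  \<comment> \<open>Both heat kernels are bounded by the maximal value at time \<open>t / 2\<close>,
    hence the factor 2.\<close>
  define M where "M = 2 * ennreal (stable_kernel \<beta> 1 (0::'a) * (t / 2) powr (- n / \<beta>))"
  have M: "M < top" by (simp add: M_def ennreal_mult_less_top)
  obtain C1 where C1: "0 \<le> C1" "\<And>\<rho>. 0 < \<rho> \<Longrightarrow> (\<integral>\<^sup>+x. riesz_near \<rho> x \<partial>lborel) \<le> ennreal (C1 * \<rho> powr \<alpha>)"
    using nn_integral_riesz_near by blast
  obtain C2 where C2: "0 \<le> C2" "\<And>\<rho>. 0 < \<rho> \<Longrightarrow> Lnorm lborel b (riesz_far \<rho>) \<le> ennreal (C2 * \<rho> powr (n / b - (n - \<alpha>)))"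
    using Lnorm_riesz_far[OF b] by blast
  define K where "K = ennreal C1 * epow M (1 - 1 / b)"
  have K: "K < top" using M by (simp add: K_def ennreal_mult_less_top)
  have "(\<lambda>k. K * epow (?d k) (1 / b) + ennreal C2 * ?d k) \<longlonglongrightarrow> 0 + 0"
    using b1 K by (intro tendsto_add tendsto_0_ennreal_cmult tendsto_0_epow d) auto
  then have lim: "(\<lambda>k. K * epow (?d k) (1 / b) + ennreal C2 * ?d k) \<longlonglongrightarrow> 0" by simp
  show ?thesis
  proof (rule tendsto_0_ennreal_le[OF lim])
    have "\<forall>\<^sub>F k in sequentially. t / 2 < r k"
      using order_tendstoD(1)[OF r(1), of "t / 2"] r(3) by simp
    then show "\<forall>\<^sub>F k in sequentially. Lnorm lborel b (kern_diff (r k) t) \<le> K * epow (?d k) (1 / b) + ennreal C2 * ?d k"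
    proof (rule eventually_mono)
      fix k assume k: "t / 2 < r k"
      have hb: "heat s x \<le> ennreal (stable_kernel \<beta> 1 (0::'a) * (t / 2) powr (- n / \<beta>))" if "t / 2 \<le> s" for s :: real and x
      proof -
        have "0 < s" using that r(3) by simp
        then have "heat s x \<le> ennreal (stable_kernel \<beta> 1 (0::'a) * s powr (- n / \<beta>))" by (rule heat_le)
        also have "\<dots> \<le> ennreal (stable_kernel \<beta> 1 (0::'a) * (t / 2) powr (- n / \<beta>))"
          using that r(3) beta stable_kernel_0_nonneg n_pos
          by (intro ennreal_leI mult_left_mono powr_mono2') auto
        finally show ?thesis .
      qed
      have "heat_diff (r k) t x \<le> M" for x
      proof -
        have "heat_diff (r k) t x \<le> heat (r k) x + heat t x" by (rule heat_diff_le)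
        also have "\<dots> \<le> M" unfolding M_def mult_2 using k r(3) by (intro add_mono hb) auto
        finally show ?thesis .
      qed
      then have N: "Lnorm lborel b (heat_diff (r k) t) \<le> epow M (1 - 1 / b) * epow (?d k) (1 / b)"
        by (intro Lnorm_le_bounded b1) auto
      have "Lnorm lborel b (kern_diff (r k) t) \<le> (\<integral>\<^sup>+x. riesz_near 1 x \<partial>lborel) * Lnorm lborel b (heat_diff (r k) t)
        + ?d k * Lnorm lborel b (riesz_far 1)"
        unfolding kern_diff_def by (rule Lnorm_conv_riesz_le[OF b]) auto
      also have "\<dots> \<le> ennreal C1 * (epow M (1 - 1 / b) * epow (?d k) (1 / b)) + ?d k * ennreal C2"
        using C1(2)[of 1] C2(2)[of 1] by (intro add_mono mult_mono N) auto
      finally show "Lnorm lborel b (kern_diff (r k) t) \<le> K * epow (?d k) (1 / b) + ennreal C2 * ?d k"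
        by (simp add: K_def mult_ac)
    qed
  qed
qed

text \<open>Half of the mass of the heat kernel sits in a ball of radius comparable to \<open>t\<^sup>1\<^sup>/\<^sup>\<beta>\<close>.\<close>

lemma kern_lower_bound:
  obtains c R where "0 < c" "0 < R"
    "\<And>t x. 0 < t \<Longrightarrow> ennreal (c * (norm x + R * t powr (1 / \<beta>)) powr (- (n - \<alpha>))) \<le> kern t x"
proof -
  let ?A = "riesz_const DIM('a) \<alpha>"
  have [measurable]: "cball (0::'a) r \<in> sets borel" for r by simp
  \<comment> \<open>Balls of growing radius exhaust the unit mass at time 1, so that one of them
    carries more than half of it.\<close>
  have "(SUP k::nat. \<integral>\<^sup>+x. heat 1 x * indicator (cball 0 (real k)) x \<partial>lborel) = (\<integral>\<^sup>+x. (SUP k::nat. heat 1 x * indicator (cball 0 (real k)) x) \<partial>lborel)"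
    by (intro nn_integral_monotone_convergence_SUP[symmetric])
       (auto simp: incseq_def le_fun_def indicator_def)
  also have "\<dots> = (\<integral>\<^sup>+x. heat 1 x \<partial>lborel)"
  proof (intro nn_integral_cong antisym SUP_least)
    fix x :: 'a and k :: nat
    show "heat 1 x * indicator (cball 0 (real k)) x \<le> heat 1 x" by (simp add: indicator_def)
    obtain j :: nat where "norm x \<le> real j" using real_arch_simple by blast
    then have "heat 1 x = heat 1 x * indicator (cball 0 (real j)) x" by simp
    also have "\<dots> \<le> (SUP k::nat. heat 1 x * indicator (cball 0 (real k)) x)" by (rule SUP_upper) simp
    finally show "heat 1 x \<le> (SUP k::nat. heat 1 x * indicator (cball 0 (real k)) x)" .
  qed
  also have "\<dots> = 1" by (simp add: nn_integral_heat)
  finally have S: "(SUP k::nat. \<integral>\<^sup>+x. heat 1 x * indicator (cball 0 (real k)) x \<partial>lborel) = 1" .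
  have "\<exists>k::nat. ennreal (1 / 2) < (\<integral>\<^sup>+x. heat 1 x * indicator (cball 0 (real k)) x \<partial>lborel)"
  proof (rule ccontr)
    assume "\<not> ?thesis"
    then have "(SUP k::nat. \<integral>\<^sup>+x. heat 1 x * indicator (cball 0 (real k)) x \<partial>lborel) \<le> ennreal (1 / 2)"
      by (intro SUP_least) (auto simp: not_less)
    then have "ennreal 1 \<le> ennreal (1 / 2)" unfolding S by simp
    then show False by (simp only: ennreal_le_iff2) auto
  qed
  then obtain k :: nat where k: "ennreal (1 / 2) < (\<integral>\<^sup>+x. heat 1 x * indicator (cball 0 (real k)) x \<partial>lborel)" by blast
  define R where "R = real k + 1"
  have R: "0 < R" by (simp add: R_def)
  have half: "ennreal (1 / 2) \<le> (\<integral>\<^sup>+x. heat 1 x * indicator (cball 0 R) x \<partial>lborel)"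
  proof -
    have "(\<integral>\<^sup>+x. heat 1 x * indicator (cball 0 (real k)) x \<partial>lborel) \<le> (\<integral>\<^sup>+x. heat 1 x * indicator (cball 0 R) x \<partial>lborel)"
      by (intro nn_integral_mono) (auto simp: indicator_def R_def)
    then show ?thesis using k by simp
  qed
  show ?thesis
  proof (rule that[of "?A / 2" R])
    show "0 < ?A / 2" using riesz_const_pos by simp
    show "0 < R" by fact
    fix t :: real and x :: 'a assume t: "0 < t"
    let ?\<rho> = "t powr (1 / \<beta>)"
    have \<rho>: "0 < ?\<rho>" using t by simp
    \<comment> \<open>By scaling, the mass in the ball of radius
      \<open>R * t powr (1 / \<beta>)\<close> does not depend on \<open>t\<close>.\<close>
    have mass: "(\<integral>\<^sup>+x. heat t x * indicator (cball 0 (R * ?\<rho>)) x \<partial>lborel) = (\<integral>\<^sup>+x. heat 1 x * indicator (cball 0 R) x \<partial>lborel)"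
    proof -
      have "(\<integral>\<^sup>+x. heat t x * indicator (cball 0 (R * ?\<rho>)) x \<partial>lborel)
        = ennreal (\<bar>?\<rho>\<bar> ^ DIM('a)) * (\<integral>\<^sup>+x. heat t (0 + ?\<rho> *\<^sub>R x) * indicator (cball 0 (R * ?\<rho>)) (0 + ?\<rho> *\<^sub>R x) \<partial>lborel)"
        by (rule nn_integral_affine) (use \<rho> in auto)
      also have "\<dots> = (\<integral>\<^sup>+x. ennreal (\<bar>?\<rho>\<bar> ^ DIM('a)) * (heat t (0 + ?\<rho> *\<^sub>R x) * indicator (cball 0 (R * ?\<rho>)) (0 + ?\<rho> *\<^sub>R x)) \<partial>lborel)"
        by (rule nn_integral_cmult[symmetric]) simp
      also have "\<dots> = (\<integral>\<^sup>+x. heat 1 x * indicator (cball 0 R) x \<partial>lborel)"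
      proof (rule nn_integral_cong)
        fix x :: 'a
        have "indicator (cball 0 (R * ?\<rho>)) (0 + ?\<rho> *\<^sub>R x) = (indicator (cball 0 R) x :: ennreal)"
          using \<rho> by (auto simp: indicator_def mult.commute)
        moreover have "ennreal (\<bar>?\<rho>\<bar> ^ DIM('a)) * heat t (0 + ?\<rho> *\<^sub>R x) = heat 1 x"
        proof -
          have "t powr (- 1 / \<beta>) *\<^sub>R (?\<rho> *\<^sub>R x) = x"
            using t by (simp add: powr_add[symmetric])
          then have "stable_kernel \<beta> t (?\<rho> *\<^sub>R x) = t powr (- n / \<beta>) * stable_kernel \<beta> 1 x"
            using kernel_scale[OF beta(1) t, of "?\<rho> *\<^sub>R x"] by simp
          moreover have "\<bar>?\<rho>\<bar> ^ DIM('a) = t powr (n / \<beta>)"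
            using \<rho> t by (simp add: powr_realpow[symmetric] powr_powr)
          moreover have "t powr (n / \<beta>) * t powr (- n / \<beta>) = 1"
            unfolding powr_add[symmetric] using t by simp
          ultimately have "\<bar>?\<rho>\<bar> ^ DIM('a) * stable_kernel \<beta> t (?\<rho> *\<^sub>R x) = stable_kernel \<beta> 1 x"
            by (simp only: mult.assoc[symmetric] mult_1_left)
          then show ?thesis
            using t by (simp add: heat_def heat_real_def ennreal_mult'[symmetric])
        qed
        ultimately show "ennreal (\<bar>?\<rho>\<bar> ^ DIM('a)) * (heat t (0 + ?\<rho> *\<^sub>R x) * indicator (cball 0 (R * ?\<rho>)) (0 + ?\<rho> *\<^sub>R x))
          = heat 1 x * indicator (cball 0 R) x"
          by (simp add: mult.assoc[symmetric])
      qed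
      finally show ?thesis .
    qed
    let ?m = "(norm x + R * ?\<rho>) powr (- (n - \<alpha>))"
    have "ennreal (?A / 2 * ?m) = ennreal ((?A * ?m) * (1 / 2))" by (simp add: mult_ac)
    also have "\<dots> = ennreal (?A * ?m) * ennreal (1 / 2)"
      using riesz_const_pos by (intro ennreal_mult) auto
    also have "\<dots> \<le> ennreal (?A * ?m) * (\<integral>\<^sup>+y. heat t y * indicator (cball 0 (R * ?\<rho>)) y \<partial>lborel)"
      unfolding mass by (intro mult_left_mono half) auto
    also have "\<dots> = (\<integral>\<^sup>+y. ennreal (?A * ?m) * (heat t y * indicator (cball 0 (R * ?\<rho>)) y) \<partial>lborel)"
      by (simp add: nn_integral_cmult)
    also have "\<dots> \<le> (\<integral>\<^sup>+y. riesz (x - y) * heat t y \<partial>lborel)"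
    proof (rule nn_integral_mono_AE)
      \<comment> \<open>At \<open>y = x\<close> the value of \<open>riesz\<close> is 0 because
        division by zero yields 0. The lower bound fails at this point, and it is discarded as a
        null set.\<close>
      have "AE y in lborel. y \<noteq> x" by (rule AE_lborel_singleton)
      then show "AE y in lborel. ennreal (?A * ?m) * (heat t y * indicator (cball 0 (R * ?\<rho>)) y) \<le> riesz (x - y) * heat t y"
      proof (rule eventually_mono)
        fix y assume y: "y \<noteq> x"
        show "ennreal (?A * ?m) * (heat t y * indicator (cball 0 (R * ?\<rho>)) y) \<le> riesz (x - y) * heat t y"
        proof (cases "norm y \<le> R * ?\<rho>")
          case True
          have "norm (x - y) \<le> norm x + R * ?\<rho>" using True norm_triangle_ineq4[of x y] by linarith
          moreover have "0 < norm (x - y)" using y by simp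
          ultimately have "?m \<le> norm (x - y) powr (- (n - \<alpha>))"
            using alpha by (intro powr_mono2') auto
          then have "ennreal (?A * ?m) \<le> riesz (x - y)"
            unfolding riesz_eq using riesz_const_pos by (simp add: ennreal_mult'[symmetric] ennreal_leI mult_left_mono)
          then show ?thesis using True by (simp add: mult_right_mono)
        qed simp
      qed
    qed
    also have "\<dots> = kern t x" unfolding kern_def by (subst conv_commute) (auto simp: conv_def)
    finally show "ennreal (?A / 2 * ?m) \<le> kern t x" .
  qed
qed

end

section \<open>The Duhamel operator\<close>

text \<open>Convexity: \<open>x + h\<close> and \<open>X\<close> are the convex combinations of
  \<open>x\<close> and \<open>X + h\<close> with complementary weights. Adding the two convexity
  inequalities gives the claim.\<close>

lemma powr_increment_mono:
  fixes x X h p :: real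
  assumes "1 \<le> p" "0 \<le> x" "x \<le> X" "0 \<le> h"
  shows "(x + h) powr p - x powr p \<le> (X + h) powr p - X powr p"
proof (cases "x = 0 \<or> X - x + h = 0")
  case True
  then show ?thesis
  proof
    assume "x = 0"
    then show ?thesis using powr_superadditive[of h X p] assms by (simp add: add.commute)
  next
    assume "X - x + h = 0"
    then have "h = 0" "X = x" using assms by linarith+
    then show ?thesis by simp
  qed
next
  case False
  define l where "l = h / (X - x + h)"
  have d: "0 < X - x + h" "0 < x" using False assms by auto
  have l: "0 \<le> l" "l \<le> 1" using assms d by (auto simp: l_def field_simps)
  have e: "l * (X - x + h) = h" using d by (simp add: l_def)
  have e1: "(1 - l) * x + l * (X + h) = x + h" using e by (simp add: algebra_simps)
  have e2: "(1 - (1 - l)) * x + (1 - l) * (X + h) = X" using e by (simp add: algebra_simps)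
  have c: "convex_on {0<..} (\<lambda>x. x powr p)" using assms by (intro powr_convex)
  have "(x + h) powr p \<le> (1 - l) * x powr p + l * (X + h) powr p"
    using convex_onD[OF c l, of x "X + h"] d assms e1 by simp
  moreover have "X powr p \<le> (1 - (1 - l)) * x powr p + (1 - l) * (X + h) powr p"
    using convex_onD[OF c, of "1 - l" x "X + h"] l d assms e2 by simp
  ultimately show ?thesis by (simp add: algebra_simps)
qed

text \<open>An increment of the convex power grows with its starting point, so it is largest when it
  starts at the majorant \<open>B\<close>. This is the scalar form of the majorant
  principle.\<close>

lemma abs_powr_diff_le:
  fixes a b A B p :: real
  assumes p: "1 \<le> p" and b: "\<bar>b\<bar> \<le> B" and ab: "\<bar>a - b\<bar> \<le> A - B"
  shows "\<bar>\<bar>a\<bar> powr p - \<bar>b\<bar> powr p\<bar> \<le> A powr p - B powr p"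
proof -
  let ?h = "A - B"
  have h: "0 \<le> ?h" "0 \<le> B" using b ab by linarith+
  have "\<bar>a\<bar> powr p \<le> (\<bar>b\<bar> + ?h) powr p" using p ab by (intro powr_mono2) auto
  then have 1: "\<bar>a\<bar> powr p - \<bar>b\<bar> powr p \<le> A powr p - B powr p"
    using powr_increment_mono[of p "\<bar>b\<bar>" B ?h] p b h by simp
  have 2: "\<bar>b\<bar> powr p - \<bar>a\<bar> powr p \<le> A powr p - B powr p"
  proof (cases "\<bar>b\<bar> \<le> \<bar>a\<bar>")
    case True
    then have "\<bar>b\<bar> powr p \<le> \<bar>a\<bar> powr p" using p by (intro powr_mono2) auto
    moreover have "B powr p \<le> A powr p" using p h by (intro powr_mono2) auto
    ultimately show ?thesis by linarith
  next
    case False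
    have "(\<bar>a\<bar> + (\<bar>b\<bar> - \<bar>a\<bar>)) powr p - \<bar>a\<bar> powr p \<le> (B + (\<bar>b\<bar> - \<bar>a\<bar>)) powr p - B powr p"
      using False b p by (intro powr_increment_mono) auto
    moreover have "(B + (\<bar>b\<bar> - \<bar>a\<bar>)) powr p \<le> A powr p"
      using False ab p h by (intro powr_mono2) auto
    ultimately show ?thesis by simp
  qed
  show ?thesis using 1 2 by linarith
qed

text \<open>Written with sums, since subtraction in \<open>ennreal\<close> would lose information
  when the majorants are infinite.\<close>

lemma abs_powr_diff_le_ennreal:
  fixes a b p :: real and A B :: ennreal
  assumes p: "1 \<le> p" and b: "ennreal \<bar>b\<bar> \<le> B" and ab: "ennreal \<bar>a - b\<bar> + B \<le> A"
  shows "ennreal \<bar>\<bar>a\<bar> powr p - \<bar>b\<bar> powr p\<bar> + epow B p \<le> epow A p"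
proof (cases "A = top")
  case False
  then obtain A' where A': "A = ennreal A'" "0 \<le> A'" by (cases A) auto
  have "B \<le> A" using ab by (metis add.commute le_iff_add order_trans)
  then obtain B' where B': "B = ennreal B'" "0 \<le> B'" using A' by (cases B) (auto simp: top_unique)
  have "\<bar>b\<bar> \<le> B'" using b B' by simp
  moreover have "\<bar>a - b\<bar> + B' \<le> A'" using ab A' B' by (simp add: ennreal_plus[symmetric] del: ennreal_plus)
  ultimately have "\<bar>\<bar>a\<bar> powr p - \<bar>b\<bar> powr p\<bar> \<le> A' powr p - B' powr p"
    by (intro abs_powr_diff_le p) auto
  then show ?thesis using A' B' by (simp add: ennreal_plus[symmetric] ennreal_leI del: ennreal_plus)
qed simp

lemma ennreal_abs_integral_le:
  fixes f :: "'a \<Rightarrow> real"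
  shows "ennreal \<bar>\<integral>x. f x \<partial>M\<bar> \<le> (\<integral>\<^sup>+x. ennreal \<bar>f x\<bar> \<partial>M)"
proof (cases "integrable M f")
  case True
  then show ?thesis using integral_norm_bound_ennreal[OF True] by simp
qed (simp add: not_integrable_integral_eq)

lemma ennreal_enn2real_le: "ennreal (enn2real x) \<le> x"
  by (cases x) auto

lemma ennreal_enn2real_diff_le:
  assumes "x \<le> y + z" "y \<le> x + z" "x < top" "y < top"
  shows "ennreal \<bar>enn2real x - enn2real y\<bar> \<le> z"
  using assms by (cases x; cases y; cases z) (auto simp: ennreal_plus[symmetric] ennreal_leI simp del: ennreal_plus)

lemma nn_integral_SUP_mult:
  fixes k :: "'a \<Rightarrow> ennreal"
  assumes [measurable]: "\<And>i::nat. f i \<in> borel_measurable M" "k \<in> borel_measurable M" and "\<And>x. incseq (\<lambda>i. f i x)"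
  shows "(\<integral>\<^sup>+x. k x * (SUP i. f i x) \<partial>M) = (SUP i. \<integral>\<^sup>+x. k x * f i x \<partial>M)"
  unfolding SUP_mult_left_ennreal using assms(3)
  by (intro nn_integral_monotone_convergence_SUP) (auto simp: incseq_def le_fun_def intro!: mult_left_mono)

context fractional_heat
begin

text \<open>The Duhamel integral up to time \<open>t\<close>: since \<open>kern\<close> vanishes at
  nonpositive times, the upper limit needs no indicator.\<close>

definition duh :: "(real \<Rightarrow> 'a \<Rightarrow> ennreal) \<Rightarrow> real \<Rightarrow> 'a \<Rightarrow> ennreal" where
  "duh f t x = (\<integral>\<^sup>+\<tau>. indicator {0..} \<tau> * conv (kern (t - \<tau>)) (f \<tau>) x \<partial>lborel)"

lemma duh_measurable [measurable (raw)]: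
  assumes [measurable]: "jointly_measurable f"
    "g \<in> borel_measurable M" "h \<in> measurable M borel"
  shows "(\<lambda>z. duh f (g z) (h z)) \<in> borel_measurable M"
  unfolding duh_def by measurable

lemma kern_nonpos: "t \<le> 0 \<Longrightarrow> kern t x = 0"
  by (simp add: kern_def conv_def heat_def heat_real_def)

lemma conv_kern_nonpos: "t \<le> 0 \<Longrightarrow> conv (kern t) f x = 0"
  by (simp add: conv_def kern_nonpos)

lemma duh_mono_AE:
  assumes "\<And>\<tau>. 0 \<le> \<tau> \<Longrightarrow> \<tau> < t \<Longrightarrow> AE y in lborel. f \<tau> y \<le> g \<tau> y"
  shows "duh f t x \<le> duh g t x"
  unfolding duh_def
proof (rule nn_integral_mono)
  fix \<tau> :: real
  show "indicator {0..} \<tau> * conv (kern (t - \<tau>)) (f \<tau>) x \<le> indicator {0..} \<tau> * conv (kern (t - \<tau>)) (g \<tau>) x"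
  proof (cases "0 \<le> \<tau> \<and> \<tau> < t")
    case True
    then show ?thesis using assms by (intro mult_left_mono conv_mono_AE) auto
  next
    case False
    then show ?thesis by (cases "0 \<le> \<tau>") (auto simp: conv_kern_nonpos)
  qed
qed

lemma duh_mono:
  assumes "\<And>\<tau> y. f \<tau> y \<le> g \<tau> y"
  shows "duh f t x \<le> duh g t x"
  using assms by (intro duh_mono_AE) auto

lemma duh_cong_AE:
  assumes "\<And>\<tau>. 0 \<le> \<tau> \<Longrightarrow> \<tau> < t \<Longrightarrow> AE y in lborel. f \<tau> y = g \<tau> y"
  shows "duh f t x = duh g t x"
proof (rule antisym)
  have "AE y in lborel. f \<tau> y \<le> g \<tau> y" "AE y in lborel. g \<tau> y \<le> f \<tau> y" if "0 \<le> \<tau>" "\<tau> < t" for \<tau>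
    using assms[OF that] by (auto elim: eventually_mono)
  then show "duh f t x \<le> duh g t x" "duh g t x \<le> duh f t x"
    by (auto intro: duh_mono_AE)
qed

lemma duh_add:
  assumes [measurable]: "jointly_measurable f" "jointly_measurable g"
  shows "duh (\<lambda>\<tau> y. f \<tau> y + g \<tau> y) t x = duh f t x + duh g t x"
  unfolding duh_def by (subst nn_integral_add[symmetric]) (auto simp: conv_add_right distrib_left intro!: nn_integral_cong)

lemma duh_SUP:
  assumes [measurable]: "\<And>i::nat. jointly_measurable (f i)"
    and inc: "\<And>t x. incseq (\<lambda>i. f i t x)"
  shows "duh (\<lambda>\<tau> y. SUP i. f i \<tau> y) t x = (SUP i. duh (f i) t x)"
proof -
  have "conv (kern s) (\<lambda>y. SUP i. f i \<tau> y) x = (SUP i. conv (kern s) (f i \<tau>) x)" for s \<tau>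
    unfolding conv_def by (rule nn_integral_SUP_mult) (use inc in auto)
  then have "duh (\<lambda>\<tau> y. SUP i. f i \<tau> y) t x = (\<integral>\<^sup>+\<tau>. indicator {0..} \<tau> * (SUP i. conv (kern (t - \<tau>)) (f i \<tau>) x) \<partial>lborel)"
    unfolding duh_def by simp
  also have "\<dots> = (SUP i. duh (f i) t x)"
    unfolding duh_def
  proof (rule nn_integral_SUP_mult)
    show "incseq (\<lambda>i. conv (kern (t - \<tau>)) (f i \<tau>) x)" for \<tau>
      using inc by (auto simp: incseq_def intro!: conv_mono)
  qed measurable
  finally show ?thesis .
qed

text \<open>Time 0 is singled out because \<open>heat 0\<close> is the zero function by convention
  and not a point mass.\<close>

definition hom :: "('a \<Rightarrow> ennreal) \<Rightarrow> real \<Rightarrow> 'a \<Rightarrow> ennreal" where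
  "hom w t x = (if t = 0 then w x else conv (heat t) w x)"

definition hom_real :: "('a \<Rightarrow> real) \<Rightarrow> real \<Rightarrow> 'a \<Rightarrow> real" where
  "hom_real v t x = (if t = 0 then v x else (\<integral>y. heat_real t (x - y) * v y \<partial>lborel))"

lemma hom_measurable [measurable (raw)]:
  assumes [measurable]: "w \<in> borel_measurable borel" "g \<in> borel_measurable M" "h \<in> measurable M borel"
  shows "(\<lambda>z. hom w (g z) (h z)) \<in> borel_measurable M"
  unfolding hom_def by measurable

lemma hom_real_measurable [measurable (raw)]:
  assumes [measurable]: "w \<in> borel_measurable borel" "g \<in> borel_measurable M" "h \<in> measurable M borel"
  shows "(\<lambda>z. hom_real w (g z) (h z)) \<in> borel_measurable M"
  unfolding hom_real_def by measurable

lemma hom_real_le: "ennreal \<bar>hom_real v t x\<bar> \<le> hom (\<lambda>x. ennreal \<bar>v x\<bar>) t x"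
proof (cases "t = 0")
  case False
  have "ennreal \<bar>\<integral>y. heat_real t (x - y) * v y \<partial>lborel\<bar> \<le> (\<integral>\<^sup>+y. ennreal \<bar>heat_real t (x - y) * v y\<bar> \<partial>lborel)"
    by (rule ennreal_abs_integral_le)
  also have "\<dots> = conv (heat t) (\<lambda>x. ennreal \<bar>v x\<bar>) x"
    unfolding conv_def heat_def using heat_real_nonneg by (simp add: abs_mult ennreal_mult')
  finally show ?thesis using False by (simp add: hom_real_def hom_def)
qed (simp add: hom_real_def hom_def)

lemma Lnorm_hom_le:
  assumes [measurable]: "w \<in> borel_measurable borel" and "1 \<le> r"
  shows "Lnorm lborel r (hom w t) \<le> Lnorm lborel r w"
proof (cases "t = 0")
  case False
  have "Lnorm lborel r (conv (heat t) w) \<le> (\<integral>\<^sup>+x. heat t x \<partial>lborel) * Lnorm lborel r w"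
    by (rule Lnorm_conv_L1) (use assms in auto)
  also have "\<dots> \<le> 1 * Lnorm lborel r w" by (intro mult_right_mono nn_integral_heat_le) auto
  finally show ?thesis using False by (simp add: hom_def[abs_def])
qed (simp add: hom_def[abs_def])

lemma hom_le_AE:
  assumes [measurable]: "w \<in> borel_measurable borel" and w: "AE x in lborel. w x \<le> c"
  shows "AE x in lborel. hom w t x \<le> c"
proof (cases "t = 0")
  case False
  have "conv (heat t) w x \<le> c" for x
  proof -
    have "conv (heat t) w x \<le> conv (heat t) (\<lambda>_. c) x" by (rule conv_mono_AE[OF w])
    also have "\<dots> = (\<integral>\<^sup>+y. heat t (x - y) \<partial>lborel) * c" unfolding conv_def by (rule nn_integral_multc) simp
    also have "\<dots> = (\<integral>\<^sup>+y. heat t y \<partial>lborel) * c" by (subst nn_integral_reflect) auto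
    also have "\<dots> \<le> 1 * c" by (intro mult_right_mono nn_integral_heat_le) auto
    finally show ?thesis by simp
  qed
  then show ?thesis using False by (simp add: hom_def)
qed (use w in \<open>simp add: hom_def\<close>)

text \<open>One constant per exponent, fixed by choice, so that \<open>kern_weight\<close> can be
  written as an explicit function of time.\<close>

definition kern_const :: "real \<Rightarrow> real" where
  "kern_const a = (SOME C. 0 < C \<and> (\<forall>t>0. Lnorm lborel (a / (a - 1)) (kern t) \<le> ennreal (C * t powr (- \<theta> a))))"

definition kern_weight :: "real \<Rightarrow> real \<Rightarrow> ennreal" where
  "kern_weight a t = indicator {0<..} t * ennreal (kern_const a * t powr (- \<theta> a))"

lemma kern_weight_measurable [measurable]: "kern_weight a \<in> borel_measurable borel"
  unfolding kern_weight_def by measurable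

text \<open>The lower bound on \<open>1 / a\<close> puts the Riesz kernel, away from its singularity, into the Lebesgue space
  conjugate to \<open>a\<close>; the upper bound makes \<open>t powr (- \<theta> a)\<close> integrable at \<open>t = 0\<close>.\<close>

definition admissible :: "real \<Rightarrow> bool" where
  "admissible a \<longleftrightarrow> 1 < a \<and> \<alpha> / n < 1 / a \<and> 1 / a < (\<alpha> + \<beta>) / n"

lemma conj_exponent: "1 < (a::real) \<Longrightarrow> 1 / (a / (a - 1)) = 1 - 1 / a"
  by (simp add: field_simps)

lemma kern_const:
  assumes "admissible a"
  shows kern_const_pos: "0 < kern_const a"
    and Lnorm_kern_le: "Lnorm lborel (a / (a - 1)) (kern t) \<le> kern_weight a t"
proof -
  have a: "1 < a" "\<alpha> / n < 1 / a" using assms by (auto simp: admissible_def)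
  obtain C where "0 < C" "\<And>t. 0 < t \<Longrightarrow> Lnorm lborel (a / (a - 1)) (kern t) \<le> ennreal (C * t powr (- \<theta> a))"
    using Lnorm_kern[OF a conj_exponent[OF a(1)]] by blast
  then have "\<exists>C. 0 < C \<and> (\<forall>t>0. Lnorm lborel (a / (a - 1)) (kern t) \<le> ennreal (C * t powr (- \<theta> a)))" by blast
  from someI_ex[OF this] have C: "0 < kern_const a"
    "\<And>t. 0 < t \<Longrightarrow> Lnorm lborel (a / (a - 1)) (kern t) \<le> ennreal (kern_const a * t powr (- \<theta> a))"
    unfolding kern_const_def by blast+
  show "0 < kern_const a" by (rule C)
  show "Lnorm lborel (a / (a - 1)) (kern t) \<le> kern_weight a t"
  proof (cases "0 < t")
    case False
    then show ?thesis by (simp add: kern_weight_def Lnorm_def kern_nonpos)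
  qed (use C(2) in \<open>simp add: kern_weight_def\<close>)
qed

lemma theta_bounds:
  assumes "admissible a"
  shows "0 < \<theta> a" "\<theta> a < 1"
proof -
  have ad: "\<alpha> / n < 1 / a" "1 / a < (\<alpha> + \<beta>) / n" using assms by (auto simp: admissible_def)
  have "\<alpha> < n / a" "n / a < \<alpha> + \<beta>"
    using mult_strict_right_mono[OF ad(1) n_pos] mult_strict_right_mono[OF ad(2) n_pos] n_pos by auto
  then have "0 < n / a - \<alpha>" "n / a - \<alpha> < \<beta>" by linarith+
  then show "0 < \<theta> a" "\<theta> a < 1" unfolding \<theta>_def using beta(1) by (auto simp: divide_less_eq_1_pos)
qed

text \<open>Intended for the nonlinearity split as \<open>\<bar>u\<bar>\<close> times its power
  \<open>p - 1\<close>. Once the second factor is bounded in the space with exponent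
  \<open>a\<close>, this is a linear Volterra inequality for the norm of the first.\<close>

lemma Lnorm_duh_le:
  assumes [measurable]: "jointly_measurable w" "jointly_measurable g"
    and a: "admissible a" and s: "0 < s" "1 / s + 1 / a < 1"
  shows "Lnorm lborel s (duh (\<lambda>\<tau> y. w \<tau> y * g \<tau> y) t)
    \<le> (\<integral>\<^sup>+\<tau>. indicator {0..} \<tau> * (kern_weight a (t - \<tau>) * (Lnorm lborel s (w \<tau>) * Lnorm lborel a (g \<tau>))) \<partial>lborel)"
proof -
  have a1: "1 < a" using a by (simp add: admissible_def)
  have "1 / s < 1" using s a1 by (smt (verit) divide_pos_pos)
  then have s1: "1 \<le> s" using s(1) by (simp add: divide_less_eq)
  have "Lnorm lborel s (duh (\<lambda>\<tau> y. w \<tau> y * g \<tau> y) t)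
    \<le> (\<integral>\<^sup>+\<tau>. Lnorm lborel s (\<lambda>x. indicator {0..} \<tau> * conv (kern (t - \<tau>)) (\<lambda>y. w \<tau> y * g \<tau> y) x) \<partial>lborel)"
    unfolding duh_def by (rule Minkowski_integral) (use s1 in \<open>auto intro: sigma_finite_lborel\<close>)
  also have "\<dots> \<le> (\<integral>\<^sup>+\<tau>. indicator {0..} \<tau> * (kern_weight a (t - \<tau>) * (Lnorm lborel s (w \<tau>) * Lnorm lborel a (g \<tau>))) \<partial>lborel)"
  proof (rule nn_integral_mono)
    fix \<tau> :: real
    have "Lnorm lborel s (conv (kern (t - \<tau>)) (\<lambda>y. w \<tau> y * g \<tau> y))
      \<le> Lnorm lborel (a / (a - 1)) (kern (t - \<tau>)) * (Lnorm lborel s (w \<tau>) * Lnorm lborel a (g \<tau>))"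
      by (rule Lnorm_conv_bilinear) (use s a1 conj_exponent[OF a1] in auto)
    also have "\<dots> \<le> kern_weight a (t - \<tau>) * (Lnorm lborel s (w \<tau>) * Lnorm lborel a (g \<tau>))"
      by (intro mult_right_mono Lnorm_kern_le a) auto
    finally show "Lnorm lborel s (\<lambda>x. indicator {0..} \<tau> * conv (kern (t - \<tau>)) (\<lambda>y. w \<tau> y * g \<tau> y) x)
      \<le> indicator {0..} \<tau> * (kern_weight a (t - \<tau>) * (Lnorm lborel s (w \<tau>) * Lnorm lborel a (g \<tau>)))"
      using s by (subst Lnorm_cmult) (auto intro!: mult_left_mono)
  qed
  finally show ?thesis .
qed

text \<open>The counterpart for essential bounds. The weight in time is the same as for the norm
  with exponent \<open>s\<close>, so both norms can be propagated together.\<close>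

lemma duh_le:
  assumes [measurable]: "jointly_measurable w" "jointly_measurable g"
    and a: "admissible a" and W: "\<And>\<tau>. 0 \<le> \<tau> \<Longrightarrow> \<tau> < t \<Longrightarrow> AE y in lborel. w \<tau> y \<le> W \<tau>"
  shows "duh (\<lambda>\<tau> y. w \<tau> y * g \<tau> y) t x
    \<le> (\<integral>\<^sup>+\<tau>. indicator {0..} \<tau> * (kern_weight a (t - \<tau>) * (W \<tau> * Lnorm lborel a (g \<tau>))) \<partial>lborel)"
  unfolding duh_def
proof (rule nn_integral_mono)
  fix \<tau> :: real
  have a1: "1 < a" using a by (simp add: admissible_def)
  show "indicator {0..} \<tau> * conv (kern (t - \<tau>)) (\<lambda>y. w \<tau> y * g \<tau> y) x
    \<le> indicator {0..} \<tau> * (kern_weight a (t - \<tau>) * (W \<tau> * Lnorm lborel a (g \<tau>)))"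
  proof (cases "0 \<le> \<tau> \<and> \<tau> < t")
    case True
    have "conv (kern (t - \<tau>)) (\<lambda>y. w \<tau> y * g \<tau> y) x
      \<le> Lnorm lborel (a / (a - 1)) (kern (t - \<tau>)) * (W \<tau> * Lnorm lborel a (g \<tau>))"
      by (rule conv_bilinear_le) (use True W a1 conj_exponent[OF a1] in auto)
    also have "\<dots> \<le> kern_weight a (t - \<tau>) * (W \<tau> * Lnorm lborel a (g \<tau>))"
      by (intro mult_right_mono Lnorm_kern_le a) auto
    finally show ?thesis by (rule mult_left_mono) simp
  next
    case False
    then show ?thesis by (cases "0 \<le> \<tau>") (auto simp: conv_kern_nonpos)
  qed
qed

end

section \<open>Picard iteration with a majorant\<close>

locale heat_equation = fractional_heat +
  fixes p :: real
  assumes p: "1 < p"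
begin

definition nonlin :: "(real \<Rightarrow> 'a \<Rightarrow> real) \<Rightarrow> real \<Rightarrow> 'a \<Rightarrow> ennreal" where
  "nonlin u \<tau> y = ennreal (\<bar>u \<tau> y\<bar> powr p)"

lemma nonlin_measurable [measurable (raw)]:
  assumes [measurable]: "jointly_measurable u"
    "g \<in> borel_measurable M" "h \<in> measurable M borel"
  shows "(\<lambda>z. nonlin u (g z) (h z)) \<in> borel_measurable M"
  unfolding nonlin_def by measurable

primrec majorant :: "('a \<Rightarrow> real) \<Rightarrow> nat \<Rightarrow> real \<Rightarrow> 'a \<Rightarrow> ennreal" where
  "majorant v 0 = (\<lambda>t x. 0)"
| "majorant v (Suc k) = (\<lambda>t x. hom (\<lambda>x. ennreal \<bar>v x\<bar>) t x + duh (\<lambda>\<tau> y. epow (majorant v k \<tau> y) p) t x)"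

text \<open>\<open>enn2real\<close> gives the value 0 where the Duhamel term is infinite, so the
  iterates are total functions. Convergence and the fixed-point equation are claimed only where
  \<open>majorant_lim\<close> is finite.\<close>

primrec picard :: "('a \<Rightarrow> real) \<Rightarrow> nat \<Rightarrow> real \<Rightarrow> 'a \<Rightarrow> real" where
  "picard v 0 = (\<lambda>t x. 0)"
| "picard v (Suc k) = (\<lambda>t x. hom_real v t x + enn2real (duh (nonlin (picard v k)) t x))"

definition majorant_lim :: "('a \<Rightarrow> real) \<Rightarrow> real \<Rightarrow> 'a \<Rightarrow> ennreal" where
  "majorant_lim v t x = (SUP k. majorant v k t x)"

definition picard_lim :: "('a \<Rightarrow> real) \<Rightarrow> real \<Rightarrow> 'a \<Rightarrow> real" where
  "picard_lim v t x = lim (\<lambda>k. picard v k t x)"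

context
  fixes v :: "'a \<Rightarrow> real"
  assumes v [measurable]: "v \<in> borel_measurable borel"
begin

lemma majorant_measurable [measurable]:
  "jointly_measurable (majorant v k)"
proof (induction k)
  case (Suc k)
  note [measurable] = Suc
  show ?case by simp
qed simp

lemma picard_measurable [measurable]:
  "jointly_measurable (picard v k)"
proof (induction k)
  case (Suc k)
  note [measurable] = Suc
  show ?case by simp
qed simp

lemma majorant_lim_measurable [measurable]:
  "jointly_measurable (majorant_lim v)"
  unfolding majorant_lim_def by measurable

lemma picard_lim_measurable [measurable]:
  "jointly_measurable (picard_lim v)"
  unfolding picard_lim_def by measurable

lemma majorant_Suc_le: "majorant v k t x \<le> majorant v (Suc k) t x"
proof (induction k arbitrary: t x)
  case (Suc k)
  show ?case unfolding majorant.simps(2) using p Suc[unfolded majorant.simps(2)]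
    by (intro add_left_mono duh_mono epow_mono) auto
qed simp

lemma incseq_majorant: "incseq (\<lambda>k. majorant v k t x)"
  by (rule incseq_SucI) (rule majorant_Suc_le)

lemma majorant_le_lim: "majorant v k t x \<le> majorant_lim v t x"
  unfolding majorant_lim_def by (rule SUP_upper) simp

text \<open>Monotone convergence passes through the power and the Duhamel integral, so the equation
  holds also where both sides are infinite.\<close>

lemma majorant_lim_eq:
  "majorant_lim v t x = hom (\<lambda>x. ennreal \<bar>v x\<bar>) t x + duh (\<lambda>\<tau> y. epow (majorant_lim v \<tau> y) p) t x"
proof -
  have inc: "incseq (\<lambda>k. epow (majorant v k t x) p)" for t x
    using incseq_majorant p by (auto simp: incseq_def intro!: epow_mono)
  have "majorant_lim v t x = (SUP k. majorant v (Suc k) t x)"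
    unfolding majorant_lim_def
  proof (rule antisym)
    show "(SUP k. majorant v k t x) \<le> (SUP k. majorant v (Suc k) t x)"
      by (rule SUP_mono) (use majorant_Suc_le in blast)
    show "(SUP k. majorant v (Suc k) t x) \<le> (SUP k. majorant v k t x)"
      by (rule SUP_mono) blast
  qed
  also have "\<dots> = (SUP k. hom (\<lambda>x. ennreal \<bar>v x\<bar>) t x + duh (\<lambda>\<tau> y. epow (majorant v k \<tau> y) p) t x)"
    by simp
  also have "\<dots> = hom (\<lambda>x. ennreal \<bar>v x\<bar>) t x + (SUP k. duh (\<lambda>\<tau> y. epow (majorant v k \<tau> y) p) t x)"
    by (rule ennreal_SUP_add_right[symmetric]) simp
  also have "(SUP k. duh (\<lambda>\<tau> y. epow (majorant v k \<tau> y) p) t x) = duh (\<lambda>\<tau> y. SUP k. epow (majorant v k \<tau> y) p) t x"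
    by (rule duh_SUP[symmetric]) (use inc in auto)
  also have "(\<lambda>\<tau> y. SUP k. epow (majorant v k \<tau> y) p) = (\<lambda>\<tau> y. epow (majorant_lim v \<tau> y) p)"
    unfolding majorant_lim_def using p by (simp add: epow_SUP)
  finally show ?thesis .
qed

lemma nonlin_eq_epow: "nonlin u t x = epow (ennreal \<bar>u t x\<bar>) p"
  by (simp add: nonlin_def)

lemma picard_le_majorant: "ennreal \<bar>picard v k t x\<bar> \<le> majorant v k t x"
proof (induction k arbitrary: t x)
  case (Suc k)
  have "\<bar>picard v (Suc k) t x\<bar> \<le> \<bar>hom_real v t x\<bar> + enn2real (duh (nonlin (picard v k)) t x)"
    using abs_triangle_ineq[of "hom_real v t x" "enn2real (duh (nonlin (picard v k)) t x)"] by simp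
  then have "ennreal \<bar>picard v (Suc k) t x\<bar> \<le> ennreal \<bar>hom_real v t x\<bar> + ennreal (enn2real (duh (nonlin (picard v k)) t x))"
    by (simp add: ennreal_plus[symmetric] ennreal_leI del: ennreal_plus)
  also have "\<dots> \<le> hom (\<lambda>x. ennreal \<bar>v x\<bar>) t x + duh (nonlin (picard v k)) t x"
    by (intro add_mono hom_real_le ennreal_enn2real_le)
  also have "\<dots> \<le> hom (\<lambda>x. ennreal \<bar>v x\<bar>) t x + duh (\<lambda>\<tau> y. epow (majorant v k \<tau> y) p) t x"
    unfolding nonlin_eq_epow[abs_def] using p Suc by (intro add_left_mono duh_mono epow_mono) auto
  finally show ?case by simp
qed simp

text \<open>Differences of nonlinear terms are controlled by differences of their majorants, without any
  finiteness assumption: where the majorant is infinite there is nothing to show.\<close>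

lemma duh_diff_le:
  assumes [measurable]: "jointly_measurable u" "jointly_measurable u'"
    "jointly_measurable V" "jointly_measurable V'"
    and u: "\<And>\<tau> y. ennreal \<bar>u \<tau> y\<bar> \<le> V \<tau> y" and u': "\<And>\<tau> y. ennreal \<bar>u' \<tau> y - u \<tau> y\<bar> + V \<tau> y \<le> V' \<tau> y"
  shows "ennreal \<bar>enn2real (duh (nonlin u') t x) - enn2real (duh (nonlin u) t x)\<bar> + duh (\<lambda>\<tau> y. epow (V \<tau> y) p) t x
    \<le> duh (\<lambda>\<tau> y. epow (V' \<tau> y) p) t x"
proof (cases "duh (\<lambda>\<tau> y. epow (V' \<tau> y) p) t x = top")
  case False
  let ?d = "\<lambda>\<tau> y. ennreal \<bar>\<bar>u' \<tau> y\<bar> powr p - \<bar>u \<tau> y\<bar> powr p\<bar>"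
  have key: "duh ?d t x + duh (\<lambda>\<tau> y. epow (V \<tau> y) p) t x \<le> duh (\<lambda>\<tau> y. epow (V' \<tau> y) p) t x"
    using p u u' by (subst duh_add[symmetric]) (auto intro!: duh_mono abs_powr_diff_le_ennreal)
  have VV': "V \<tau> y \<le> V' \<tau> y" for \<tau> y
    using u'[of \<tau> y] by (metis add.commute le_iff_add order_trans)
  have uV: "ennreal \<bar>u' \<tau> y\<bar> \<le> V' \<tau> y" for \<tau> y
  proof -
    have "ennreal \<bar>u' \<tau> y\<bar> \<le> ennreal \<bar>u' \<tau> y - u \<tau> y\<bar> + ennreal \<bar>u \<tau> y\<bar>"
      by (simp add: ennreal_plus[symmetric] ennreal_leI del: ennreal_plus)
    also have "\<dots> \<le> V' \<tau> y" using u[of \<tau> y] u'[of \<tau> y] by (meson add_left_mono order_trans)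
    finally show ?thesis .
  qed
  have f1: "duh (nonlin u') t x \<le> duh (\<lambda>\<tau> y. epow (V' \<tau> y) p) t x"
    unfolding nonlin_eq_epow[abs_def] using p uV by (intro duh_mono epow_mono) auto
  have f2: "duh (nonlin u) t x \<le> duh (\<lambda>\<tau> y. epow (V' \<tau> y) p) t x"
    unfolding nonlin_eq_epow[abs_def] using p order_trans[OF u VV'] by (intro duh_mono epow_mono) auto
  have "ennreal \<bar>enn2real (duh (nonlin u') t x) - enn2real (duh (nonlin u) t x)\<bar> \<le> duh ?d t x"
  proof (rule ennreal_enn2real_diff_le)
    show "duh (nonlin u') t x \<le> duh (nonlin u) t x + duh ?d t x"
      unfolding nonlin_def by (subst duh_add[symmetric]) (auto intro!: duh_mono simp: ennreal_plus[symmetric] ennreal_leI simp del: ennreal_plus)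
    show "duh (nonlin u) t x \<le> duh (nonlin u') t x + duh ?d t x"
      unfolding nonlin_def by (subst duh_add[symmetric]) (auto intro!: duh_mono simp: ennreal_plus[symmetric] ennreal_leI simp del: ennreal_plus)
    show "duh (nonlin u') t x < top" "duh (nonlin u) t x < top"
      using f1 f2 False by (auto simp: less_top[symmetric] top_unique)
  qed
  then show ?thesis using key by (meson add_right_mono order_trans)
qed simp

text \<open>The linear term cancels in the difference on the left. For the Duhamel terms,
  \<open>duh_diff_le\<close> uses the inequality at the previous index.\<close>

lemma picard_diff_le: "ennreal \<bar>picard v (Suc k) t x - picard v k t x\<bar> + majorant v k t x \<le> majorant v (Suc k) t x"
proof (induction k arbitrary: t x)
  case 0
  have "duh (nonlin (\<lambda>t x. 0)) t x = 0" unfolding nonlin_def duh_def conv_def by simp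
  then have "picard v (Suc 0) t x = hom_real v t x" by (simp add: fun_eq_iff)
  then have "ennreal \<bar>picard v (Suc 0) t x - picard v 0 t x\<bar> + majorant v 0 t x \<le> hom (\<lambda>x. ennreal \<bar>v x\<bar>) t x"
    using hom_real_le[of v t x] by simp
  also have "\<dots> \<le> majorant v (Suc 0) t x" by simp
  finally show ?case .
next
  case (Suc k)
  have "ennreal \<bar>enn2real (duh (nonlin (picard v (Suc k))) t x) - enn2real (duh (nonlin (picard v k)) t x)\<bar> + duh (\<lambda>\<tau> y. epow (majorant v k \<tau> y) p) t x
    \<le> duh (\<lambda>\<tau> y. epow (majorant v (Suc k) \<tau> y) p) t x"
    by (intro duh_diff_le picard_measurable majorant_measurable picard_le_majorant Suc)
  then have "hom (\<lambda>x. ennreal \<bar>v x\<bar>) t x + (ennreal \<bar>enn2real (duh (nonlin (picard v (Suc k))) t x) - enn2real (duh (nonlin (picard v k)) t x)\<bar> + duh (\<lambda>\<tau> y. epow (majorant v k \<tau> y) p) t x)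
    \<le> hom (\<lambda>x. ennreal \<bar>v x\<bar>) t x + duh (\<lambda>\<tau> y. epow (majorant v (Suc k) \<tau> y) p) t x"
    by (rule add_left_mono)
  then show ?case
    unfolding picard.simps(2)[of v "Suc k"] picard.simps(2)[of v k] majorant.simps(2)[of v "Suc k"] majorant.simps(2)[of v k]
    by (simp add: add_ac del: picard.simps majorant.simps)
qed

lemma picard_diff_le': 
  assumes "k \<le> m"
  shows "ennreal \<bar>picard v m t x - picard v k t x\<bar> + majorant v k t x \<le> majorant v m t x"
  using assms
proof (induction m rule: dec_induct)
  case (step m)
  have "ennreal \<bar>picard v (Suc m) t x - picard v k t x\<bar> \<le> ennreal \<bar>picard v (Suc m) t x - picard v m t x\<bar> + ennreal \<bar>picard v m t x - picard v k t x\<bar>"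
    by (simp add: ennreal_plus[symmetric] ennreal_leI del: ennreal_plus picard.simps)
  then have "ennreal \<bar>picard v (Suc m) t x - picard v k t x\<bar> + majorant v k t x
    \<le> ennreal \<bar>picard v (Suc m) t x - picard v m t x\<bar> + (ennreal \<bar>picard v m t x - picard v k t x\<bar> + majorant v k t x)"
    by (metis add.assoc add_right_mono)
  also have "\<dots> \<le> ennreal \<bar>picard v (Suc m) t x - picard v m t x\<bar> + majorant v m t x"
    by (intro add_left_mono step)
  also have "\<dots> \<le> majorant v (Suc m) t x" by (rule picard_diff_le)
  finally show ?case .
qed simp

text \<open>The increments are dominated by those of a bounded monotone sequence, which is
  Cauchy.\<close>

lemma picard_converges:
  assumes fin: "majorant_lim v t x < top"
  shows "(\<lambda>k. picard v k t x) \<longlonglongrightarrow> picard_lim v t x"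
proof -
  define V where "V k = enn2real (majorant v k t x)" for k
  have Vk: "majorant v k t x = ennreal (V k)" for k
    using order_le_less_trans[OF majorant_le_lim fin] by (simp add: V_def)
  have V0: "0 \<le> V k" for k by (simp add: V_def)
  have "incseq V"
    using incseq_majorant[of t x] V0 by (simp add: incseq_def Vk)
  moreover have "V k \<le> enn2real (majorant_lim v t x)" for k
    unfolding V_def using majorant_le_lim fin by (intro enn2real_mono) auto
  ultimately have "convergent V" using incseq_convergent by (metis convergentI)
  then have CV: "Cauchy V" by (simp add: Cauchy_convergent_iff)
  have d: "\<bar>picard v m t x - picard v k t x\<bar> \<le> \<bar>V m - V k\<bar>" if "k \<le> m" for k m
  proof -
    have "\<bar>picard v m t x - picard v k t x\<bar> + V k \<le> V m"
      using picard_diff_le'[OF that, of t x] V0 by (simp add: Vk ennreal_plus[symmetric] del: ennreal_plus)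
    then show ?thesis by linarith
  qed
  have "Cauchy (\<lambda>k. picard v k t x)"
  proof (rule metric_CauchyI)
    fix e :: real assume "0 < e"
    then obtain M where M: "\<And>m k. m \<ge> M \<Longrightarrow> k \<ge> M \<Longrightarrow> dist (V m) (V k) < e"
      using CV by (meson metric_CauchyD)
    have "dist (picard v m t x) (picard v k t x) < e" if "m \<ge> M" "k \<ge> M" for m k
    proof (cases "k \<le> m")
      case True
      then show ?thesis using d[OF True] M[OF that] by (simp add: dist_real_def)
    next
      case False
      then show ?thesis using d[of m k] M[OF that(2,1)] by (simp add: dist_real_def abs_minus_commute)
    qed
    then show "\<exists>M. \<forall>m\<ge>M. \<forall>k\<ge>M. dist (picard v m t x) (picard v k t x) < e" by blast
  qed
  then have "convergent (\<lambda>k. picard v k t x)" by (simp add: Cauchy_convergent_iff)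
  then show ?thesis unfolding picard_lim_def by (simp add: convergent_LIMSEQ_iff)
qed

lemma picard_lim_diff_le: "ennreal \<bar>picard_lim v t x - picard v k t x\<bar> + majorant v k t x \<le> majorant_lim v t x"
proof (cases "majorant_lim v t x = top")
  case False
  then have fin: "majorant_lim v t x < top" by (simp add: less_top)
  have "(\<lambda>m. ennreal \<bar>picard v m t x - picard v k t x\<bar> + majorant v k t x) \<longlonglongrightarrow> ennreal \<bar>picard_lim v t x - picard v k t x\<bar> + majorant v k t x"
    by (intro tendsto_add tendsto_ennrealI tendsto_rabs tendsto_diff tendsto_const picard_converges fin)
  moreover have "\<forall>m\<ge>k. ennreal \<bar>picard v m t x - picard v k t x\<bar> + majorant v k t x \<le> majorant_lim v t x"
    using picard_diff_le'[of k _ t x] majorant_le_lim[of _ t x] by (blast intro: order_trans)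
  ultimately show ?thesis by (meson LIMSEQ_le_const2)
qed simp

lemma picard_lim_le: "ennreal \<bar>picard_lim v t x\<bar> \<le> majorant_lim v t x"
  using picard_lim_diff_le[of t x 0] by simp

text \<open>\<open>duh_diff_le\<close> is applied to the limit and the \<open>k\<close>-th iterate.
  It bounds the error of the Duhamel term by what is missing from the majorant's Duhamel term at
  step \<open>k\<close>, which tends to 0 where the limit is finite.\<close>

lemma picard_lim_eq:
  assumes fin: "majorant_lim v t x < top"
  shows "picard_lim v t x = hom_real v t x + enn2real (duh (nonlin (picard_lim v)) t x)"
proof -
  let ?D = "\<lambda>k. duh (\<lambda>\<tau> y. epow (majorant v k \<tau> y) p) t x" and ?DL = "duh (\<lambda>\<tau> y. epow (majorant_lim v \<tau> y) p) t x"
  have DL: "?DL < top" using fin by (subst (asm) majorant_lim_eq) (auto simp: less_top)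
  have inc: "incseq (\<lambda>k. epow (majorant v k t x) p)" for t x
    using incseq_majorant p by (auto simp: incseq_def intro!: epow_mono)
  have "?DL = (SUP k. ?D k)"
  proof -
    have "(\<lambda>\<tau> y. epow (majorant_lim v \<tau> y) p) = (\<lambda>\<tau> y. SUP k. epow (majorant v k \<tau> y) p)"
      unfolding majorant_lim_def using p by (simp add: epow_SUP)
    then show ?thesis using inc by (simp add: duh_SUP)
  qed
  moreover have "incseq ?D" using inc by (auto simp: incseq_def intro!: duh_mono)
  ultimately have DT: "?D \<longlonglongrightarrow> ?DL" using LIMSEQ_SUP[of ?D] by simp
  have le: "ennreal \<bar>enn2real (duh (nonlin (picard_lim v)) t x) - enn2real (duh (nonlin (picard v k)) t x)\<bar> + ?D k \<le> ?DL" for k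
    by (intro duh_diff_le picard_measurable picard_lim_measurable majorant_measurable majorant_lim_measurable picard_le_majorant picard_lim_diff_le)
  have "(\<lambda>k. enn2real (?D k)) \<longlonglongrightarrow> enn2real ?DL"
    using DT DL by (intro tendsto_enn2real) (auto simp: less_top)
  then have z: "(\<lambda>k. enn2real ?DL - enn2real (?D k)) \<longlonglongrightarrow> 0"
    using tendsto_diff[OF tendsto_const[of "enn2real ?DL"]] by fastforce
  have "\<bar>enn2real (duh (nonlin (picard v k)) t x) - enn2real (duh (nonlin (picard_lim v)) t x)\<bar> \<le> enn2real ?DL - enn2real (?D k)" for k
  proof -
    have aux: "\<bar>b - a\<bar> \<le> enn2real y - enn2real x" if "ennreal \<bar>a - b\<bar> + x \<le> y" "y < top" for a b x y
      using that by (cases x; cases y) (auto simp: ennreal_plus[symmetric] abs_minus_commute top_unique simp del: ennreal_plus)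
    show ?thesis by (rule aux[OF le DL])
  qed
  then have "(\<lambda>k. enn2real (duh (nonlin (picard v k)) t x) - enn2real (duh (nonlin (picard_lim v)) t x)) \<longlonglongrightarrow> 0"
    by (intro Lim_null_comparison[OF _ z]) auto
  then have "(\<lambda>k. enn2real (duh (nonlin (picard v k)) t x)) \<longlonglongrightarrow> enn2real (duh (nonlin (picard_lim v)) t x)"
    by (rule LIM_zero_cancel)
  then have "(\<lambda>k. picard v (Suc k) t x) \<longlonglongrightarrow> hom_real v t x + enn2real (duh (nonlin (picard_lim v)) t x)"
    by (simp add: tendsto_add)
  moreover have "(\<lambda>k. picard v (Suc k) t x) \<longlonglongrightarrow> picard_lim v t x"
    by (rule LIMSEQ_Suc[OF picard_converges[OF fin]])
  ultimately show ?thesis by (rule LIMSEQ_unique[symmetric])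
qed

end

end

section \<open>Time integrals against the kernel weight\<close>

lemma measurable_Lnorm_param [measurable (raw)]:
  assumes "sigma_finite_measure M" and [measurable]: "(\<lambda>(t, x). f t x) \<in> borel_measurable (N \<Otimes>\<^sub>M M)"
  shows "(\<lambda>t. Lnorm M s (f t)) \<in> borel_measurable N"
proof -
  interpret sigma_finite_measure M by fact
  show ?thesis unfolding Lnorm_def by measurable
qed

lemmas measurable_Lnorm_lborel [measurable (raw)] = measurable_Lnorm_param[OF sigma_finite_lborel]

text \<open>Of the exponent \<open>c * a\<close>, the part \<open>r\<close> is spent on the norm and
  the remainder \<open>c * a - r\<close> on the essential bound.\<close>

lemma Lnorm_power_le:
  assumes [measurable]: "f \<in> borel_measurable M" and f: "AE x in M. f x \<le> ennreal m" "Lnorm M r f \<le> ennreal l"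
    and "0 < m" "0 \<le> l" "0 < r" "0 < a" "r \<le> c * a"
  shows "Lnorm M a (\<lambda>x. epow (f x) c) \<le> ennreal (m powr (c - r / a) * l powr (r / a))"
proof -
  have "(\<integral>\<^sup>+x. epow (f x) (c * a) \<partial>M) \<le> (\<integral>\<^sup>+x. epow (ennreal m) (c * a - r) * epow (f x) r \<partial>M)"
  proof (rule nn_integral_mono_AE, use f(1) in \<open>rule eventually_mono\<close>)
    fix x assume "f x \<le> ennreal m"
    then have le: "epow (f x) (c * a - r) \<le> epow (ennreal m) (c * a - r)"
      using assms by (intro epow_mono) auto
    have e: "epow (f x) (c * a) = epow (f x) (c * a - r) * epow (f x) r"
      using epow_add[of "f x" "c * a - r" r] by simp
    show "epow (f x) (c * a) \<le> epow (ennreal m) (c * a - r) * epow (f x) r"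
      unfolding e by (rule mult_right_mono[OF le]) simp
  qed
  also have "\<dots> = epow (ennreal m) (c * a - r) * (\<integral>\<^sup>+x. epow (f x) r \<partial>M)"
    by (simp add: nn_integral_cmult)
  also have "\<dots> \<le> epow (ennreal m) (c * a - r) * epow (ennreal l) r"
    using f(2) assms by (intro mult_left_mono) (auto simp: Lnorm_le_iff)
  also have "\<dots> = ennreal (m powr (c * a - r) * l powr r)"
    using assms by (simp add: ennreal_mult')
  finally have le: "(\<integral>\<^sup>+x. epow (f x) (c * a) \<partial>M) \<le> ennreal (m powr (c * a - r) * l powr r)" .
  have "Lnorm M a (\<lambda>x. epow (f x) c) \<le> epow (ennreal (m powr (c * a - r) * l powr r)) (1 / a)"
    unfolding Lnorm_def using assms le by (intro epow_mono) auto
  also have "\<dots> = ennreal (m powr ((c * a - r) * (1 / a)) * l powr (r * (1 / a)))"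
    using assms by (simp add: powr_mult powr_powr)
  also have "(c * a - r) * (1 / a) = c - r / a" using assms by (simp add: field_simps)
  finally show ?thesis by simp
qed

lemma Lnorm_finite_AE:
  assumes [measurable]: "f \<in> borel_measurable M" and "Lnorm M s f < top" "0 < s"
  shows "AE x in M. f x < top"
proof -
  have "(\<integral>\<^sup>+x. epow (f x) s \<partial>M) \<noteq> \<infinity>" using assms by (auto simp: Lnorm_def less_top)
  then have "AE x in M. epow (f x) s \<noteq> \<infinity>" by (intro nn_integral_PInf_AE) auto
  then show ?thesis by (rule eventually_mono) (auto simp: less_top)
qed

lemma nn_integral_reflect_real:
  fixes f :: "real \<Rightarrow> ennreal"
  assumes "f \<in> borel_measurable borel"
  shows "(\<integral>\<^sup>+y. f (x - y) \<partial>lborel) = (\<integral>\<^sup>+y. f y \<partial>lborel)"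
  using nn_integral_reflect[OF assms] .

context fractional_heat
begin

lemma nn_integral_kern_weight:
  assumes a: "admissible a" and t: "0 \<le> t"
  shows "(\<integral>\<^sup>+s. indicator {..t} s * kern_weight a s \<partial>lborel) = ennreal (kern_const a * t powr (1 - \<theta> a) / (1 - \<theta> a))"
proof -
  note th = theta_bounds[OF a] and C = kern_const_pos[OF a]
  have "(\<integral>\<^sup>+s. indicator {..t} s * kern_weight a s \<partial>lborel) = (\<integral>\<^sup>+s. ennreal (kern_const a) * (indicator {0..t} s * ennreal (s powr (- \<theta> a))) \<partial>lborel)"
    using C by (intro nn_integral_cong) (auto simp: kern_weight_def indicator_def ennreal_mult')
  also have "\<dots> = ennreal (kern_const a) * ennreal (t powr (- \<theta> a + 1) / (- \<theta> a + 1))"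
    using th t by (simp add: nn_integral_cmult nn_integral_powr_Icc del: add_uminus_conv_diff)
  finally show ?thesis using C th by (simp add: ennreal_mult'[symmetric])
qed

lemma nn_integral_kern_weight_reflect:
  assumes [measurable]: "f \<in> borel_measurable borel"
  shows "(\<integral>\<^sup>+\<tau>. indicator {0..} \<tau> * (kern_weight a (t - \<tau>) * f (t - \<tau>)) \<partial>lborel) = (\<integral>\<^sup>+s. indicator {..t} s * (kern_weight a s * f s) \<partial>lborel)"
proof -
  have "(\<integral>\<^sup>+s. indicator {..t} s * (kern_weight a s * f s) \<partial>lborel) = (\<integral>\<^sup>+\<tau>. indicator {..t} (t - \<tau>) * (kern_weight a (t - \<tau>) * f (t - \<tau>)) \<partial>lborel)"
    by (rule nn_integral_reflect_real[symmetric]) measurable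
  then show ?thesis by (simp add: indicator_def)
qed

lemma volterra_const:
  assumes a: "admissible a" and t: "0 \<le> t"
  shows "(\<integral>\<^sup>+\<tau>. indicator {0..} \<tau> * (kern_weight a (t - \<tau>) * c) \<partial>lborel) = ennreal (kern_const a * t powr (1 - \<theta> a) / (1 - \<theta> a)) * c"
proof -
  have "(\<integral>\<^sup>+\<tau>. indicator {0..} \<tau> * (kern_weight a (t - \<tau>) * c) \<partial>lborel) = (\<integral>\<^sup>+s. indicator {..t} s * (kern_weight a s * c) \<partial>lborel)"
    by (rule nn_integral_kern_weight_reflect) simp
  also have "\<dots> = (\<integral>\<^sup>+s. (indicator {..t} s * kern_weight a s) * c \<partial>lborel)" by (simp add: mult_ac)
  also have "\<dots> = (\<integral>\<^sup>+s. indicator {..t} s * kern_weight a s \<partial>lborel) * c" by (rule nn_integral_multc) simp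
  finally show ?thesis by (simp add: nn_integral_kern_weight[OF a t])
qed

text \<open>Up to the factor \<open>kern_const a\<close>, this is Euler's Beta integral with its
  scaling in \<open>t\<close>. On each half of the interval one of the two powers is regular and is
  replaced by its value at \<open>t / 2\<close>.\<close>

lemma volterra_beta:
  assumes a: "admissible a" and e: "0 \<le> \<eta>" "\<eta> < 1"
  obtains B where "0 < B" "\<And>t. 0 < t \<Longrightarrow> (\<integral>\<^sup>+\<tau>. indicator {0..} \<tau> * (kern_weight a (t - \<tau>) * ennreal (\<tau> powr (- \<eta>))) \<partial>lborel)
      \<le> ennreal (B * t powr (1 - \<theta> a - \<eta>))"
proof -
  note th = theta_bounds[OF a] and C = kern_const_pos[OF a]
  define C where "C = kern_const a"
  have C0: "0 < C" using C by (simp add: C_def)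
  \<comment> \<open>The factor that \<open>(t / 2) powr (1 - \<theta> a - \<eta>)\<close>
    contributes beside \<open>t powr (1 - \<theta> a - \<eta>)\<close>.\<close>
  define c where "c = 2 powr (\<theta> a + \<eta> - 1)"
  have c: "0 < c" by (simp add: c_def)
  define B where "B = C * c * (1 / (1 - \<eta>) + 1 / (1 - \<theta> a))"
  have B: "0 < B" unfolding B_def using C0 c e th by (intro mult_pos_pos add_pos_pos) auto
  show ?thesis
  proof (rule that[OF B])
    fix t :: real assume t: "0 < t"
    let ?h = "t / 2"
    have "(\<integral>\<^sup>+\<tau>. indicator {0..} \<tau> * (kern_weight a (t - \<tau>) * ennreal (\<tau> powr (- \<eta>))) \<partial>lborel)
      \<le> (\<integral>\<^sup>+\<tau>. ennreal (C * ?h powr (- \<theta> a)) * (indicator {0..?h} \<tau> * ennreal (\<tau> powr (- \<eta>)))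
          + ennreal (?h powr (- \<eta>)) * (indicator {..?h} (t - \<tau>) * kern_weight a (t - \<tau>)) \<partial>lborel)"
    proof (rule nn_integral_mono)
      fix \<tau> :: real
      show "indicator {0..} \<tau> * (kern_weight a (t - \<tau>) * ennreal (\<tau> powr (- \<eta>)))
        \<le> ennreal (C * ?h powr (- \<theta> a)) * (indicator {0..?h} \<tau> * ennreal (\<tau> powr (- \<eta>)))
          + ennreal (?h powr (- \<eta>)) * (indicator {..?h} (t - \<tau>) * kern_weight a (t - \<tau>))"
      proof (cases "0 \<le> \<tau>")
        case True
        show ?thesis
        proof (cases "\<tau> \<le> ?h")
          case th1: True
          have "(t - \<tau>) powr (- \<theta> a) \<le> ?h powr (- \<theta> a)" using th1 t th by (intro powr_mono2') auto
          then have "kern_weight a (t - \<tau>) \<le> ennreal (C * ?h powr (- \<theta> a))"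
            using C0 by (auto simp: kern_weight_def C_def indicator_def intro!: ennreal_leI)
          then have "kern_weight a (t - \<tau>) * ennreal (\<tau> powr (- \<eta>)) \<le> ennreal (C * ?h powr (- \<theta> a)) * ennreal (\<tau> powr (- \<eta>))"
            by (rule mult_right_mono) simp
          then show ?thesis using True th1 by (simp add: add_increasing2)
        next
          case False
          have "\<tau> powr (- \<eta>) \<le> ?h powr (- \<eta>)" using False t e by (intro powr_mono2') auto
          then have "kern_weight a (t - \<tau>) * ennreal (\<tau> powr (- \<eta>)) \<le> kern_weight a (t - \<tau>) * ennreal (?h powr (- \<eta>))"
            by (intro mult_left_mono ennreal_leI) auto
          then show ?thesis using True False by (simp add: mult.commute)
        qed
      qed simp
    qed
    also have "\<dots> = ennreal (C * ?h powr (- \<theta> a)) * (\<integral>\<^sup>+\<tau>. indicator {0..?h} \<tau> * ennreal (\<tau> powr (- \<eta>)) \<partial>lborel)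
       + ennreal (?h powr (- \<eta>)) * (\<integral>\<^sup>+\<tau>. indicator {..?h} (t - \<tau>) * kern_weight a (t - \<tau>) \<partial>lborel)"
      by (subst nn_integral_add) (auto simp: nn_integral_cmult)
    also have "(\<integral>\<^sup>+\<tau>. indicator {..?h} (t - \<tau>) * kern_weight a (t - \<tau>) \<partial>lborel) = ennreal (C * ?h powr (1 - \<theta> a) / (1 - \<theta> a))"
      using t by (subst nn_integral_reflect_real[where f="\<lambda>s. indicator {..?h} s * kern_weight a s"])
        (auto simp: nn_integral_kern_weight[OF a] C_def)
    also have "(\<integral>\<^sup>+\<tau>. indicator {0..?h} \<tau> * ennreal (\<tau> powr (- \<eta>)) \<partial>lborel) = ennreal (?h powr (- \<eta> + 1) / (- \<eta> + 1))"
      using e t by (intro nn_integral_powr_Icc) auto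
    also have "ennreal (C * ?h powr (- \<theta> a)) * ennreal (?h powr (- \<eta> + 1) / (- \<eta> + 1))
        + ennreal (?h powr (- \<eta>)) * ennreal (C * ?h powr (1 - \<theta> a) / (1 - \<theta> a))
      = ennreal (C * (?h powr (- \<theta> a) * ?h powr (- \<eta> + 1)) * (1 / (1 - \<eta>)) + C * (?h powr (- \<eta>) * ?h powr (1 - \<theta> a)) * (1 / (1 - \<theta> a)))"
      using C0 e th by (simp add: ennreal_mult'[symmetric] mult_ac)
    also have "?h powr (- \<theta> a) * ?h powr (- \<eta> + 1) = c * t powr (1 - \<theta> a - \<eta>)"
      using t by (simp add: c_def powr_add[symmetric] powr_divide powr_minus_divide[symmetric] algebra_simps)
        (simp add: powr_diff powr_add field_simps)
    also have "?h powr (- \<eta>) * ?h powr (1 - \<theta> a) = c * t powr (1 - \<theta> a - \<eta>)"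
      using t by (simp add: c_def powr_add[symmetric] powr_divide powr_minus_divide[symmetric] algebra_simps)
        (simp add: powr_diff powr_add field_simps)
    also have "C * (c * t powr (1 - \<theta> a - \<eta>)) * (1 / (1 - \<eta>)) + C * (c * t powr (1 - \<theta> a - \<eta>)) * (1 / (1 - \<theta> a)) = B * t powr (1 - \<theta> a - \<eta>)"
      by (simp add: B_def algebra_simps)
    finally show "(\<integral>\<^sup>+\<tau>. indicator {0..} \<tau> * (kern_weight a (t - \<tau>) * ennreal (\<tau> powr (- \<eta>))) \<partial>lborel)
      \<le> ennreal (B * t powr (1 - \<theta> a - \<eta>))" .
  qed
qed

lemma exp_minus_le_inverse_square: "0 < (x::real) \<Longrightarrow> exp (- x) \<le> 4 / x\<^sup>2"
proof -
  assume x: "0 < x"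
  have "x / 2 \<le> exp (x / 2)" using exp_ge_add_one_self[of "x / 2"] by linarith
  then have "(x / 2)\<^sup>2 \<le> (exp (x / 2))\<^sup>2" using x by (intro power_mono) auto
  also have "(exp (x / 2))\<^sup>2 = exp x" by (simp add: power2_eq_square mult_exp_exp)
  finally show ?thesis using x by (simp add: exp_minus field_simps power2_eq_square)
qed

text \<open>An exponential weight makes the singular kernel small on the whole half-line. It takes
  the place of a Gronwall inequality and avoids stepping through short time intervals.\<close>

lemma kern_weight_exp_small:
  assumes a: "admissible a" and K: "0 < K"
  obtains l where "0 < l" "(\<integral>\<^sup>+s. kern_weight a s * ennreal (exp (- l * s)) \<partial>lborel) \<le> ennreal K"
proof -
  note th = theta_bounds[OF a]
  define C where "C = kern_const a"
  have C: "0 < C" using kern_const_pos[OF a] by (simp add: C_def)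
  \<comment> \<open>Makes the integral of the weight up to \<open>h\<close> equal to
    \<open>K / 2\<close>.\<close>
  define h where "h = (K * (1 - \<theta> a) / (2 * C)) powr (1 / (1 - \<theta> a))"
  have h: "0 < h" using K th C by (simp add: h_def)
  have hp: "C * h powr (1 - \<theta> a) / (1 - \<theta> a) = K / 2"
  proof -
    have aux: "C * ((K * e / (2 * C)) powr (1 / e)) powr e / e = K / 2" if "0 < e" for e
      using that K C by (simp add: powr_powr)
    show ?thesis unfolding h_def by (rule aux) (use th in simp)
  qed
  \<comment> \<open>Beyond \<open>h\<close> the exponential is at most
    \<open>4 / (l * s)\<^sup>2\<close>, so the tail is at most \<open>D / l\<^sup>2\<close>;
    \<open>l\<close> is chosen to make this the other \<open>K / 2\<close>.\<close>
  define D where "D = 4 * C * (h powr (- \<theta> a - 1) / (\<theta> a + 1))"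
  have D: "0 < D" using C h th by (simp add: D_def)
  define l where "l = sqrt (2 * D / K)"
  have l: "0 < l" "D / l\<^sup>2 = K / 2" using D K by (auto simp: l_def field_simps)
  show ?thesis
  proof (rule that[OF l(1)])
    have "(\<integral>\<^sup>+s. kern_weight a s * ennreal (exp (- l * s)) \<partial>lborel)
      \<le> (\<integral>\<^sup>+s. indicator {..h} s * kern_weight a s + ennreal (4 * C / l\<^sup>2) * (indicator {h..} s * ennreal (s powr (- \<theta> a - 2))) \<partial>lborel)"
    proof (rule nn_integral_mono)
      fix s :: real
      show "kern_weight a s * ennreal (exp (- l * s)) \<le> indicator {..h} s * kern_weight a s + ennreal (4 * C / l\<^sup>2) * (indicator {h..} s * ennreal (s powr (- \<theta> a - 2)))"
      proof (cases "s \<le> h")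
        case True
        have "kern_weight a s * ennreal (exp (- l * s)) \<le> kern_weight a s * 1"
        proof (cases "0 < s")
          case True
          then show ?thesis using l by (intro mult_left_mono) (auto simp: ennreal_le_1)
        qed (simp add: kern_weight_def)
        then show ?thesis using True by (simp add: add_increasing2)
      next
        case False
        then have s: "0 < s" using h by simp
        have "C * s powr (- \<theta> a) * exp (- l * s) \<le> C * s powr (- \<theta> a) * (4 / (l * s)\<^sup>2)"
          using exp_minus_le_inverse_square[of "l * s"] s l C by (intro mult_left_mono) auto
        also have "\<dots> = 4 * C / l\<^sup>2 * s powr (- \<theta> a - 2)"
          using s l by (simp add: powr_diff power_mult_distrib)
        finally show ?thesis using s False C
          by (simp add: kern_weight_def C_def[symmetric] ennreal_mult'[symmetric] ennreal_leI)
      qed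
    qed
    also have "\<dots> = (\<integral>\<^sup>+s. indicator {..h} s * kern_weight a s \<partial>lborel) + ennreal (4 * C / l\<^sup>2) * (\<integral>\<^sup>+s. indicator {h..} s * ennreal (s powr (- \<theta> a - 2)) \<partial>lborel)"
      by (subst nn_integral_add) (auto simp: nn_integral_cmult)
    also have "\<dots> = ennreal (C * h powr (1 - \<theta> a) / (1 - \<theta> a)) + ennreal (4 * C / l\<^sup>2) * ennreal (h powr (- \<theta> a - 2 + 1) / - (- \<theta> a - 2 + 1))"
      using h th nn_integral_powr_Ici[of "- \<theta> a - 2" h] nn_integral_kern_weight[OF a, of h] by (simp add: C_def)
    also have "\<dots> = ennreal (K / 2) + ennreal (D / l\<^sup>2)"
    proof -
      have e: "- \<theta> a - 2 + 1 = - \<theta> a - 1" "- (- \<theta> a - 1) = \<theta> a + 1" by simp_all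
      show ?thesis unfolding hp e D_def using C l(1) th by (simp add: ennreal_mult'[symmetric] mult_ac)
    qed
    also have "\<dots> = ennreal K" unfolding l(2) using K by (simp add: ennreal_plus[symmetric] del: ennreal_plus)
    finally show "(\<integral>\<^sup>+s. kern_weight a s * ennreal (exp (- l * s)) \<partial>lborel) \<le> ennreal K" .
  qed
qed

lemma volterra_exp:
  assumes l: "(\<integral>\<^sup>+s. kern_weight a s * ennreal (exp (- l * s)) \<partial>lborel) \<le> ennreal K"
  shows "(\<integral>\<^sup>+\<tau>. indicator {0..} \<tau> * (kern_weight a (t - \<tau>) * ennreal (exp (l * \<tau>))) \<partial>lborel) \<le> ennreal K * ennreal (exp (l * t))"
proof -
  have "(\<integral>\<^sup>+\<tau>. indicator {0..} \<tau> * (kern_weight a (t - \<tau>) * ennreal (exp (l * \<tau>))) \<partial>lborel)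
    = (\<integral>\<^sup>+\<tau>. indicator {0..} \<tau> * (kern_weight a (t - \<tau>) * ennreal (exp (l * (t - (t - \<tau>))))) \<partial>lborel)" by simp
  also have "\<dots> = (\<integral>\<^sup>+s. indicator {..t} s * (kern_weight a s * ennreal (exp (l * (t - s)))) \<partial>lborel)"
    by (rule nn_integral_kern_weight_reflect) simp
  also have "\<dots> \<le> (\<integral>\<^sup>+s. (kern_weight a s * ennreal (exp (- l * s))) * ennreal (exp (l * t)) \<partial>lborel)"
  proof (rule nn_integral_mono)
    fix s :: real
    have e: "ennreal (exp (l * (t - s))) = ennreal (exp (- l * s)) * ennreal (exp (l * t))"
      by (simp add: ennreal_mult'[symmetric] mult_exp_exp algebra_simps)
    show "indicator {..t} s * (kern_weight a s * ennreal (exp (l * (t - s)))) \<le> kern_weight a s * ennreal (exp (- l * s)) * ennreal (exp (l * t))"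
      unfolding e by (simp add: indicator_def mult.assoc)
  qed
  also have "\<dots> = (\<integral>\<^sup>+s. kern_weight a s * ennreal (exp (- l * s)) \<partial>lborel) * ennreal (exp (l * t))"
    by (rule nn_integral_multc) simp
  also have "\<dots> \<le> ennreal K * ennreal (exp (l * t))" by (intro mult_right_mono l) simp
  finally show ?thesis .
qed

section \<open>Continuity in time\<close>

text \<open>The modulus of continuity in time of the composed kernel. There is no lower limit on
  \<open>s\<close>: for \<open>s \<le> 0 < s + h\<close> the difference is the later kernel alone,
  which accounts for the part of the Duhamel integral gained between two times.\<close>

definition kern_modulus :: "real \<Rightarrow> real \<Rightarrow> real \<Rightarrow> ennreal" where
  "kern_modulus a T h = (\<integral>\<^sup>+s. indicator {..T} s * Lnorm lborel (a / (a - 1)) (kern_diff (s + h) s) \<partial>lborel)"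

lemma b_large: "admissible a \<Longrightarrow> n / (n - \<alpha>) < a / (a - 1)"
proof -
  assume "admissible a"
  then have a: "1 < a" "\<alpha> / n < 1 / a" by (auto simp: admissible_def)
  then have "\<alpha> * a < n" using n_pos by (simp add: field_simps)
  then show ?thesis using a alpha by (simp add: field_simps)
qed

lemma Lnorm_kern_diff_le:
  assumes a: "admissible a"
  shows "Lnorm lborel (a / (a - 1)) (kern_diff s t) \<le> kern_weight a s + kern_weight a t"
proof -
  have b: "1 < a / (a - 1)" by (rule b_gt_1[OF b_large[OF a]])
  have "Lnorm lborel (a / (a - 1)) (kern_diff s t) \<le> Lnorm lborel (a / (a - 1)) (\<lambda>x. kern s x + kern t x)"
    using b by (intro Lnorm_mono kern_diff_le) auto
  also have "\<dots> \<le> Lnorm lborel (a / (a - 1)) (kern s) + Lnorm lborel (a / (a - 1)) (kern t)"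
    using b by (intro Lnorm_triangle sigma_finite_lborel) auto
  also have "\<dots> \<le> kern_weight a s + kern_weight a t"
    by (intro add_mono Lnorm_kern_le a)
  finally show ?thesis .
qed

text \<open>For positive \<open>s\<close> dominated convergence applies, because the weight
  decreases in time and twice its value at \<open>s\<close> dominates. The nonpositive
  \<open>s\<close> contribute the integral of the weight up to \<open>h\<close>, a multiple of
  \<open>h powr (1 - \<theta> a)\<close>.\<close>

lemma kern_modulus_tendsto:
  assumes a: "admissible a" and h: "h \<longlonglongrightarrow> 0" "\<And>k::nat. 0 \<le> h k" and T: "0 \<le> T"
  shows "(\<lambda>k. kern_modulus a T (h k)) \<longlonglongrightarrow> 0"
proof -
  note th = theta_bounds[OF a] and C = kern_const_pos[OF a]
  let ?L = "\<lambda>k s. Lnorm lborel (a / (a - 1)) (kern_diff (s + h k) s)"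
  have mono: "kern_weight a (s + h k) \<le> kern_weight a s" if "0 < s" for s k
  proof -
    have "(s + h k) powr (- \<theta> a) \<le> s powr (- \<theta> a)" using that h(2)[of k] th by (intro powr_mono2') auto
    then show ?thesis using that h(2)[of k] C by (simp add: kern_weight_def ennreal_leI)
  qed
  have "(\<lambda>k. \<integral>\<^sup>+s. indicator {0<..T} s * ?L k s \<partial>lborel) \<longlonglongrightarrow> (\<integral>\<^sup>+(s::real). 0 \<partial>lborel)"
  proof (rule nn_integral_dominated_convergence[where w="\<lambda>s. 2 * (indicator {..T} s * kern_weight a s)"])
    show "AE s in lborel. indicator {0<..T} s * ?L k s \<le> 2 * (indicator {..T} s * kern_weight a s)" for k
    proof (rule AE_I2)
      fix s :: real
      have "?L k s \<le> 2 * kern_weight a s" if "0 < s"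
        using order_trans[OF Lnorm_kern_diff_le[OF a] add_right_mono[OF mono[OF that]]] by (simp add: mult_2)
      then show "indicator {0<..T} s * ?L k s \<le> 2 * (indicator {..T} s * kern_weight a s)"
        by (auto simp: indicator_def)
    qed
    show "(\<integral>\<^sup>+s. 2 * (indicator {..T} s * kern_weight a s) \<partial>lborel) < \<infinity>"
      by (simp add: nn_integral_cmult nn_integral_kern_weight[OF a T] ennreal_mult_less_top)
    show "AE s in lborel. (\<lambda>k. indicator {0<..T} s * ?L k s) \<longlonglongrightarrow> 0"
    proof (rule AE_I2)
      fix s :: real
      show "(\<lambda>k. indicator {0<..T} s * ?L k s) \<longlonglongrightarrow> 0"
      proof (cases "0 < s")
        case True
        have "(\<lambda>k. s + h k) \<longlonglongrightarrow> s + 0" by (intro tendsto_add h tendsto_const)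
        then have "(\<lambda>k. ?L k s) \<longlonglongrightarrow> 0"
          using True h(2) by (intro Lnorm_kern_diff_tendsto b_large a) (auto intro: add_pos_nonneg)
        then show ?thesis by (intro tendsto_0_ennreal_cmult) (auto simp: indicator_def)
      qed simp
    qed
  qed measurable
  moreover have "(\<lambda>k. ennreal (kern_const a * h k powr (1 - \<theta> a) / (1 - \<theta> a))) \<longlonglongrightarrow> ennreal (kern_const a * 0 powr (1 - \<theta> a) / (1 - \<theta> a))"
    using th h by (intro tendsto_ennrealI tendsto_divide tendsto_mult tendsto_const tendsto_powr2) auto
  ultimately have lim: "(\<lambda>k. (\<integral>\<^sup>+s. indicator {0<..T} s * ?L k s \<partial>lborel) + ennreal (kern_const a * h k powr (1 - \<theta> a) / (1 - \<theta> a))) \<longlonglongrightarrow> 0 + 0"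
    by (intro tendsto_add) auto
  show ?thesis
  proof (rule tendsto_0_ennreal_le)
    show "(\<lambda>k. (\<integral>\<^sup>+s. indicator {0<..T} s * ?L k s \<partial>lborel) + ennreal (kern_const a * h k powr (1 - \<theta> a) / (1 - \<theta> a))) \<longlonglongrightarrow> 0"
      using lim by simp
    show "\<forall>\<^sub>F k in sequentially. kern_modulus a T (h k) \<le> (\<integral>\<^sup>+s. indicator {0<..T} s * ?L k s \<partial>lborel) + ennreal (kern_const a * h k powr (1 - \<theta> a) / (1 - \<theta> a))"
    proof (rule always_eventually, rule allI)
      fix k
      have "kern_modulus a T (h k) \<le> (\<integral>\<^sup>+s. indicator {0<..T} s * ?L k s + indicator {..h k} (s + h k) * kern_weight a (s + h k) \<partial>lborel)"
        unfolding kern_modulus_def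
      proof (rule nn_integral_mono)
        fix s :: real
        show "indicator {..T} s * ?L k s \<le> indicator {0<..T} s * ?L k s + indicator {..h k} (s + h k) * kern_weight a (s + h k)"
        proof (cases "0 < s")
          case False
          then have "?L k s \<le> kern_weight a (s + h k)"
            using Lnorm_kern_diff_le[OF a, of "s + h k" s] by (simp add: kern_weight_def)
          then show ?thesis using False by (simp add: indicator_def)
        qed (simp add: indicator_def)
      qed
      also have "\<dots> = (\<integral>\<^sup>+s. indicator {0<..T} s * ?L k s \<partial>lborel) + (\<integral>\<^sup>+s. indicator {..h k} (s + h k) * kern_weight a (s + h k) \<partial>lborel)"
        by (rule nn_integral_add) measurable
      also have "(\<integral>\<^sup>+s. indicator {..h k} (s + h k) * kern_weight a (s + h k) \<partial>lborel) = ennreal (kern_const a * h k powr (1 - \<theta> a) / (1 - \<theta> a))"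
        using nn_integral_shift[of "\<lambda>s. indicator {..h k} s * kern_weight a s" "- h k"]
        by (simp add: nn_integral_kern_weight[OF a h(2)])
      finally show "kern_modulus a T (h k) \<le> (\<integral>\<^sup>+s. indicator {0<..T} s * ?L k s \<partial>lborel) + ennreal (kern_const a * h k powr (1 - \<theta> a) / (1 - \<theta> a))" .
    qed
  qed
qed

definition duh_diff :: "(real \<Rightarrow> 'a \<Rightarrow> ennreal) \<Rightarrow> real \<Rightarrow> real \<Rightarrow> 'a \<Rightarrow> ennreal" where
  "duh_diff f t' t x = (\<integral>\<^sup>+\<tau>. indicator {0..} \<tau> * conv (kern_diff (t' - \<tau>) (t - \<tau>)) (f \<tau>) x \<partial>lborel)"

lemma duh_le_duh_diff:
  assumes [measurable]: "jointly_measurable f"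
  shows "duh f t' x \<le> duh f t x + duh_diff f t' t x"
proof -
  have "duh f t' x \<le> (\<integral>\<^sup>+\<tau>. indicator {0..} \<tau> * conv (kern (t - \<tau>)) (f \<tau>) x + indicator {0..} \<tau> * conv (kern_diff (t' - \<tau>) (t - \<tau>)) (f \<tau>) x \<partial>lborel)"
    unfolding duh_def
  proof (rule nn_integral_mono)
    fix \<tau> :: real
    have "conv (kern (t' - \<tau>)) (f \<tau>) x \<le> conv (\<lambda>x. kern (t - \<tau>) x + kern_diff (t' - \<tau>) (t - \<tau>) x) (f \<tau>) x"
      by (intro conv_mono kern_le_kern_diff) auto
    also have "\<dots> = conv (kern (t - \<tau>)) (f \<tau>) x + conv (kern_diff (t' - \<tau>) (t - \<tau>)) (f \<tau>) x"
      by (rule conv_add_left) auto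
    finally show "indicator {0..} \<tau> * conv (kern (t' - \<tau>)) (f \<tau>) x \<le> indicator {0..} \<tau> * conv (kern (t - \<tau>)) (f \<tau>) x + indicator {0..} \<tau> * conv (kern_diff (t' - \<tau>) (t - \<tau>)) (f \<tau>) x"
      by (auto simp: indicator_def)
  qed
  also have "\<dots> = duh f t x + duh_diff f t' t x"
    unfolding duh_def duh_diff_def by (rule nn_integral_add) measurable
  finally show ?thesis .
qed

lemma duh_diff_commute: "duh_diff f t' t x = duh_diff f t t' x"
  unfolding duh_diff_def by (subst kern_diff_commute) simp

lemma kern_diff_nonpos: "s \<le> 0 \<Longrightarrow> t \<le> 0 \<Longrightarrow> kern_diff s t x = 0"
  using kern_diff_le[of s t x] by (simp add: kern_nonpos)

lemma Lnorm_duh_diff_le: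
  assumes [measurable]: "jointly_measurable w" "jointly_measurable g"
    and a: "admissible a" and s: "0 < s" "1 / s + 1 / a < 1"
    and W: "\<And>\<tau>. 0 \<le> \<tau> \<Longrightarrow> \<tau> < T \<Longrightarrow> Lnorm lborel s (w \<tau>) \<le> W"
    and G: "\<And>\<tau>. 0 \<le> \<tau> \<Longrightarrow> \<tau> < T \<Longrightarrow> Lnorm lborel a (g \<tau>) \<le> G"
    and t: "t \<le> T" "t' \<le> T"
  shows "Lnorm lborel s (duh_diff (\<lambda>\<tau> y. w \<tau> y * g \<tau> y) t' t) \<le> kern_modulus a T \<bar>t' - t\<bar> * (W * G)"
proof -
  \<comment> \<open>The difference kernel is symmetric in the two times, so the case
    \<open>t \<le> t'\<close> suffices.\<close>
  have main: "Lnorm lborel s (duh_diff (\<lambda>\<tau> y. w \<tau> y * g \<tau> y) t' t) \<le> kern_modulus a T (t' - t) * (W * G)"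
    if le: "t \<le> t'" "t' \<le> T" for t t'
  proof -
  have a1: "1 < a" using a by (simp add: admissible_def)
  have "1 / s < 1" using s a1 by (smt (verit) divide_pos_pos)
  then have s1: "1 \<le> s" using s(1) by (simp add: divide_less_eq)
  let ?N = "\<lambda>\<tau>. Lnorm lborel (a / (a - 1)) (kern_diff (t' - \<tau>) (t - \<tau>))"
  have "Lnorm lborel s (duh_diff (\<lambda>\<tau> y. w \<tau> y * g \<tau> y) t' t)
    \<le> (\<integral>\<^sup>+\<tau>. Lnorm lborel s (\<lambda>x. indicator {0..} \<tau> * conv (kern_diff (t' - \<tau>) (t - \<tau>)) (\<lambda>y. w \<tau> y * g \<tau> y) x) \<partial>lborel)"
    unfolding duh_diff_def by (rule Minkowski_integral) (use s1 in \<open>auto intro: sigma_finite_lborel\<close>)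
  also have "\<dots> \<le> (\<integral>\<^sup>+\<tau>. indicator {..T} (t - \<tau>) * ?N \<tau> * (W * G) \<partial>lborel)"
  proof (rule nn_integral_mono)
    fix \<tau> :: real
    show "Lnorm lborel s (\<lambda>x. indicator {0..} \<tau> * conv (kern_diff (t' - \<tau>) (t - \<tau>)) (\<lambda>y. w \<tau> y * g \<tau> y) x) \<le> indicator {..T} (t - \<tau>) * ?N \<tau> * (W * G)"
    proof (cases "0 \<le> \<tau> \<and> \<tau> < T")
      case True
      have "Lnorm lborel s (conv (kern_diff (t' - \<tau>) (t - \<tau>)) (\<lambda>y. w \<tau> y * g \<tau> y)) \<le> ?N \<tau> * (Lnorm lborel s (w \<tau>) * Lnorm lborel a (g \<tau>))"
        by (rule Lnorm_conv_bilinear) (use s a1 conj_exponent[OF a1] in auto)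
      also have "\<dots> \<le> ?N \<tau> * (W * G)" using True W G by (intro mult_left_mono mult_mono) auto
      finally show ?thesis using True le by (simp add: indicator_def)
    next
      case False
      have "indicator {0..} \<tau> * conv (kern_diff (t' - \<tau>) (t - \<tau>)) (\<lambda>y. w \<tau> y * g \<tau> y) x = 0" for x
      proof (cases "0 \<le> \<tau>")
        case True
        then have "t' - \<tau> \<le> 0" "t - \<tau> \<le> 0" using False le by auto
        then show ?thesis by (simp add: conv_def kern_diff_nonpos)
      qed simp
      then have z: "(\<lambda>x. indicator {0..} \<tau> * conv (kern_diff (t' - \<tau>) (t - \<tau>)) (\<lambda>y. w \<tau> y * g \<tau> y) x) = (\<lambda>x. 0)" by (rule ext)
      show ?thesis unfolding z by (simp add: Lnorm_def)
    qed
  qed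
  also have "\<dots> = (\<integral>\<^sup>+\<tau>. indicator {..T} (t - \<tau>) * ?N \<tau> \<partial>lborel) * (W * G)"
    by (rule nn_integral_multc) measurable
  also have "(\<integral>\<^sup>+\<tau>. indicator {..T} (t - \<tau>) * ?N \<tau> \<partial>lborel)
     = (\<integral>\<^sup>+\<tau>. indicator {..T} (t - \<tau>) * Lnorm lborel (a / (a - 1)) (kern_diff ((t - \<tau>) + (t' - t)) (t - \<tau>)) \<partial>lborel)"
    by (simp add: algebra_simps)
  also have "\<dots> = kern_modulus a T (t' - t)"
    unfolding kern_modulus_def
    by (rule nn_integral_reflect_real[where f="\<lambda>s. indicator {..T} s * Lnorm lborel (a / (a - 1)) (kern_diff (s + (t' - t)) s)"]) measurable
  finally show ?thesis .
  qed
  show ?thesis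
  proof (cases "t \<le> t'")
    case True
    then show ?thesis using main[OF True t(2)] by simp
  next
    case False
    have "duh_diff (\<lambda>\<tau> y. w \<tau> y * g \<tau> y) t' t = duh_diff (\<lambda>\<tau> y. w \<tau> y * g \<tau> y) t t'"
      by (rule ext) (rule duh_diff_commute)
    moreover have "\<bar>t' - t\<bar> = t - t'" using False by simp
    ultimately show ?thesis using main[OF _ t(1), of t'] False by simp
  qed
qed

lemma integrable_heat_real_mult:
  assumes [measurable]: "v \<in> borel_measurable borel" and "conv (heat t) (\<lambda>x. ennreal \<bar>v x\<bar>) x < top"
  shows "integrable lborel (\<lambda>y. heat_real t (x - y) * v y)"
proof (rule integrableI_bounded)
  have "(\<integral>\<^sup>+y. ennreal (norm (heat_real t (x - y) * v y)) \<partial>lborel) = conv (heat t) (\<lambda>x. ennreal \<bar>v x\<bar>) x"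
    unfolding conv_def heat_def using heat_real_nonneg by (simp add: abs_mult ennreal_mult')
  then show "(\<integral>\<^sup>+y. ennreal (norm (heat_real t (x - y) * v y)) \<partial>lborel) < \<infinity>" using assms by simp
qed measurable

lemma conv_heat_finite_AE:
  assumes [measurable]: "w \<in> borel_measurable borel" and "Lnorm lborel s w < top" "1 \<le> s"
  shows "AE x in lborel. conv (heat t) w x < top"
proof -
  have "Lnorm lborel s (conv (heat t) w) \<le> (\<integral>\<^sup>+x. heat t x \<partial>lborel) * Lnorm lborel s w"
    by (rule Lnorm_conv_L1) (use assms in auto)
  also have "\<dots> \<le> 1 * Lnorm lborel s w" by (intro mult_right_mono nn_integral_heat_le) auto
  finally have "Lnorm lborel s (conv (heat t) w) < top" using assms(2) by simp
  then show ?thesis using assms by (intro Lnorm_finite_AE) auto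
qed

text \<open>At positive times only the kernel has to be continuous, in the mean, and Young's
  inequality transfers this to every \<open>v\<close>.\<close>

lemma hom_real_tendsto:
  assumes [measurable]: "v \<in> borel_measurable borel" and v: "Lnorm_abs s v < top" and s: "1 \<le> s"
    and r: "r \<longlonglongrightarrow> t" "\<And>k. 0 \<le> r k" "0 < t"
  shows "(\<lambda>k. Lnorm lborel s (\<lambda>x. ennreal \<bar>hom_real v (r k) x - hom_real v t x\<bar>)) \<longlonglongrightarrow> 0"
proof -
  \<comment> \<open>The times \<open>r k\<close> may vanish for finitely many \<open>k\<close>. The
    maximum keeps all times positive and eventually equals \<open>r k\<close>.\<close>
  define q where "q k = max (r k) (t / 2)" for k
  have q: "q \<longlonglongrightarrow> t" "\<And>k. 0 < q k"
  proof -
    have "q \<longlonglongrightarrow> max t (t / 2)" unfolding q_def by (intro tendsto_max r tendsto_const)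
    then show "q \<longlonglongrightarrow> t" using r(3) by simp
    show "0 < q k" for k using r(3) by (simp add: q_def max_def)
  qed
  let ?w = "\<lambda>x. ennreal \<bar>v x\<bar>"
  have "(\<lambda>k. Lnorm lborel s ?w * (\<integral>\<^sup>+x. heat_diff (q k) t x \<partial>lborel)) \<longlonglongrightarrow> 0"
    by (intro tendsto_0_ennreal_cmult heat_diff_L1_tendsto q r(3) v)
  then show ?thesis
  proof (rule tendsto_0_ennreal_le)
    have "\<forall>\<^sub>F k in sequentially. t / 2 < r k" using order_tendstoD(1)[OF r(1), of "t / 2"] r(3) by simp
    then show "\<forall>\<^sub>F k in sequentially. Lnorm lborel s (\<lambda>x. ennreal \<bar>hom_real v (r k) x - hom_real v t x\<bar>) \<le> Lnorm lborel s ?w * (\<integral>\<^sup>+x. heat_diff (q k) t x \<partial>lborel)"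
    proof (rule eventually_mono)
      fix k assume k: "t / 2 < r k"
      then have qr: "q k = r k" and rp: "0 < r k" using r(3) by (auto simp: q_def)
      have "AE x in lborel. conv (heat (r k)) ?w x < top" "AE x in lborel. conv (heat t) ?w x < top"
        by (rule conv_heat_finite_AE[OF _ v s], simp)+
      then have "AE x in lborel. ennreal \<bar>hom_real v (r k) x - hom_real v t x\<bar> \<le> conv (heat_diff (r k) t) ?w x"
      proof eventually_elim
        case (elim x)
        have "hom_real v (r k) x - hom_real v t x = (\<integral>y. heat_real (r k) (x - y) * v y - heat_real t (x - y) * v y \<partial>lborel)"
          using rp r(3) elim by (simp add: hom_real_def integrable_heat_real_mult)
        then have "ennreal \<bar>hom_real v (r k) x - hom_real v t x\<bar> \<le> (\<integral>\<^sup>+y. ennreal \<bar>heat_real (r k) (x - y) * v y - heat_real t (x - y) * v y\<bar> \<partial>lborel)"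
          by (simp only: ennreal_abs_integral_le)
        also have "\<dots> = conv (heat_diff (r k) t) ?w x"
          unfolding conv_def heat_diff_def
          by (intro nn_integral_cong) (simp add: ennreal_mult'[symmetric] abs_mult[symmetric] left_diff_distrib)
        finally show ?case .
      qed
      then have "Lnorm lborel s (\<lambda>x. ennreal \<bar>hom_real v (r k) x - hom_real v t x\<bar>) \<le> Lnorm lborel s (conv (heat_diff (r k) t) ?w)"
        using s by (intro Lnorm_mono_AE) auto
      also have "\<dots> \<le> (\<integral>\<^sup>+x. heat_diff (r k) t x \<partial>lborel) * Lnorm lborel s ?w"
        by (rule Lnorm_conv_L1) (use s in auto)
      finally show "Lnorm lborel s (\<lambda>x. ennreal \<bar>hom_real v (r k) x - hom_real v t x\<bar>) \<le> Lnorm lborel s ?w * (\<integral>\<^sup>+x. heat_diff (q k) t x \<partial>lborel)"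
        by (simp add: qr mult.commute)
    qed
  qed
qed

lemma heat_scale:
  assumes t: "0 < t" and [measurable]: "f \<in> borel_measurable borel"
  shows "(\<integral>\<^sup>+y. heat t y * f y \<partial>lborel) = (\<integral>\<^sup>+z. heat 1 z * f (t powr (1 / \<beta>) *\<^sub>R z) \<partial>lborel)"
proof -
  let ?\<rho> = "t powr (1 / \<beta>)"
  have \<rho>: "0 < ?\<rho>" using t by simp
  have "(\<integral>\<^sup>+x. heat t x * f x \<partial>lborel)
    = ennreal (\<bar>?\<rho>\<bar> ^ DIM('a)) * (\<integral>\<^sup>+x. heat t (0 + ?\<rho> *\<^sub>R x) * f (0 + ?\<rho> *\<^sub>R x) \<partial>lborel)"
    by (rule nn_integral_affine) (use \<rho> in auto)
  also have "\<dots> = (\<integral>\<^sup>+x. ennreal (\<bar>?\<rho>\<bar> ^ DIM('a)) * (heat t (0 + ?\<rho> *\<^sub>R x) * f (0 + ?\<rho> *\<^sub>R x)) \<partial>lborel)"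
    by (rule nn_integral_cmult[symmetric]) simp
  also have "\<dots> = (\<integral>\<^sup>+z. heat 1 z * f (?\<rho> *\<^sub>R z) \<partial>lborel)"
  proof (rule nn_integral_cong)
    fix x :: 'a
    have "t powr (- 1 / \<beta>) *\<^sub>R (?\<rho> *\<^sub>R x) = x"
      using t by (simp add: powr_add[symmetric])
    then have "stable_kernel \<beta> t (?\<rho> *\<^sub>R x) = t powr (- n / \<beta>) * stable_kernel \<beta> 1 x"
      using kernel_scale[OF beta(1) t, of "?\<rho> *\<^sub>R x"] by simp
    moreover have "\<bar>?\<rho>\<bar> ^ DIM('a) = t powr (n / \<beta>)"
      using \<rho> t by (simp add: powr_realpow[symmetric] powr_powr)
    moreover have "t powr (n / \<beta>) * t powr (- n / \<beta>) = 1"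
      unfolding powr_add[symmetric] using t by simp
    ultimately have "\<bar>?\<rho>\<bar> ^ DIM('a) * stable_kernel \<beta> t (?\<rho> *\<^sub>R x) = stable_kernel \<beta> 1 x"
      by (simp only: mult.assoc[symmetric] mult_1_left)
    then have "ennreal (\<bar>?\<rho>\<bar> ^ DIM('a)) * heat t (0 + ?\<rho> *\<^sub>R x) = heat 1 x"
      using t by (simp add: heat_def heat_real_def ennreal_mult'[symmetric])
    then show "ennreal (\<bar>?\<rho>\<bar> ^ DIM('a)) * (heat t (0 + ?\<rho> *\<^sub>R x) * f (0 + ?\<rho> *\<^sub>R x)) = heat 1 x * f (?\<rho> *\<^sub>R x)"
      by (simp add: mult.assoc[symmetric])
  qed
  finally show ?thesis .
qed

text \<open>The unit mass of the kernel puts \<open>v x\<close> under the integral, and scaling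
  turns the kernel into a fixed profile with dilation \<open>r k powr (1 / \<beta>)\<close>, an
  approximate identity.\<close>

lemma hom_real_tendsto_0:
  assumes [measurable]: "v \<in> borel_measurable borel" and v: "Lnorm_abs s v < top" and s: "1 \<le> s"
    and r: "r \<longlonglongrightarrow> 0" "\<And>k. 0 < r k"
  shows "(\<lambda>k. Lnorm lborel s (\<lambda>x. ennreal \<bar>hom_real v (r k) x - hom_real v 0 x\<bar>)) \<longlonglongrightarrow> 0"
proof -
  let ?w = "\<lambda>x. ennreal \<bar>v x\<bar>" and ?\<rho> = "\<lambda>k. r k powr (1 / \<beta>)"
  have "?\<rho> \<longlonglongrightarrow> 0 powr (1 / \<beta>)"
    using beta r by (intro tendsto_powr2 tendsto_const) (auto intro!: always_eventually less_imp_le)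
  then have \<rho>: "?\<rho> \<longlonglongrightarrow> 0" by simp
  have "(\<lambda>k. Lnorm lborel s (\<lambda>x. \<integral>\<^sup>+y. heat 1 y * ennreal \<bar>v (x - ?\<rho> k *\<^sub>R y) - v x\<bar> \<partial>lborel)) \<longlonglongrightarrow> 0"
    by (rule approximate_identity) (use v s \<rho> in \<open>auto simp: nn_integral_heat\<close>)
  then show ?thesis
  proof (rule tendsto_0_ennreal_le)
    show "\<forall>\<^sub>F k in sequentially. Lnorm lborel s (\<lambda>x. ennreal \<bar>hom_real v (r k) x - hom_real v 0 x\<bar>)
      \<le> Lnorm lborel s (\<lambda>x. \<integral>\<^sup>+y. heat 1 y * ennreal \<bar>v (x - ?\<rho> k *\<^sub>R y) - v x\<bar> \<partial>lborel)"
    proof (rule always_eventually, rule allI)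
      fix k
      note t = r(2)[of k]
      have "AE x in lborel. conv (heat (r k)) ?w x < top"
        by (rule conv_heat_finite_AE[OF _ v s]) simp
      then have "AE x in lborel. ennreal \<bar>hom_real v (r k) x - hom_real v 0 x\<bar> \<le> (\<integral>\<^sup>+y. heat 1 y * ennreal \<bar>v (x - ?\<rho> k *\<^sub>R y) - v x\<bar> \<partial>lborel)"
      proof eventually_elim
        case (elim x)
        have "(\<integral>y. heat_real (r k) (x - y) \<partial>lborel) = 1" "integrable lborel (\<lambda>y. heat_real (r k) (x - y))"
        proof -
          have N: "(\<integral>\<^sup>+y. ennreal (heat_real (r k) (x - y)) \<partial>lborel) = 1"
            using nn_integral_reflect[of "heat (r k)" x] nn_integral_heat[OF t] by (simp add: heat_def)
          show "integrable lborel (\<lambda>y. heat_real (r k) (x - y))"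
            using N heat_real_nonneg by (intro integrableI_bounded) auto
          show "(\<integral>y. heat_real (r k) (x - y) \<partial>lborel) = 1"
            using N heat_real_nonneg by (subst integral_eq_nn_integral) auto
        qed
        then have "hom_real v (r k) x - hom_real v 0 x = (\<integral>y. heat_real (r k) (x - y) * v y - heat_real (r k) (x - y) * v x \<partial>lborel)"
          using t elim by (simp add: hom_real_def integrable_heat_real_mult)
        then have "ennreal \<bar>hom_real v (r k) x - hom_real v 0 x\<bar> \<le> (\<integral>\<^sup>+y. ennreal \<bar>heat_real (r k) (x - y) * v y - heat_real (r k) (x - y) * v x\<bar> \<partial>lborel)"
          by (simp only: ennreal_abs_integral_le)
        also have "\<dots> = (\<integral>\<^sup>+y. heat (r k) (x - y) * ennreal \<bar>v (x - (x - y)) - v x\<bar> \<partial>lborel)"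
          unfolding heat_def using heat_real_nonneg
          by (intro nn_integral_cong) (simp add: ennreal_mult'[symmetric] abs_mult right_diff_distrib[symmetric])
        also have "\<dots> = (\<integral>\<^sup>+y. heat (r k) y * ennreal \<bar>v (x - y) - v x\<bar> \<partial>lborel)"
          by (rule nn_integral_reflect[where f="\<lambda>y. heat (r k) y * ennreal \<bar>v (x - y) - v x\<bar>"]) simp
        also have "\<dots> = (\<integral>\<^sup>+y. heat 1 y * ennreal \<bar>v (x - ?\<rho> k *\<^sub>R y) - v x\<bar> \<partial>lborel)"
          by (rule heat_scale[OF t]) simp
        finally show ?case .
      qed
      then show "Lnorm lborel s (\<lambda>x. ennreal \<bar>hom_real v (r k) x - hom_real v 0 x\<bar>)
        \<le> Lnorm lborel s (\<lambda>x. \<integral>\<^sup>+y. heat 1 y * ennreal \<bar>v (x - ?\<rho> k *\<^sub>R y) - v x\<bar> \<partial>lborel)"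
        using s by (intro Lnorm_mono_AE) auto
    qed
  qed
qed

end

section \<open>A priori bounds\<close>

context heat_equation
begin

lemma nonlin_split: "nonlin u \<tau> y = ennreal \<bar>u \<tau> y\<bar> * epow (ennreal \<bar>u \<tau> y\<bar>) (p - 1)"
proof -
  have "\<bar>u \<tau> y\<bar> powr p = \<bar>u \<tau> y\<bar> * \<bar>u \<tau> y\<bar> powr (p - 1)" by (cases "u \<tau> y = 0") (auto simp: powr_diff)
  then show ?thesis using p by (simp add: nonlin_def ennreal_mult')
qed

lemma epow_p_split: "epow x p = x * epow x (p - 1)"
  using epow_add[of x 1 "p - 1"] by simp

lemma volterra_mono:
  assumes "\<And>\<tau>. 0 < \<tau> \<Longrightarrow> \<tau> < t \<Longrightarrow> F \<tau> \<le> G \<tau>"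
  shows "(\<integral>\<^sup>+\<tau>. indicator {0..} \<tau> * (kern_weight a (t - \<tau>) * F \<tau>) \<partial>lborel)
    \<le> (\<integral>\<^sup>+\<tau>. indicator {0..} \<tau> * (kern_weight a (t - \<tau>) * G \<tau>) \<partial>lborel)"
proof (rule nn_integral_mono_AE)
  have "AE \<tau> in lborel. \<tau> \<noteq> (0::real)" by (rule AE_lborel_singleton)
  then show "AE \<tau> in lborel. indicator {0..} \<tau> * (kern_weight a (t - \<tau>) * F \<tau>) \<le> indicator {0..} \<tau> * (kern_weight a (t - \<tau>) * G \<tau>)"
  proof (rule eventually_mono)
    fix \<tau> :: real assume "\<tau> \<noteq> 0"
    then consider "\<tau> < 0" | "t \<le> \<tau>" | "0 < \<tau>" "\<tau> < t" by linarith
    then show "indicator {0..} \<tau> * (kern_weight a (t - \<tau>) * F \<tau>) \<le> indicator {0..} \<tau> * (kern_weight a (t - \<tau>) * G \<tau>)"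
      by cases (auto simp: kern_weight_def intro!: mult_left_mono assms)
  qed
qed

lemma duh_nonlin_le:
  assumes [measurable]: "jointly_measurable u"
    and a: "admissible a" and t: "0 \<le> t"
    and G: "\<And>\<tau>. 0 \<le> \<tau> \<Longrightarrow> \<tau> < t \<Longrightarrow> Lnorm lborel a (\<lambda>y. epow (ennreal \<bar>u \<tau> y\<bar>) (p - 1)) \<le> G"
    and M: "\<And>\<tau>. 0 \<le> \<tau> \<Longrightarrow> \<tau> < t \<Longrightarrow> AE y in lborel. ennreal \<bar>u \<tau> y\<bar> \<le> M"
  shows "duh (nonlin u) t x \<le> ennreal (kern_const a * t powr (1 - \<theta> a) / (1 - \<theta> a)) * (M * G)"
proof -
  have "duh (nonlin u) t x \<le> (\<integral>\<^sup>+\<tau>. indicator {0..} \<tau> * (kern_weight a (t - \<tau>) * (M * Lnorm lborel a (\<lambda>y. epow (ennreal \<bar>u \<tau> y\<bar>) (p - 1)))) \<partial>lborel)"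
    unfolding nonlin_split[abs_def] by (rule duh_le) (use a M in auto)
  also have "\<dots> \<le> (\<integral>\<^sup>+\<tau>. indicator {0..} \<tau> * (kern_weight a (t - \<tau>) * (M * G)) \<partial>lborel)"
    by (intro volterra_mono mult_left_mono G) auto
  also have "\<dots> = ennreal (kern_const a * t powr (1 - \<theta> a) / (1 - \<theta> a)) * (M * G)"
    by (rule volterra_const[OF a t])
  finally show ?thesis .
qed

lemma s_ge_1:
  assumes "admissible a" "0 < s" "1 / s + 1 / a < 1"
  shows "1 < s"
proof -
  have "0 < 1 / a" using assms(1) by (simp add: admissible_def)
  then have "1 / s < 1" using assms(3) by linarith
  then show ?thesis using assms(2) by (simp add: divide_less_eq)
qed

text \<open>The two terms of the integral equation are treated separately: the linear one by
  continuity of the semigroup, the Duhamel one by \<open>kern_modulus\<close> times uniform bounds.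
  Excluding \<open>r k = t\<close> makes all times positive when \<open>t = 0\<close>.\<close>

lemma solution_continuous:
  assumes [measurable]: "jointly_measurable u" "v \<in> borel_measurable borel"
    and v: "Lnorm_abs s v < top"
    and a: "admissible a" and s: "0 < s" "1 / s + 1 / a < 1"
    and W: "\<And>\<tau>. 0 \<le> \<tau> \<Longrightarrow> \<tau> < T \<Longrightarrow> Lnorm_abs s (u \<tau>) \<le> W" "W < top"
    and G: "\<And>\<tau>. 0 \<le> \<tau> \<Longrightarrow> \<tau> < T \<Longrightarrow> Lnorm lborel a (\<lambda>y. epow (ennreal \<bar>u \<tau> y\<bar>) (p - 1)) \<le> G" "G < top"
    and M: "\<And>\<tau>. 0 \<le> \<tau> \<Longrightarrow> \<tau> < T \<Longrightarrow> AE y in lborel. ennreal \<bar>u \<tau> y\<bar> \<le> M" "M < top"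
    and eq: "\<And>t. 0 \<le> t \<Longrightarrow> t < T \<Longrightarrow> AE x in lborel. u t x = hom_real v t x + enn2real (duh (nonlin u) t x)"
    and r: "r \<longlonglongrightarrow> t" "\<And>k::nat. 0 \<le> r k" "\<And>k. r k < T" "\<And>k. r k \<noteq> t" "0 \<le> t" "t < T"
  shows "(\<lambda>k. Lnorm lborel s (\<lambda>x. ennreal \<bar>u (r k) x - u t x\<bar>)) \<longlonglongrightarrow> 0"
proof -
  have s1: "1 \<le> s" using s_ge_1[OF a s] by simp
  let ?H = "\<lambda>k. Lnorm lborel s (\<lambda>x. ennreal \<bar>hom_real v (r k) x - hom_real v t x\<bar>)"
  let ?K = "\<lambda>k. kern_modulus a T \<bar>r k - t\<bar>"
  have fin: "duh (nonlin u) \<tau> x < top" if "0 \<le> \<tau>" "\<tau> < T" for \<tau> x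
    using order_le_less_trans[OF duh_nonlin_le[OF assms(1) a that(1) G(1) M(1)]] that G(2) M(2)
    by (auto simp: ennreal_mult_less_top)
  have H: "?H \<longlonglongrightarrow> 0"
  proof (cases "t = 0")
    case True
    have "0 < r k" for k using r(2)[of k] r(4)[of k] True by simp
    then show ?thesis using hom_real_tendsto_0[of v s r] v s1 r(1) True by simp
  next
    case False
    then show ?thesis by (intro hom_real_tendsto v s1 r) (use r(5) in auto)
  qed
  have K: "?K \<longlonglongrightarrow> 0"
  proof (rule kern_modulus_tendsto[OF a])
    show "(\<lambda>k. \<bar>r k - t\<bar>) \<longlonglongrightarrow> 0"
      using tendsto_rabs[OF tendsto_diff[OF r(1) tendsto_const[of t]]] by simp
  qed (use r(5,6) in auto)
  have "W * G < top" using W(2) G(2) by (simp add: ennreal_mult_less_top)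
  then have "(\<lambda>k. ?H k + (W * G) * ?K k) \<longlonglongrightarrow> 0 + 0"
    by (intro tendsto_add H tendsto_0_ennreal_cmult K)
  then have L: "(\<lambda>k. ?H k + (W * G) * ?K k) \<longlonglongrightarrow> 0" by simp
  show ?thesis
  proof (rule tendsto_0_ennreal_le[OF L], rule always_eventually, rule allI)
    fix k
    let ?t = "r k"
    have "AE x in lborel. ennreal \<bar>u ?t x - u t x\<bar> \<le> ennreal \<bar>hom_real v ?t x - hom_real v t x\<bar> + duh_diff (nonlin u) ?t t x"
      using eq[OF r(5,6)] eq[OF r(2,3)[of k]]
    proof eventually_elim
      case (elim x)
      have "ennreal \<bar>enn2real (duh (nonlin u) ?t x) - enn2real (duh (nonlin u) t x)\<bar> \<le> duh_diff (nonlin u) ?t t x"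
        using duh_le_duh_diff[of "nonlin u" ?t x t] duh_le_duh_diff[of "nonlin u" t x ?t]
        by (intro ennreal_enn2real_diff_le fin r) (auto simp: duh_diff_commute[of _ t ?t])
      moreover have "ennreal \<bar>u ?t x - u t x\<bar> \<le> ennreal \<bar>hom_real v ?t x - hom_real v t x\<bar> + ennreal \<bar>enn2real (duh (nonlin u) ?t x) - enn2real (duh (nonlin u) t x)\<bar>"
        unfolding elim by (simp add: ennreal_plus[symmetric] ennreal_leI del: ennreal_plus)
      ultimately show ?case by (meson add_left_mono order_trans)
    qed
    then have "Lnorm lborel s (\<lambda>x. ennreal \<bar>u ?t x - u t x\<bar>) \<le> Lnorm lborel s (\<lambda>x. ennreal \<bar>hom_real v ?t x - hom_real v t x\<bar> + duh_diff (nonlin u) ?t t x)"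
      by (intro Lnorm_mono_AE s)
    also have "\<dots> \<le> ?H k + Lnorm lborel s (duh_diff (nonlin u) ?t t)"
      unfolding duh_diff_def by (intro Lnorm_triangle sigma_finite_lborel s1) measurable
    also have "\<dots> \<le> ?H k + ?K k * (W * G)"
      unfolding nonlin_split[abs_def]
      by (intro add_left_mono Lnorm_duh_diff_le a s W G) (use r(3)[of k] r(6) in auto)
    finally show "Lnorm lborel s (\<lambda>x. ennreal \<bar>u ?t x - u t x\<bar>) \<le> ?H k + (W * G) * ?K k"
      by (simp add: mult.commute)
  qed
qed

context
  fixes v :: "'a \<Rightarrow> real"
  assumes v [measurable]: "v \<in> borel_measurable borel"
begin

lemmas majorant_joint [measurable] = majorant_measurable[OF v]
lemmas majorant_lim_joint [measurable] = majorant_lim_measurable[OF v]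

lemma Lnorm_majorant_lim_le:
  assumes "0 < s" "\<And>k. Lnorm lborel s (majorant v k t) \<le> B"
  shows "Lnorm lborel s (majorant_lim v t) \<le> B"
proof -
  have "Lnorm lborel s (majorant_lim v t) = (SUP k. Lnorm lborel s (majorant v k t))"
    unfolding majorant_lim_def
    by (rule Lnorm_SUP) (use assms incseq_majorant[OF v] in \<open>auto simp: incseq_def le_fun_def\<close>)
  then show ?thesis using assms by (auto intro: SUP_least)
qed

lemma majorant_lim_le_AE:
  assumes "\<And>k. AE x in lborel. majorant v k t x \<le> M"
  shows "AE x in lborel. majorant_lim v t x \<le> M"
proof -
  have "AE x in lborel. \<forall>k. majorant v k t x \<le> M" using assms by (simp add: AE_all_countable)
  then show ?thesis by (rule eventually_mono) (auto simp: majorant_lim_def intro: SUP_least)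
qed

lemma Lnorm_majorant_Suc_le:
  assumes a: "admissible a" and s: "0 < s" "1 / s + 1 / a < 1"
  shows "Lnorm lborel s (majorant v (Suc k) t) \<le> Lnorm lborel s (hom (\<lambda>x. ennreal \<bar>v x\<bar>) t)
    + (\<integral>\<^sup>+\<tau>. indicator {0..} \<tau> * (kern_weight a (t - \<tau>) * (Lnorm lborel s (majorant v k \<tau>) * Lnorm lborel a (\<lambda>y. epow (majorant v k \<tau> y) (p - 1)))) \<partial>lborel)"
proof -
  have s1: "1 \<le> s" using s_ge_1[OF a s] by simp
  have "Lnorm lborel s (majorant v (Suc k) t) \<le> Lnorm lborel s (hom (\<lambda>x. ennreal \<bar>v x\<bar>) t) + Lnorm lborel s (duh (\<lambda>\<tau> y. epow (majorant v k \<tau> y) p) t)"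
    unfolding majorant.simps(2) by (intro Lnorm_triangle sigma_finite_lborel s1) measurable
  also have "\<dots> \<le> Lnorm lborel s (hom (\<lambda>x. ennreal \<bar>v x\<bar>) t)
    + (\<integral>\<^sup>+\<tau>. indicator {0..} \<tau> * (kern_weight a (t - \<tau>) * (Lnorm lborel s (majorant v k \<tau>) * Lnorm lborel a (\<lambda>y. epow (majorant v k \<tau> y) (p - 1)))) \<partial>lborel)"
    unfolding epow_p_split by (intro add_left_mono Lnorm_duh_le a s) measurable
  finally show ?thesis .
qed

lemma majorant_Suc_le_AE:
  assumes a: "admissible a" and N: "AE x in lborel. ennreal \<bar>v x\<bar> \<le> N"
    and W: "\<And>\<tau>. 0 \<le> \<tau> \<Longrightarrow> \<tau> < t \<Longrightarrow> AE y in lborel. majorant v k \<tau> y \<le> W"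
  shows "AE x in lborel. majorant v (Suc k) t x \<le> N
    + (\<integral>\<^sup>+\<tau>. indicator {0..} \<tau> * (kern_weight a (t - \<tau>) * (W * Lnorm lborel a (\<lambda>y. epow (majorant v k \<tau> y) (p - 1)))) \<partial>lborel)"
proof -
  have "AE x in lborel. hom (\<lambda>x. ennreal \<bar>v x\<bar>) t x \<le> N" by (rule hom_le_AE) (use N in auto)
  then show ?thesis
  proof (rule eventually_mono)
    fix x assume h: "hom (\<lambda>x. ennreal \<bar>v x\<bar>) t x \<le> N"
    show "majorant v (Suc k) t x \<le> N
      + (\<integral>\<^sup>+\<tau>. indicator {0..} \<tau> * (kern_weight a (t - \<tau>) * (W * Lnorm lborel a (\<lambda>y. epow (majorant v k \<tau> y) (p - 1)))) \<partial>lborel)"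
      unfolding majorant.simps(2) epow_p_split by (intro add_mono h duh_le a W) auto
  qed
qed

text \<open>The iterates stay in the ball of radius \<open>2 * N\<close>: the data account for
  \<open>N\<close>, and up to time \<open>T\<close> the Duhamel term accounts for at most another
  \<open>N\<close>.\<close>

lemma majorant_local_bounds:
  assumes a: "admissible a" and s: "0 < s" "1 / s + 1 / a < 1" "s \<le> (p - 1) * a"
    and N: "0 < N" "Lnorm_abs s v \<le> ennreal N" "AE x in lborel. ennreal \<bar>v x\<bar> \<le> ennreal N"
  obtains T where "0 < T" "\<And>k t. 0 \<le> t \<Longrightarrow> t \<le> T \<Longrightarrow> Lnorm lborel s (majorant v k t) \<le> ennreal (2 * N)"
    "\<And>k t. 0 \<le> t \<Longrightarrow> t \<le> T \<Longrightarrow> AE x in lborel. majorant v k t x \<le> ennreal (2 * N)"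
proof -
  note th = theta_bounds[OF a] and C = kern_const_pos[OF a]
  have s1: "1 \<le> s" using s_ge_1[OF a s(1,2)] by simp
  have a1: "1 < a" using a by (simp add: admissible_def)
  define e where "e = 1 - \<theta> a"
  have e: "0 < e" using th by (simp add: e_def)
  define R where "R = 2 * N * (2 * N) powr (p - 1)"
  have R: "0 < R" using N by (simp add: R_def)
  \<comment> \<open>The time at which the kernel integral times \<open>R\<close>, the size of the
    nonlinearity on the ball of radius \<open>2 * N\<close>, equals \<open>N\<close>.\<close>
  define T where "T = (e * N / (kern_const a * R)) powr (1 / e)"
  have T: "0 < T" using e N C R by (simp add: T_def)
  have small: "ennreal (kern_const a * t powr e / e) * ennreal R \<le> ennreal N" if "0 \<le> t" "t \<le> T" for t
  proof -
    have "t powr e \<le> T powr e" using that e by (intro powr_mono2) auto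
    also have "\<dots> = e * N / (kern_const a * R)" using e N C R by (simp add: T_def powr_powr)
    finally have "kern_const a * t powr e / e * R \<le> kern_const a * (e * N / (kern_const a * R)) / e * R"
      using C R e by (intro mult_right_mono divide_right_mono mult_left_mono) auto
    also have "\<dots> = N" using C R e by (simp add: field_simps)
    finally show ?thesis using R C e by (simp add: ennreal_mult'[symmetric] ennreal_leI)
  qed
  have g: "Lnorm lborel a (\<lambda>y. epow (V y) (p - 1)) \<le> ennreal ((2 * N) powr (p - 1))"
    if [measurable]: "V \<in> borel_measurable borel" and V: "AE y in lborel. V y \<le> ennreal (2 * N)" "Lnorm lborel s V \<le> ennreal (2 * N)" for V :: "'a \<Rightarrow> ennreal"
  proof -
    have "Lnorm lborel a (\<lambda>y. epow (V y) (p - 1)) \<le> ennreal ((2 * N) powr (p - 1 - s / a) * (2 * N) powr (s / a))"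
      by (rule Lnorm_power_le) (use V N s a1 in auto)
    then show ?thesis using N by (simp add: powr_add[symmetric])
  qed
  have "Lnorm lborel s (majorant v k t) \<le> ennreal (2 * N) \<and> (AE x in lborel. majorant v k t x \<le> ennreal (2 * N))" if "0 \<le> t" "t \<le> T" for k t
    using that
  proof (induction k arbitrary: t)
    case 0
    then show ?case using s by (simp add: Lnorm_def)
  next
    case (Suc k)
    have IH: "Lnorm lborel s (majorant v k \<tau>) \<le> ennreal (2 * N)" "AE x in lborel. majorant v k \<tau> x \<le> ennreal (2 * N)"
      "Lnorm lborel a (\<lambda>y. epow (majorant v k \<tau> y) (p - 1)) \<le> ennreal ((2 * N) powr (p - 1))" if "0 \<le> \<tau>" "\<tau> < t" for \<tau>
      using Suc.IH[of \<tau>] that Suc.prems by (auto intro!: g)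
    have int: "(\<integral>\<^sup>+\<tau>. indicator {0..} \<tau> * (kern_weight a (t - \<tau>) * (ennreal (2 * N) * ennreal ((2 * N) powr (p - 1)))) \<partial>lborel) \<le> ennreal N"
      using small[OF Suc.prems] volterra_const[OF a Suc.prems(1), of "ennreal R"] N
      by (simp add: R_def e_def ennreal_mult'[symmetric] mult.assoc)
    have 2: "ennreal N + ennreal N = ennreal (2 * N)" using N by (simp add: ennreal_plus[symmetric] del: ennreal_plus)
    have "Lnorm lborel s (majorant v (Suc k) t) \<le> Lnorm_abs s v
      + (\<integral>\<^sup>+\<tau>. indicator {0..} \<tau> * (kern_weight a (t - \<tau>) * (ennreal (2 * N) * ennreal ((2 * N) powr (p - 1)))) \<partial>lborel)"
      by (intro order_trans[OF Lnorm_majorant_Suc_le[OF a s(1,2)]] add_mono Lnorm_hom_le s1 volterra_mono mult_mono IH) auto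
    also have "\<dots> \<le> ennreal N + ennreal N" by (intro add_mono N int)
    finally have 1: "Lnorm lborel s (majorant v (Suc k) t) \<le> ennreal (2 * N)" unfolding 2 .
    have "AE x in lborel. majorant v (Suc k) t x \<le> ennreal N
      + (\<integral>\<^sup>+\<tau>. indicator {0..} \<tau> * (kern_weight a (t - \<tau>) * (ennreal (2 * N) * Lnorm lborel a (\<lambda>y. epow (majorant v k \<tau> y) (p - 1)))) \<partial>lborel)"
      by (rule majorant_Suc_le_AE[OF a N(3) IH(2)])
    moreover have "(\<integral>\<^sup>+\<tau>. indicator {0..} \<tau> * (kern_weight a (t - \<tau>) * (ennreal (2 * N) * Lnorm lborel a (\<lambda>y. epow (majorant v k \<tau> y) (p - 1)))) \<partial>lborel) \<le> ennreal N"
      by (rule order_trans[OF volterra_mono int]) (intro mult_left_mono IH, auto)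
    ultimately have "AE x in lborel. majorant v (Suc k) t x \<le> ennreal (2 * N)"
      unfolding 2[symmetric] by (auto elim!: eventually_mono intro: order_trans[OF _ add_left_mono])
    with 1 show ?case by blast
  qed
  with T show ?thesis by (intro that[of T]) auto
qed

text \<open>Young's inequality with the heat kernel in the space with exponent \<open>b\<close>,
  where \<open>1 - 1/b = 1/q - 1/r\<close>.\<close>

lemma Lnorm_hom_decay:
  assumes q: "1 < q" "q < r"
  shows "0 < t \<Longrightarrow> Lnorm lborel r (hom (\<lambda>x. ennreal \<bar>v x\<bar>) t)
    \<le> ennreal (stable_kernel \<beta> 1 (0::'a) powr (1 / q - 1 / r) * t powr (- n / \<beta> * (1 / q - 1 / r))) * Lnorm_abs q v"
proof -
  assume t: "0 < t"
  define b where "b = 1 / (1 + 1 / r - 1 / q)"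
  have i: "1 / q < 1" "0 < 1 / r" "1 / r < 1 / q" using q by (auto simp: frac_less2)
  have d: "0 < 1 + 1 / r - 1 / q" "1 + 1 / r - 1 / q < 1" using i by linarith+
  have b: "1 / b = 1 + 1 / r - 1 / q" "0 < b" "1 < b" using d by (auto simp: b_def)
  have e: "1 - 1 / b = 1 / q - 1 / r" unfolding b(1) by simp
  have "Lnorm lborel r (conv (heat t) (\<lambda>x. ennreal \<bar>v x\<bar>)) \<le> Lnorm lborel b (heat t) * Lnorm_abs q v"
    by (rule Lnorm_conv_Young) (use q b in auto)
  also have "\<dots> \<le> ennreal (stable_kernel \<beta> 1 (0::'a) powr (1 - 1 / b) * t powr (- n / \<beta> * (1 - 1 / b))) * Lnorm_abs q v"
    by (intro mult_right_mono Lnorm_heat_le b t) auto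
  finally show ?thesis using t unfolding e by (simp add: hom_def[abs_def])
qed

text \<open>In the next two lemmas \<open>r\<close> is the auxiliary exponent and \<open>t\<^sup>-\<^sup>\<kappa>\<close> the decay of the scale-invariant
  norm; the relation between \<open>\<kappa>\<close> and \<open>\<theta>\<close> expresses that the equation is critical in \<open>L\<^sup>q\<close>.\<close>

lemma majorant_decay:
  assumes a: "admissible a" "a = r / (p - 1)" and r: "p < r" and q: "1 < q" "q < r"
    and kap: "\<kappa> = n / \<beta> * (1 / q - 1 / r)" "\<theta> a + \<kappa> * (p - 1) = 1"
    and B: "\<And>t. 0 < t \<Longrightarrow> (\<integral>\<^sup>+\<tau>. indicator {0..} \<tau> * (kern_weight a (t - \<tau>) * ennreal (\<tau> powr (- (\<kappa> * p)))) \<partial>lborel)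
      \<le> ennreal (B * t powr (1 - \<theta> a - \<kappa> * p))" "0 < B"
    and M: "0 < M" "M powr (p - 1) * B \<le> 1 / 2"
    and eps: "Lnorm_abs q v \<le> ennreal \<epsilon>" "0 \<le> \<epsilon>" "2 * stable_kernel \<beta> 1 (0::'a) powr (1 / q - 1 / r) * \<epsilon> \<le> M"
    and t: "0 < t"
  shows "Lnorm lborel r (majorant v k t) \<le> ennreal (M * t powr (- \<kappa>))"
  using t
proof (induction k arbitrary: t)
  case 0
  have "0 < r" using r p by simp
  then show ?case by (simp add: Lnorm_def)
next
  case (Suc k)
  have r0: "0 < r" using r p by simp
  have ra: "1 / r + 1 / a < 1"
  proof -
    have "1 / r + 1 / a = p / r" using p by (simp add: a(2) add_divide_distrib[symmetric])
    then show ?thesis using r r0 by simp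
  qed
  have ar: "(p - 1) * a = r" "0 < a" using a(2) p r0 by auto
  have ga: "Lnorm lborel a (\<lambda>y. epow (V y) (p - 1)) = epow (Lnorm lborel r V) (p - 1)" for V :: "'a \<Rightarrow> ennreal"
    using p ar by (simp add: Lnorm_epow)
  have step: "Lnorm lborel r (majorant v k \<tau>) * Lnorm lborel a (\<lambda>y. epow (majorant v k \<tau> y) (p - 1)) \<le> ennreal (M powr p) * ennreal (\<tau> powr (- (\<kappa> * p)))"
    if "0 < \<tau>" for \<tau>
  proof -
    have "Lnorm lborel r (majorant v k \<tau>) * Lnorm lborel a (\<lambda>y. epow (majorant v k \<tau> y) (p - 1)) = epow (Lnorm lborel r (majorant v k \<tau>)) p"
      unfolding ga by (rule epow_p_split[symmetric])
    also have "\<dots> \<le> epow (ennreal (M * \<tau> powr (- \<kappa>))) p" using p by (intro epow_mono Suc.IH that) auto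
    also have "\<dots> = ennreal (M powr p) * ennreal (\<tau> powr (- (\<kappa> * p)))"
    proof -
      have "epow (ennreal (M * \<tau> powr (- \<kappa>))) p = ennreal ((M * \<tau> powr (- \<kappa>)) powr p)" using M p by (intro epow_ennreal) auto
      then show ?thesis using M that by (simp add: powr_mult powr_powr ennreal_mult)
    qed
    finally show ?thesis .
  qed
  have "Lnorm lborel r (majorant v (Suc k) t) \<le> Lnorm lborel r (hom (\<lambda>x. ennreal \<bar>v x\<bar>) t)
      + (\<integral>\<^sup>+\<tau>. indicator {0..} \<tau> * (kern_weight a (t - \<tau>) * (ennreal (M powr p) * ennreal (\<tau> powr (- (\<kappa> * p))))) \<partial>lborel)"
    by (intro order_trans[OF Lnorm_majorant_Suc_le[OF a(1) r0 ra]] add_left_mono volterra_mono step)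
  also have "(\<integral>\<^sup>+\<tau>. indicator {0..} \<tau> * (kern_weight a (t - \<tau>) * (ennreal (M powr p) * ennreal (\<tau> powr (- (\<kappa> * p))))) \<partial>lborel)
      = ennreal (M powr p) * (\<integral>\<^sup>+\<tau>. indicator {0..} \<tau> * (kern_weight a (t - \<tau>) * ennreal (\<tau> powr (- (\<kappa> * p)))) \<partial>lborel)"
    by (subst nn_integral_cmult[symmetric]) (auto simp: mult_ac)
  also have "\<dots> \<le> ennreal (M powr p) * ennreal (B * t powr (1 - \<theta> a - \<kappa> * p))"
    by (intro mult_left_mono B Suc.prems) auto
  \<comment> \<open>Criticality reproduces the rate of the induction hypothesis. The choice of
    \<open>M\<close> then leaves at most half of the bound to the Duhamel term, and smallness of the
    data provides the other half.\<close>
  also have "1 - \<theta> a - \<kappa> * p = - \<kappa>" using kap(2) by (simp add: algebra_simps)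
  also have "ennreal (M powr p) * ennreal (B * t powr - \<kappa>) \<le> ennreal (M / 2 * t powr - \<kappa>)"
  proof -
    have "M powr p = M * M powr (p - 1)" using M by (simp add: powr_diff)
    then have "M powr p * B \<le> M * (1 / 2)" using mult_left_mono[OF M(2), of M] M(1) by simp
    from mult_right_mono[OF this, of "t powr - \<kappa>"] show ?thesis
      using B(2) by (simp add: ennreal_mult'[symmetric] ennreal_leI mult.assoc)
  qed
  also have "Lnorm lborel r (hom (\<lambda>x. ennreal \<bar>v x\<bar>) t) \<le> ennreal (M / 2 * t powr - \<kappa>)"
  proof -
    let ?S = "stable_kernel \<beta> 1 (0::'a) powr (1 / q - 1 / r)"
    have "Lnorm lborel r (hom (\<lambda>x. ennreal \<bar>v x\<bar>) t) \<le> ennreal (?S * t powr (- n / \<beta> * (1 / q - 1 / r))) * ennreal \<epsilon>"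
      by (rule order_trans[OF Lnorm_hom_decay[OF q Suc.prems] mult_left_mono[OF eps(1)]]) simp
    also have "\<dots> = ennreal (?S * \<epsilon> * t powr (- \<kappa>))"
      using eps(2) by (simp add: kap(1) ennreal_mult'[symmetric] mult_ac)
    also have "\<dots> \<le> ennreal (M / 2 * t powr - \<kappa>)"
      using eps(3) by (intro ennreal_leI mult_right_mono) auto
    finally show ?thesis .
  qed
  finally show ?case using M by (simp add: ennreal_plus[symmetric] del: ennreal_plus)
qed

lemma majorant_global_bounds:
  assumes a: "admissible a" "a = r / (p - 1)" and r: "p < r" and kap: "\<theta> a + \<kappa> * (p - 1) = 1"
    and B: "\<And>t. 0 < t \<Longrightarrow> (\<integral>\<^sup>+\<tau>. indicator {0..} \<tau> * (kern_weight a (t - \<tau>) * ennreal (\<tau> powr (- (\<kappa> * (p - 1))))) \<partial>lborel)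
      \<le> ennreal (B * t powr (1 - \<theta> a - \<kappa> * (p - 1)))" "0 < B"
    and M: "0 < M" "M powr (p - 1) * B \<le> 1 / 2"
    and dec: "\<And>k t. 0 < t \<Longrightarrow> Lnorm lborel r (majorant v k t) \<le> ennreal (M * t powr (- \<kappa>))"
    and N: "0 < N" "AE x in lborel. ennreal \<bar>v x\<bar> \<le> ennreal N" "Lnorm_abs r v \<le> ennreal N"
    and t: "0 \<le> t"
  shows "(AE x in lborel. majorant v k t x \<le> ennreal (2 * N)) \<and> Lnorm lborel r (majorant v k t) \<le> ennreal (2 * N)"
  using t
proof (induction k arbitrary: t)
  case 0
  have "0 < r" using r p by simp
  then show ?case by (simp add: Lnorm_def)
next
  case (Suc k)
  have r0: "0 < r" using r p by simp
  have ra: "1 / r + 1 / a < 1"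
  proof -
    have "1 / r + 1 / a = p / r" using p by (simp add: a(2) add_divide_distrib[symmetric])
    then show ?thesis using r r0 by simp
  qed
  have r1: "1 \<le> r" using r p by simp
  have ar: "(p - 1) * a = r" "0 < a" using a(2) p r0 by auto
  have ga: "Lnorm lborel a (\<lambda>y. epow (V y) (p - 1)) = epow (Lnorm lborel r V) (p - 1)" for V :: "'a \<Rightarrow> ennreal"
    using p ar by (simp add: Lnorm_epow)
  have g: "Lnorm lborel a (\<lambda>y. epow (majorant v k \<tau> y) (p - 1)) \<le> ennreal (M powr (p - 1)) * ennreal (\<tau> powr (- (\<kappa> * (p - 1))))"
    if "0 < \<tau>" for \<tau>
  proof -
    have "Lnorm lborel a (\<lambda>y. epow (majorant v k \<tau> y) (p - 1)) \<le> epow (ennreal (M * \<tau> powr (- \<kappa>))) (p - 1)"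
      unfolding ga using p by (intro epow_mono dec that) auto
    also have "\<dots> = ennreal (M powr (p - 1)) * ennreal (\<tau> powr (- (\<kappa> * (p - 1))))"
    proof -
      have "epow (ennreal (M * \<tau> powr (- \<kappa>))) (p - 1) = ennreal ((M * \<tau> powr (- \<kappa>)) powr (p - 1))" using M p by (intro epow_ennreal) auto
      then show ?thesis using M that by (simp add: powr_mult powr_powr ennreal_mult)
    qed
    finally show ?thesis .
  qed
  have int: "(\<integral>\<^sup>+\<tau>. indicator {0..} \<tau> * (kern_weight a (t - \<tau>) * (ennreal (2 * N) * (ennreal (M powr (p - 1)) * ennreal (\<tau> powr (- (\<kappa> * (p - 1))))))) \<partial>lborel) \<le> ennreal N"
  proof (cases "t = 0")
    case True
    have "indicator {0..} \<tau> * (kern_weight a (t - \<tau>) * c) = 0" for \<tau> c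
      using True by (auto simp: kern_weight_def indicator_def)
    then show ?thesis by (simp only: nn_integral_const) simp
  next
    case False
    then have t: "0 < t" using Suc.prems by simp
    have "(\<integral>\<^sup>+\<tau>. indicator {0..} \<tau> * (kern_weight a (t - \<tau>) * (ennreal (2 * N) * (ennreal (M powr (p - 1)) * ennreal (\<tau> powr (- (\<kappa> * (p - 1))))))) \<partial>lborel)
      = ennreal (2 * N * M powr (p - 1)) * (\<integral>\<^sup>+\<tau>. indicator {0..} \<tau> * (kern_weight a (t - \<tau>) * ennreal (\<tau> powr (- (\<kappa> * (p - 1))))) \<partial>lborel)"
      using N by (subst nn_integral_cmult[symmetric]) (auto simp: ennreal_mult' mult_ac)
    also have "\<dots> \<le> ennreal (2 * N * M powr (p - 1)) * ennreal (B * t powr (1 - \<theta> a - \<kappa> * (p - 1)))"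
      by (intro mult_left_mono B t) auto
    \<comment> \<open>Criticality cancels the power of \<open>t\<close>, so the bound is uniform
      over all times.\<close>
    also have "1 - \<theta> a - \<kappa> * (p - 1) = 0" using kap by simp
    also have "ennreal (2 * N * M powr (p - 1)) * ennreal (B * t powr 0) = ennreal (2 * N * (M powr (p - 1) * B))"
      using t N B(2) by (simp add: ennreal_mult'[symmetric] mult.assoc)
    also have "\<dots> \<le> ennreal (2 * N * (1 / 2))" using M(2) N by (intro ennreal_leI mult_left_mono) auto
    finally show ?thesis by simp
  qed
  have 2: "ennreal N + ennreal N = ennreal (2 * N)" using N by (simp add: ennreal_plus[symmetric] del: ennreal_plus)
  have IH: "AE x in lborel. majorant v k \<tau> x \<le> ennreal (2 * N)" "Lnorm lborel r (majorant v k \<tau>) \<le> ennreal (2 * N)" if "0 \<le> \<tau>" for \<tau>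
    using Suc.IH[OF that] by auto
  have "AE x in lborel. majorant v (Suc k) t x \<le> ennreal N
    + (\<integral>\<^sup>+\<tau>. indicator {0..} \<tau> * (kern_weight a (t - \<tau>) * (ennreal (2 * N) * Lnorm lborel a (\<lambda>y. epow (majorant v k \<tau> y) (p - 1)))) \<partial>lborel)"
    by (rule majorant_Suc_le_AE[OF a(1) N(2) IH(1)])
  moreover have "(\<integral>\<^sup>+\<tau>. indicator {0..} \<tau> * (kern_weight a (t - \<tau>) * (ennreal (2 * N) * Lnorm lborel a (\<lambda>y. epow (majorant v k \<tau> y) (p - 1)))) \<partial>lborel) \<le> ennreal N"
    by (rule order_trans[OF volterra_mono int]) (intro mult_left_mono g, auto)
  ultimately have 1: "AE x in lborel. majorant v (Suc k) t x \<le> ennreal (2 * N)"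
    unfolding 2[symmetric] by (auto elim!: eventually_mono intro: order_trans[OF _ add_left_mono])
  have "Lnorm lborel r (majorant v (Suc k) t) \<le> Lnorm_abs r v
    + (\<integral>\<^sup>+\<tau>. indicator {0..} \<tau> * (kern_weight a (t - \<tau>) * (ennreal (2 * N) * (ennreal (M powr (p - 1)) * ennreal (\<tau> powr (- (\<kappa> * (p - 1))))))) \<partial>lborel)"
    by (intro order_trans[OF Lnorm_majorant_Suc_le[OF a(1) r0 ra]] add_mono Lnorm_hom_le r1 volterra_mono mult_mono IH g) auto
  also have "\<dots> \<le> ennreal N + ennreal N" by (intro add_mono N int)
  finally have "Lnorm lborel r (majorant v (Suc k) t) \<le> ennreal (2 * N)" unfolding 2 .
  with 1 show ?case by blast
qed

text \<open>With the coefficient bounded by \<open>G\<close> for all times, the recursion for the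
  norm is linear. Exponential growth is acceptable, because for this norm only bounds on compact
  time intervals are needed.\<close>

lemma majorant_exp_bound:
  assumes a: "admissible a" and s: "0 < s" "1 / s + 1 / a < 1"
    and N: "0 \<le> N" "Lnorm_abs s v \<le> ennreal N"
    and G: "\<And>k \<tau>. 0 \<le> \<tau> \<Longrightarrow> Lnorm lborel a (\<lambda>y. epow (majorant v k \<tau> y) (p - 1)) \<le> ennreal G" "0 \<le> G"
  obtains l where "0 < l" "\<And>k t. 0 \<le> t \<Longrightarrow> Lnorm lborel s (majorant v k t) \<le> ennreal (2 * N * exp (l * t))"
proof -
  \<comment> \<open>Makes the Volterra term at most half of the exponential bound;
    \<open>G + 1\<close> avoids division by zero.\<close>
  define K where "K = 1 / (2 * (G + 1))"
  have K: "0 < K" "G * K \<le> 1 / 2" using G(2) by (auto simp: K_def field_simps)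
  obtain l where l: "0 < l" "(\<integral>\<^sup>+s. kern_weight a s * ennreal (exp (- l * s)) \<partial>lborel) \<le> ennreal K"
    using kern_weight_exp_small[OF a K(1)] by blast
  have s1: "1 \<le> s" using s_ge_1[OF a s] by simp
  have "Lnorm lborel s (majorant v k t) \<le> ennreal (2 * N * exp (l * t))" if "0 \<le> t" for k t
    using that
  proof (induction k arbitrary: t)
    case 0
    then show ?case using s by (simp add: Lnorm_def)
  next
    case (Suc k)
    have "Lnorm lborel s (majorant v (Suc k) t) \<le> Lnorm_abs s v
      + (\<integral>\<^sup>+\<tau>. indicator {0..} \<tau> * (kern_weight a (t - \<tau>) * (ennreal (2 * N * exp (l * \<tau>)) * ennreal G)) \<partial>lborel)"
      by (intro order_trans[OF Lnorm_majorant_Suc_le[OF a s]] add_mono Lnorm_hom_le s1 volterra_mono mult_mono Suc.IH G) auto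
    also have "(\<integral>\<^sup>+\<tau>. indicator {0..} \<tau> * (kern_weight a (t - \<tau>) * (ennreal (2 * N * exp (l * \<tau>)) * ennreal G)) \<partial>lborel)
      = ennreal (2 * N * G) * (\<integral>\<^sup>+\<tau>. indicator {0..} \<tau> * (kern_weight a (t - \<tau>) * ennreal (exp (l * \<tau>))) \<partial>lborel)"
      using N G(2) by (subst nn_integral_cmult[symmetric]) (auto simp: ennreal_mult' mult_ac)
    also have "\<dots> \<le> ennreal (2 * N * G) * (ennreal K * ennreal (exp (l * t)))"
      by (intro mult_left_mono volterra_exp l) auto
    also have "\<dots> = ennreal (2 * N * (G * K) * exp (l * t))"
      using N G(2) K by (simp add: ennreal_mult'[symmetric] mult_ac)
    also have "\<dots> \<le> ennreal (2 * N * (1 / 2) * exp (l * t))"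
      using K N by (intro ennreal_leI mult_right_mono mult_left_mono) auto
    also have "Lnorm_abs s v \<le> ennreal (N * exp (l * t))"
    proof -
      have "N * 1 \<le> N * exp (l * t)" using N l Suc.prems by (intro mult_left_mono) auto
      then show ?thesis using N(2) by (simp add: order_trans ennreal_leI)
    qed
    finally show ?case using N by (simp add: ennreal_plus[symmetric] mult.assoc del: ennreal_plus majorant.simps)
  qed
  with l(1) show ?thesis by (rule that)
qed

end

end

section \<open>Existence, uniqueness and continuation\<close>

lemma powr_diff_le_nonneg:
  fixes x y p :: real
  assumes "1 \<le> p" "0 \<le> x" "x \<le> y"
  shows "y powr p - x powr p \<le> p * (y - x) * y powr (p - 1)"
proof (cases "x = 0 \<or> x = y")
  case True
  have "y powr p \<le> p * (y * y powr (p - 1))"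
  proof (cases "y = 0")
    case False
    then have "y * y powr (p - 1) = y powr p" using assms by (simp add: powr_diff)
    then show ?thesis using assms by (simp add: mult_le_cancel_right1)
  qed simp
  with True show ?thesis by (auto simp: mult.assoc)
next
  case False
  then have xy: "0 < x" "x < y" using assms by auto
  obtain z where z: "x < z" "z < y" "y powr p - x powr p = (y - x) * (p * z powr (p - 1))"
  proof -
    have "((\<lambda>z. z powr p) has_real_derivative p * z powr (p - 1)) (at z)" if "x \<le> z" for z
      using that xy by (intro has_real_derivative_powr) simp
    then show ?thesis using MVT2[of x y "\<lambda>z. z powr p" "\<lambda>z. p * z powr (p - 1)"] xy that by blast
  qed
  have "z powr (p - 1) \<le> y powr (p - 1)" using z xy assms by (intro powr_mono2) auto
  then have "(y - x) * (p * z powr (p - 1)) \<le> (y - x) * (p * y powr (p - 1))"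
    using xy assms by (intro mult_left_mono) auto
  then show ?thesis using z(3) by (simp add: mult_ac)
qed

lemma abs_powr_diff_Lipschitz:
  fixes a b p :: real
  assumes p: "1 \<le> p"
  shows "\<bar>\<bar>a\<bar> powr p - \<bar>b\<bar> powr p\<bar> \<le> \<bar>a - b\<bar> * (p * (\<bar>a\<bar> powr (p - 1) + \<bar>b\<bar> powr (p - 1)))"
proof -
  have *: "\<bar>\<bar>a\<bar> powr p - \<bar>b\<bar> powr p\<bar> \<le> \<bar>a - b\<bar> * (p * (\<bar>a\<bar> powr (p - 1) + \<bar>b\<bar> powr (p - 1)))" if "\<bar>b\<bar> \<le> \<bar>a\<bar>" for a b :: real
  proof -
    have "\<bar>b\<bar> powr p \<le> \<bar>a\<bar> powr p" using that p by (intro powr_mono2) auto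
    then have "\<bar>\<bar>a\<bar> powr p - \<bar>b\<bar> powr p\<bar> \<le> (\<bar>a\<bar> - \<bar>b\<bar>) * (p * \<bar>a\<bar> powr (p - 1))"
      using powr_diff_le_nonneg[OF p, of "\<bar>b\<bar>" "\<bar>a\<bar>"] that by (simp add: mult_ac)
    also have "\<dots> \<le> \<bar>a - b\<bar> * (p * (\<bar>a\<bar> powr (p - 1) + \<bar>b\<bar> powr (p - 1)))"
      using p that by (intro mult_mono) auto
    finally show ?thesis .
  qed
  show ?thesis using *[of a b] *[of b a] by (cases "\<bar>b\<bar> \<le> \<bar>a\<bar>") (auto simp: abs_minus_commute add.commute)
qed

context heat_equation
begin

text \<open>The working notion of solution: jointly measurable, with bounds at every time of a
  compact interval rather than almost every time, and with the Duhamel term as a nonnegative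
  integral.\<close>

definition solves :: "real \<Rightarrow> ('a \<Rightarrow> real) \<Rightarrow> ereal \<Rightarrow> (real \<Rightarrow> 'a \<Rightarrow> real) \<Rightarrow> bool" where
  "solves s v T u \<longleftrightarrow> jointly_measurable u \<and>
    (\<forall>T'. 0 \<le> T' \<and> ereal T' < T \<longrightarrow> (\<exists>N. \<forall>t\<in>{0..T'}.
      Lnorm_abs s (u t) \<le> ennreal N \<and> (AE x in lborel. ennreal \<bar>u t x\<bar> \<le> ennreal N))) \<and>
    (\<forall>t. 0 \<le> t \<and> ereal t < T \<longrightarrow> (AE x in lborel. u t x = hom_real v t x + enn2real (duh (nonlin u) t x)))"

text \<open>The first three conditions make the bilinear estimate in exponent \<open>s\<close>
  available. The last one places the power \<open>p - 1\<close> of a bounded function with finite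
  \<open>s\<close>-norm into the space with exponent \<open>a\<close>.\<close>

definition compatible :: "real \<Rightarrow> real \<Rightarrow> bool" where
  "compatible s a \<longleftrightarrow> admissible a \<and> 0 < s \<and> 1 / s + 1 / a < 1 \<and> s \<le> (p - 1) * a"

lemma compatibleD:
  assumes "compatible s a"
  shows "admissible a" "0 < s" "1 / s + 1 / a < 1" "s \<le> (p - 1) * a" "1 < a" "1 < s"
  using assms s_ge_1[of a s] by (auto simp: compatible_def admissible_def)

text \<open>The value \<open>1 / a\<close> has to lie above \<open>\<alpha> / n\<close> and below
  \<open>(\<alpha> + \<beta>) / n\<close>, \<open>1 - 1 / s\<close> and \<open>(p - 1) / s\<close>.
  The two hypotheses on \<open>s\<close> say that the last two bounds exceed
  \<open>\<alpha> / n\<close>.\<close>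

lemma compatible_exists:
  assumes s: "n / (n - \<alpha>) < s" "s < n * (p - 1) / \<alpha>"
  obtains a where "compatible s a"
proof -
  have n: "0 < n" "0 < n - \<alpha>" "0 < \<alpha>" using alpha by auto
  have s0: "0 < s" using s(1) n by (smt (verit) divide_pos_pos)
  have "\<alpha> / n < (\<alpha> + \<beta>) / n" using n beta by (simp add: divide_strict_right_mono)
  moreover have "\<alpha> / n < 1 - 1 / s" using s(1) n s0 by (simp add: field_simps)
  moreover have "\<alpha> / n < (p - 1) / s" using s(2) n s0 by (simp add: field_simps)
  ultimately have "\<alpha> / n < min ((\<alpha> + \<beta>) / n) (min (1 - 1 / s) ((p - 1) / s))" by simp
  then obtain c where "\<alpha> / n < c" "c < min ((\<alpha> + \<beta>) / n) (min (1 - 1 / s) ((p - 1) / s))"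
    using dense by blast
  then have c: "\<alpha> / n < c" "c < (\<alpha> + \<beta>) / n" "c < 1 - 1 / s" "c < (p - 1) / s" by auto
  have "0 < \<alpha> / n" using n by simp
  then have c0: "0 < c" using c by linarith
  have "c < 1" using c(3) s0 by (smt (verit) divide_pos_pos)
  then have "compatible s (1 / c)"
    using c c0 s0 by (auto simp: compatible_def admissible_def field_simps)
  then show ?thesis by (rule that)
qed

lemma Lnorm_power_le_compatible:
  assumes sa: "compatible s a" and [measurable]: "w \<in> borel_measurable borel"
    and N: "0 < N" "Lnorm lborel s w \<le> ennreal N" "AE x in lborel. w x \<le> ennreal N"
  shows "Lnorm lborel a (\<lambda>y. epow (w y) (p - 1)) \<le> ennreal (N powr (p - 1))"
proof -
  note c = compatibleD[OF sa]
  have "Lnorm lborel a (\<lambda>y. epow (w y) (p - 1)) \<le> ennreal (N powr (p - 1 - s / a) * N powr (s / a))"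
    by (rule Lnorm_power_le) (use N c in auto)
  then show ?thesis using N by (simp add: powr_add[symmetric])
qed

lemma solves_measurable:
  "solves s v T u \<Longrightarrow> jointly_measurable u"
  by (simp add: solves_def)

lemma solves_eq:
  "solves s v T u \<Longrightarrow> 0 \<le> t \<Longrightarrow> ereal t < T \<Longrightarrow> AE x in lborel. u t x = hom_real v t x + enn2real (duh (nonlin u) t x)"
  by (simp add: solves_def)

lemma solves_bounds:
  assumes "solves s v T u" "0 \<le> T'" "ereal T' < T"
  obtains N where "0 < N" "\<And>t. 0 \<le> t \<Longrightarrow> t \<le> T' \<Longrightarrow> Lnorm_abs s (u t) \<le> ennreal N"
    "\<And>t. 0 \<le> t \<Longrightarrow> t \<le> T' \<Longrightarrow> AE x in lborel. ennreal \<bar>u t x\<bar> \<le> ennreal N"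
proof -
  obtain N where N: "\<forall>t\<in>{0..T'}. Lnorm_abs s (u t) \<le> ennreal N \<and> (AE x in lborel. ennreal \<bar>u t x\<bar> \<le> ennreal N)"
    using assms unfolding solves_def by blast
  have le: "ennreal N \<le> ennreal (max N 1)" by (intro ennreal_leI) simp
  show ?thesis
  proof (rule that[of "max N 1"])
    fix t assume t: "0 \<le> t" "t \<le> T'"
    then have "Lnorm_abs s (u t) \<le> ennreal N" using N by auto
    then show "Lnorm_abs s (u t) \<le> ennreal (max N 1)" using le by (rule order_trans)
    have "AE x in lborel. ennreal \<bar>u t x\<bar> \<le> ennreal N" using N t by auto
    then show "AE x in lborel. ennreal \<bar>u t x\<bar> \<le> ennreal (max N 1)"
      by (rule eventually_mono) (rule order_trans[OF _ le])
  qed simp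
qed

lemma solves_duh_finite:
  assumes u: "solves s v T u" and sa: "compatible s a" and t: "0 \<le> t" "ereal t < T"
  shows "duh (nonlin u) t x < top"
proof -
  note [measurable] = solves_measurable[OF u]
  note c = compatibleD[OF sa]
  obtain N where N: "0 < N" "\<And>\<tau>. 0 \<le> \<tau> \<Longrightarrow> \<tau> \<le> t \<Longrightarrow> Lnorm_abs s (u \<tau>) \<le> ennreal N"
    "\<And>\<tau>. 0 \<le> \<tau> \<Longrightarrow> \<tau> \<le> t \<Longrightarrow> AE x in lborel. ennreal \<bar>u \<tau> x\<bar> \<le> ennreal N"
    using solves_bounds[OF u t] by blast
  have "duh (nonlin u) t x \<le> ennreal (kern_const a * t powr (1 - \<theta> a) / (1 - \<theta> a)) * (ennreal N * ennreal (N powr (p - 1)))"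
    by (intro duh_nonlin_le c t N Lnorm_power_le_compatible[OF sa] solves_measurable[OF u]) auto
  also have "\<dots> < top" by (simp add: ennreal_mult_less_top)
  finally show ?thesis .
qed

lemma solves_continuous:
  assumes u: "solves s v T u" and sa: "compatible s a" and [measurable]: "v \<in> borel_measurable borel"
    and v: "Lnorm_abs s v < top"
    and r: "r \<longlonglongrightarrow> t" "\<And>k::nat. 0 \<le> r k" "\<And>k. ereal (r k) < T" "\<And>k. r k \<noteq> t" "0 \<le> t" "ereal t < T"
  shows "(\<lambda>k. Lnorm lborel s (\<lambda>x. ennreal \<bar>u (r k) x - u t x\<bar>)) \<longlonglongrightarrow> 0"
proof -
  note [measurable] = solves_measurable[OF u]
  note c = compatibleD[OF sa]
  obtain T' where T': "ereal t < ereal T'" "ereal T' < T" using ereal_dense2[OF r(6)] by blast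
  obtain N where N: "0 < N" "\<And>\<tau>. 0 \<le> \<tau> \<Longrightarrow> \<tau> \<le> T' \<Longrightarrow> Lnorm_abs s (u \<tau>) \<le> ennreal N"
    "\<And>\<tau>. 0 \<le> \<tau> \<Longrightarrow> \<tau> \<le> T' \<Longrightarrow> AE x in lborel. ennreal \<bar>u \<tau> x\<bar> \<le> ennreal N"
    using solves_bounds[OF u _ T'(2)] T'(1) r(5) by (metis ereal_less_eq(3) order_less_imp_le order_trans)
  have "\<forall>\<^sub>F k in sequentially. r k < T'" using order_tendstoD(2)[OF r(1), of T'] T'(1) by simp
  then obtain m where m: "\<And>k. m \<le> k \<Longrightarrow> r k < T'" by (auto simp: eventually_sequentially)
  have lt: "ereal \<tau> < T" if "\<tau> < T'" for \<tau>
    using that T'(2) by (meson ereal_less(2) less_ereal.simps(1) order_less_trans)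
  have "(\<lambda>k. Lnorm lborel s (\<lambda>x. ennreal \<bar>u (r (k + m)) x - u t x\<bar>)) \<longlonglongrightarrow> 0"
  proof (rule solution_continuous[where W = "ennreal N" and M = "ennreal N" and G = "ennreal (N powr (p - 1))" and v = v and T = T' and a = a])
    show "(\<lambda>k. r (k + m)) \<longlonglongrightarrow> t" using r(1) by (rule LIMSEQ_ignore_initial_segment)
    show "Lnorm lborel a (\<lambda>y. epow (ennreal \<bar>u \<tau> y\<bar>) (p - 1)) \<le> ennreal (N powr (p - 1))" if "0 \<le> \<tau>" "\<tau> < T'" for \<tau>
      using that by (intro Lnorm_power_le_compatible[OF sa] N) auto
  qed (use c v r N m T' lt in \<open>auto intro!: solves_eq[OF u] solves_measurable[OF u]\<close>)
  then show ?thesis by (rule LIMSEQ_offset)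
qed

lemma duh_nonlin_diff_le:
  assumes [measurable]: "jointly_measurable u" "jointly_measurable w"
  shows "duh (nonlin u) t x \<le> duh (nonlin w) t x + duh (\<lambda>\<tau> y. ennreal \<bar>u \<tau> y - w \<tau> y\<bar> * (ennreal p * (epow (ennreal \<bar>u \<tau> y\<bar>) (p - 1) + epow (ennreal \<bar>w \<tau> y\<bar>) (p - 1)))) t x"
proof -
  have "duh (nonlin u) t x \<le> duh (\<lambda>\<tau> y. nonlin w \<tau> y + ennreal \<bar>u \<tau> y - w \<tau> y\<bar> * (ennreal p * (epow (ennreal \<bar>u \<tau> y\<bar>) (p - 1) + epow (ennreal \<bar>w \<tau> y\<bar>) (p - 1)))) t x"
  proof (rule duh_mono)
    fix \<tau> y
    let ?g = "p * (\<bar>u \<tau> y\<bar> powr (p - 1) + \<bar>w \<tau> y\<bar> powr (p - 1))"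
    have "\<bar>u \<tau> y\<bar> powr p \<le> \<bar>w \<tau> y\<bar> powr p + \<bar>u \<tau> y - w \<tau> y\<bar> * ?g"
      using abs_powr_diff_Lipschitz[of p "u \<tau> y" "w \<tau> y"] p by linarith
    then have "ennreal (\<bar>u \<tau> y\<bar> powr p) \<le> ennreal (\<bar>w \<tau> y\<bar> powr p + \<bar>u \<tau> y - w \<tau> y\<bar> * ?g)" by (rule ennreal_leI)
    also have "\<dots> = nonlin w \<tau> y + ennreal \<bar>u \<tau> y - w \<tau> y\<bar> * (ennreal p * (epow (ennreal \<bar>u \<tau> y\<bar>) (p - 1) + epow (ennreal \<bar>w \<tau> y\<bar>) (p - 1)))"
      using p by (simp add: nonlin_def ennreal_mult ennreal_plus)
    finally show "nonlin u \<tau> y \<le> nonlin w \<tau> y + ennreal \<bar>u \<tau> y - w \<tau> y\<bar> * (ennreal p * (epow (ennreal \<bar>u \<tau> y\<bar>) (p - 1) + epow (ennreal \<bar>w \<tau> y\<bar>) (p - 1)))"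
      by (simp add: nonlin_def)
  qed
  also have "\<dots> = duh (nonlin w) t x + duh (\<lambda>\<tau> y. ennreal \<bar>u \<tau> y - w \<tau> y\<bar> * (ennreal p * (epow (ennreal \<bar>u \<tau> y\<bar>) (p - 1) + epow (ennreal \<bar>w \<tau> y\<bar>) (p - 1)))) t x"
    by (rule duh_add) measurable
  finally show ?thesis .
qed

text \<open>The norm of the difference satisfies a homogeneous linear Volterra inequality. In an
  exponentially weighted supremum the Volterra operator has norm at most 1/2, so iteration leaves
  only 0.\<close>

lemma solves_unique:
  assumes sa: "compatible s a" and u: "solves s v T u" "ereal t < T" and w: "solves s v T' w" "ereal t < T'" and t: "0 \<le> t"
  shows "AE x in lborel. u t x = w t x"
proof -
  note c = compatibleD[OF sa]
  note [measurable] = solves_measurable[OF u(1)] solves_measurable[OF w(1)]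
  obtain N where N: "0 < N" "\<And>\<tau>. 0 \<le> \<tau> \<Longrightarrow> \<tau> \<le> t \<Longrightarrow> Lnorm_abs s (u \<tau>) \<le> ennreal N"
    "\<And>\<tau>. 0 \<le> \<tau> \<Longrightarrow> \<tau> \<le> t \<Longrightarrow> AE x in lborel. ennreal \<bar>u \<tau> x\<bar> \<le> ennreal N"
    using solves_bounds[OF u(1) t u(2)] by blast
  obtain L where L: "0 < L" "\<And>\<tau>. 0 \<le> \<tau> \<Longrightarrow> \<tau> \<le> t \<Longrightarrow> Lnorm_abs s (w \<tau>) \<le> ennreal L"
    "\<And>\<tau>. 0 \<le> \<tau> \<Longrightarrow> \<tau> \<le> t \<Longrightarrow> AE x in lborel. ennreal \<bar>w \<tau> x\<bar> \<le> ennreal L"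
    using solves_bounds[OF w(1) t w(2)] by blast
  have s1: "1 \<le> s" "1 \<le> a" using c by auto
  let ?g = "\<lambda>\<tau> y. ennreal p * (epow (ennreal \<bar>u \<tau> y\<bar>) (p - 1) + epow (ennreal \<bar>w \<tau> y\<bar>) (p - 1))"
  let ?g' = "\<lambda>\<tau> y. ennreal p * (epow (ennreal \<bar>w \<tau> y\<bar>) (p - 1) + epow (ennreal \<bar>u \<tau> y\<bar>) (p - 1))"
  define G where "G = p * (N powr (p - 1) + L powr (p - 1))"
  have G0: "0 < G" using p N L by (simp add: G_def add_pos_pos)
  have G: "Lnorm lborel a (?g \<tau>) \<le> ennreal G" if "0 \<le> \<tau>" "\<tau> \<le> t" for \<tau>
  proof -
    have "Lnorm lborel a (?g \<tau>) = ennreal p * Lnorm lborel a (\<lambda>y. epow (ennreal \<bar>u \<tau> y\<bar>) (p - 1) + epow (ennreal \<bar>w \<tau> y\<bar>) (p - 1))"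
      using s1 by (intro Lnorm_cmult) auto
    also have "\<dots> \<le> ennreal p * (Lnorm lborel a (\<lambda>y. epow (ennreal \<bar>u \<tau> y\<bar>) (p - 1)) + Lnorm lborel a (\<lambda>y. epow (ennreal \<bar>w \<tau> y\<bar>) (p - 1)))"
      by (intro mult_left_mono Lnorm_triangle sigma_finite_lborel s1) measurable
    also have "\<dots> \<le> ennreal p * (ennreal (N powr (p - 1)) + ennreal (L powr (p - 1)))"
      using that by (intro mult_left_mono add_mono Lnorm_power_le_compatible[OF sa] N L) auto
    also have "\<dots> = ennreal G" using p by (simp add: G_def ennreal_mult ennreal_plus)
    finally show ?thesis .
  qed
  define \<phi> where "\<phi> \<tau> = Lnorm lborel s (\<lambda>x. ennreal \<bar>u \<tau> x - w \<tau> x\<bar>)" for \<tau>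
  have phi_bound: "\<phi> \<tau> \<le> ennreal (N + L)" if "0 \<le> \<tau>" "\<tau> \<le> t" for \<tau>
  proof -
    have "\<phi> \<tau> \<le> Lnorm lborel s (\<lambda>x. ennreal \<bar>u \<tau> x\<bar> + ennreal \<bar>w \<tau> x\<bar>)"
      unfolding \<phi>_def using c by (intro Lnorm_mono) (auto simp: ennreal_plus[symmetric] intro!: ennreal_leI simp del: ennreal_plus)
    also have "\<dots> \<le> Lnorm_abs s (u \<tau>) + Lnorm_abs s (w \<tau>)"
      by (intro Lnorm_triangle sigma_finite_lborel s1) measurable
    also have "\<dots> \<le> ennreal N + ennreal L" using that by (intro add_mono N L)
    finally show ?thesis using N L by simp
  qed
  have phi_le: "\<phi> t' \<le> (\<integral>\<^sup>+\<tau>. indicator {0..} \<tau> * (kern_weight a (t' - \<tau>) * (\<phi> \<tau> * ennreal G)) \<partial>lborel)" if t': "0 \<le> t'" "t' \<le> t" for t'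
  proof -
    have lt: "ereal t' < T" "ereal t' < T'" using t'(2) u(2) w(2) by (meson ereal_less_eq(3) order_le_less_trans)+
    have "AE x in lborel. ennreal \<bar>u t' x - w t' x\<bar> \<le> duh (\<lambda>\<tau> y. ennreal \<bar>u \<tau> y - w \<tau> y\<bar> * ?g \<tau> y) t' x"
      using solves_eq[OF u(1) t'(1) lt(1)] solves_eq[OF w(1) t'(1) lt(2)]
    proof eventually_elim
      case (elim x)
      have sym: "duh (\<lambda>\<tau> y. ennreal \<bar>w \<tau> y - u \<tau> y\<bar> * ?g' \<tau> y) t' x = duh (\<lambda>\<tau> y. ennreal \<bar>u \<tau> y - w \<tau> y\<bar> * ?g \<tau> y) t' x"
        by (simp add: abs_minus_commute add.commute)
      have "ennreal \<bar>enn2real (duh (nonlin u) t' x) - enn2real (duh (nonlin w) t' x)\<bar> \<le> duh (\<lambda>\<tau> y. ennreal \<bar>u \<tau> y - w \<tau> y\<bar> * ?g \<tau> y) t' x"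
        using duh_nonlin_diff_le[of u w t' x] duh_nonlin_diff_le[of w u t' x] sym
        by (intro ennreal_enn2real_diff_le solves_duh_finite[OF u(1) sa t'(1) lt(1)] solves_duh_finite[OF w(1) sa t'(1) lt(2)]) auto
      then show ?case unfolding elim by simp
    qed
    then have "\<phi> t' \<le> Lnorm lborel s (duh (\<lambda>\<tau> y. ennreal \<bar>u \<tau> y - w \<tau> y\<bar> * ?g \<tau> y) t')"
      unfolding \<phi>_def by (intro Lnorm_mono_AE c)
    also have "\<dots> \<le> (\<integral>\<^sup>+\<tau>. indicator {0..} \<tau> * (kern_weight a (t' - \<tau>) * (\<phi> \<tau> * Lnorm lborel a (?g \<tau>))) \<partial>lborel)"
      unfolding \<phi>_def by (intro Lnorm_duh_le c) measurable
    also have "\<dots> \<le> (\<integral>\<^sup>+\<tau>. indicator {0..} \<tau> * (kern_weight a (t' - \<tau>) * (\<phi> \<tau> * ennreal G)) \<partial>lborel)"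
      using t' by (intro volterra_mono mult_left_mono G) auto
    finally show ?thesis .
  qed
  \<comment> \<open>Each pass through the Volterra inequality multiplies the exponential bound by
    \<open>G * K\<close>, that is by 1/2.\<close>
  define K where "K = 1 / (2 * G)"
  have K: "0 < K" "G * K = 1 / 2" using G0 by (auto simp: K_def)
  obtain l where l: "0 < l" "(\<integral>\<^sup>+s. kern_weight a s * ennreal (exp (- l * s)) \<partial>lborel) \<le> ennreal K"
    using kern_weight_exp_small[OF c(1) K(1)] by blast
  have it: "\<phi> t' \<le> ennreal ((N + L) * (1 / 2) ^ k * exp (l * t'))" if "0 \<le> t'" "t' \<le> t" for k t'
    using that
  proof (induction k arbitrary: t')
    case 0
    have "(N + L) * 1 \<le> (N + L) * exp (l * t')" using N L l 0 by (intro mult_left_mono) auto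
    then show ?case using order_trans[OF phi_bound[OF 0] ennreal_leI] by simp
  next
    case (Suc k)
    let ?c = "(N + L) * (1 / 2) ^ k"
    have c0: "0 \<le> ?c" using N L by simp
    have "\<phi> t' \<le> (\<integral>\<^sup>+\<tau>. indicator {0..} \<tau> * (kern_weight a (t' - \<tau>) * (ennreal (?c * exp (l * \<tau>)) * ennreal G)) \<partial>lborel)"
      using Suc.prems by (intro order_trans[OF phi_le] volterra_mono mult_right_mono Suc.IH) auto
    also have "\<dots> = ennreal (?c * G) * (\<integral>\<^sup>+\<tau>. indicator {0..} \<tau> * (kern_weight a (t' - \<tau>) * ennreal (exp (l * \<tau>))) \<partial>lborel)"
      unfolding ennreal_mult'[OF c0, of "exp _"] ennreal_mult[OF c0 less_imp_le[OF G0]]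
      by (subst nn_integral_cmult[symmetric]) (simp_all only: mult_ac, measurable)
    also have "\<dots> \<le> ennreal (?c * G) * (ennreal K * ennreal (exp (l * t')))"
      by (intro mult_left_mono volterra_exp l) auto
    also have "\<dots> = ennreal (?c * (G * K) * exp (l * t'))"
      using c0 G0 K(1) by (simp only: ennreal_mult[symmetric] mult_nonneg_nonneg exp_ge_zero less_imp_le mult_ac)
    also have "?c * (G * K) * exp (l * t') = (N + L) * (1 / 2) ^ Suc k * exp (l * t')" unfolding K(2) by simp
    finally show ?case .
  qed
  have "(\<lambda>k. ennreal ((N + L) * (1 / 2) ^ k * exp (l * t))) \<longlonglongrightarrow> ennreal ((N + L) * 0 * exp (l * t))"
    by (intro tendsto_intros tendsto_ennrealI LIMSEQ_power_zero) auto
  then have "\<phi> t \<le> ennreal ((N + L) * 0 * exp (l * t))"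
    by (rule tendsto_lowerbound) (use it[OF t] in auto)
  then have "\<phi> t = 0" by simp
  then have "AE x in lborel. ennreal \<bar>u t x - w t x\<bar> = 0"
    unfolding \<phi>_def by (subst (asm) Lnorm_eq_0_iff) auto
  then show ?thesis by (rule eventually_mono) simp
qed

text \<open>The supremum of the existence times is reached by a sequence, so countably many
  solutions are glued. Uniqueness makes them agree almost everywhere at common times, and
  countability preserves joint measurability.\<close>

lemma solves_maximal:
  assumes sa: "compatible s a" and u0: "solves s v T0 u0" "0 < T0"
  obtains T u where "0 < T" "solves s v T u" "\<And>T' u'. solves s v T' u' \<Longrightarrow> T' \<le> T"
proof -
  let ?A = "{T. \<exists>u. solves s v T u}"
  define S where "S = Sup ?A"
  have ne: "?A \<noteq> {}" using u0 by auto
  obtain f :: "nat \<Rightarrow> ereal" where f: "range f \<subseteq> ?A" "S = (SUP i. f i)"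
    unfolding S_def using Sup_countable_SUP[OF ne] by blast
  have "\<forall>i. \<exists>u. solves s v (f i) u" using f(1) by auto
  then obtain U where U: "\<And>i. solves s v (f i) (U i)" by metis
  note Um [measurable] = solves_measurable[OF U]
  \<comment> \<open>The first solution of the sequence that lives beyond time \<open>t\<close>; as a
    least index it depends measurably on \<open>t\<close>.\<close>
  define k where "k t = (LEAST i. ereal t < f i)" for t
  define u where "u t x = U (k t) t x" for t x
  have k: "ereal t < f (k t)" if "ereal t < S" for t
  proof -
    have "\<exists>i. ereal t < f i" using that unfolding f(2) less_SUP_iff by auto
    then show ?thesis unfolding k_def by (rule LeastI_ex)
  qed
  have ae: "AE x in lborel. u \<tau> x = U i \<tau> x" if "0 \<le> \<tau>" "ereal \<tau> < f i" for i \<tau>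
  proof -
    have "ereal \<tau> < S" using that(2) unfolding f(2) less_SUP_iff by blast
    then show ?thesis unfolding u_def using that by (intro solves_unique[OF sa U _ U]) (auto intro: k)
  qed
  have [measurable]: "jointly_measurable u"
  proof -
    have "(\<lambda>z. (\<lambda>(t, x). U i t x) z) \<in> borel_measurable (borel \<Otimes>\<^sub>M borel)" for i by simp
    moreover have "(\<lambda>z::real \<times> 'a. k (fst z)) \<in> measurable (borel \<Otimes>\<^sub>M borel) (count_space UNIV)"
      unfolding k_def by measurable
    ultimately have "(\<lambda>z. (\<lambda>(t, x). U (k (fst z)) t x) z) \<in> borel_measurable (borel \<Otimes>\<^sub>M borel)"
      by (rule measurable_compose_countable)
    then show ?thesis by (simp add: u_def split_beta')
  qed
  have "solves s v (S) u"
    unfolding solves_def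
  proof (intro conjI allI impI)
    fix T' assume T': "0 \<le> T' \<and> ereal T' < S"
    let ?i = "k T'"
    obtain N where N: "0 < N" "\<And>\<tau>. 0 \<le> \<tau> \<Longrightarrow> \<tau> \<le> T' \<Longrightarrow> Lnorm_abs s (U ?i \<tau>) \<le> ennreal N"
      "\<And>\<tau>. 0 \<le> \<tau> \<Longrightarrow> \<tau> \<le> T' \<Longrightarrow> AE x in lborel. ennreal \<bar>U ?i \<tau> x\<bar> \<le> ennreal N"
      using solves_bounds[OF U, of T' ?i] k[of T'] T' by blast
    have "Lnorm_abs s (u t) \<le> ennreal N \<and> (AE x in lborel. ennreal \<bar>u t x\<bar> \<le> ennreal N)" if "t \<in> {0..T'}" for t
    proof -
      have t: "0 \<le> t" "t \<le> T'" using that by auto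
      then have "ereal t < f ?i" using k[of T'] T' by (meson ereal_less_eq(3) order_le_less_trans)
      from ae[OF t(1) this] have e: "AE x in lborel. u t x = U ?i t x" .
      have "Lnorm_abs s (u t) = Lnorm_abs s (U ?i t)"
        by (rule Lnorm_cong_AE) (use e in eventually_elim, simp)
      moreover have "AE x in lborel. ennreal \<bar>u t x\<bar> \<le> ennreal N"
        using e N(3)[OF t] by eventually_elim simp
      ultimately show ?thesis using N(2)[OF t] by simp
    qed
    then show "\<exists>N. \<forall>t\<in>{0..T'}. Lnorm_abs s (u t) \<le> ennreal N \<and> (AE x in lborel. ennreal \<bar>u t x\<bar> \<le> ennreal N)" by blast
  next
    fix t assume t: "0 \<le> t \<and> ereal t < S"
    have kt: "ereal t < f (k t)" using k[of t] t by blast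
    have "duh (nonlin u) t x = duh (nonlin (U (k t))) t x" for x
    proof (rule duh_cong_AE)
      fix \<tau> assume \<tau>: "0 \<le> \<tau>" "\<tau> < t"
      then have "ereal \<tau> < f (k t)" using kt by (meson less_ereal.simps(1) order_less_trans)
      from ae[OF \<tau>(1) this] show "AE y in lborel. nonlin u \<tau> y = nonlin (U (k t)) \<tau> y"
        by (rule eventually_mono) (simp add: nonlin_def)
    qed
    then show "AE x in lborel. u t x = hom_real v t x + enn2real (duh (nonlin u) t x)"
      using solves_eq[OF U _ kt] t by (simp add: u_def)
  qed measurable
  moreover have "0 < S" unfolding S_def using u0 by (auto intro: less_le_trans Sup_upper)
  ultimately show ?thesis by (intro that) (auto simp: S_def intro: Sup_upper)
qed

context
  fixes v :: "'a \<Rightarrow> real"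
  assumes v [measurable]: "v \<in> borel_measurable borel"
begin

lemma solves_picard_lim:
  assumes "0 < s" and bounds: "\<And>T'. 0 \<le> T' \<Longrightarrow> ereal T' < T \<Longrightarrow> \<exists>N. \<forall>t\<in>{0..T'}. \<forall>k.
    Lnorm lborel s (majorant v k t) \<le> ennreal N \<and> (AE x in lborel. majorant v k t x \<le> ennreal N)"
  shows "solves s v T (picard_lim v)"
  unfolding solves_def
proof (intro conjI allI impI)
  show "jointly_measurable (picard_lim v)" by (rule picard_lim_measurable[OF v])
  have lim: "\<exists>N. \<forall>t\<in>{0..T'}. Lnorm lborel s (majorant_lim v t) \<le> ennreal N \<and> (AE x in lborel. majorant_lim v t x \<le> ennreal N)"
    if "0 \<le> T'" "ereal T' < T" for T'
    using bounds[OF that] Lnorm_majorant_lim_le[OF v assms(1)] majorant_lim_le_AE[OF v] by meson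
  {
    fix T' assume "0 \<le> T' \<and> ereal T' < T"
    then obtain N where N: "\<forall>t\<in>{0..T'}. Lnorm lborel s (majorant_lim v t) \<le> ennreal N \<and> (AE x in lborel. majorant_lim v t x \<le> ennreal N)"
      using lim by blast
    have "Lnorm_abs s (picard_lim v t) \<le> Lnorm lborel s (majorant_lim v t)" for t
      by (intro Lnorm_mono assms(1) picard_lim_le[OF v])
    then show "\<exists>N. \<forall>t\<in>{0..T'}. Lnorm_abs s (picard_lim v t) \<le> ennreal N \<and> (AE x in lborel. ennreal \<bar>picard_lim v t x\<bar> \<le> ennreal N)"
      using N by (intro exI[of _ N]) (auto intro: order_trans elim!: eventually_mono intro: order_trans[OF picard_lim_le[OF v]])
  next
    fix t assume t: "0 \<le> t \<and> ereal t < T"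
    then obtain N where "AE x in lborel. majorant_lim v t x \<le> ennreal N" using lim[of t] by (meson atLeastAtMost_iff order_refl)
    then show "AE x in lborel. picard_lim v t x = hom_real v t x + enn2real (duh (nonlin (picard_lim v)) t x)"
      by (rule eventually_mono) (auto intro!: picard_lim_eq[OF v] intro: le_less_trans)
  }
qed

lemma solves_local:
  assumes sa: "compatible s a" and N: "0 < N" "Lnorm_abs s v \<le> ennreal N" "AE x in lborel. ennreal \<bar>v x\<bar> \<le> ennreal N"
  obtains T where "0 < T" "solves s v (ereal T) (picard_lim v)"
proof -
  obtain T where T: "0 < T" "\<And>k t. 0 \<le> t \<Longrightarrow> t \<le> T \<Longrightarrow> Lnorm lborel s (majorant v k t) \<le> ennreal (2 * N)"
    "\<And>k t. 0 \<le> t \<Longrightarrow> t \<le> T \<Longrightarrow> AE x in lborel. majorant v k t x \<le> ennreal (2 * N)"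
    using majorant_local_bounds[OF v compatibleD(1-4)[OF sa] N] by blast
  have "solves s v (ereal T) (picard_lim v)"
  proof (rule solves_picard_lim)
    fix T' assume "0 \<le> T'" "ereal T' < ereal T"
    then show "\<exists>N. \<forall>t\<in>{0..T'}. \<forall>k. Lnorm lborel s (majorant v k t) \<le> ennreal N \<and> (AE x in lborel. majorant v k t x \<le> ennreal N)"
      using T(2,3) by (intro exI[of _ "2 * N"]) auto
  qed (rule compatibleD(2)[OF sa])
  with T(1) show ?thesis by (rule that)
qed

end

end

section \<open>Global solutions for small data in the critical space\<close>

context heat_equation
begin

text \<open>Everything is expressed through \<open>x = 1 / r\<close>. The bounds from below give the
  lower bound in \<open>admissible a\<close> and \<open>\<kappa> * p < 1\<close>; those from above
  give \<open>p < r\<close> and \<open>q < r\<close>, the latter also the upper bound in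
  \<open>admissible a\<close>.\<close>

lemma critical_exponents:
  assumes p_Fuj: "1 + (\<alpha> + \<beta>) / (n - \<alpha>) < p" and q: "q = n * (p - 1) / (\<alpha> + \<beta>)"
  obtains r a \<kappa> where "admissible a" "a = r / (p - 1)" "p < r" "1 < q" "q < r"
    "\<kappa> = n / \<beta> * (1 / q - 1 / r)" "0 \<le> \<kappa>" "\<kappa> * p < 1" "\<theta> a + \<kappa> * (p - 1) = 1"
proof -
  have n: "0 < n" "0 < n - \<alpha>" "0 < \<alpha>" "0 < \<beta>" "0 < p" "0 < p - 1" using alpha beta p by auto
  have F: "n + \<beta> < p * (n - \<alpha>)" using p_Fuj n by (simp add: field_simps)
  have q0: "0 < q" using q n by simp
  have iq: "1 / q = (\<alpha> + \<beta>) / (n * (p - 1))" using q by simp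
  have q1: "1 < q"
  proof -
    have "\<alpha> + \<beta> < (p - 1) * (n - \<alpha>)" using F by (simp add: algebra_simps)
    also have "\<dots> \<le> (p - 1) * n" using n by (intro mult_left_mono) auto
    finally show ?thesis using n by (simp add: q field_simps)
  qed
  have "\<alpha> / (n * (p - 1)) < 1 / p"
  proof -
    have "n + \<alpha> * p < n * p" using F n by (simp add: algebra_simps)
    then show ?thesis using n by (simp add: divide_simps algebra_simps)
  qed
  moreover have "\<alpha> / (n * (p - 1)) < 1 / q" using n by (simp add: iq divide_strict_right_mono)
  moreover have "1 / q - \<beta> / (n * p) < 1 / p"
  proof -
    have "p * (\<alpha> + \<beta>) < (n + \<beta>) * (p - 1)" using F by (simp add: algebra_simps)
    then have "p * (\<alpha> + \<beta>) / (n * p * (p - 1)) < (n + \<beta>) * (p - 1) / (n * p * (p - 1))" using n by (intro divide_strict_right_mono) auto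
    moreover have "p * (\<alpha> + \<beta>) / (n * p * (p - 1)) = 1 / q" using n by (simp add: iq)
    moreover have "(n + \<beta>) * (p - 1) / (n * p * (p - 1)) = 1 / p + \<beta> / (n * p)" using n by (simp add: field_simps)
    ultimately show ?thesis by linarith
  qed
  moreover have "1 / q - \<beta> / (n * p) < 1 / q" using n by simp
  \<comment> \<open>Of the four comparisons, \<open>1 / q - \<beta> / (n * p) < 1 / p\<close> is
    equivalent to the Fujita condition; the others are weaker or automatic.\<close>
  ultimately have "max (\<alpha> / (n * (p - 1))) (1 / q - \<beta> / (n * p)) < min (1 / p) (1 / q)" by simp
  then obtain x where "max (\<alpha> / (n * (p - 1))) (1 / q - \<beta> / (n * p)) < x" "x < min (1 / p) (1 / q)"
    using dense by blast
  then have x: "\<alpha> / (n * (p - 1)) < x" "1 / q - \<beta> / (n * p) < x" "x < 1 / p" "x < 1 / q" by auto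
  have "0 < \<alpha> / (n * (p - 1))" using n by simp
  then have x0: "0 < x" using x by linarith
  define r where "r = 1 / x"
  define a where "a = r / (p - 1)"
  define \<kappa> where "\<kappa> = n / \<beta> * (1 / q - 1 / r)"
  have ir: "1 / r = x" by (simp add: r_def)
  have ia: "1 / a = (p - 1) * x" by (simp add: a_def r_def)
  have pr: "p < r" using x(3) x0 n by (simp add: r_def field_simps)
  have qr: "q < r" using x(4) x0 q0 by (simp add: r_def field_simps)
  have "admissible a"
    unfolding admissible_def ia
  proof (intro conjI)
    have "p - 1 < r" using pr by simp
    then show "1 < a" using n by (simp add: a_def)
    show "\<alpha> / n < (p - 1) * x" using x(1) n by (simp add: field_simps)
    have "(p - 1) * x < (p - 1) * (1 / q)" using x(4) n by (intro mult_strict_left_mono) auto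
    then show "(p - 1) * x < (\<alpha> + \<beta>) / n" using n by (simp add: iq)
  qed
  moreover have "0 \<le> \<kappa>" using x(4) n by (simp add: \<kappa>_def ir)
  moreover have "\<kappa> * p < 1"
  proof -
    have "n / \<beta> * p * (1 / q - x) < n / \<beta> * p * (\<beta> / (n * p))" using x(2) n by (intro mult_strict_left_mono) auto
    then show ?thesis using n by (simp add: \<kappa>_def ir mult_ac)
  qed
  moreover have "\<theta> a + \<kappa> * (p - 1) = 1"
  proof -
    have "n / a = n * ((p - 1) * x)" using ia by (simp add: divide_inverse)
    moreover have "\<kappa> * (p - 1) = (n * (p - 1) * (1 / q) - n * (p - 1) * x) / \<beta>"
      unfolding \<kappa>_def ir using n by (simp add: divide_simps) (simp add: algebra_simps)
    moreover have "n * (p - 1) * (1 / q) = \<alpha> + \<beta>" using n by (simp add: iq)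
    ultimately show ?thesis using n by (simp add: \<theta>_def add_divide_distrib[symmetric] algebra_simps)
  qed
  ultimately show ?thesis using pr qr q1 by (intro that[of a r \<kappa>]) (auto simp: a_def \<kappa>_def)
qed

text \<open>The number \<open>\<epsilon>\<close> is built from the exponents and kernel constants
  alone, before \<open>v\<close>, \<open>s\<close> and the bound \<open>N\<close> are fixed. Those
  affect only the size of the final bounds.\<close>

lemma solves_global:
  assumes p_Fuj: "1 + (\<alpha> + \<beta>) / (n - \<alpha>) < p" and q: "q = n * (p - 1) / (\<alpha> + \<beta>)"
  obtains \<epsilon> where "0 < \<epsilon>" "\<And>v s a N. v \<in> borel_measurable borel \<Longrightarrow> compatible s a \<Longrightarrow>
    Lnorm_abs s v < top \<Longrightarrow> AE x in lborel. ennreal \<bar>v x\<bar> \<le> ennreal N \<Longrightarrow>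
    Lnorm_abs q v \<le> ennreal \<epsilon> \<Longrightarrow>
    solves s v \<infinity> (picard_lim v) \<and> (\<exists>C. \<forall>t\<ge>0. AE x in lborel. ennreal \<bar>picard_lim v t x\<bar> \<le> ennreal C)"
proof -
  obtain r a \<kappa> where ad: "admissible a" and a_eq: "a = r / (p - 1)" and pr: "p < r" and q1: "1 < q" and qr: "q < r"
    and kap: "\<kappa> = n / \<beta> * (1 / q - 1 / r)" "0 \<le> \<kappa>" "\<kappa> * p < 1" "\<theta> a + \<kappa> * (p - 1) = 1"
    using critical_exponents[OF p_Fuj q] by metis
  have kp: "0 \<le> \<kappa> * p" "0 \<le> \<kappa> * (p - 1)" using kap(2) p by auto
  have kp1: "\<kappa> * (p - 1) < 1" using kap(2,3) by (simp add: right_diff_distrib)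
  obtain B1 where B1: "0 < B1" "\<And>t. 0 < t \<Longrightarrow> (\<integral>\<^sup>+\<tau>. indicator {0..} \<tau> * (kern_weight a (t - \<tau>) * ennreal (\<tau> powr (- (\<kappa> * p)))) \<partial>lborel)
      \<le> ennreal (B1 * t powr (1 - \<theta> a - \<kappa> * p))"
    using volterra_beta[OF ad kp(1) kap(3)] by blast
  obtain B2 where B2: "0 < B2" "\<And>t. 0 < t \<Longrightarrow> (\<integral>\<^sup>+\<tau>. indicator {0..} \<tau> * (kern_weight a (t - \<tau>) * ennreal (\<tau> powr (- (\<kappa> * (p - 1))))) \<partial>lborel)
      \<le> ennreal (B2 * t powr (1 - \<theta> a - \<kappa> * (p - 1)))"
    using volterra_beta[OF ad kp(2) kp1] by blast
  \<comment> \<open>Small enough for both Volterra constants: \<open>B1\<close> in the decay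
    estimate and \<open>B2\<close> in the uniform bounds.\<close>
  define M where "M = (1 / (2 * (B1 + B2))) powr (1 / (p - 1))"
  have Mp: "M powr (p - 1) = 1 / (2 * (B1 + B2))" using B1 B2 p by (simp add: M_def powr_powr)
  have M: "0 < M" "M powr (p - 1) * B1 \<le> 1 / 2" "M powr (p - 1) * B2 \<le> 1 / 2"
    using B1(1) B2(1) unfolding Mp by (auto simp: M_def field_simps)
  let ?S = "stable_kernel \<beta> 1 (0::'a) powr (1 / q - 1 / r)"
  define \<epsilon> where "\<epsilon> = M / (2 * (?S + 1))"
  have S0: "0 \<le> ?S" by simp
  have eps: "0 < \<epsilon>" using M S0 by (simp add: \<epsilon>_def add_nonneg_pos)
  have epsM: "2 * ?S * \<epsilon> \<le> M"
  proof -
    have "2 * z * (M / (2 * (z + 1))) = M * (z / (z + 1))" if "0 \<le> z" for z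
      using that by (simp add: divide_simps)
    then have "2 * ?S * \<epsilon> = M * (?S / (?S + 1))" unfolding \<epsilon>_def using S0 by blast
    also have "\<dots> \<le> M * 1" using M S0 by (intro mult_left_mono) (auto simp: divide_le_eq add_nonneg_pos)
    finally show ?thesis by simp
  qed
  show ?thesis
  proof (rule that[OF eps])
    fix v :: "'a \<Rightarrow> real" and s a' N
    assume v [measurable]: "v \<in> borel_measurable borel" and sa: "compatible s a'" and vs: "Lnorm_abs s v < top"
      and vN: "AE x in lborel. ennreal \<bar>v x\<bar> \<le> ennreal N" and vq: "Lnorm_abs q v \<le> ennreal \<epsilon>"
    have r0: "0 < r" "0 < q" using qr q1 by auto
    define m where "m = max N 1"
    have m: "0 < m" "AE x in lborel. ennreal \<bar>v x\<bar> \<le> ennreal m"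
    proof -
      have "ennreal N \<le> ennreal m" by (intro ennreal_leI) (simp add: m_def)
      then show "AE x in lborel. ennreal \<bar>v x\<bar> \<le> ennreal m" using vN by (auto elim!: eventually_mono intro: order_trans)
    qed (simp add: m_def)
    have dec: "Lnorm lborel r (majorant v k t) \<le> ennreal (M * t powr (- \<kappa>))" if "0 < t" for k t
      using majorant_decay[OF v ad a_eq pr q1 qr kap(1,4) B1(2,1) M(1,2) vq _ epsM that] eps by simp
    \<comment> \<open>The second entry bounds the \<open>r\<close>-norm of the data by interpolation
      between the small critical norm and the essential bound.\<close>
    define L where "L = max m (m powr (1 - q / r) * \<epsilon> powr (q / r))"
    have L: "0 < L" "AE x in lborel. ennreal \<bar>v x\<bar> \<le> ennreal L" "Lnorm_abs r v \<le> ennreal L"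
    proof -
      show "0 < L" using m by (simp add: L_def)
      have le: "ennreal m \<le> ennreal L" by (intro ennreal_leI) (simp add: L_def)
      show "AE x in lborel. ennreal \<bar>v x\<bar> \<le> ennreal L" using m(2) by (rule eventually_mono) (rule order_trans[OF _ le])
      have "Lnorm lborel r (\<lambda>x. epow (ennreal \<bar>v x\<bar>) 1) \<le> ennreal (m powr (1 - q / r) * \<epsilon> powr (q / r))"
        by (rule Lnorm_power_le[OF _ m(2) vq m(1)]) (use eps r0 qr in auto)
      also have "\<dots> \<le> ennreal L" by (intro ennreal_leI) (simp add: L_def)
      finally show "Lnorm_abs r v \<le> ennreal L" by simp
    qed
    have glob: "AE x in lborel. majorant v k t x \<le> ennreal (2 * L)" "Lnorm lborel r (majorant v k t) \<le> ennreal (2 * L)" if "0 \<le> t" for k t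
      using majorant_global_bounds[OF v ad a_eq pr kap(4) B2(2,1) M(1,3) dec L that] by auto
    note c = compatibleD[OF sa]
    \<comment> \<open>A third exponent \<open>1 / x\<close> links the two scales. Being above
      \<open>a'\<close>, it keeps the bilinear estimate in exponent \<open>s\<close>; being above
      \<open>a\<close>, it lets the \<open>r\<close>-norm and the essential bound control the power
      \<open>p - 1\<close>. The Riesz condition \<open>\<alpha> / n < x\<close> leaves room for
      it.\<close>
    have "\<alpha> / n < 1 / a" "\<alpha> / n < 1 / a'" using ad c(1) by (auto simp: admissible_def)
    then have "\<alpha> / n < min (1 / a) (1 / a')" by simp
    then obtain x where "\<alpha> / n < x" "x < min (1 / a) (1 / a')" using dense by blast
    then have x: "\<alpha> / n < x" "x < 1 / a" "x < 1 / a'" by auto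
    have "0 < \<alpha> / n" using alpha by simp
    then have x0: "0 < x" using x by linarith
    have a0: "0 < a" "1 / a < 1" "1 / a < (\<alpha> + \<beta>) / n" using ad by (auto simp: admissible_def)
    have "1 < 1 / x" using x(2) a0(2) x0 by (simp only: less_divide_eq_1_pos)
    moreover have "x < (\<alpha> + \<beta>) / n" using x(2) a0(3) by linarith
    ultimately have ad2: "admissible (1 / x)" using x(1) by (simp add: admissible_def)
    have s2: "1 / s + 1 / (1 / x) < 1" using c(3) x by simp
    have ra: "r \<le> (p - 1) * (1 / x)"
    proof -
      have "a \<le> 1 / x" using x(2) x0 a0 by (simp add: field_simps)
      then have "(p - 1) * a \<le> (p - 1) * (1 / x)" using p by (intro mult_left_mono) auto
      then show ?thesis using a_eq p by simp
    qed
    define G where "G = (2 * L) powr (p - 1 - r / (1 / x)) * (2 * L) powr (r / (1 / x))"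
    have G: "Lnorm lborel (1 / x) (\<lambda>y. epow (majorant v k \<tau> y) (p - 1)) \<le> ennreal G" if "0 \<le> \<tau>" for k \<tau>
      unfolding G_def using glob[OF that] L(1) r0 x0 ra majorant_measurable[OF v, of k]
      by (intro Lnorm_power_le) auto
    define N' where "N' = enn2real (Lnorm_abs s v)"
    have N': "0 \<le> N'" "Lnorm_abs s v \<le> ennreal N'" using vs by (auto simp: N'_def)
    obtain l where l: "0 < l" "\<And>k t. 0 \<le> t \<Longrightarrow> Lnorm lborel s (majorant v k t) \<le> ennreal (2 * N' * exp (l * t))"
      using majorant_exp_bound[OF v ad2 c(2) s2 N' G] by (auto simp: G_def)
    have "solves s v \<infinity> (picard_lim v)"
    proof (rule solves_picard_lim[OF v c(2)])
      fix T' :: real assume T': "0 \<le> T'"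
      define Q where "Q = max (2 * L) (2 * N' * exp (l * T'))"
      have "Lnorm lborel s (majorant v k t) \<le> ennreal Q \<and> (AE x in lborel. majorant v k t x \<le> ennreal Q)" if t: "t \<in> {0..T'}" for t k
      proof
        have "2 * N' * exp (l * t) \<le> 2 * N' * exp (l * T')" using t l N' by (intro mult_left_mono) auto
        then have "ennreal (2 * N' * exp (l * t)) \<le> ennreal Q" by (intro ennreal_leI) (simp add: Q_def)
        then show "Lnorm lborel s (majorant v k t) \<le> ennreal Q" using l(2)[of t k] t by (auto intro: order_trans)
        have "ennreal (2 * L) \<le> ennreal Q" by (intro ennreal_leI) (simp add: Q_def)
        then show "AE x in lborel. majorant v k t x \<le> ennreal Q" using glob(1)[of t k] t by (auto elim!: eventually_mono intro: order_trans)
      qed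
      then show "\<exists>N. \<forall>t\<in>{0..T'}. \<forall>k. Lnorm lborel s (majorant v k t) \<le> ennreal N \<and> (AE x in lborel. majorant v k t x \<le> ennreal N)" by blast
    qed
    moreover have "AE x in lborel. ennreal \<bar>picard_lim v t x\<bar> \<le> ennreal (2 * L)" if "0 \<le> t" for t
      using majorant_lim_le_AE[OF v glob(1)[OF that]] by (rule eventually_mono) (rule order_trans[OF picard_lim_le[OF v]])
    ultimately show "solves s v \<infinity> (picard_lim v) \<and> (\<exists>C. \<forall>t\<ge>0. AE x in lborel. ennreal \<bar>picard_lim v t x\<bar> \<le> ennreal C)" by blast
  qed
qed

end

section \<open>Blow-up\<close>

text \<open>With \<open>b = 2 powr (1 / (p - 1))\<close>, a superlinear recursion started above \<open>K = (b / c) powr (1 / (p - 1))\<close>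
  stays above the geometric sequence \<open>K * b ^ j\<close>.\<close>

lemma superlinear_recursion_unbounded:
  fixes X :: "nat \<Rightarrow> real" and c p :: real
  assumes p: "1 < p" and c: "0 < c" and X0: "(2 powr (1 / (p - 1)) / c) powr (1 / (p - 1)) \<le> X 0"
    and step: "\<And>j. c * (1 / 2) ^ j * X j powr p \<le> X (Suc j)"
  shows "\<exists>j. Z < X j"
proof -
  define b where "b = (2::real) powr (1 / (p - 1))"
  define K where "K = (b / c) powr (1 / (p - 1))"
  have b: "1 < b" using p unfolding b_def by (intro gr_one_powr) auto
  have K: "0 < K" using b c by (simp add: K_def)
  have Kp: "c * K powr p = b * K"
  proof -
    have "K powr (p - 1) = b / c" using p b c by (simp add: K_def powr_powr)
    moreover have "K powr p = K * K powr (p - 1)" using K by (simp add: powr_diff)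
    ultimately show ?thesis using c by simp
  qed
  have bp: "(b ^ j) powr p = 2 ^ j * b ^ j" for j
  proof -
    have "(b ^ j) powr (p - 1) = 2 ^ j"
    proof -
      have "(b ^ j) powr (p - 1) = 2 powr real j" using p by (simp add: b_def powr_power powr_powr)
      then show ?thesis by (simp add: powr_realpow)
    qed
    moreover have "(b ^ j) powr p = b ^ j * (b ^ j) powr (p - 1)" using b by (simp add: powr_diff)
    ultimately show ?thesis by simp
  qed
  have ge: "K * b ^ j \<le> X j" for j
  proof (induction j)
    case 0
    then show ?case using X0 by (simp add: K_def b_def)
  next
    case (Suc j)
    have "K * b ^ Suc j = c * K powr p * b ^ j" by (simp add: Kp)
    also have "\<dots> = c * (1 / 2) ^ j * (K powr p * (b ^ j) powr p)" by (simp add: bp power_one_over)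
    also have "\<dots> = c * (1 / 2) ^ j * (K * b ^ j) powr p" using K b by (simp add: powr_mult)
    also have "\<dots> \<le> c * (1 / 2) ^ j * X j powr p"
      using Suc c K b p by (intro mult_left_mono powr_mono2) auto
    also have "\<dots> \<le> X (Suc j)" by (rule step)
    finally show ?case .
  qed
  obtain j where "Z / K < b ^ j" using real_arch_pow[OF b] by blast
  then have "Z < K * b ^ j" using K by (simp add: field_simps)
  then show ?thesis using ge[of j] by (intro exI[of _ j]) linarith
qed

text \<open>The growth inequality along the times \<open>\<rho>\<^sup>\<beta> * (1 - 2 powr - j)\<close> bounds \<open>F \<rho> (\<rho>\<^sup>\<beta> / 2)\<close> independently of
  \<open>\<rho> \<ge> 1\<close>. A positive value of \<open>F\<close>, on the other hand, contributes a fixed amount to each of the disjoint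
  time slabs from \<open>\<rho>\<^sup>\<beta> / 4\<close> to \<open>\<rho>\<^sup>\<beta> / 2\<close> with \<open>\<rho>\<^sup>\<beta>\<close> a power of 2.\<close>

lemma growth_inequality_zero:
  fixes F :: "real \<Rightarrow> real \<Rightarrow> real"
  assumes p: "1 < p" and c: "0 < c" and \<beta>: "0 < \<beta>" and e: "0 \<le> \<beta> + e"
    and F0: "\<And>\<rho> t. 0 \<le> F \<rho> t" and mono: "\<And>\<rho> \<rho>' t. \<rho> \<le> \<rho>' \<Longrightarrow> F \<rho> t \<le> F \<rho>' t"
    and mono_time: "\<And>\<rho> t t'. t \<le> t' \<Longrightarrow> F \<rho> t \<le> F \<rho> t'"
    and growth: "\<And>\<rho> t t'. 0 < \<rho> \<Longrightarrow> 0 \<le> t \<Longrightarrow> t \<le> t' \<Longrightarrow> t' \<le> \<rho> powr \<beta> \<Longrightarrow>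
      F \<rho> t + (t' - t) * c * \<rho> powr e * F \<rho> t powr p \<le> F \<rho> t'"
  shows "F \<rho> t = 0"
proof -
  \<comment> \<open>The threshold of \<open>superlinear_recursion_unbounded\<close> for the constant
    \<open>c / 4\<close>. The 4 stems from the lengths of the time steps below, which are
    \<open>(1 / 2) ^ j / 4\<close> times \<open>\<rho> powr \<beta>\<close>.\<close>
  define K where "K = (2 powr (1 / (p - 1)) / (c / 4)) powr (1 / (p - 1))"
  \<comment> \<open>For \<open>e = n - (n - \<alpha>) * p\<close> the hypothesis on
    \<open>\<beta> + e\<close> is the Fujita condition. At the critical power the product equals 1,
    and the lower bound is still sufficient.\<close>
  have scaled: "1 \<le> \<rho> powr \<beta> * \<rho> powr e" if "1 \<le> \<rho>" for \<rho>
    using that e by (simp add: powr_add[symmetric] ge_one_powr_ge_zero)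
  have bound: "F \<rho> (\<rho> powr \<beta> / 2) < K" if \<rho>: "1 \<le> \<rho>" for \<rho>
  proof (rule ccontr)
    assume "\<not> F \<rho> (\<rho> powr \<beta> / 2) < K"
    define T where "T j = \<rho> powr \<beta> * (1 - (1 / 2) ^ Suc j)" for j :: nat
    have r: "0 < \<rho> powr \<beta>" using \<rho> by simp
    have T: "0 \<le> T j" "T j \<le> T (Suc j)" "T j \<le> \<rho> powr \<beta>" for j
    proof -
      have 1: "(1 / 2 :: real) ^ Suc j \<le> 1" by (rule power_le_one) auto
      then show "0 \<le> T j" using r by (simp add: T_def)
      show "T j \<le> T (Suc j)" unfolding T_def using r by (intro mult_left_mono) auto
      show "T j \<le> \<rho> powr \<beta>" using r by (simp add: T_def mult_le_cancel_left2)
    qed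
    have "\<exists>j. F \<rho> (\<rho> powr \<beta>) < F \<rho> (T j)"
    proof (rule superlinear_recursion_unbounded[OF p, of "c / 4"])
      show "(2 powr (1 / (p - 1)) / (c / 4)) powr (1 / (p - 1)) \<le> F \<rho> (T 0)"
        unfolding K_def[symmetric] using \<open>\<not> F \<rho> (\<rho> powr \<beta> / 2) < K\<close> by (simp add: T_def)
      fix j :: nat
      have d: "T (Suc j) - T j = \<rho> powr \<beta> * ((1 / 2) ^ j / 4)" by (simp add: T_def field_simps)
      have "c / 4 * (1 / 2) ^ j * F \<rho> (T j) powr p = 1 * (c * ((1 / 2) ^ j / 4) * F \<rho> (T j) powr p)" by simp
      also have "\<dots> \<le> (\<rho> powr \<beta> * \<rho> powr e) * (c * ((1 / 2) ^ j / 4) * F \<rho> (T j) powr p)"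
        using c scaled[OF \<rho>] by (intro mult_right_mono) auto
      also have "\<dots> = (T (Suc j) - T j) * c * \<rho> powr e * F \<rho> (T j) powr p" unfolding d by (simp add: mult_ac)
      also have "\<dots> \<le> F \<rho> (T (Suc j))" using growth[of \<rho> "T j" "T (Suc j)"] T \<rho> F0[of \<rho> "T j"] by auto
      finally show "c / 4 * (1 / 2) ^ j * F \<rho> (T j) powr p \<le> F \<rho> (T (Suc j))" .
    qed (use c in simp)
    then obtain j where "F \<rho> (\<rho> powr \<beta>) < F \<rho> (T j)" by blast
    then show False using mono_time[OF T(3)[of j], of \<rho>] by linarith
  qed
  show ?thesis
  proof (rule ccontr)
    assume "F \<rho> t \<noteq> 0"
    then have m: "0 < F \<rho> t" using F0[of \<rho> t] by linarith
    define r where "r k = 2 powr (real k / \<beta>)" for k :: nat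
    have r: "r k powr \<beta> = 2 ^ k" "1 \<le> r k" for k
      using \<beta> by (simp_all add: r_def powr_powr powr_realpow ge_one_powr_ge_zero)
    obtain i :: nat where i: "max \<rho> 1 powr \<beta> \<le> 2 ^ i" "t \<le> 2 ^ i"
    proof -
      obtain i1 where "max \<rho> 1 powr \<beta> < (2::real) ^ i1" using real_arch_pow[of 2] by auto
      moreover obtain i2 where "t < (2::real) ^ i2" using real_arch_pow[of 2] by auto
      moreover have "(2::real) ^ i1 \<le> 2 ^ max i1 i2" "(2::real) ^ i2 \<le> 2 ^ max i1 i2" by (auto intro: power_increasing)
      ultimately show ?thesis by (intro that[of "max i1 i2"]) linarith+
    qed
    \<comment> \<open>The gain per slab, measured by the mass at the initial cylinder; later masses
      are larger, so the gain never drops below it.\<close>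
    define \<eta> where "\<eta> = c / 4 * F \<rho> t powr p"
    have \<eta>: "0 < \<eta>" using c m by (simp add: \<eta>_def)
    have lower: "F \<rho> t \<le> F (r (Suc (i + k))) (2 ^ (i + k))" for k
    proof -
      have "(max \<rho> 1) powr \<beta> \<le> r (Suc (i + k)) powr \<beta>"
      proof -
        have "(2::real) ^ i \<le> 2 ^ Suc (i + k)" by (rule power_increasing) auto
        then show ?thesis using i(1) unfolding r(1) by linarith
      qed
      then have "max \<rho> 1 \<le> r (Suc (i + k))"
        using \<beta> by (meson max.cobounded2 not_less order_trans powr_less_mono2 r(2) zero_le_one)
      moreover have "t \<le> 2 ^ (i + k)"
      proof -
        have "(2::real) ^ i \<le> 2 ^ (i + k)" by (rule power_increasing) auto
        then show ?thesis using i(2) by linarith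
      qed
      ultimately show ?thesis using mono[of \<rho> "r (Suc (i + k))" t] mono_time[of t "2 ^ (i + k)" "r (Suc (i + k))"] by linarith
    qed
    have inc: "\<eta> * real k \<le> F (r (Suc (i + k))) (2 ^ (i + k))" for k
    proof (induction k)
      case 0
      then show ?case using F0 by simp
    next
      case (Suc k)
      let ?r = "r (Suc (i + Suc k))"
      have "r (Suc (i + k)) \<le> ?r" using \<beta> by (simp add: r_def divide_right_mono)
      then have 1: "F (r (Suc (i + k))) (2 ^ (i + k)) \<le> F ?r (2 ^ (i + k))" by (rule mono)
      have 2: "F ?r (2 ^ (i + k)) + (2 ^ (i + Suc k) - 2 ^ (i + k)) * c * ?r powr e * F ?r (2 ^ (i + k)) powr p \<le> F ?r (2 ^ (i + Suc k))"
        using r(2)[of "Suc (i + Suc k)"] less_le_trans[OF zero_less_one r(2)[of "Suc (i + Suc k)"]] by (intro growth) (auto simp: r(1))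
      have "(2 ^ (i + Suc k) - 2 ^ (i + k) :: real) = ?r powr \<beta> / 4" by (simp add: r(1))
      then have 3: "(2 ^ (i + Suc k) - 2 ^ (i + k)) * c * ?r powr e * F ?r (2 ^ (i + k)) powr p
        = (?r powr \<beta> * ?r powr e) * (c / 4 * F ?r (2 ^ (i + k)) powr p)" by simp
      have 4: "1 * (c / 4 * F \<rho> t powr p) \<le> (?r powr \<beta> * ?r powr e) * (c / 4 * F ?r (2 ^ (i + k)) powr p)"
        using c p m order_trans[OF lower 1] scaled[OF r(2)] by (intro mult_mono powr_mono2) auto
      have "\<eta> * real (Suc k) = \<eta> * real k + 1 * (c / 4 * F \<rho> t powr p)" by (simp add: \<eta>_def algebra_simps)
      then show ?case using 1 2 Suc unfolding 3 using 4 by linarith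
    qed
    obtain k where "K < real k * \<eta>" using reals_Archimedean3[OF \<eta>] by blast
    then have "K < F (r (Suc (i + k))) (2 ^ (i + k))" using inc[of k] by (simp add: mult.commute)
    moreover have "r (Suc (i + k)) powr \<beta> / 2 = 2 ^ (i + k)" by (simp add: r(1))
    ultimately show False using bound[OF r(2), of "Suc (i + k)"] by simp
  qed
qed

lemma cball_borel [measurable]: "cball (x :: 'a::euclidean_space) r \<in> sets borel"
  by simp

section \<open>The mass of the nonlinearity on parabolic cylinders\<close>

context heat_equation
begin

text \<open>The time interval is half-open, so that the masses of consecutive intervals add
  up.\<close>

definition cylinder_mass :: "(real \<Rightarrow> 'a \<Rightarrow> real) \<Rightarrow> real \<Rightarrow> real \<Rightarrow> ennreal" where
  "cylinder_mass u \<rho> t = (\<integral>\<^sup>+\<tau>. indicator {0..<t} \<tau> * (\<integral>\<^sup>+y. indicator (cball 0 \<rho>) y * nonlin u \<tau> y \<partial>lborel) \<partial>lborel)"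

lemma cylinder_mass_mono:
  assumes "\<rho> \<le> \<rho>'" "t \<le> t'"
  shows "cylinder_mass u \<rho> t \<le> cylinder_mass u \<rho>' t'"
  unfolding cylinder_mass_def using assms
  by (intro nn_integral_mono mult_mono) (auto simp: indicator_def intro!: nn_integral_mono)

lemma nn_integral_cball_const:
  assumes "0 \<le> \<rho>"
  shows "(\<integral>\<^sup>+(y::'a). indicator (cball 0 \<rho>) y * c \<partial>lborel) = ennreal (unit_ball_vol n * \<rho> powr n) * c"
proof -
  have "\<rho> ^ DIM('a) = \<rho> powr n" using assms n_pos by (cases "\<rho> = 0") (auto simp: powr_realpow[symmetric])
  then have "emeasure lborel (cball (0::'a) \<rho>) = ennreal (unit_ball_vol n * \<rho> powr n)"
    using emeasure_cball[OF assms, of "0::'a"] by simp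
  moreover have "(\<integral>\<^sup>+(y::'a). indicator (cball 0 \<rho>) y * c \<partial>lborel) = emeasure lborel (cball (0::'a) \<rho>) * c"
    by (subst nn_integral_multc) auto
  ultimately show ?thesis by simp
qed

context
  fixes s a v T u
  assumes u: "solves s v T u" and sa: "compatible s a" and v [measurable]: "v \<in> borel_measurable borel"
    and v0: "AE x in lborel. 0 \<le> v x" and v1: "(\<integral>\<^sup>+x. ennreal (v x) \<partial>lborel) < top"
begin

lemma hom_real_nonneg: "AE x in lborel. 0 \<le> hom_real v t x"
proof (cases "t = 0")
  case True
  then show ?thesis using v0 by (simp add: hom_real_def)
next
  case False
  have "0 \<le> hom_real v t x" for x
    using False v0 by (auto simp: hom_real_def heat_real_nonneg intro!: integral_nonneg_AE elim!: eventually_mono)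
  then show ?thesis by simp
qed

lemma solution_ge_hom:
  assumes t: "0 < t" "ereal t < T"
  shows "AE x in lborel. conv (heat t) (\<lambda>y. ennreal (v y)) x \<le> ennreal \<bar>u t x\<bar>"
proof -
  have t0: "0 \<le> t" using t by simp
  have "AE x in lborel. conv (heat t) (\<lambda>y. ennreal (v y)) x < top"
    by (rule conv_heat_finite_AE[of _ 1]) (use v1 in \<open>auto simp: Lnorm_1\<close>)
  then show ?thesis
    using solves_eq[OF u t0 t(2)] hom_real_nonneg[of t]
  proof eventually_elim
    case (elim x)
    have "hom_real v t x = enn2real (\<integral>\<^sup>+y. ennreal (heat_real t (x - y) * v y) \<partial>lborel)"
      unfolding hom_real_def using t v0
      by (simp, subst integral_eq_nn_integral) (auto simp: heat_real_nonneg elim!: eventually_mono)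
    also have "(\<integral>\<^sup>+y. ennreal (heat_real t (x - y) * v y) \<partial>lborel) = conv (heat t) (\<lambda>y. ennreal (v y)) x"
      unfolding conv_def heat_def by (simp add: ennreal_mult' heat_real_nonneg)
    finally have "conv (heat t) (\<lambda>y. ennreal (v y)) x = ennreal (hom_real v t x)" using elim(1) by simp
    also have "hom_real v t x \<le> \<bar>u t x\<bar>"
      using elim(2,3) enn2real_nonneg[of "duh (nonlin u) t x"] by linarith
    finally show ?case by (simp add: ennreal_leI)
  qed
qed

text \<open>Nonnegative data make the linear term nonnegative, so the Duhamel term alone is a lower
  bound.\<close>

lemma solution_ge_duh:
  assumes t: "0 \<le> t" "ereal t < T"
  shows "AE x in lborel. duh (nonlin u) t x \<le> ennreal \<bar>u t x\<bar>"
  using solves_eq[OF u t] hom_real_nonneg[of t]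
proof eventually_elim
  case (elim x)
  have "duh (nonlin u) t x = ennreal (enn2real (duh (nonlin u) t x))"
    using solves_duh_finite[OF u sa t, of x] by simp
  also have "\<dots> \<le> ennreal \<bar>u t x\<bar>" unfolding elim(1) using elim(2) by (intro ennreal_leI) simp
  finally show ?case .
qed

lemma cylinder_mass_finite:
  assumes t: "0 \<le> t" "ereal t < T" and \<rho>: "0 \<le> \<rho>"
  shows "cylinder_mass u \<rho> t < top"
proof -
  obtain N where N: "0 < N" "\<And>\<tau>. 0 \<le> \<tau> \<Longrightarrow> \<tau> \<le> t \<Longrightarrow> AE x in lborel. ennreal \<bar>u \<tau> x\<bar> \<le> ennreal N"
    using solves_bounds[OF u t] by metis
  have "cylinder_mass u \<rho> t \<le> (\<integral>\<^sup>+\<tau>. indicator {0..<t} \<tau> * (ennreal (unit_ball_vol n * \<rho> powr n) * ennreal (N powr p)) \<partial>lborel)"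
    unfolding cylinder_mass_def
  proof (rule nn_integral_mono)
    fix \<tau> :: real
    show "indicator {0..<t} \<tau> * (\<integral>\<^sup>+y. indicator (cball 0 \<rho>) y * nonlin u \<tau> y \<partial>lborel) \<le> indicator {0..<t} \<tau> * (ennreal (unit_ball_vol n * \<rho> powr n) * ennreal (N powr p))"
    proof (cases "0 \<le> \<tau> \<and> \<tau> < t")
      case True
      have "(\<integral>\<^sup>+y. indicator (cball 0 \<rho>) y * nonlin u \<tau> y \<partial>lborel) \<le> (\<integral>\<^sup>+(y::'a). indicator (cball 0 \<rho>) y * ennreal (N powr p) \<partial>lborel)"
      proof (rule nn_integral_mono_AE)
        have "AE x in lborel. ennreal \<bar>u \<tau> x\<bar> \<le> ennreal N" using N True by simp
        then show "AE y in lborel. indicator (cball 0 \<rho>) y * nonlin u \<tau> y \<le> indicator (cball 0 \<rho>) y * ennreal (N powr p)"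
          by (rule eventually_mono) (use p N in \<open>auto simp: nonlin_def intro!: mult_left_mono ennreal_leI powr_mono2\<close>)
      qed
      then show ?thesis unfolding nn_integral_cball_const[OF \<rho>] by (intro mult_left_mono) auto
    qed auto
  qed
  also have "\<dots> = ennreal t * (ennreal (unit_ball_vol n * \<rho> powr n) * ennreal (N powr p))"
    using t by (subst nn_integral_multc) auto
  also have "\<dots> < top" by (simp add: ennreal_mult_less_top)
  finally show ?thesis .
qed

text \<open>From time \<open>t\<close> on, the mass accumulated so far bounds \<open>u\<close> from
  below on the ball through the Duhamel term. Integrating the \<open>p\<close>-th power of this
  bound over the ball and the interval from \<open>t\<close> to \<open>t'\<close> gives the new
  mass; the volume contributes \<open>n\<close> to the exponent of \<open>\<rho>\<close>, the kernel
  bound \<open>- (n - \<alpha>) * p\<close>.\<close>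

lemma cylinder_mass_growth:
  obtains c where "0 < c" "\<And>\<rho> t t'. 0 < \<rho> \<Longrightarrow> 0 \<le> t \<Longrightarrow> t \<le> t' \<Longrightarrow> t' \<le> \<rho> powr \<beta> \<Longrightarrow> ereal t' < T \<Longrightarrow>
    cylinder_mass u \<rho> t + ennreal ((t' - t) * c * \<rho> powr (n - (n - \<alpha>) * p)) * epow (cylinder_mass u \<rho> t) p \<le> cylinder_mass u \<rho> t'"
proof -
  note [measurable] = solves_measurable[OF u]
  obtain c R where cR: "0 < c" "0 < R" and K: "\<And>t x. 0 < t \<Longrightarrow> ennreal (c * (norm x + R * t powr (1 / \<beta>)) powr (- (n - \<alpha>))) \<le> kern t x"
    using kern_lower_bound by blast
  \<comment> \<open>The kernel bound on the cylinder: two points of the ball have distance at most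
    \<open>2 * \<rho>\<close>, and a time difference up to \<open>\<rho> powr \<beta>\<close> adds
    at most \<open>R * \<rho>\<close>.\<close>
  define L where "L \<rho> = c * ((2 + R) * \<rho>) powr (- (n - \<alpha>))" for \<rho>
  have L0: "0 < L \<rho>" if "0 < \<rho>" for \<rho> using cR that by (simp add: L_def)
  have duh_lower: "ennreal (L \<rho>) * cylinder_mass u \<rho> t \<le> duh (nonlin u) t' x"
    if \<rho>: "0 < \<rho>" and t: "0 \<le> t" "t \<le> t'" "t' \<le> \<rho> powr \<beta>" and x: "norm x \<le> \<rho>" for \<rho> t t' x
  proof -
    have "ennreal (L \<rho>) * cylinder_mass u \<rho> t
      = (\<integral>\<^sup>+\<tau>. indicator {0..<t} \<tau> * (\<integral>\<^sup>+y. indicator (cball 0 \<rho>) y * (ennreal (L \<rho>) * nonlin u \<tau> y) \<partial>lborel) \<partial>lborel)"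
    proof -
      have "ennreal (L \<rho>) * (\<integral>\<^sup>+y. indicator (cball 0 \<rho>) y * nonlin u \<tau> y \<partial>lborel)
        = (\<integral>\<^sup>+y. indicator (cball 0 \<rho>) y * (ennreal (L \<rho>) * nonlin u \<tau> y) \<partial>lborel)" for \<tau>
        by (subst nn_integral_cmult[symmetric]) (simp_all add: mult.left_commute)
      then show ?thesis
        unfolding cylinder_mass_def by (subst nn_integral_cmult[symmetric]) (simp_all only: mult.left_commute[of "ennreal (L \<rho>)"], measurable)
    qed
    also have "\<dots> \<le> duh (nonlin u) t' x"
      unfolding duh_def conv_def
    proof (rule nn_integral_mono)
      fix \<tau> :: real
      show "indicator {0..<t} \<tau> * (\<integral>\<^sup>+y. indicator (cball 0 \<rho>) y * (ennreal (L \<rho>) * nonlin u \<tau> y) \<partial>lborel)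
        \<le> indicator {0..} \<tau> * (\<integral>\<^sup>+y. kern (t' - \<tau>) (x - y) * nonlin u \<tau> y \<partial>lborel)"
      proof (cases "0 \<le> \<tau> \<and> \<tau> < t")
        case True
        have "indicator (cball 0 \<rho>) y * (ennreal (L \<rho>) * nonlin u \<tau> y) \<le> kern (t' - \<tau>) (x - y) * nonlin u \<tau> y" for y
        proof (cases "norm y \<le> \<rho>")
          case y: True
          have d: "0 < t' - \<tau>" "t' - \<tau> \<le> \<rho> powr \<beta>" using True t by auto
          have "(t' - \<tau>) powr (1 / \<beta>) \<le> (\<rho> powr \<beta>) powr (1 / \<beta>)" using d beta by (intro powr_mono2) auto
          also have "\<dots> = \<rho>" using \<rho> beta by (simp add: powr_powr)
          finally have "R * (t' - \<tau>) powr (1 / \<beta>) \<le> R * \<rho>" using cR by (intro mult_left_mono) auto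
          moreover have "norm (x - y) \<le> 2 * \<rho>" using norm_triangle_ineq4[of x y] x y by linarith
          ultimately have "norm (x - y) + R * (t' - \<tau>) powr (1 / \<beta>) \<le> (2 + R) * \<rho>" by (simp add: algebra_simps)
          moreover have "0 < norm (x - y) + R * (t' - \<tau>) powr (1 / \<beta>)" using cR d by (intro add_nonneg_pos) auto
          ultimately have "L \<rho> \<le> c * (norm (x - y) + R * (t' - \<tau>) powr (1 / \<beta>)) powr (- (n - \<alpha>))"
            unfolding L_def using cR alpha by (intro mult_left_mono powr_mono2') auto
          then have "ennreal (L \<rho>) \<le> kern (t' - \<tau>) (x - y)" using K[OF d(1), of "x - y"] by (meson ennreal_leI order_trans)
          then show ?thesis using y by (simp add: mult_right_mono)
        qed simp
        then show ?thesis using True by (auto intro!: nn_integral_mono)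
      qed auto
    qed
    finally show ?thesis .
  qed
  define C where "C = (c * (2 + R) powr (- (n - \<alpha>))) powr p * unit_ball_vol n"
  show ?thesis
  proof (rule that[of C])
    show "0 < C" using cR n_pos by (simp add: C_def)
    fix \<rho> t t' :: real assume \<rho>: "0 < \<rho>" and t: "0 \<le> t" "t \<le> t'" "t' \<le> \<rho> powr \<beta>" and T: "ereal t' < T"
    let ?m = "cylinder_mass u \<rho> t"
    have C: "unit_ball_vol n * \<rho> powr n * L \<rho> powr p = C * \<rho> powr (n - (n - \<alpha>) * p)"
    proof -
      have "L \<rho> powr p = (c * (2 + R) powr (- (n - \<alpha>))) powr p * \<rho> powr (- (n - \<alpha>) * p)"
        using \<rho> cR by (simp add: L_def powr_mult powr_powr)
      moreover have "\<rho> powr n * \<rho> powr (- (n - \<alpha>) * p) = \<rho> powr (n - (n - \<alpha>) * p)"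
        by (simp add: powr_add[symmetric] algebra_simps)
      ultimately show ?thesis by (simp add: C_def mult_ac)
    qed
    have slice: "ennreal (C * \<rho> powr (n - (n - \<alpha>) * p)) * epow ?m p \<le> (\<integral>\<^sup>+y. indicator (cball 0 \<rho>) y * nonlin u \<tau> y \<partial>lborel)"
      if \<tau>: "t \<le> \<tau>" "\<tau> < t'" for \<tau>
    proof -
      have \<tau>': "0 \<le> \<tau>" "\<tau> \<le> \<rho> powr \<beta>" "ereal \<tau> < T" using \<tau> t T by (auto intro: less_trans[of "ereal \<tau>" "ereal t'"])
      have "ennreal (C * \<rho> powr (n - (n - \<alpha>) * p)) * epow ?m p = ennreal (unit_ball_vol n * \<rho> powr n) * (ennreal (L \<rho> powr p) * epow ?m p)"
        using n_pos by (simp add: C[symmetric] ennreal_mult mult.assoc)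
      also have "\<dots> = (\<integral>\<^sup>+(y::'a). indicator (cball 0 \<rho>) y * epow (ennreal (L \<rho>) * ?m) p \<partial>lborel)"
        using \<rho> L0[OF \<rho>] by (subst nn_integral_cball_const) (auto simp: epow_mult)
      also have "\<dots> \<le> (\<integral>\<^sup>+y. indicator (cball 0 \<rho>) y * nonlin u \<tau> y \<partial>lborel)"
      proof (rule nn_integral_mono_AE)
        show "AE y in lborel. indicator (cball 0 \<rho>) y * epow (ennreal (L \<rho>) * ?m) p \<le> indicator (cball 0 \<rho>) y * nonlin u \<tau> y"
          using solution_ge_duh[OF \<tau>'(1,3)]
        proof (rule eventually_mono)
          fix y assume y: "duh (nonlin u) \<tau> y \<le> ennreal \<bar>u \<tau> y\<bar>"
          show "indicator (cball 0 \<rho>) y * epow (ennreal (L \<rho>) * ?m) p \<le> indicator (cball 0 \<rho>) y * nonlin u \<tau> y"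
          proof (cases "norm y \<le> \<rho>")
            case True
            have "ennreal (L \<rho>) * ?m \<le> ennreal \<bar>u \<tau> y\<bar>"
              using duh_lower[OF \<rho> t(1) \<tau>(1) \<tau>'(2) True] y by (rule order_trans)
            then have "epow (ennreal (L \<rho>) * ?m) p \<le> epow (ennreal \<bar>u \<tau> y\<bar>) p" using p by (intro epow_mono) auto
            then show ?thesis by (auto simp: nonlin_def intro: mult_left_mono)
          qed simp
        qed
      qed
      finally show ?thesis .
    qed
    have "?m + ennreal ((t' - t) * C * \<rho> powr (n - (n - \<alpha>) * p)) * epow ?m p
      = ?m + (\<integral>\<^sup>+\<tau>. indicator {t..<t'} \<tau> * (ennreal (C * \<rho> powr (n - (n - \<alpha>) * p)) * epow ?m p) \<partial>lborel)"
      using t \<open>0 < C\<close> by (subst nn_integral_multc) (auto simp: ennreal_mult mult.assoc)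
    also have "\<dots> \<le> ?m + (\<integral>\<^sup>+\<tau>. indicator {t..<t'} \<tau> * (\<integral>\<^sup>+y. indicator (cball 0 \<rho>) y * nonlin u \<tau> y \<partial>lborel) \<partial>lborel)"
    proof (intro add_left_mono nn_integral_mono)
      fix \<tau>
      show "indicator {t..<t'} \<tau> * (ennreal (C * \<rho> powr (n - (n - \<alpha>) * p)) * epow ?m p)
        \<le> indicator {t..<t'} \<tau> * (\<integral>\<^sup>+y. indicator (cball 0 \<rho>) y * nonlin u \<tau> y \<partial>lborel)"
        by (cases "t \<le> \<tau> \<and> \<tau> < t'") (auto intro!: slice)
    qed
    also have "\<dots> = (\<integral>\<^sup>+\<tau>. indicator {0..<t} \<tau> * (\<integral>\<^sup>+y. indicator (cball 0 \<rho>) y * nonlin u \<tau> y \<partial>lborel)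
        + indicator {t..<t'} \<tau> * (\<integral>\<^sup>+y. indicator (cball 0 \<rho>) y * nonlin u \<tau> y \<partial>lborel) \<partial>lborel)"
      unfolding cylinder_mass_def by (rule nn_integral_add[symmetric]) measurable
    also have "\<dots> = cylinder_mass u \<rho> t'"
      unfolding cylinder_mass_def using t by (intro nn_integral_cong) (auto simp: indicator_def)
    finally show "?m + ennreal ((t' - t) * C * \<rho> powr (n - (n - \<alpha>) * p)) * epow ?m p \<le> cylinder_mass u \<rho> t'" .
  qed
qed

text \<open>If the mass vanished on all cylinders, \<open>u\<close> would vanish almost everywhere
  at some positive time. At such a time \<open>u\<close> dominates the linear evolution, whose
  integral is that of the data.\<close>

lemma cylinder_mass_pos:
  assumes pos: "0 < (\<integral>\<^sup>+x. ennreal (v x) \<partial>lborel)" and T: "ereal 1 < T"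
  obtains k :: nat where "0 < cylinder_mass u (real k) 1"
proof -
  note [measurable] = solves_measurable[OF u]
  have "\<exists>k::nat. cylinder_mass u (real k) 1 \<noteq> 0"
  proof (rule ccontr)
    assume "\<not> ?thesis"
    then have "AE \<tau> in lborel. indicator {0..<1} \<tau> * (\<integral>\<^sup>+y. indicator (cball 0 (real k)) y * nonlin u \<tau> y \<partial>lborel) = 0" for k :: nat
      unfolding cylinder_mass_def by (subst (asm) nn_integral_0_iff_AE) auto
    then have 1: "AE \<tau> in lborel. \<forall>k::nat. indicator {0..<1} \<tau> * (\<integral>\<^sup>+y. indicator (cball 0 (real k)) y * nonlin u \<tau> y \<partial>lborel) = 0"
      unfolding AE_all_countable by blast
    have "\<exists>\<tau>. 0 < \<tau> \<and> \<tau> < 1 \<and> (\<forall>k::nat. (\<integral>\<^sup>+y. indicator (cball 0 (real k)) y * nonlin u \<tau> y \<partial>lborel) = 0)"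
    proof (rule ccontr)
      assume n: "\<not> ?thesis"
      have "AE \<tau> in lborel. \<not> (0 < \<tau> \<and> \<tau> < (1::real))"
        using 1 by (rule eventually_mono) (use n in \<open>auto simp: indicator_def\<close>)
      then have "emeasure lborel {0<..<1::real} = 0"
        by (subst (asm) AE_iff_measurable[of "{0<..<1}"]) auto
      then show False by simp
    qed
    then obtain \<tau> where \<tau>: "0 < \<tau>" "\<tau> < 1" "\<And>k::nat. (\<integral>\<^sup>+y. indicator (cball 0 (real k)) y * nonlin u \<tau> y \<partial>lborel) = 0" by blast
    have "AE y in lborel. indicator (cball 0 (real k)) y * nonlin u \<tau> y = 0" for k :: nat
      using \<tau>(3)[of k] by (subst (asm) nn_integral_0_iff_AE) auto
    then have "AE y in lborel. \<forall>k::nat. indicator (cball 0 (real k)) y * nonlin u \<tau> y = 0"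
      unfolding AE_all_countable by blast
    moreover have "AE x in lborel. conv (heat \<tau>) (\<lambda>y. ennreal (v y)) x \<le> ennreal \<bar>u \<tau> x\<bar>"
      using \<tau> T by (intro solution_ge_hom) (auto intro: less_trans[of "ereal \<tau>" "ereal 1"])
    ultimately have "AE x in lborel. conv (heat \<tau>) (\<lambda>y. ennreal (v y)) x = 0"
    proof eventually_elim
      case (elim x)
      obtain k :: nat where "norm x \<le> real k" using real_arch_simple by blast
      then have "nonlin u \<tau> x = 0" using elim(1)[rule_format, of k] by simp
      then have "u \<tau> x = 0" by (auto simp: nonlin_def)
      then show ?case using elim(2) by simp
    qed
    then have "(\<integral>\<^sup>+x. conv (heat \<tau>) (\<lambda>y. ennreal (v y)) x \<partial>lborel) = 0"
      by (subst nn_integral_0_iff_AE) auto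
    then show False using pos nn_integral_heat[OF \<tau>(1)] by (simp add: nn_integral_conv)
  qed
  then show ?thesis using that by (auto simp: zero_less_iff_neq_zero)
qed

end

text \<open>For a solution on the whole half-line the growth inequality holds on every cylinder and
  forces all masses to be 0, contrary to \<open>cylinder_mass_pos\<close>.\<close>

lemma no_global_solution:
  assumes sa: "compatible s a" and v [measurable]: "v \<in> borel_measurable borel"
    and v0: "AE x in lborel. 0 \<le> v x" and v1: "(\<integral>\<^sup>+x. ennreal (v x) \<partial>lborel) < top" and pos: "0 < (\<integral>\<^sup>+x. ennreal (v x) \<partial>lborel)"
    and p_Fuj: "p \<le> 1 + (\<alpha> + \<beta>) / (n - \<alpha>)"
  shows "\<not> solves s v \<infinity> u"
proof
  assume u: "solves s v \<infinity> u"
  obtain c where c: "0 < c" "\<And>\<rho> t t'. 0 < \<rho> \<Longrightarrow> 0 \<le> t \<Longrightarrow> t \<le> t' \<Longrightarrow> t' \<le> \<rho> powr \<beta> \<Longrightarrow>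
    cylinder_mass u \<rho> t + ennreal ((t' - t) * c * \<rho> powr (n - (n - \<alpha>) * p)) * epow (cylinder_mass u \<rho> t) p \<le> cylinder_mass u \<rho> t'"
    using cylinder_mass_growth[OF u sa v v0 v1] by auto
  obtain k :: nat where k: "0 < cylinder_mass u (real k) 1"
    using cylinder_mass_pos[OF u sa v v0 v1 pos] by auto
  \<comment> \<open>Negative radii and times are sent to 0, because the hypotheses of
    \<open>growth_inequality_zero\<close> on sign and monotonicity range over all reals.\<close>
  define F where "F \<rho> t = enn2real (cylinder_mass u (max \<rho> 0) (max t 0))" for \<rho> t
  have fin: "cylinder_mass u \<rho> t < top" if "0 \<le> \<rho>" "0 \<le> t" for \<rho> t
    by (rule cylinder_mass_finite[OF u sa v v0 v1 that(2) _ that(1)]) simp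
  have F: "cylinder_mass u \<rho> t = ennreal (F \<rho> t)" if "0 \<le> \<rho>" "0 \<le> t" for \<rho> t
    using that fin[OF that] by (simp add: F_def max_def)
  have F0: "0 \<le> F \<rho> t" for \<rho> t by (simp add: F_def)
  have mono: "F \<rho> t \<le> F \<rho>' t'" if "\<rho> \<le> \<rho>'" "t \<le> t'" for \<rho> \<rho>' t t'
    unfolding F_def using that by (intro enn2real_mono cylinder_mass_mono fin) auto
  have "F (real k) 1 = 0"
  proof (rule growth_inequality_zero[where F = F and e = "n - (n - \<alpha>) * p", OF p c(1) beta(1)])
    have "(p - 1) * (n - \<alpha>) \<le> \<alpha> + \<beta>" using p_Fuj alpha by (simp add: field_simps)
    then show "0 \<le> \<beta> + (n - (n - \<alpha>) * p)" by (simp add: algebra_simps)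
    fix \<rho> t t' :: real assume \<rho>: "0 < \<rho>" and t: "0 \<le> t" "t \<le> t'" "t' \<le> \<rho> powr \<beta>"
    have "0 \<le> \<rho>" "0 \<le> t'" using \<rho> t by auto
    then have "ennreal (F \<rho> t) + ennreal ((t' - t) * c * \<rho> powr (n - (n - \<alpha>) * p)) * epow (ennreal (F \<rho> t)) p \<le> ennreal (F \<rho> t')"
      using c(2)[OF \<rho> t] t(1) by (simp only: F)
    then show "F \<rho> t + (t' - t) * c * \<rho> powr (n - (n - \<alpha>) * p) * F \<rho> t powr p \<le> F \<rho> t'"
      using c(1) t F0 by (simp add: ennreal_mult[symmetric] ennreal_plus[symmetric] del: ennreal_plus)
  qed (use F0 mono in auto)
  then show False using k F[of "real k" 1] by simp
qed

end

section \<open>Jointly measurable representatives\<close>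

text \<open>\<open>u\<close> is replaced by its values at the dyadic times to the left of \<open>t\<close>. How fine a grid gives an
  error of \<open>2 powr - j\<close> depends on \<open>t\<close>, but the least such grid can be read off from the approximations
  alone, so it is a measurable function of \<open>t\<close>.\<close>

lemma measurable_representative:
  fixes u :: "real \<Rightarrow> 'a::euclidean_space \<Rightarrow> real" and I :: "real set"
  assumes I [measurable]: "I \<in> sets borel" and Ile: "\<And>t t'. t \<in> I \<Longrightarrow> 0 \<le> t' \<Longrightarrow> t' \<le> t \<Longrightarrow> t' \<in> I" and I0: "\<And>t. t \<in> I \<Longrightarrow> 0 \<le> t"
    and um: "\<And>t. t \<in> I \<Longrightarrow> u t \<in> borel_measurable borel" and s: "1 \<le> s"
    and cont: "\<And>t r. t \<in> I \<Longrightarrow> (\<And>k::nat. r k \<in> I) \<Longrightarrow> r \<longlonglongrightarrow> t \<Longrightarrow> (\<lambda>k. Lnorm lborel s (\<lambda>x. ennreal \<bar>u (r k) x - u t x\<bar>)) \<longlonglongrightarrow> 0"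
  obtains w where "jointly_measurable w" "\<And>t. t \<in> I \<Longrightarrow> AE x in lborel. w t x = u t x"
proof -
  define g where "g k t = real_of_int \<lfloor>t * 2 ^ k\<rfloor> / 2 ^ k" for k :: nat and t :: real
  define U where "U k t x = (if t \<in> I then u (g k t) x else 0)" for k t x
  have gI: "g k t \<in> I" if "t \<in> I" for k t
    using I0[OF that] by (intro Ile[OF that]) (auto simp: g_def divide_le_eq)
  have g_lim: "(\<lambda>k. g k t) \<longlonglongrightarrow> t" for t
  proof (rule tendsto_sandwich[of "\<lambda>k. t - (1 / 2) ^ k" _ _ "\<lambda>k. t"])
    show "\<forall>\<^sub>F k in sequentially. t - (1 / 2) ^ k \<le> g k t"
    proof (rule always_eventually, rule allI)
      fix k :: nat
      have "t * 2 ^ k - 1 \<le> real_of_int \<lfloor>t * 2 ^ k\<rfloor>" by linarith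
      then have "(t * 2 ^ k - 1) / 2 ^ k \<le> g k t" unfolding g_def by (rule divide_right_mono) simp
      then show "t - (1 / 2) ^ k \<le> g k t" by (simp add: diff_divide_distrib power_one_over)
    qed
    have "(\<lambda>k. t - (1 / 2) ^ k) \<longlonglongrightarrow> t - 0" by (intro tendsto_intros LIMSEQ_power_zero) simp
    then show "(\<lambda>k. t - (1 / 2) ^ k) \<longlonglongrightarrow> t" by simp
  qed (auto simp: g_def divide_le_eq)
  have U [measurable]: "jointly_measurable (U k)" for k
  proof -
    define f where "f j z = (if fst z \<in> I \<and> real_of_int j / 2 ^ k \<in> I then u (real_of_int j / 2 ^ k) (snd z) else 0)" for j :: int and z :: "real \<times> 'a"
    have *: "(\<lambda>z::real \<times> 'a. if fst z \<in> I then u c (snd z) else 0) \<in> borel_measurable (borel \<Otimes>\<^sub>M borel)" if "c \<in> I" for c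
    proof -
      note [measurable] = um[OF that]
      show ?thesis by measurable
    qed
    have "f j \<in> borel_measurable (borel \<Otimes>\<^sub>M borel)" for j
    proof (cases "real_of_int j / 2 ^ k \<in> I")
      case True
      then have "f j = (\<lambda>z. if fst z \<in> I then u (real_of_int j / 2 ^ k) (snd z) else 0)" by (auto simp: f_def fun_eq_iff)
      then show ?thesis using *[OF True] by simp
    next
      case False
      then have "f j = (\<lambda>z. 0)" by (auto simp: f_def fun_eq_iff)
      then show ?thesis by simp
    qed
    moreover have "(\<lambda>z::real \<times> 'a. \<lfloor>fst z * 2 ^ k\<rfloor>) \<in> measurable (borel \<Otimes>\<^sub>M borel) (count_space UNIV)" by measurable
    ultimately have "(\<lambda>z. f \<lfloor>fst z * 2 ^ k\<rfloor> z) \<in> borel_measurable (borel \<Otimes>\<^sub>M borel)"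
      by (rule measurable_compose_countable[where f = f and g = "\<lambda>z. \<lfloor>fst z * 2 ^ k\<rfloor>"])
    moreover have "(\<lambda>z. f \<lfloor>fst z * 2 ^ k\<rfloor> z) = (\<lambda>(t, x). U k t x)"
      using gI by (auto simp: fun_eq_iff f_def U_def g_def)
    ultimately show ?thesis by simp
  qed
  define D where "D k l t = Lnorm lborel s (\<lambda>x. ennreal \<bar>U k t x - U l t x\<bar>)" for k l t
  define d where "d k t = Lnorm lborel s (\<lambda>x. ennreal \<bar>U k t x - u t x\<bar>)" for k t
  have [measurable]: "D k l \<in> borel_measurable borel" for k l unfolding D_def by measurable
  have tri: "Lnorm lborel s (\<lambda>x. ennreal \<bar>f x - h x\<bar>) \<le> Lnorm lborel s (\<lambda>x. ennreal \<bar>f x - g x\<bar>) + Lnorm lborel s (\<lambda>x. ennreal \<bar>g x - h x\<bar>)"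
    if [measurable]: "f \<in> borel_measurable borel" "g \<in> borel_measurable borel" "h \<in> borel_measurable borel" for f g h :: "'a \<Rightarrow> real"
  proof -
    have "Lnorm lborel s (\<lambda>x. ennreal \<bar>f x - h x\<bar>) \<le> Lnorm lborel s (\<lambda>x. ennreal \<bar>f x - g x\<bar> + ennreal \<bar>g x - h x\<bar>)"
      using s by (intro Lnorm_mono) (auto simp: ennreal_plus[symmetric] intro!: ennreal_leI simp del: ennreal_plus)
    also have "\<dots> \<le> Lnorm lborel s (\<lambda>x. ennreal \<bar>f x - g x\<bar>) + Lnorm lborel s (\<lambda>x. ennreal \<bar>g x - h x\<bar>)"
      by (intro Lnorm_triangle sigma_finite_lborel s) measurable
    finally show ?thesis .
  qed
  have Ut [measurable]: "U k t \<in> borel_measurable borel" for k t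
    using um[OF gI, of t k] by (cases "t \<in> I") (auto simp: U_def cong: measurable_cong)
  have d_lim: "(\<lambda>k. d k t) \<longlonglongrightarrow> 0" if "t \<in> I" for t
    unfolding d_def U_def using cont[OF that gI[OF that] g_lim] that by simp
  define m where "m j t = (LEAST k. \<forall>l\<ge>k. D k l t \<le> ennreal ((1 / 2) ^ j))" for j :: nat and t
  have m: "D (m j t) l t \<le> ennreal ((1 / 2) ^ j)" if t: "t \<in> I" and l: "m j t \<le> l" for j t l
  proof -
    have "\<forall>\<^sub>F k in sequentially. d k t \<le> ennreal ((1 / 2) ^ j / 2)"
      using d_lim[OF t] unfolding tendsto_0_ennreal_iff by simp
    then obtain k where k: "\<And>l. k \<le> l \<Longrightarrow> d l t \<le> ennreal ((1 / 2) ^ j / 2)" by (auto simp: eventually_sequentially)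
    have "D k l t \<le> ennreal ((1 / 2) ^ j)" if "k \<le> l" for l
    proof -
      have "D k l t \<le> d k t + d l t"
        using tri[OF Ut um[OF t] Ut, of k t l t] unfolding D_def d_def by (simp add: abs_minus_commute)
      also have "\<dots> \<le> ennreal ((1 / 2) ^ j / 2) + ennreal ((1 / 2) ^ j / 2)" using that by (intro add_mono k) auto
      also have "\<dots> = ennreal ((1 / 2) ^ j)" by (simp add: ennreal_plus[symmetric] del: ennreal_plus)
      finally show ?thesis .
    qed
    then have "\<exists>k. \<forall>l\<ge>k. D k l t \<le> ennreal ((1 / 2) ^ j)" by blast
    from LeastI_ex[OF this] show ?thesis using l unfolding m_def by blast
  qed
  define w where "w j t x = U (m j t) t x" for j t x
  have [measurable]: "jointly_measurable (w j)" for j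
  proof -
    have "(\<lambda>z. (\<lambda>(t, x). U k t x) z) \<in> borel_measurable (borel \<Otimes>\<^sub>M borel)" for k by simp
    moreover have "(\<lambda>z::real \<times> 'a. m j (fst z)) \<in> measurable (borel \<Otimes>\<^sub>M borel) (count_space UNIV)"
      unfolding m_def by measurable
    ultimately have "(\<lambda>z. (\<lambda>(t, x). U (m j (fst z)) t x) z) \<in> borel_measurable (borel \<Otimes>\<^sub>M borel)"
      by (rule measurable_compose_countable)
    then show ?thesis by (simp add: w_def split_beta')
  qed
  show ?thesis
  proof (rule that[of "\<lambda>t x. lim (\<lambda>j. w j t x)"])
    show "(\<lambda>(t, x). lim (\<lambda>j. w j t x)) \<in> borel_measurable (borel \<Otimes>\<^sub>M borel)" by measurable
    fix t assume t: "t \<in> I"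
    note [measurable] = um[OF t]
    have [measurable]: "w j t \<in> borel_measurable borel" for j unfolding w_def by measurable
    \<comment> \<open>The triangle inequality through a finer grid \<open>l\<close>; its distance to
      \<open>u t\<close> vanishes as \<open>l\<close> grows.\<close>
    have close: "Lnorm lborel s (\<lambda>x. ennreal \<bar>w j t x - u t x\<bar>) \<le> ennreal ((1 / 2) ^ j)" for j
    proof (rule tendsto_lowerbound)
      show "(\<lambda>l. ennreal ((1 / 2) ^ j) + d l t) \<longlonglongrightarrow> ennreal ((1 / 2) ^ j)"
        using tendsto_add[OF tendsto_const d_lim[OF t]] by simp
      have *: "Lnorm lborel s (\<lambda>x. ennreal \<bar>w j t x - u t x\<bar>) \<le> ennreal ((1 / 2) ^ j) + d l t" if l: "m j t \<le> l" for l
      proof -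
        have "Lnorm lborel s (\<lambda>x. ennreal \<bar>w j t x - u t x\<bar>) \<le> D (m j t) l t + d l t"
          using tri[OF Ut Ut um[OF t]] unfolding w_def D_def d_def .
        also have "\<dots> \<le> ennreal ((1 / 2) ^ j) + d l t" by (intro add_right_mono m t l)
        finally show ?thesis .
      qed
      show "\<forall>\<^sub>F l in sequentially. Lnorm lborel s (\<lambda>x. ennreal \<bar>w j t x - u t x\<bar>) \<le> ennreal ((1 / 2) ^ j) + d l t"
        using eventually_ge_at_top[of "m j t"]
        by (rule eventually_mono) (rule *)
    qed simp
    \<comment> \<open>The integrals of the \<open>s\<close>-th powers of the errors are summable
      over \<open>j\<close>, so the errors tend to 0 at almost every point and not only in
      norm.\<close>
    let ?f = "\<lambda>j x. ennreal (\<bar>w j t x - u t x\<bar> powr s)"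
    have "(\<integral>\<^sup>+x. (\<Sum>j. ?f j x) \<partial>lborel) = (\<Sum>j. \<integral>\<^sup>+x. ?f j x \<partial>lborel)" by (rule nn_integral_suminf) measurable
    also have "\<dots> \<le> (\<Sum>j. ennreal ((1 / 2) ^ j))"
    proof (intro suminf_le summableI)
      fix j
      have "(\<integral>\<^sup>+x. epow (ennreal \<bar>w j t x - u t x\<bar>) s \<partial>lborel) \<le> epow (ennreal ((1 / 2) ^ j)) s"
        using close[of j] s by (simp add: Lnorm_le_iff)
      also have "\<dots> = ennreal (((1 / 2) ^ j) powr s)" by simp
      also have "\<dots> \<le> ennreal (((1 / 2) ^ j) powr 1)"
        using s by (intro ennreal_leI powr_mono') (auto intro: power_le_one)
      finally show "(\<integral>\<^sup>+x. ?f j x \<partial>lborel) \<le> ennreal ((1 / 2) ^ j)" by simp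
    qed
    also have "\<dots> < top"
      unfolding less_top[symmetric] by (rule ennreal_suminf_neq_top) (auto intro: summable_geometric)
    finally have "AE x in lborel. (\<Sum>j. ?f j x) \<noteq> \<infinity>" by (intro nn_integral_PInf_AE) auto
    then show "AE x in lborel. lim (\<lambda>j. w j t x) = u t x"
    proof (rule eventually_mono)
      fix x assume "(\<Sum>j. ?f j x) \<noteq> \<infinity>"
      then have "(\<lambda>j. \<bar>w j t x - u t x\<bar> powr s) \<longlonglongrightarrow> 0"
        by (intro summable_LIMSEQ_zero summable_suminf_not_top) auto
      then have "(\<lambda>j. ?f j x) \<longlonglongrightarrow> ennreal 0" by (rule tendsto_ennrealI)
      then have "(\<lambda>j. epow (?f j x) (1 / s)) \<longlonglongrightarrow> 0" using s by (intro tendsto_0_epow) simp_all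
      moreover have "epow (?f j x) (1 / s) = ennreal \<bar>w j t x - u t x\<bar>" for j
        using s by (simp add: powr_powr)
      ultimately have "(\<lambda>j. ennreal \<bar>w j t x - u t x\<bar>) \<longlonglongrightarrow> ennreal 0" by simp
      then have "(\<lambda>j. \<bar>w j t x - u t x\<bar>) \<longlonglongrightarrow> 0" by (rule tendsto_ennrealD) auto
      then have "(\<lambda>j. w j t x) \<longlonglongrightarrow> u t x" by (simp add: LIM_zero_iff tendsto_rabs_zero_iff)
      then show "lim (\<lambda>j. w j t x) = u t x" by (rule limI)
    qed
  qed
qed

section \<open>Mild solutions\<close>

lemma enn2real_epow: "enn2real (epow x a) = enn2real x powr a"
  by (simp add: epow_def)

lemma Lp_space_iff:
  "f \<in> Lp_space q \<longleftrightarrow> f \<in> borel_measurable borel \<and> Lnorm_abs q f < top"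
proof -
  have "integrable lborel (\<lambda>x. \<bar>f x\<bar> powr q) \<longleftrightarrow> (\<integral>\<^sup>+x. ennreal (\<bar>f x\<bar> powr q) \<partial>lborel) < top" if "f \<in> borel_measurable borel"
    using that by (simp add: integrable_iff_bounded)
  then show ?thesis by (auto simp: Lp_space_def Lnorm_def)
qed

lemma Lp_norm_eq:
  assumes [measurable]: "f \<in> borel_measurable borel"
  shows "Lp_norm q f = enn2real (Lnorm_abs q f)"
  by (simp add: Lp_norm_def Lnorm_def enn2real_epow integral_eq_nn_integral)

lemma Linf_norm_le_iff:
  assumes [measurable]: "f \<in> borel_measurable borel"
  shows "Linf_norm f \<le> ereal C \<longleftrightarrow> (AE x in lborel. \<bar>f x\<bar> \<le> C)"
proof
  assume le: "Linf_norm f \<le> ereal C"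
  have "AE x in lborel. ereal \<bar>f x\<bar> \<le> Linf_norm f" unfolding Linf_norm_def by (rule esssup_AE)
  then show "AE x in lborel. \<bar>f x\<bar> \<le> C"
  proof (rule eventually_mono)
    fix x assume "ereal \<bar>f x\<bar> \<le> Linf_norm f"
    then have "ereal \<bar>f x\<bar> \<le> ereal C" using le by (rule order_trans)
    then show "\<bar>f x\<bar> \<le> C" by simp
  qed
next
  assume "AE x in lborel. \<bar>f x\<bar> \<le> C"
  then show "Linf_norm f \<le> ereal C" unfolding Linf_norm_def by (intro esssup_I) auto
qed

lemma Linf_norm_nonneg: "0 \<le> Linf_norm (f :: real ^ 'n \<Rightarrow> real)"
proof -
  have "esssup lborel (\<lambda>x::real ^ 'n. 0) \<le> Linf_norm f" unfolding Linf_norm_def by (intro esssup_mono) auto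
  then show ?thesis by (simp add: esssup_const)
qed

lemma Linf_spaceD:
  assumes "f \<in> Linf_space"
  obtains N where "0 \<le> N" "AE x in lborel. \<bar>f x\<bar> \<le> N"
proof -
  have f: "f \<in> borel_measurable borel" "Linf_norm f < \<infinity>" using assms by (auto simp: Linf_space_def)
  then obtain N where "Linf_norm f = ereal N" "0 \<le> N" using Linf_norm_nonneg[of f] by (cases "Linf_norm f") auto
  then show ?thesis using Linf_norm_le_iff[OF f(1), of N] that by simp
qed

lemma Linf_spaceI: "f \<in> borel_measurable borel \<Longrightarrow> Linf_norm f \<le> ereal C \<Longrightarrow> f \<in> Linf_space"
  by (cases "Linf_norm f") (auto simp: Linf_space_def)

lemma AE_interval_exists:
  assumes "AE t in lborel. t \<in> {a<..<b} \<longrightarrow> P t" "a < (b::real)"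
  shows "\<exists>t\<in>{a<..<b}. P t"
proof (rule ccontr)
  assume n: "\<not> ?thesis"
  have "AE t in lborel. \<not> (a < t \<and> t < b)" using assms(1) by (rule eventually_mono) (use n in auto)
  then have "emeasure lborel {a<..<b} = 0" by (subst (asm) AE_iff_measurable[of "{a<..<b}"]) auto
  then show False using assms(2) by simp
qed

text \<open>The limit in \<open>continuous_in_Lp\<close> leaves out the point \<open>t\<close>.
  Since the norm of the difference vanishes there, it is continuous within the interval, and
  sequences may take the value \<open>t\<close>.\<close>

lemma continuous_in_Lp_Lnorm:
  fixes u :: "real \<Rightarrow> real ^ 'n \<Rightarrow> real"
  assumes u: "continuous_in_Lp s T u" and s: "1 \<le> s" and t: "0 \<le> t" "ereal t < T"
    and r: "\<And>k::nat. 0 \<le> r k" "\<And>k. ereal (r k) < T" "r \<longlonglongrightarrow> t"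
  shows "(\<lambda>k. Lnorm lborel s (\<lambda>x. ennreal \<bar>u (r k) x - u t x\<bar>)) \<longlonglongrightarrow> 0"
proof -
  let ?f = "\<lambda>r. Lp_norm s (\<lambda>x. u r x - u t x)"
  have Lp: "u t' \<in> Lp_space s" if "0 \<le> t'" "ereal t' < T" for t' using u that by (auto simp: continuous_in_Lp_def)
  have [measurable]: "u t \<in> borel_measurable borel" "u (r k) \<in> borel_measurable borel" for k
    using Lp t r by (auto simp: Lp_space_iff)
  have "?f t = 0" using s by (simp add: Lp_norm_def)
  then have "continuous (at t within {r. 0 \<le> r \<and> ereal r < T}) ?f"
    using u t unfolding continuous_in_Lp_def continuous_within by auto
  then have "(\<lambda>k. ?f (r k)) \<longlonglongrightarrow> ?f t" by (rule continuous_within_tendsto_compose') (use r in auto)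
  then have "(\<lambda>k. ennreal (?f (r k))) \<longlonglongrightarrow> ennreal 0" using \<open>?f t = 0\<close> by (intro tendsto_ennrealI) simp
  moreover have "ennreal (?f (r k)) = Lnorm lborel s (\<lambda>x. ennreal \<bar>u (r k) x - u t x\<bar>)" for k
  proof -
    have "Lnorm lborel s (\<lambda>x. ennreal \<bar>u (r k) x - u t x\<bar>) \<le> Lnorm lborel s (\<lambda>x. ennreal \<bar>u (r k) x\<bar> + ennreal \<bar>u t x\<bar>)"
      using s by (intro Lnorm_mono) (auto simp: ennreal_plus[symmetric] intro!: ennreal_leI simp del: ennreal_plus)
    also have "\<dots> \<le> Lnorm_abs s (u (r k)) + Lnorm_abs s (u t)"
      by (intro Lnorm_triangle sigma_finite_lborel s) measurable
    also have "\<dots> < top" using Lp[OF t] Lp[OF r(1,2)] by (simp add: Lp_space_iff)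
    finally show ?thesis by (simp add: Lp_norm_eq)
  qed
  ultimately show ?thesis by simp
qed

locale vector_heat_equation = heat_equation \<alpha> \<beta> "real CARD('n)" dom p
  for \<alpha> \<beta> p :: real and dom :: "(real ^ 'n) itself"
begin

text \<open>For nonnegative integrands this holds also when the integral diverges: the Lebesgue
  integral and \<open>enn2real\<close> of the infinite integral are then both 0.\<close>

lemma riesz_potential_eq:
  assumes [measurable]: "f \<in> borel_measurable borel" and f: "\<And>y. 0 \<le> f y"
  shows "riesz_potential \<alpha> f x = enn2real (conv riesz (\<lambda>y. ennreal (f y)) (x :: real ^ 'n))"
proof -
  let ?c = "riesz_const CARD('n) \<alpha>"
  have c: "0 < ?c" using riesz_const_pos by simp
  have "riesz_potential \<alpha> f x = (LINT y|lborel. ?c * (f y / norm (x - y) powr (real CARD('n) - \<alpha>)))"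
    unfolding riesz_potential_def by (rule integral_mult_right_zero[symmetric])
  also have "\<dots> = enn2real (\<integral>\<^sup>+y. ennreal (?c * (f y / norm (x - y) powr (real CARD('n) - \<alpha>))) \<partial>lborel)"
    using c f by (intro integral_eq_nn_integral) auto
  also have "(\<lambda>y. ennreal (?c * (f y / norm (x - y) powr (real CARD('n) - \<alpha>)))) = (\<lambda>y. riesz (x - y) * ennreal (f y))"
    using c f by (simp add: riesz_def ennreal_mult'[symmetric] fun_eq_iff)
  finally show ?thesis by (simp add: conv_def)
qed

lemma frac_heat_semigroup_eq: "0 \<le> t \<Longrightarrow> frac_heat_semigroup \<beta> t w x = hom_real w t x"
  using frac_heat_kernel_eq[OF beta(1), where 'n = 'n]
  by (auto simp: frac_heat_semigroup_def hom_real_def heat_real_def)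

text \<open>The near part of the Riesz kernel is integrable and meets the essential bound of
  \<open>w\<close>. The far part lies in the space conjugate to \<open>a\<close> and meets the
  bilinear estimate.\<close>

lemma conv_riesz_finite:
  assumes sa: "compatible s a" and [measurable]: "w \<in> borel_measurable borel"
    and N: "0 < N" "Lnorm_abs s w \<le> ennreal N" "AE x in lborel. ennreal \<bar>w x\<bar> \<le> ennreal N"
  shows "conv riesz (\<lambda>y. ennreal (\<bar>w y\<bar> powr p)) x < top"
proof -
  note c = compatibleD[OF sa]
  have b: "real CARD('n) / (real CARD('n) - \<alpha>) < a / (a - 1)" by (rule b_large[OF c(1)])
  obtain C1 where C1: "(\<integral>\<^sup>+x. riesz_near 1 x \<partial>lborel) \<le> ennreal (C1 * 1 powr \<alpha>)"
    using nn_integral_riesz_near zero_less_one by metis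
  obtain C2 where C2: "Lnorm lborel (a / (a - 1)) (riesz_far 1) \<le> ennreal (C2 * 1 powr (real CARD('n) / (a / (a - 1)) - (real CARD('n) - \<alpha>)))"
    using Lnorm_riesz_far[OF b] zero_less_one by metis
  have "conv (riesz_near 1) (\<lambda>y. ennreal (\<bar>w y\<bar> powr p)) x \<le> conv (riesz_near 1) (\<lambda>y. ennreal (N powr p)) x"
    by (rule conv_mono_AE, rule eventually_mono[OF N(3)]) (use p N(1) in \<open>auto intro!: ennreal_leI powr_mono2\<close>)
  also have "\<dots> = (\<integral>\<^sup>+y. riesz_near 1 y \<partial>lborel) * ennreal (N powr p)"
    unfolding conv_def by (subst nn_integral_multc) (simp_all add: nn_integral_reflect)
  also have "\<dots> < top" using C1 by (auto simp: ennreal_mult_less_top intro: le_less_trans)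
  finally have near: "conv (riesz_near 1) (\<lambda>y. ennreal (\<bar>w y\<bar> powr p)) x < top" .
  have "conv (riesz_far 1) (\<lambda>y. ennreal (\<bar>w y\<bar> powr p)) x
    = conv (riesz_far 1) (\<lambda>y. ennreal \<bar>w y\<bar> * epow (ennreal \<bar>w y\<bar>) (p - 1)) x"
    using nonlin_split[of "\<lambda>_. w" 0] by (simp add: nonlin_def)
  also have "\<dots> \<le> Lnorm lborel (a / (a - 1)) (riesz_far 1) * (ennreal N * Lnorm lborel a (\<lambda>y. epow (ennreal \<bar>w y\<bar>) (p - 1)))"
    using c N by (intro conv_bilinear_le conj_exponent) auto
  also have "\<dots> \<le> Lnorm lborel (a / (a - 1)) (riesz_far 1) * (ennreal N * ennreal (N powr (p - 1)))"
    by (intro mult_left_mono Lnorm_power_le_compatible[OF sa] N) auto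
  also have "\<dots> < top" using C2 by (auto simp: ennreal_mult_less_top intro: le_less_trans)
  finally have far: "conv (riesz_far 1) (\<lambda>y. ennreal (\<bar>w y\<bar> powr p)) x < top" .
  show ?thesis unfolding riesz_split[of 1] using near far by (simp add: conv_add_left)
qed

text \<open>Associativity of convolution. Finiteness of the Riesz potential is needed to remove the
  inner \<open>enn2real\<close> before it can be applied.\<close>

lemma semigroup_riesz_potential_eq:
  assumes sa: "compatible s a" and w [measurable]: "w \<in> borel_measurable borel"
    and N: "0 < N" "Lnorm_abs s w \<le> ennreal N" "AE x in lborel. ennreal \<bar>w x\<bar> \<le> ennreal N"
    and t: "0 < t"
  shows "frac_heat_semigroup \<beta> t (riesz_potential \<alpha> (\<lambda>y. \<bar>w y\<bar> powr p)) x = enn2real (conv (kern t) (\<lambda>y. ennreal (\<bar>w y\<bar> powr p)) x)"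
proof -
  let ?f = "\<lambda>y. ennreal (\<bar>w y\<bar> powr p)"
  have "frac_heat_semigroup \<beta> t (riesz_potential \<alpha> (\<lambda>y. \<bar>w y\<bar> powr p)) x = (LINT y|lborel. heat_real t (x - y) * enn2real (conv riesz ?f y))"
    using t by (simp add: frac_heat_semigroup_eq hom_real_def riesz_potential_eq)
  also have "\<dots> = enn2real (\<integral>\<^sup>+y. ennreal (heat_real t (x - y) * enn2real (conv riesz ?f y)) \<partial>lborel)"
    by (intro integral_eq_nn_integral) (auto simp: heat_real_nonneg)
  also have "(\<integral>\<^sup>+y. ennreal (heat_real t (x - y) * enn2real (conv riesz ?f y)) \<partial>lborel) = conv (heat t) (conv riesz ?f) x"
    unfolding conv_def[of "heat t"] heat_def
    by (intro nn_integral_cong) (use conv_riesz_finite[OF sa w N] in \<open>simp add: ennreal_mult heat_real_nonneg\<close>)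
  also have "\<dots> = conv (kern t) ?f x" unfolding kern_def by (rule conv_assoc[symmetric]) measurable
  finally show ?thesis .
qed

lemma duhamel_integral_eq:
  assumes sa: "compatible s a" and [measurable]: "jointly_measurable u"
    and N: "0 < N" "\<And>\<tau>. 0 \<le> \<tau> \<Longrightarrow> \<tau> \<le> t \<Longrightarrow> Lnorm_abs s (u \<tau>) \<le> ennreal N"
      "\<And>\<tau>. 0 \<le> \<tau> \<Longrightarrow> \<tau> \<le> t \<Longrightarrow> AE x in lborel. ennreal \<bar>u \<tau> x\<bar> \<le> ennreal N"
    and t: "0 \<le> t"
  shows "(LINT \<tau>:{0..t}|lborel. frac_heat_semigroup \<beta> (t - \<tau>) (riesz_potential \<alpha> (\<lambda>y. \<bar>u \<tau> y\<bar> powr p)) x) = enn2real (duh (nonlin u) t x)"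
proof -
  note c = compatibleD[OF sa]
  let ?c = "\<lambda>\<tau>. conv (kern (t - \<tau>)) (nonlin u \<tau>) x"
  have "duh (nonlin u) t x \<le> ennreal (kern_const a * t powr (1 - \<theta> a) / (1 - \<theta> a)) * (ennreal N * ennreal (N powr (p - 1)))"
    by (intro duh_nonlin_le c t N Lnorm_power_le_compatible[OF sa] assms(2)) auto
  also have "\<dots> < top" by (simp add: ennreal_mult_less_top)
  finally have fin: "AE \<tau> in lborel. indicator {0..} \<tau> * ?c \<tau> \<noteq> \<infinity>"
    unfolding duh_def by (intro nn_integral_PInf_AE) auto
  have "(LINT \<tau>:{0..t}|lborel. frac_heat_semigroup \<beta> (t - \<tau>) (riesz_potential \<alpha> (\<lambda>y. \<bar>u \<tau> y\<bar> powr p)) x)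
    = (LINT \<tau>|lborel. indicator {0..t} \<tau> * enn2real (?c \<tau>))"
    unfolding set_lebesgue_integral_def
  \<comment> \<open>At the endpoint the semigroup at time 0 is the identity, whereas
    \<open>kern 0\<close> is 0. The two integrands may differ at this single point.\<close>
  proof (rule integral_discrete_difference[of "{t}"])
    fix \<tau> assume "\<tau> \<notin> {t}"
    then consider "\<tau> < 0" | "t < \<tau>" | "0 \<le> \<tau>" "\<tau> < t" by force
    then show "indicator {0..t} \<tau> *\<^sub>R frac_heat_semigroup \<beta> (t - \<tau>) (riesz_potential \<alpha> (\<lambda>y. \<bar>u \<tau> y\<bar> powr p)) x
      = indicator {0..t} \<tau> * enn2real (?c \<tau>)"
    proof cases
      case 3
      then have "frac_heat_semigroup \<beta> (t - \<tau>) (riesz_potential \<alpha> (\<lambda>y. \<bar>u \<tau> y\<bar> powr p)) x = enn2real (?c \<tau>)"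
        unfolding nonlin_def by (intro semigroup_riesz_potential_eq[OF sa _ N(1)] N) auto
      then show ?thesis by simp
    qed auto
  qed auto
  also have "\<dots> = enn2real (\<integral>\<^sup>+\<tau>. ennreal (indicator {0..t} \<tau> * enn2real (?c \<tau>)) \<partial>lborel)"
    by (intro integral_eq_nn_integral) auto
  also have "(\<integral>\<^sup>+\<tau>. ennreal (indicator {0..t} \<tau> * enn2real (?c \<tau>)) \<partial>lborel) = duh (nonlin u) t x"
    unfolding duh_def
  proof (rule nn_integral_cong_AE, rule eventually_mono[OF fin])
    fix \<tau> assume f: "indicator {0..} \<tau> * ?c \<tau> \<noteq> \<infinity>"
    consider "\<tau> < 0" | "t < \<tau>" | "0 \<le> \<tau>" "\<tau> \<le> t" by linarith
    then show "ennreal (indicator {0..t} \<tau> * enn2real (?c \<tau>)) = indicator {0..} \<tau> * ?c \<tau>"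
    proof cases
      case 2
      then have "?c \<tau> = 0" by (intro conv_kern_nonpos) simp
      with 2 show ?thesis by simp
    next
      case 3
      then show ?thesis using f by (simp add: less_top)
    qed simp
  qed
  finally show ?thesis .
qed

lemma solves_imp_mild_solution_upto:
  assumes sa: "compatible s a" and v [measurable]: "v \<in> borel_measurable borel"
    and vs: "Lnorm_abs s v < top" and u: "solves s v T u"
  shows "mild_solution_upto \<alpha> \<beta> p s v T u"
proof -
  note c = compatibleD[OF sa]
  note [measurable] = solves_measurable[OF u]
  have ut [measurable]: "u t \<in> borel_measurable borel" for t by measurable
  have Lp: "u t \<in> Lp_space s" if t: "0 \<le> t" "ereal t < T" for t
  proof -
    obtain N where "\<And>t'. 0 \<le> t' \<Longrightarrow> t' \<le> t \<Longrightarrow> Lnorm_abs s (u t') \<le> ennreal N"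
      using solves_bounds[OF u t] by metis
    from order_le_less_trans[OF this[OF t(1) order_refl] ennreal_less_top] show ?thesis by (simp add: Lp_space_iff)
  qed
  have "continuous_in_Lp s T u"
    unfolding continuous_in_Lp_def
  proof (intro allI impI conjI)
    fix t assume t: "0 \<le> t \<and> ereal t < T"
    then show "u t \<in> Lp_space s" using Lp by blast
    show "((\<lambda>r. Lp_norm s (\<lambda>x. u r x - u t x)) \<longlongrightarrow> 0) (at t within {r. 0 \<le> r \<and> ereal r < T})"
      unfolding tendsto_at_iff_sequentially
    proof (intro allI impI)
      fix r :: "nat \<Rightarrow> real" assume r: "\<forall>i. r i \<in> {r. 0 \<le> r \<and> ereal r < T} - {t}" "r \<longlonglongrightarrow> t"
      have "(\<lambda>k. Lnorm lborel s (\<lambda>x. ennreal \<bar>u (r k) x - u t x\<bar>)) \<longlonglongrightarrow> ennreal 0"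
        using solves_continuous[OF u sa v vs r(2)] r(1) t by simp
      then have "(\<lambda>k. enn2real (Lnorm lborel s (\<lambda>x. ennreal \<bar>u (r k) x - u t x\<bar>))) \<longlonglongrightarrow> 0"
        by (rule tendsto_enn2real) simp
      then show "((\<lambda>r. Lp_norm s (\<lambda>x. u r x - u t x)) \<circ> r) \<longlonglongrightarrow> 0"
        by (simp add: comp_def Lp_norm_eq)
    qed
  qed
  moreover have "ess_bounded_in_Linf {0<..<T'} u \<and> mild_solution \<alpha> \<beta> p s v T' u" if T': "0 < T'" "ereal T' < T" for T'
  proof -
    have T0: "0 \<le> T'" using T' by simp
    obtain N where N: "0 < N" "\<And>t. 0 \<le> t \<Longrightarrow> t \<le> T' \<Longrightarrow> Lnorm_abs s (u t) \<le> ennreal N"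
      "\<And>t. 0 \<le> t \<Longrightarrow> t \<le> T' \<Longrightarrow> AE x in lborel. ennreal \<bar>u t x\<bar> \<le> ennreal N"
      using solves_bounds[OF u T0 T'(2)] by blast
    have lt: "ereal t < T" if "t \<le> T'" for t using that T'(2) by (meson ereal_less_eq(3) order_le_less_trans)
    have Linf: "u t \<in> Linf_space" "Linf_norm (u t) \<le> ereal N" if "0 \<le> t" "t \<le> T'" for t
    proof -
      show *: "Linf_norm (u t) \<le> ereal N" using N(3)[OF that] N(1) by (simp add: Linf_norm_le_iff)
      show "u t \<in> Linf_space" by (rule Linf_spaceI[OF ut *])
    qed
    have Lpn: "Lp_norm s (u t) \<le> N" if "0 \<le> t" "t \<le> T'" for t
      using enn2real_mono[OF N(2)[OF that]] N(1) by (simp add: Lp_norm_eq)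
    have "ess_bounded_in_Linf {0<..<T'} u"
      unfolding ess_bounded_in_Linf_def using Linf by (intro exI[of _ N] always_eventually) auto
    moreover have "mild_solution \<alpha> \<beta> p s v T' u"
      unfolding mild_solution_def
    proof (intro conjI ballI)
      have "u t \<in> Lp_space s \<inter> Linf_space \<and> ereal (Lp_norm s (u t)) + Linf_norm (u t) \<le> ereal (N + N)" if "t \<in> {0<..<T'}" for t
      proof -
        have t: "0 \<le> t" "t \<le> T'" using that by auto
        have "ereal (Lp_norm s (u t)) + Linf_norm (u t) \<le> ereal N + ereal N"
          using Lpn[OF t] Linf(2)[OF t] by (intro add_mono) auto
        then show ?thesis using Lp[OF t(1) lt[OF t(2)]] Linf(1)[OF t] by simp
      qed
      then show "\<exists>C. AE t in lborel. t \<in> {0<..<T'} \<longrightarrow> u t \<in> Lp_space s \<inter> Linf_space \<and> ereal (Lp_norm s (u t)) + Linf_norm (u t) \<le> ereal C"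
        by (intro exI[of _ "N + N"] always_eventually) auto
    next
      fix t assume "t \<in> {0..T'}"
      then have t: "0 \<le> t" "t \<le> T'" by auto
      have "(LINT \<tau>:{0..t}|lborel. frac_heat_semigroup \<beta> (t - \<tau>) (riesz_potential \<alpha> (\<lambda>y. \<bar>u \<tau> y\<bar> powr p)) x) = enn2real (duh (nonlin u) t x)" for x
        using t by (intro duhamel_integral_eq[OF sa _ N(1)] N) auto
      then show "AE x in lborel. u t x = frac_heat_semigroup \<beta> t v x +
          (LINT \<tau>:{0..t}|lborel. frac_heat_semigroup \<beta> (t - \<tau>) (riesz_potential \<alpha> (\<lambda>y. \<bar>u \<tau> y\<bar> powr p)) x)"
        using solves_eq[OF u t(1) lt[OF t(2)]] t(1) by (simp add: frac_heat_semigroup_eq)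
    qed
    ultimately show ?thesis by blast
  qed
  ultimately show ?thesis unfolding mild_solution_upto_def by blast
qed

text \<open>The bound that a mild solution satisfies at almost every time extends to every time, because the
  closed balls of \<open>L\<^sup>s\<close> and \<open>L\<^sup>\<infinity>\<close> are closed under limits in \<open>L\<^sup>s\<close>.\<close>

lemma mild_solution_upto_bounds:
  assumes s: "1 \<le> s" and u: "mild_solution_upto \<alpha> \<beta> p s v T u" and T': "0 \<le> T'" "ereal T' < T"
  obtains N where "\<And>t. 0 \<le> t \<Longrightarrow> t \<le> T' \<Longrightarrow> Lnorm_abs s (u t) \<le> ennreal N"
    "\<And>t. 0 \<le> t \<Longrightarrow> t \<le> T' \<Longrightarrow> AE x in lborel. ennreal \<bar>u t x\<bar> \<le> ennreal N"
proof -
  have cont: "continuous_in_Lp s T u" using u by (simp add: mild_solution_upto_def)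
  obtain T2 where T2: "ereal T' < ereal T2" "ereal T2 < T" using ereal_dense2[OF T'(2)] by blast
  then have "mild_solution \<alpha> \<beta> p s v T2 u" using u T'(1) by (simp add: mild_solution_upto_def)
  then obtain C where C: "AE t in lborel. t \<in> {0<..<T2} \<longrightarrow>
      u t \<in> Lp_space s \<inter> Linf_space \<and> ereal (Lp_norm s (u t)) + Linf_norm (u t) \<le> ereal C"
    unfolding mild_solution_def by blast
  have lt: "ereal t < T" if "t \<le> T2" for t using that T2(2) by (meson ereal_less_eq(3) order_le_less_trans)
  have good: "0 \<le> C \<and> Lnorm_abs s (u t) \<le> ennreal C \<and> (AE x in lborel. \<bar>u t x\<bar> \<le> C)"
    if g: "u t \<in> Lp_space s \<inter> Linf_space" "ereal (Lp_norm s (u t)) + Linf_norm (u t) \<le> ereal C" for t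
  proof -
    have m: "u t \<in> borel_measurable borel" "Lnorm_abs s (u t) < top" using g(1) by (auto simp: Lp_space_iff)
    have L0: "0 \<le> Lp_norm s (u t)" by (simp add: Lp_norm_def)
    obtain M where M: "Linf_norm (u t) = ereal M" "0 \<le> M"
      using g(1) Linf_norm_nonneg[of "u t"] by (cases "Linf_norm (u t)") (auto simp: Linf_space_def)
    have le: "Lp_norm s (u t) + M \<le> C" using g(2) by (simp add: M)
    have "Linf_norm (u t) \<le> ereal C" using le L0 by (simp add: M)
    moreover have "Lnorm_abs s (u t) = ennreal (Lp_norm s (u t))" using m by (simp add: Lp_norm_eq)
    ultimately show ?thesis using le L0 M(2) m(1) by (simp add: Linf_norm_le_iff ennreal_leI)
  qed
  have bounds: "Lnorm_abs s (u t) \<le> ennreal C \<and> (AE x in lborel. ennreal \<bar>u t x\<bar> \<le> ennreal C)"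
    if t: "0 \<le> t" "t \<le> T'" for t
  proof -
    have "\<exists>r\<in>{t<..<min T2 (t + 1 / real (Suc k))}. 0 \<le> C \<and> u r \<in> borel_measurable borel \<and> Lnorm_abs s (u r) \<le> ennreal C \<and> (AE x in lborel. \<bar>u r x\<bar> \<le> C)" for k :: nat
    proof (rule AE_interval_exists)
      show "AE r in lborel. r \<in> {t<..<min T2 (t + 1 / real (Suc k))} \<longrightarrow> 0 \<le> C \<and> u r \<in> borel_measurable borel \<and> Lnorm_abs s (u r) \<le> ennreal C \<and> (AE x in lborel. \<bar>u r x\<bar> \<le> C)"
        using C by (rule eventually_mono) (use good t in \<open>auto simp: Lp_space_iff\<close>)
      show "t < min T2 (t + 1 / real (Suc k))" using t T2(1) by simp
    qed
    then obtain r where r: "\<And>k::nat. r k \<in> {t<..<min T2 (t + 1 / real (Suc k))}" "0 \<le> C" "\<And>k. u (r k) \<in> borel_measurable borel"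
      "\<And>k. Lnorm_abs s (u (r k)) \<le> ennreal C" "\<And>k. AE x in lborel. \<bar>u (r k) x\<bar> \<le> C" by metis
    note [measurable] = r(3)
    have tT: "ereal t < T" using t T2(1) by (intro lt) simp
    have [measurable]: "u t \<in> borel_measurable borel"
      using cont t(1) tT by (auto simp: continuous_in_Lp_def Lp_space_iff)
    have "(\<lambda>k. t + 1 / real (Suc k)) \<longlonglongrightarrow> t + 0" by (intro tendsto_add tendsto_const LIMSEQ_Suc[OF lim_1_over_n])
    then have rt: "r \<longlonglongrightarrow> t"
      by (intro tendsto_sandwich[of "\<lambda>_. t" r sequentially "\<lambda>k. t + 1 / real (Suc k)"])
        (use r(1) in \<open>auto intro!: always_eventually less_imp_le\<close>)
    have rk: "0 \<le> r k" "ereal (r k) < T" for k using r(1)[of k] t(1) by (auto intro: lt)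
    have lim: "(\<lambda>k. Lnorm lborel s (\<lambda>x. ennreal \<bar>u (r k) x - u t x\<bar>)) \<longlonglongrightarrow> 0" (is "?d \<longlonglongrightarrow> 0")
      by (rule continuous_in_Lp_Lnorm[OF cont s t(1) tT rk rt])
    have "Lnorm_abs s (u t) \<le> ennreal C"
    proof (rule tendsto_lowerbound)
      show "(\<lambda>k. ?d k + ennreal C) \<longlonglongrightarrow> ennreal C" using tendsto_add[OF lim tendsto_const[of "ennreal C"]] by simp
      have "Lnorm_abs s (u t) \<le> ?d k + ennreal C" for k
      proof -
        have "Lnorm_abs s (u t) \<le> Lnorm lborel s (\<lambda>x. ennreal \<bar>u (r k) x - u t x\<bar> + ennreal \<bar>u (r k) x\<bar>)"
          using s by (intro Lnorm_mono) (auto simp: ennreal_plus[symmetric] intro!: ennreal_leI simp del: ennreal_plus)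
        also have "\<dots> \<le> ?d k + Lnorm_abs s (u (r k))"
          by (intro Lnorm_triangle sigma_finite_lborel s) measurable
        also have "\<dots> \<le> ?d k + ennreal C" by (intro add_left_mono r)
        finally show ?thesis .
      qed
      then show "\<forall>\<^sub>F k in sequentially. Lnorm_abs s (u t) \<le> ?d k + ennreal C" by simp
    qed simp
    \<comment> \<open>The excess of \<open>\<bar>u t x\<bar>\<close> over \<open>C\<close> is at
      most the distance to a function bounded by \<open>C\<close>, so its norm is the limit of a
      null sequence.\<close>
    moreover have "Lnorm lborel s (\<lambda>x. ennreal (max 0 (\<bar>u t x\<bar> - C))) \<le> 0"
    proof (rule tendsto_lowerbound[OF lim])
      have "Lnorm lborel s (\<lambda>x. ennreal (max 0 (\<bar>u t x\<bar> - C))) \<le> ?d k" for k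
      proof (rule Lnorm_mono_AE)
        show "AE x in lborel. ennreal (max 0 (\<bar>u t x\<bar> - C)) \<le> ennreal \<bar>u (r k) x - u t x\<bar>"
          using r(5)[of k] by (rule eventually_mono) (intro ennreal_leI, linarith)
      qed (use s in simp)
      then show "\<forall>\<^sub>F k in sequentially. Lnorm lborel s (\<lambda>x. ennreal (max 0 (\<bar>u t x\<bar> - C))) \<le> ?d k" by simp
    qed simp
    then have "AE x in lborel. ennreal (max 0 (\<bar>u t x\<bar> - C)) = 0"
      by (simp add: Lnorm_eq_0_iff)
    then have "AE x in lborel. ennreal \<bar>u t x\<bar> \<le> ennreal C"
      by (rule eventually_mono) (auto simp: max_def intro!: ennreal_leI split: if_splits)
    ultimately show ?thesis by blast
  qed
  then show ?thesis using that by blast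
qed

text \<open>The solution is replaced by a jointly measurable representative. This changes it on a
  null set at each time and leaves all integrals in the Duhamel term unchanged.\<close>

lemma mild_solution_upto_imp_solves:
  assumes sa: "compatible s a" and u: "mild_solution_upto \<alpha> \<beta> p s v T u"
  obtains w where "solves s v T w" "\<And>t. 0 \<le> t \<Longrightarrow> ereal t < T \<Longrightarrow> AE x in lborel. w t x = u t x"
proof -
  note c = compatibleD[OF sa]
  have s: "1 \<le> s" using c by simp
  have cont: "continuous_in_Lp s T u" using u by (simp add: mild_solution_upto_def)
  have um: "u t \<in> borel_measurable borel" if "0 \<le> t" "ereal t < T" for t
    using cont that by (auto simp: continuous_in_Lp_def Lp_space_iff)
  let ?I = "{t. 0 \<le> t \<and> ereal t < T}"
  obtain w where wm [measurable]: "jointly_measurable w"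
    and w: "\<And>t. t \<in> ?I \<Longrightarrow> AE x in lborel. w t x = u t x"
  proof (rule measurable_representative[of ?I u s])
    show "?I \<in> sets borel" by measurable
    show "t' \<in> ?I" if "t \<in> ?I" "0 \<le> t'" "t' \<le> t" for t t'
      using that by (auto intro: le_less_trans[of "ereal t'" "ereal t"])
  qed (use um s continuous_in_Lp_Lnorm[OF cont s] in auto)
  have "solves s v T w"
    unfolding solves_def
  proof (intro conjI allI impI)
    fix T' assume T': "0 \<le> T' \<and> ereal T' < T"
    then obtain N where N: "\<And>t. 0 \<le> t \<Longrightarrow> t \<le> T' \<Longrightarrow> Lnorm_abs s (u t) \<le> ennreal N"
      "\<And>t. 0 \<le> t \<Longrightarrow> t \<le> T' \<Longrightarrow> AE x in lborel. ennreal \<bar>u t x\<bar> \<le> ennreal N"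
      using mild_solution_upto_bounds[OF s u, of T'] by blast
    have "Lnorm_abs s (w t) \<le> ennreal N \<and> (AE x in lborel. ennreal \<bar>w t x\<bar> \<le> ennreal N)" if "t \<in> {0..T'}" for t
    proof -
      have t: "0 \<le> t" "t \<le> T'" using that by auto
      have "ereal t < T" using t(2) T' by (meson ereal_less_eq(3) order_le_less_trans)
      then have e: "AE x in lborel. w t x = u t x" using w t(1) by simp
      have "Lnorm_abs s (w t) = Lnorm_abs s (u t)"
        by (rule Lnorm_cong_AE) (use e in eventually_elim, simp)
      moreover have "AE x in lborel. ennreal \<bar>w t x\<bar> \<le> ennreal N" using e N(2)[OF t] by eventually_elim simp
      ultimately show ?thesis using N(1)[OF t] by simp
    qed
    then show "\<exists>N. \<forall>t\<in>{0..T'}. Lnorm_abs s (w t) \<le> ennreal N \<and> (AE x in lborel. ennreal \<bar>w t x\<bar> \<le> ennreal N)" by blast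
  next
    fix t assume t: "0 \<le> t \<and> ereal t < T"
    have lt: "ereal \<tau> < T" if "\<tau> \<le> t" for \<tau> using that t by (meson ereal_less_eq(3) order_le_less_trans)
    have we: "AE x in lborel. w \<tau> x = u \<tau> x" if "0 \<le> \<tau>" "\<tau> \<le> t" for \<tau> using w[of \<tau>] that lt by simp
    obtain T2 where T2: "ereal t < ereal T2" "ereal T2 < T" using ereal_dense2 t by blast
    then have "0 < T2" "t \<in> {0..T2}" using t by auto
    then have "mild_solution \<alpha> \<beta> p s v T2 u" using u T2(2) by (simp add: mild_solution_upto_def)
    then have mild: "AE x in lborel. u t x = frac_heat_semigroup \<beta> t v x +
          (LINT \<tau>:{0..t}|lborel. frac_heat_semigroup \<beta> (t - \<tau>) (riesz_potential \<alpha> (\<lambda>y. \<bar>u \<tau> y\<bar> powr p)) x)"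
      using \<open>t \<in> {0..T2}\<close> unfolding mild_solution_def by blast
    have t0: "0 \<le> t" "ereal t < T" using t by auto
    obtain N where N: "\<And>\<tau>. 0 \<le> \<tau> \<Longrightarrow> \<tau> \<le> t \<Longrightarrow> Lnorm_abs s (u \<tau>) \<le> ennreal N"
      "\<And>\<tau>. 0 \<le> \<tau> \<Longrightarrow> \<tau> \<le> t \<Longrightarrow> AE x in lborel. ennreal \<bar>u \<tau> x\<bar> \<le> ennreal N"
      using mild_solution_upto_bounds[OF s u t0] by blast
    have le: "ennreal N \<le> ennreal (max N 1)" by (intro ennreal_leI) simp
    have duh: "(LINT \<tau>:{0..t}|lborel. frac_heat_semigroup \<beta> (t - \<tau>) (riesz_potential \<alpha> (\<lambda>y. \<bar>w \<tau> y\<bar> powr p)) x) = enn2real (duh (nonlin w) t x)" for x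
    proof (rule duhamel_integral_eq[OF sa wm, of "max N 1"])
      fix \<tau> assume \<tau>: "0 \<le> \<tau>" "\<tau> \<le> t"
      have "Lnorm_abs s (w \<tau>) = Lnorm_abs s (u \<tau>)"
        by (rule Lnorm_cong_AE) (use we[OF \<tau>] in eventually_elim, simp)
      then show "Lnorm_abs s (w \<tau>) \<le> ennreal (max N 1)" using order_trans[OF N(1)[OF \<tau>] le] by simp
      show "AE x in lborel. ennreal \<bar>w \<tau> x\<bar> \<le> ennreal (max N 1)"
        using we[OF \<tau>] N(2)[OF \<tau>]
      proof eventually_elim
        case (elim x)
        then show ?case using order_trans[OF elim(2) le] by simp
      qed
    qed (use t in auto)
    \<comment> \<open>Equality almost everywhere under the Riesz potential becomes equality at every
      point, so the time integral at a fixed \<open>x\<close> is the same for \<open>u\<close> and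
      \<open>w\<close>.\<close>
    have "riesz_potential \<alpha> (\<lambda>y. \<bar>u \<tau> y\<bar> powr p) = riesz_potential \<alpha> (\<lambda>y. \<bar>w \<tau> y\<bar> powr p)" if \<tau>: "\<tau> \<in> {0..t}" for \<tau>
    proof
      fix x :: "real ^ 'n"
      have [measurable]: "u \<tau> \<in> borel_measurable borel" using \<tau> by (intro um lt) auto
      have "AE y in lborel. w \<tau> y = u \<tau> y" using we \<tau> by simp
      then have "(LINT y|lborel. \<bar>u \<tau> y\<bar> powr p / norm (x - y) powr (real CARD('n) - \<alpha>))
        = (LINT y|lborel. \<bar>w \<tau> y\<bar> powr p / norm (x - y) powr (real CARD('n) - \<alpha>))"
        by (intro integral_cong_AE) (auto elim!: eventually_mono)
      then show "riesz_potential \<alpha> (\<lambda>y. \<bar>u \<tau> y\<bar> powr p) x = riesz_potential \<alpha> (\<lambda>y. \<bar>w \<tau> y\<bar> powr p) x"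
        by (simp add: riesz_potential_def)
    qed
    then have "(LINT \<tau>:{0..t}|lborel. frac_heat_semigroup \<beta> (t - \<tau>) (riesz_potential \<alpha> (\<lambda>y. \<bar>u \<tau> y\<bar> powr p)) x)
      = enn2real (duh (nonlin w) t x)" for x
      unfolding duh[symmetric] by (intro set_lebesgue_integral_cong) auto
    with mild we[OF t0(1) order_refl] show "AE x in lborel. w t x = hom_real v t x + enn2real (duh (nonlin w) t x)"
      by (auto simp: frac_heat_semigroup_eq[OF t0(1)] elim!: eventually_elim2)
  qed measurable
  then show ?thesis using w by (intro that) auto
qed

text \<open>\<open>solves_maximal\<close> excludes every solution on a longer interval, not only
  those that extend \<open>u\<close>; this implies the maximality in the definition.\<close>

lemma maximal_mild_solution_exists:
  fixes v :: "real ^ 'n \<Rightarrow> real"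
  assumes sa: "compatible s a" and v [measurable]: "v \<in> borel_measurable borel"
    and vs: "Lnorm_abs s v < top" and vb: "AE x in lborel. ennreal \<bar>v x\<bar> \<le> ennreal M"
  shows "\<exists>T u. maximal_mild_solution \<alpha> \<beta> p s v T u"
proof -
  define N where "N = max 1 (max M (enn2real (Lnorm_abs s v)))"
  have N: "0 < N" "Lnorm_abs s v \<le> ennreal N" "AE x in lborel. ennreal \<bar>v x\<bar> \<le> ennreal N"
  proof -
    show "0 < N" by (simp add: N_def)
    have "Lnorm_abs s v = ennreal (enn2real (Lnorm_abs s v))" using vs by simp
    also have "\<dots> \<le> ennreal N" by (intro ennreal_leI) (simp add: N_def)
    finally show "Lnorm_abs s v \<le> ennreal N" .
    have le: "ennreal M \<le> ennreal N" by (intro ennreal_leI) (simp add: N_def)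
    show "AE x in lborel. ennreal \<bar>v x\<bar> \<le> ennreal N" using vb by (rule eventually_mono) (rule order_trans[OF _ le])
  qed
  obtain T0 where T0: "0 < T0" "solves s v (ereal T0) (picard_lim v)" using solves_local[OF v sa N] by blast
  obtain T u where T: "0 < T" "solves s v T u" "\<And>T' u'. solves s v T' u' \<Longrightarrow> T' \<le> T"
    using solves_maximal[OF sa T0(2)] T0(1) by auto
  have "\<not> mild_solution_upto \<alpha> \<beta> p s v T' w" if "T < T'" for T' w
    using mild_solution_upto_imp_solves[OF sa, of v T' w] T(3) that by (metis not_less)
  then have "maximal_mild_solution \<alpha> \<beta> p s v T u"
    unfolding maximal_mild_solution_def using T(1) solves_imp_mild_solution_upto[OF sa v vs T(2)] by blast
  then show ?thesis by blast
qed

text \<open>By uniqueness \<open>u\<close> agrees with \<open>w\<close> on its whole interval, so a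
  finite \<open>T\<close> would make \<open>w\<close> a proper extension.\<close>

lemma maximal_mild_solution_global:
  assumes sa: "compatible s a" and v: "v \<in> borel_measurable borel" "Lnorm_abs s v < top"
    and w: "solves s v \<infinity> w" and C: "\<And>t. 0 \<le> t \<Longrightarrow> AE x in lborel. ennreal \<bar>w t x\<bar> \<le> ennreal C"
    and u: "maximal_mild_solution \<alpha> \<beta> p s v T u"
  shows "T = \<infinity> \<and> ess_bounded_in_Linf {0<..} u"
proof -
  have mild: "mild_solution_upto \<alpha> \<beta> p s v T u" using u by (simp add: maximal_mild_solution_def)
  obtain u' where u': "solves s v T u'" "\<And>t. 0 \<le> t \<Longrightarrow> ereal t < T \<Longrightarrow> AE x in lborel. u' t x = u t x"
    using mild_solution_upto_imp_solves[OF sa mild] by blast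
  have eq: "AE x in lborel. w t x = u t x" if "0 \<le> t" "ereal t < T" for t
  proof -
    have "AE x in lborel. w t x = u' t x" using that by (intro solves_unique[OF sa w _ u'(1)]) auto
    then show ?thesis using u'(2)[OF that] by eventually_elim simp
  qed
  have T: "T = \<infinity>"
  proof (rule ccontr)
    assume "T \<noteq> \<infinity>"
    then have "T < \<infinity>" by simp
    then show False
      using u eq solves_imp_mild_solution_upto[OF sa v w] unfolding maximal_mild_solution_def by blast
  qed
  define D where "D = max C 0"
  have "u t \<in> Linf_space \<and> Linf_norm (u t) \<le> ereal D" if "0 < t" for t
  proof -
    have m: "u t \<in> borel_measurable borel"
      using mild T that by (auto simp: mild_solution_upto_def continuous_in_Lp_def Lp_space_iff)
    have "AE x in lborel. w t x = u t x" "AE x in lborel. ennreal \<bar>w t x\<bar> \<le> ennreal C" using eq[of t] C that T by auto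
    then have "AE x in lborel. \<bar>u t x\<bar> \<le> D"
      by eventually_elim (auto simp: ennreal_le_iff2 D_def)
    then have "Linf_norm (u t) \<le> ereal D" using m by (simp add: Linf_norm_le_iff)
    then show ?thesis using Linf_spaceI[OF m] by blast
  qed
  then have "ess_bounded_in_Linf {0<..} u" unfolding ess_bounded_in_Linf_def by (intro exI[of _ D]) auto
  with T show ?thesis by blast
qed

end

theorem theorem1p4:
  fixes \<alpha> \<beta> p :: real
  assumes "0 < \<alpha>" and "\<alpha> < real CARD('n)" and "0 < \<beta>" and "\<beta> \<le> 2" and "1 < p"
  shows
    "(real CARD('n) / (real CARD('n) - \<alpha>) < p \<and> p \<le> p_Fuj CARD('n) \<beta> \<alpha> \<longrightarrow>
       (\<forall>(u0 :: real ^ 'n \<Rightarrow> real) s.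
          u0 \<in> Lp_space 1 \<inter> Linf_space \<and> (AE x in lborel. 0 \<le> u0 x) \<and>
          0 < (LINT x|lborel. u0 x) \<and>
          real CARD('n) / (real CARD('n) - \<alpha>) < s \<and> s < real CARD('n) * (p - 1) / \<alpha> \<longrightarrow>
          (\<exists>T u. maximal_mild_solution \<alpha> \<beta> p s u0 T u) \<and>
          (\<forall>T u. maximal_mild_solution \<alpha> \<beta> p s u0 T u \<longrightarrow> T < \<infinity>)))
     \<and>
     (p_Fuj CARD('n) \<beta> \<alpha> < p \<longrightarrow>
       (\<exists>\<epsilon>>0. \<forall>(u0 :: real ^ 'n \<Rightarrow> real) s.
          u0 \<in> Lp_space (q_sc CARD('n) \<beta> \<alpha> p) \<inter> Linf_space \<and>
          Lp_norm (q_sc CARD('n) \<beta> \<alpha> p) u0 \<le> \<epsilon> \<and>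
          real CARD('n) / (real CARD('n) - \<alpha>) < s \<and> s < real CARD('n) * (p - 1) / \<alpha> \<and>
          u0 \<in> Lp_space s \<longrightarrow>
          (\<exists>T u. maximal_mild_solution \<alpha> \<beta> p s u0 T u) \<and>
          (\<forall>T u. maximal_mild_solution \<alpha> \<beta> p s u0 T u \<longrightarrow>
             T = \<infinity> \<and> ess_bounded_in_Linf {0<..} u)))"
proof -
  interpret vector_heat_equation \<alpha> \<beta> p "TYPE(real ^ 'n)"
    by unfold_locales (use assms in auto)
  have Linf: "\<exists>N>0. AE x in lborel. ennreal \<bar>u0 x\<bar> \<le> ennreal N" if u0: "u0 \<in> Linf_space" for u0 :: "real ^ 'n \<Rightarrow> real"
  proof -
    obtain N where N: "0 \<le> N" "AE x in lborel. \<bar>u0 x\<bar> \<le> N" using Linf_spaceD[OF u0] by blast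
    have "AE x in lborel. ennreal \<bar>u0 x\<bar> \<le> ennreal (N + 1)"
      using N(2) by (rule eventually_mono) (intro ennreal_leI, simp)
    then show ?thesis using N(1) by (intro exI[of _ "N + 1"]) auto
  qed
  show ?thesis
  proof (intro conjI impI)
    assume p': "real CARD('n) / (real CARD('n) - \<alpha>) < p \<and> p \<le> p_Fuj CARD('n) \<beta> \<alpha>"
    show "\<forall>(u0 :: real ^ 'n \<Rightarrow> real) s.
          u0 \<in> Lp_space 1 \<inter> Linf_space \<and> (AE x in lborel. 0 \<le> u0 x) \<and>
          0 < (LINT x|lborel. u0 x) \<and>
          real CARD('n) / (real CARD('n) - \<alpha>) < s \<and> s < real CARD('n) * (p - 1) / \<alpha> \<longrightarrow>
          (\<exists>T u. maximal_mild_solution \<alpha> \<beta> p s u0 T u) \<and>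
          (\<forall>T u. maximal_mild_solution \<alpha> \<beta> p s u0 T u \<longrightarrow> T < \<infinity>)"
    proof (intro allI impI)
      fix u0 :: "real ^ 'n \<Rightarrow> real" and s
      assume H: "u0 \<in> Lp_space 1 \<inter> Linf_space \<and> (AE x in lborel. 0 \<le> u0 x) \<and>
          0 < (LINT x|lborel. u0 x) \<and>
          real CARD('n) / (real CARD('n) - \<alpha>) < s \<and> s < real CARD('n) * (p - 1) / \<alpha>"
      obtain a where sa: "compatible s a" using compatible_exists H by metis
      have m [measurable]: "u0 \<in> borel_measurable borel" and L1: "(\<integral>\<^sup>+x. ennreal \<bar>u0 x\<bar> \<partial>lborel) < top"
        using H by (auto simp: Lp_space_iff Lnorm_1)
      obtain N where N: "0 < N" "AE x in lborel. ennreal \<bar>u0 x\<bar> \<le> ennreal N" using Linf H by blast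
      have pos_part: "(\<integral>\<^sup>+x. ennreal (u0 x) \<partial>lborel) = (\<integral>\<^sup>+x. ennreal \<bar>u0 x\<bar> \<partial>lborel)"
        using H by (intro nn_integral_cong_AE) (auto elim!: eventually_mono)
      have "(LINT x|lborel. u0 x) = enn2real (\<integral>\<^sup>+x. ennreal (u0 x) \<partial>lborel)"
        by (rule integral_eq_nn_integral) (use H in auto)
      then have "0 < enn2real (\<integral>\<^sup>+x. ennreal (u0 x) \<partial>lborel)" using H by linarith
      then have pos: "0 < (\<integral>\<^sup>+x. ennreal (u0 x) \<partial>lborel)" by (simp add: enn2real_positive_iff)
      define M where "M = enn2real (\<integral>\<^sup>+x. ennreal \<bar>u0 x\<bar> \<partial>lborel)"
      \<comment> \<open>Since \<open>s > 1\<close>, integrable bounded data have a finite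
        \<open>s\<close>-norm by interpolation.\<close>
      have "Lnorm lborel s (\<lambda>x. epow (ennreal \<bar>u0 x\<bar>) 1) \<le> ennreal (N powr (1 - 1 / s) * M powr (1 / s))"
        by (rule Lnorm_power_le) (use N L1 compatibleD(6)[OF sa] in \<open>auto simp: Lnorm_1 M_def\<close>)
      then have Ls: "Lnorm_abs s u0 < top" by (auto intro: le_less_trans)
      have "T < \<infinity>" if u: "maximal_mild_solution \<alpha> \<beta> p s u0 T u" for T u
      proof (rule ccontr)
        assume "\<not> T < \<infinity>"
        \<comment> \<open>An infinite existence time yields a global mild solution, whose
          representative is excluded by \<open>no_global_solution\<close>.\<close>
        then have "mild_solution_upto \<alpha> \<beta> p s u0 \<infinity> u" using u by (simp add: maximal_mild_solution_def)
        then obtain w where "solves s u0 \<infinity> w" using mild_solution_upto_imp_solves[OF sa] by blast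
        moreover have "(\<integral>\<^sup>+x. ennreal (u0 x) \<partial>lborel) < top" using L1 unfolding pos_part .
        moreover have "p \<le> 1 + (\<alpha> + \<beta>) / (real CARD('n) - \<alpha>)" using p' by (simp add: p_Fuj_def add.commute)
        ultimately show False using no_global_solution[OF sa m _ _ pos, of w] H by blast
      qed
      then show "(\<exists>T u. maximal_mild_solution \<alpha> \<beta> p s u0 T u) \<and> (\<forall>T u. maximal_mild_solution \<alpha> \<beta> p s u0 T u \<longrightarrow> T < \<infinity>)"
        using maximal_mild_solution_exists[OF sa m Ls N(2)] by blast
    qed
  next
    assume p': "p_Fuj CARD('n) \<beta> \<alpha> < p"
    let ?q = "q_sc CARD('n) \<beta> \<alpha> p"
    have p'': "1 + (\<alpha> + \<beta>) / (real CARD('n) - \<alpha>) < p" and q: "?q = real CARD('n) * (p - 1) / (\<alpha> + \<beta>)"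
      using p' by (simp_all add: p_Fuj_def q_sc_def add.commute)
    \<comment> \<open>Obtained before \<open>u0\<close> and \<open>s\<close> are introduced, so that
      one threshold serves all of them.\<close>
    obtain \<epsilon> where \<epsilon>: "0 < \<epsilon>" "\<And>v s a N. v \<in> borel_measurable borel \<Longrightarrow> compatible s a \<Longrightarrow>
      Lnorm_abs s v < top \<Longrightarrow> AE x in lborel. ennreal \<bar>v x\<bar> \<le> ennreal N \<Longrightarrow>
      Lnorm_abs ?q v \<le> ennreal \<epsilon> \<Longrightarrow>
      solves s v \<infinity> (picard_lim v) \<and> (\<exists>C. \<forall>t\<ge>0. AE x in lborel. ennreal \<bar>picard_lim v t x\<bar> \<le> ennreal C)"
      using solves_global[OF p'' q] by blast
    show "\<exists>\<epsilon>>0. \<forall>(u0 :: real ^ 'n \<Rightarrow> real) s.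
          u0 \<in> Lp_space ?q \<inter> Linf_space \<and> Lp_norm ?q u0 \<le> \<epsilon> \<and>
          real CARD('n) / (real CARD('n) - \<alpha>) < s \<and> s < real CARD('n) * (p - 1) / \<alpha> \<and>
          u0 \<in> Lp_space s \<longrightarrow>
          (\<exists>T u. maximal_mild_solution \<alpha> \<beta> p s u0 T u) \<and>
          (\<forall>T u. maximal_mild_solution \<alpha> \<beta> p s u0 T u \<longrightarrow> T = \<infinity> \<and> ess_bounded_in_Linf {0<..} u)"
    proof (intro exI[of _ \<epsilon>] conjI allI impI \<epsilon>(1))
      fix u0 :: "real ^ 'n \<Rightarrow> real" and s
      assume H: "u0 \<in> Lp_space ?q \<inter> Linf_space \<and> Lp_norm ?q u0 \<le> \<epsilon> \<and>
          real CARD('n) / (real CARD('n) - \<alpha>) < s \<and> s < real CARD('n) * (p - 1) / \<alpha> \<and> u0 \<in> Lp_space s"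
      obtain a where sa: "compatible s a" using compatible_exists H by metis
      have m: "u0 \<in> borel_measurable borel" and Ls: "Lnorm_abs s u0 < top"
        and Lq: "Lnorm_abs ?q u0 < top"
        using H by (auto simp: Lp_space_iff)
      obtain N where N: "AE x in lborel. ennreal \<bar>u0 x\<bar> \<le> ennreal N" using Linf H by blast
      show "\<exists>T u. maximal_mild_solution \<alpha> \<beta> p s u0 T u" by (rule maximal_mild_solution_exists[OF sa m Ls N])
      have "Lnorm_abs ?q u0 = ennreal (Lp_norm ?q u0)" using m Lq by (simp add: Lp_norm_eq)
      also have "\<dots> \<le> ennreal \<epsilon>" using H by (intro ennreal_leI) simp
      finally obtain C where w: "solves s u0 \<infinity> (picard_lim u0)" "\<And>t. 0 \<le> t \<Longrightarrow> AE x in lborel. ennreal \<bar>picard_lim u0 t x\<bar> \<le> ennreal C"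
        using \<epsilon>(2)[OF m sa Ls N] by blast
      fix T u assume u: "maximal_mild_solution \<alpha> \<beta> p s u0 T u"
      from maximal_mild_solution_global[OF sa m Ls w u]
      show "T = \<infinity>" "ess_bounded_in_Linf {0<..} u" by auto
    qed
  qed
qed

end
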